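(* Let $a,b\in\mathbb{C}$, $c,c'\in\mathbb{C}\setminus\mathbb{Z}_{\leqslant 0}$ with $a-b\notin\mathbb{Z}$ and $a-c\notin\mathbb{Z}$, and let $0<\gamma_1\leqslant\gamma_2<\infty$ be fixed. For $k\in\mathbb{Z}_{\geqslant 0}$ put $$a_k(x,y)=\sum_{j=0}^{k}\frac{(b)_j\,(b-a+c')_{k-j}\,(j+b-a+1)_{k-j}}{j!\,(k-j)!}\;{}_3F_2\left[\begin{matrix}-j,\;j-k,\;c+c'-a-1\\ b-a+c',\;a-b-k\end{matrix};1\right]\left(\frac{y}{1-x}\right)^{b+j},$$ so that in particular $a_0(x,y)=\left(\frac{y}{1-x}\right)^b$. Then, as $$x\to\infty,\quad y\to+\infty\ (y\text{ real}),\quad |\arg(1-x)|<\pi,\quad \gamma_1\leqslant\frac{y}{|1-x|}\leqslant\gamma_2,$$ the Humbert function $\Psi_1$ has the asymptotic expansion $$\Psi_1[a,b;c,c';x,y]\sim\frac{\Gamma(c)\Gamma(c')}{\Gamma(a)\Gamma(c-b)}\,y^{a-2b-c'}\,\mathrm{e}^{y}\sum_{k=0}^{\infty}a_k(x,y)\,y^{-k}.$$ That is, for every integer $N\geqslant 1$, $$\Psi_1[a,b;c,c';x,y]=\frac{\Gamma(c)\Gamma(c')}{\Gamma(a)\Gamma(c-b)}\,y^{a-2b-c'}\,\mathrm{e}^{y}\sum_{k=0}^{N-1}a_k(x,y)\,y^{-k}+\mathcal{O}\left(y^{\Re(a-2b-c')-N}\,\mathrm{e}^{y}\right)$$ in this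 limit.
   Context: $(\lambda)_n=\lambda(\lambda+1)\cdots(\lambda+n-1)$, $(\lambda)_0=1$, is the Pochhammer symbol. The generalized hypergeometric function is ${}_pF_q[a_1,\dots,a_p;b_1,\dots,b_q;z]=\sum_{n\ge0}\frac{(a_1)_n\cdots(a_p)_n}{(b_1)_n\cdots(b_q)_n}\frac{z^n}{n!}$ (the ${}_3F_2$ in the claim is a terminating sum). The Humbert function $\Psi_1$ is defined for $|x|<1$, $|y|<\infty$, $a,b\in\mathbb{C}$, $c,c'\notin\mathbb{Z}_{\leqslant0}$ by $$\Psi_1[a,b;c,c';x,y]=\sum_{m,n=0}^{\infty}\frac{(a)_{m+n}(b)_m}{(c)_m(c')_n}\frac{x^m}{m!}\frac{y^n}{n!},$$ and is extended by analytic continuation to $\{(x,y)\in\mathbb{C}^2: x\neq1,\ |\arg(1-x)|<\pi,\ |y|<\infty\}$. Conventions: $1/\Gamma$ is the entire reciprocal gamma function (equal to $0$ at nonpositive integers). Complex powers are principal: $y^\mu=\mathrm{e}^{\mu\log y}$ for $y>0$ and $\left(\frac{y}{1-x}\right)^\mu=y^\mu(1-x)^{-\mu}$ with $|\arg(1-x)|<\pi$. If $b-a+c'\in\mathbb{Z}_{\leqslant0}$, the product $(b-a+c')_{k-j}\,{}_3F_2[\cdots]$ is understood by continuity in the parameters (each ratio $(\beta)_{k-j}/(\beta)_i$, $0\le i\le k-j$, with $\beta=b-a+c'$, means $(\beta+i)_{k-j-i}$). The implied constant in $\mathcal{O}$ may depend on $a,b,c,c',\gamma_1,\gamma_2,N$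 but not on $x,y$. *)

theory Defs
  imports "HOL-Complex_Analysis.Complex_Analysis" "HOL-Library.Landau_Symbols"
begin

definition hypergeo :: "complex list \<Rightarrow> complex list \<Rightarrow> complex \<Rightarrow> complex" where
  "hypergeo as bs z =
     (\<Sum>n. (\<Prod>\<alpha>\<leftarrow>as. pochhammer \<alpha> n) / (\<Prod>\<beta>\<leftarrow>bs. pochhammer \<beta> n) * z ^ n / fact n)"

definition Psi1_series ::
    "complex \<Rightarrow> complex \<Rightarrow> complex \<Rightarrow> complex \<Rightarrow> complex \<Rightarrow> complex \<Rightarrow> complex" where
  "Psi1_series a b c c' x y =
     (\<Sum>\<^sub>\<infinity>(m, n)\<in>UNIV. pochhammer a (m + n) * pochhammer b m / (pochhammer c m * pochhammer c' n)
        * (x ^ m / fact m) * (y ^ n / fact n))"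

definition slit_plane :: "complex set" where
  "slit_plane = {x. x \<noteq> 1 \<and> \<bar>Arg (1 - x)\<bar> < pi}"

text \<open>
  Holomorphy in two variables on a product of open sets: joint continuity together with
  holomorphy in each variable separately (by Osgood's lemma this is complex differentiability).
\<close>

definition holomorphic2_on :: "(complex \<Rightarrow> complex \<Rightarrow> complex) \<Rightarrow> complex set \<Rightarrow> complex set \<Rightarrow> bool" where
  "holomorphic2_on F A B \<longleftrightarrow>
     continuous_on (A \<times> B) (\<lambda>(x, y). F x y) \<and>
     (\<forall>y\<in>B. (\<lambda>x. F x y) holomorphic_on A) \<and>
     (\<forall>x\<in>A. (\<lambda>y. F x y) holomorphic_on B)"

definition is_Psi1_continuation ::
    "complex \<Rightarrow> complex \<Rightarrow> complex \<Rightarrow> complex \<Rightarrow> (complex \<Rightarrow> complex \<Rightarrow> complex) \<Rightarrow> bool" where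
  "is_Psi1_continuation a b c c' F \<longleftrightarrow>
     holomorphic2_on F slit_plane UNIV \<and>
     (\<forall>x y. norm x < 1 \<longrightarrow> F x y = Psi1_series a b c c' x y)"

text \<open>
  The choice is unambiguous on the slit plane, since continuations agree there
  (lemma \<open>is_Psi1_continuation_unique\<close>); values outside it are irrelevant.
\<close>

definition Psi1 ::
    "complex \<Rightarrow> complex \<Rightarrow> complex \<Rightarrow> complex \<Rightarrow> complex \<Rightarrow> complex \<Rightarrow> complex" where
  "Psi1 a b c c' = (SOME F. is_Psi1_continuation a b c c' F)"

lemma slit_plane_eq: "slit_plane = (\<lambda>w. 1 - w) ` (- \<real>\<^sub>\<le>\<^sub>0)"
proof -
  have *: "x \<in> slit_plane \<longleftrightarrow> 1 - x \<notin> \<real>\<^sub>\<le>\<^sub>0" for x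
  proof (cases "x = 1")
    case False
    then have "1 - x \<noteq> 0" by simp
    moreover have "- pi < Arg (1 - x)" "Arg (1 - x) \<le> pi"
      using mpi_less_Arg Arg_le_pi by auto
    ultimately show ?thesis
      using False Arg_eq_pi[of "1 - x"]
      by (auto simp: slit_plane_def complex_nonpos_Reals_iff complex_eq_iff abs_less_iff)
  qed (simp add: slit_plane_def)
  show ?thesis
    by (auto simp: * intro!: image_eqI[where x = "1 - _"])
qed

lemma open_slit_plane: "open slit_plane"
proof -
  have *: "slit_plane = (\<lambda>x. 1 - x) -` (- \<real>\<^sub>\<le>\<^sub>0)"
    unfolding slit_plane_eq by (auto intro!: image_eqI[where x = "1 - _"])
  show ?thesis
    unfolding * by (intro open_vimage continuous_intros open_Compl closed_nonpos_Reals_complex)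
qed

lemma connected_slit_plane: "connected slit_plane"
proof -
  have "(\<real>\<^sub>\<le>\<^sub>0 :: complex set) = complex_of_real ` {..0}"
    by (auto simp: nonpos_Reals_def)
  then have "starlike (- \<real>\<^sub>\<le>\<^sub>0 :: complex set)"
    using starlike_slotted_complex_plane_left[of 0] by simp
  then show ?thesis
    unfolding slit_plane_eq
    by (intro connected_continuous_image continuous_intros starlike_imp_connected)
qed

lemma ball_subset_slit_plane: "ball 0 1 \<subseteq> slit_plane"
proof
  fix x :: complex assume "x \<in> ball 0 1"
  then have "Re x < 1" using complex_Re_le_cmod[of x] by simp
  then have "1 - x \<notin> \<real>\<^sub>\<le>\<^sub>0" by (auto simp: complex_nonpos_Reals_iff)
  then show "x \<in> slit_plane"
    unfolding slit_plane_eq by (auto intro!: image_eqI[where x = "1 - x"])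
qed

lemma is_Psi1_continuation_unique:
  assumes "is_Psi1_continuation a b c c' F" "is_Psi1_continuation a b c c' G" "x \<in> slit_plane"
  shows "F x y = G x y"
proof -
  have "F x y - G x y = 0"
  proof (rule analytic_continuation[where f = "\<lambda>x. F x y - G x y" and S = slit_plane
           and U = "ball 0 1" and \<xi> = 0])
    show "(\<lambda>x. F x y - G x y) holomorphic_on slit_plane"
      using assms(1,2)
      by (auto simp: is_Psi1_continuation_def holomorphic2_on_def intro!: holomorphic_intros)
    show "0 islimpt ball (0::complex) 1" by (simp add: islimpt_ball)
    show "F z y - G z y = 0" if "z \<in> ball 0 1" for z
      using that assms(1,2) by (simp add: is_Psi1_continuation_def)
  qed (use assms(3) ball_subset_slit_plane in \<open>auto simp: open_slit_plane connected_slit_plane\<close>)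
  then show ?thesis by simp
qed

text \<open>
  \<open>poch_hyp k j \<beta> s \<delta>\<close> is the product of \<open>(\<beta>)_{k-j}\<close> and the terminating
  \<open>3F2[-j, j-k, s; \<beta>, \<delta>; 1]\<close>. For \<open>\<beta>\<close> a nonpositive integer the product is understood
  by continuity, each ratio \<open>(\<beta>)_{k-j} / (\<beta>)_i\<close> meaning \<open>(\<beta>+i)_{k-j-i}\<close>; the terms with
  \<open>i > k - j\<close> vanish because of the factor \<open>(j-k)_i\<close>.
\<close>

definition poch_hyp :: "nat \<Rightarrow> nat \<Rightarrow> complex \<Rightarrow> complex \<Rightarrow> complex \<Rightarrow> complex" where
  "poch_hyp k j \<beta> s \<delta> =
     (if \<beta> \<notin> \<int>\<^sub>\<le>\<^sub>0
      then pochhammer \<beta> (k - j) *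
           hypergeo [- of_nat j, of_nat j - of_nat k, s] [\<beta>, \<delta>] 1
      else (\<Sum>i\<le>k - j. pochhammer (\<beta> + of_nat i) (k - j - i) *
           (pochhammer (- of_nat j) i * pochhammer (of_nat j - of_nat k) i * pochhammer s i
            / (pochhammer \<delta> i * fact i))))"

definition acoeff ::
    "complex \<Rightarrow> complex \<Rightarrow> complex \<Rightarrow> complex \<Rightarrow> nat \<Rightarrow> complex \<Rightarrow> real \<Rightarrow> complex" where
  "acoeff a b c c' k x y =
     (\<Sum>j\<le>k. pochhammer b j * pochhammer (of_nat j + b - a + 1) (k - j) / (fact j * fact (k - j))
        * poch_hyp k j (b - a + c') (c + c' - a - 1) (a - b - of_nat k)
        * (of_real y / (1 - x)) powr (b + of_nat j))"

lemma poch_hyp_altdef: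
  assumes "j \<le> k"
  shows "poch_hyp k j \<beta> s \<delta> =
     (\<Sum>i\<le>k - j. pochhammer (\<beta> + of_nat i) (k - j - i) *
        (pochhammer (- of_nat j) i * pochhammer (of_nat j - of_nat k) i * pochhammer s i
         / (pochhammer \<delta> i * fact i)))"
proof (cases "\<beta> \<in> \<int>\<^sub>\<le>\<^sub>0")
  case False
  let ?t = "\<lambda>i. pochhammer (- of_nat j) i * (pochhammer (of_nat j - of_nat k) i * pochhammer s i)
              / (pochhammer \<beta> i * pochhammer \<delta> i) * 1 ^ i / fact i :: complex"
  have 0: "of_nat j - of_nat k = (- of_nat (k - j) :: complex)"
    using assms by (simp add: of_nat_diff)
  have "hypergeo [- of_nat j, of_nat j - of_nat k, s] [\<beta>, \<delta>] 1 = (\<Sum>i. ?t i)"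
    by (simp add: hypergeo_def)
  also have "\<dots> = (\<Sum>i\<le>k - j. ?t i)"
    unfolding 0 by (rule suminf_finite) (auto simp: pochhammer_of_nat_eq_0_iff)
  finally have 1: "hypergeo [- of_nat j, of_nat j - of_nat k, s] [\<beta>, \<delta>] 1 = (\<Sum>i\<le>k - j. ?t i)" .
  have 2: "pochhammer \<beta> (k - j) = pochhammer \<beta> i * pochhammer (\<beta> + of_nat i) (k - j - i)"
    if "i \<le> k - j" for i
    using that by (rule pochhammer_product)
  have 3: "pochhammer \<beta> i \<noteq> 0" for i
    using False by (auto simp: pochhammer_eq_0_iff)
  have "pochhammer \<beta> (k - j) * (\<Sum>i\<le>k - j. ?t i) =
     (\<Sum>i\<le>k - j. pochhammer (\<beta> + of_nat i) (k - j - i) *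
        (pochhammer (- of_nat j) i * pochhammer (of_nat j - of_nat k) i * pochhammer s i
         / (pochhammer \<delta> i * fact i)))"
    unfolding sum_distrib_left
  proof (rule sum.cong)
    fix i assume "i \<in> {..k - j}"
    then show "pochhammer \<beta> (k - j) * ?t i = pochhammer (\<beta> + of_nat i) (k - j - i) *
        (pochhammer (- of_nat j) i * pochhammer (of_nat j - of_nat k) i * pochhammer s i
         / (pochhammer \<delta> i * fact i))"
      using 2[of i] 3[of i] by simp
  qed simp
  with False 1 show ?thesis by (simp add: poch_hyp_def)
qed (simp add: poch_hyp_def)

lemma continuous_poch_hyp:
  assumes "j \<le> k"
  shows "isCont (\<lambda>\<beta>. poch_hyp k j \<beta> s \<delta>) \<beta>"
  unfolding poch_hyp_altdef[OF assms] pochhammer_prod by (intro continuous_intros)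

lemma acoeff_0: "acoeff a b c c' 0 x y = (of_real y / (1 - x)) powr b"
  by (simp add: acoeff_def poch_hyp_altdef)

definition humbert_filter :: "real \<Rightarrow> real \<Rightarrow> (complex \<times> real) filter" where
  "humbert_filter \<gamma>1 \<gamma>2 =
     inf (at_infinity \<times>\<^sub>F at_top)
         (principal {(x, y). x \<in> slit_plane \<and> \<gamma>1 \<le> y / norm (1 - x) \<and> y / norm (1 - x) \<le> \<gamma>2})"

end

theory Submission
  imports Defs
begin

text \<open>
  Summing the double series over \<open>m\<close> first gives Gauss functions in \<open>x\<close>. Their connection
  formula at infinity, applied term by term, writes \<open>Psi1\<close> for \<open>norm (1 - x) > 1\<close> as a
  combination of \<open>(1 - x) powr (- b) * S1\<close> and \<open>(1 - x) powr (- a) * S2\<close>, where \<open>S1\<close> and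
  \<open>S2\<close> are power series in \<open>u = inverse (1 - x)\<close>. In the limit regime \<open>u\<close> is of order
  \<open>1 / y\<close>, so \<open>S2\<close> stays bounded and is negligible against \<open>exp y\<close>. The coefficient of
  \<open>u ^ m\<close> in \<open>S1\<close> is a finite combination of Kummer-type series in \<open>y\<close>. Each of these has an
  expansion in \<open>1 / y\<close> because the quotient of Gamma functions in its coefficients is an inverse
  factorial series by Gauss's summation theorem. Collecting powers of \<open>1 / y\<close> yields the
  coefficients \<open>acoeff\<close> through two applications of Vandermonde's identity.
\<close>

section \<open>Pochhammer symbols\<close>

text \<open>\<open>Psi1\<close> is a choice among continuations, so a continuation has to be
  constructed before anything can be said about it. The Gauss functions in the sum over n are
  therefore continued to the slit plane all at once, with growth at most geometric in n on compact
  sets; the factorial in the coefficient of y ^ n absorbs such growth. The two-term formula is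
  verified by rearranging series only for x in (-1, 0), where every series involved converges
  absolutely. Both sides are holomorphic on the connected part norm (1 - x) > 1 of the slit plane,
  so this segment determines them. Reordering by powers of u shifts the Gamma quotients by n - m, in
  either direction. The estimates below must thus be uniform over all integer shifts and may cost
  only a polynomial factor in m; that a - b is not an integer keeps every shifted factor away from
  zero. Gauss's theorem, Euler's integral and the Gamma integral each demand positive or large real
  parts. Such restrictions are removed by relations that lower a parameter by 1.\<close>

lemma norm_add_int_le_mult:
  fixes \<alpha> \<beta> :: complex and S :: "int set"
  assumes "\<And>j. j \<in> S \<Longrightarrow> \<beta> + of_int j \<noteq> 0"
  shows "\<exists>D::nat. \<forall>j\<in>S. norm (\<alpha> + of_int j) \<le> (1 + real D / (1 + \<bar>real_of_int j\<bar>)) * norm (\<beta> + of_int j)"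
proof -
  define g where "g = (\<lambda>j::int. norm (\<alpha> - \<beta>) * (1 + \<bar>j\<bar>) / norm (\<beta> + of_int j))"
  \<comment> \<open>Beyond this radius norm (\<beta> + j) is at least a quarter of 1 + |j|, so
    \<open>g j\<close> is at most 4 * norm (\<alpha> - \<beta>). Finitely many j remain, and for
    these a maximum exists because \<beta> + j is nonzero.\<close>
  define R where "R = 2 * norm \<beta> + 1"
  define F where "F = {j::int. \<bar>of_int j\<bar> \<le> R}"
  have "F \<subseteq> {-\<lceil>R\<rceil>..\<lceil>R\<rceil>}" unfolding F_def by (auto simp: abs_le_iff) linarith+
  then have "finite F" by (rule finite_subset) auto
  then obtain D1 where D1: "\<And>j. j \<in> F \<Longrightarrow> g j \<le> D1"
    by (metis (mono_tags, opaque_lifting) Max_ge finite_imageI imageI)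
  obtain D :: nat where D: "real D \<ge> max D1 (4 * norm (\<alpha> - \<beta>))"
    using real_arch_simple by blast
  have "norm (\<alpha> + of_int j) \<le> (1 + real D / (1 + \<bar>real_of_int j\<bar>)) * norm (\<beta> + of_int j)" if j: "j \<in> S" for j
  proof -
    have pos: "norm (\<beta> + of_int j) > 0" using assms[OF j] by simp
    have "g j \<le> D"
    proof (cases "j \<in> F")
      case True
      then show ?thesis using D1 D by fastforce
    next
      case False
      then have big: "\<bar>real_of_int j\<bar> > 2 * norm \<beta> + 1" by (simp add: F_def R_def)
      have "norm (of_int j :: complex) \<le> norm (\<beta> + of_int j) + norm \<beta>"
        using norm_triangle_ineq4[of "\<beta> + of_int j" \<beta>] by simp
      then have "\<bar>real_of_int j\<bar> \<le> norm (\<beta> + of_int j) + norm \<beta>" by simp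
      then have "1 + \<bar>real_of_int j\<bar> \<le> 4 * norm (\<beta> + of_int j)"
        using big norm_ge_zero[of \<beta>] by linarith
      then have "norm (\<alpha> - \<beta>) * (1 + \<bar>real_of_int j\<bar>) \<le> norm (\<alpha> - \<beta>) * (4 * norm (\<beta> + of_int j))"
        by (intro mult_left_mono) auto
      then have "g j \<le> 4 * norm (\<alpha> - \<beta>)"
        unfolding g_def using pos by (simp add: divide_le_eq mult_ac)
      then show ?thesis using D by linarith
    qed
    then have "norm (\<alpha> - \<beta>) \<le> D / (1 + \<bar>j\<bar>) * norm (\<beta> + of_int j)"
      unfolding g_def using pos by (simp add: field_simps)
    moreover have "norm (\<alpha> + of_int j) \<le> norm (\<beta> + of_int j) + norm (\<alpha> - \<beta>)"
      using norm_triangle_ineq[of "\<beta> + of_int j" "\<alpha> - \<beta>"] by (simp add: algebra_simps)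
    ultimately show ?thesis by (simp add: algebra_simps)
  qed
  then show ?thesis by blast
qed

text \<open>The product is the binomial coefficient of D + m over m, hence of degree D in m. This
  closed form is the reason for taking D natural.\<close>

lemma prod_one_plus_inverse_le:
  fixes D :: nat
  shows "(\<Prod>i<m. 1 + real D / (1 + real i)) \<le> real (m + 1) ^ D"
proof -
  have *: "(\<Prod>i<m. 1 + real D / (1 + real i)) = real ((D + m) choose m)"
  proof (induction m)
    case (Suc m)
    have "real ((D + Suc m) choose Suc m) * real (Suc m) = real ((D + m) choose m) * real (D + Suc m)"
      by (metis Suc_times_binomial_eq add_Suc_right mult.commute of_nat_mult)
    then show ?case using Suc by (simp add: field_simps)
  qed simp
  have "(D + m) choose m \<le> (m + 1) ^ D"
  proof (induction D)
    case (Suc D)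
    have "Suc D * ((Suc D + m) choose Suc D) = (Suc (D + m)) * ((D + m) choose D)"
      using Suc_times_binomial_eq[of "D + m" D] by simp
    also have "\<dots> \<le> (Suc D * (m + 1)) * ((D + m) choose D)"
      by (intro mult_right_mono) auto
    finally have "(Suc D + m) choose Suc D \<le> (m + 1) * ((D + m) choose D)"
      by (metis mult.assoc Suc_mult_le_cancel1)
    also have "(D + m) choose D = (D + m) choose m"
      using binomial_symmetric[of D "D + m"] by simp
    also have "(m + 1) * ((D + m) choose m) \<le> (m + 1) * (m + 1) ^ D"
      using Suc by (intro mult_left_mono) auto
    finally show ?case
      using binomial_symmetric[of "Suc D" "Suc D + m"] by (simp add: power_Suc)
  qed simp
  then show ?thesis unfolding * by (metis of_nat_le_iff of_nat_power)
qed

text \<open>A window of m consecutive integers is cut at 0, and each half, read outwards from 0, is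
  dominated by a window starting at 0. The two halves account for the exponent 2 * D, which does not
  depend on k.\<close>

lemma prod_one_plus_inverse_shift_le:
  fixes D :: nat and k :: int
  shows "(\<Prod>i<m. 1 + real D / (1 + \<bar>real_of_int k + real i\<bar>)) \<le> real (m + 1) ^ (2 * D)"
proof -
  have up: "(\<Prod>i<n. 1 + real D / (1 + \<bar>real_of_int l + real i\<bar>)) \<le> real (n + 1) ^ D"
    if "l \<ge> 0" for l :: int and n
    by (rule order.trans[OF _ prod_one_plus_inverse_le])
       (use that in \<open>auto intro!: prod_mono add_mono divide_left_mono\<close>)
  have down: "(\<Prod>i<n. 1 + real D / (1 + \<bar>real_of_int l + real i\<bar>)) \<le> real (n + 1) ^ D"
    if "l \<le> - int n" for l :: int and n
  proof -
    have "(\<Prod>i<n. 1 + real D / (1 + \<bar>real_of_int l + real i\<bar>)) =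
          (\<Prod>i<n. 1 + real D / (1 + \<bar>real_of_int l + real (n - Suc i)\<bar>))"
      by (rule prod.nat_diff_reindex[symmetric])
    also have "\<dots> \<le> (\<Prod>i<n. 1 + real D / (1 + real i))"
      using that by (intro prod_mono conjI add_mono divide_left_mono) (auto simp: of_nat_diff)
    finally show ?thesis using prod_one_plus_inverse_le order.trans by blast
  qed
  have sq: "real (n + 1) ^ D \<le> real (m + 1) ^ (2 * D)" if "n \<le> m" for n
  proof -
    have "real (n + 1) ^ D \<le> real (m + 1) ^ D" using that by (intro power_mono) auto
    also have "\<dots> \<le> real (m + 1) ^ (2 * D)" by (intro power_increasing) auto
    finally show ?thesis .
  qed
  consider "k \<ge> 0" | "k \<le> - int m" | "- int m < k" "k < 0" by linarith
  then show ?thesis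
  proof cases
    case 3
    define n where "n = nat (- k)"
    have n: "n \<le> m" "k = - int n" using 3 by (auto simp: n_def)
    have "(\<Prod>i<m. 1 + real D / (1 + \<bar>real_of_int k + real i\<bar>)) =
      (\<Prod>i<n. 1 + real D / (1 + \<bar>real_of_int k + real i\<bar>)) *
      (\<Prod>i=n..<m. 1 + real D / (1 + \<bar>real_of_int k + real i\<bar>))"
      using n by (metis atLeast0LessThan prod.atLeastLessThan_concat zero_le)
    also have "(\<Prod>i=n..<m. 1 + real D / (1 + \<bar>real_of_int k + real i\<bar>)) =
       (\<Prod>i<m - n. 1 + real D / (1 + real i))"
      using n by (intro prod.reindex_bij_witness[of _ "\<lambda>i. i + n" "\<lambda>i. i - n"]) auto
    also have "(\<Prod>i<n. 1 + real D / (1 + \<bar>real_of_int k + real i\<bar>)) * \<dots> \<le> real (n + 1) ^ D * real (m - n + 1) ^ D"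
      by (intro mult_mono prod_one_plus_inverse_le down prod_nonneg) (use n in auto)
    also have "\<dots> \<le> real (m + 1) ^ D * real (m + 1) ^ D"
      using n by (intro mult_mono power_mono) auto
    finally show ?thesis by (simp add: mult_2 power_add)
  qed (use up down sq[of m] in \<open>fastforce intro: order.trans\<close>)+
qed

text \<open>The exponent depends neither on the position k nor on the length m of the window; the
  uniformity in k is what the expansion in powers of u requires. The set S is taken to be the
  nonnegative integers when \<beta> is only known not to be a nonpositive integer, and all integers
  when \<beta> is not an integer.\<close>

lemma norm_pochhammer_le_shift:
  fixes \<alpha> \<beta> :: complex and S :: "int set"
  assumes "\<And>j. j \<in> S \<Longrightarrow> \<beta> + of_int j \<noteq> 0"
  shows "\<exists>q. \<forall>k m. {k..<k + int m} \<subseteq> S \<longrightarrow>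
     norm (pochhammer (\<alpha> + of_int k) m) \<le> real (m + 1) ^ q * norm (pochhammer (\<beta> + of_int k) m)"
proof -
  obtain D :: nat where D: "\<And>j. j \<in> S \<Longrightarrow> norm (\<alpha> + of_int j) \<le> (1 + real D / (1 + \<bar>real_of_int j\<bar>)) * norm (\<beta> + of_int j)"
    using norm_add_int_le_mult[of S \<beta> \<alpha>] assms by auto
  show ?thesis
  proof (intro exI[of _ "2 * D"] allI impI)
    fix k m assume sub: "{k..<k + int m} \<subseteq> S"
    have "norm (pochhammer (\<alpha> + of_int k) m) = (\<Prod>i<m. norm (\<alpha> + of_int (k + int i)))"
      by (simp add: pochhammer_prod prod_norm atLeast0LessThan add.assoc)
    also have "\<dots> \<le> (\<Prod>i<m. (1 + real D / (1 + \<bar>real_of_int (k + int i)\<bar>)) * norm (\<beta> + of_int (k + int i)))"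
      using sub by (intro prod_mono conjI D) auto
    also have "\<dots> = (\<Prod>i<m. 1 + real D / (1 + \<bar>real_of_int k + real i\<bar>)) * norm (pochhammer (\<beta> + of_int k) m)"
      by (simp add: pochhammer_prod prod_norm atLeast0LessThan add.assoc prod.distrib)
    also have "\<dots> \<le> real (m + 1) ^ (2 * D) * norm (pochhammer (\<beta> + of_int k) m)"
      by (intro mult_right_mono prod_one_plus_inverse_shift_le) auto
    finally show "norm (pochhammer (\<alpha> + of_int k) m) \<le> \<dots>" .
  qed
qed

lemma norm_pochhammer_le_shift_nat:
  fixes \<alpha> \<beta> :: complex
  assumes "\<beta> \<notin> \<int>\<^sub>\<le>\<^sub>0"
  shows "\<exists>q. \<forall>n m. norm (pochhammer (\<alpha> + of_nat n) m) \<le> real (m + 1) ^ q * norm (pochhammer (\<beta> + of_nat n) m)"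
proof -
  have "\<beta> + of_int j \<noteq> 0" if "j \<in> {0..}" for j
    using assms that by (metis add_eq_0_iff2 atLeast_iff neg_0_le_iff_le neg_le_0_iff_le nonpos_Ints_of_int of_int_minus)
  then obtain q where q: "\<And>k m. {k..<k + int m} \<subseteq> {0..} \<Longrightarrow>
     norm (pochhammer (\<alpha> + of_int k) m) \<le> real (m + 1) ^ q * norm (pochhammer (\<beta> + of_int k) m)"
    using norm_pochhammer_le_shift[of "{0..}" \<beta> \<alpha>] by blast
  show ?thesis
  proof (intro exI[of _ q] allI)
    fix n m
    have "{int n..<int n + int m} \<subseteq> {0..}" by auto
    from q[OF this] show "norm (pochhammer (\<alpha> + of_nat n) m) \<le> real (m + 1) ^ q * norm (pochhammer (\<beta> + of_nat n) m)"
      by simp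
  qed
qed

lemma pochhammer_nonzero: "\<beta> \<notin> \<int>\<^sub>\<le>\<^sub>0 \<Longrightarrow> pochhammer (\<beta>::complex) n \<noteq> 0"
  by (auto simp: pochhammer_eq_0_iff)

lemma add_of_nat_notin_nonpos_Ints: "\<beta> \<notin> \<int>\<^sub>\<le>\<^sub>0 \<Longrightarrow> (\<beta>::complex) + of_nat n \<notin> \<int>\<^sub>\<le>\<^sub>0"
  using nonpos_Ints_diff_Nats[of "\<beta> + of_nat n" "of_nat n"] by auto

lemma norm_pochhammer_ratio_le:
  fixes \<alpha> \<beta> :: complex
  assumes "\<beta> \<notin> \<int>\<^sub>\<le>\<^sub>0"
  shows "\<exists>q. \<forall>n m. norm (pochhammer (\<alpha> + of_nat n) m / pochhammer (\<beta> + of_nat n) m) \<le> real (m + 1) ^ q"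
proof -
  obtain q where q: "\<And>n m. norm (pochhammer (\<alpha> + of_nat n) m) \<le> real (m + 1) ^ q * norm (pochhammer (\<beta> + of_nat n) m)"
    using norm_pochhammer_le_shift_nat[OF assms, of \<alpha>] by blast
  have "norm (pochhammer (\<alpha> + of_nat n) m / pochhammer (\<beta> + of_nat n) m) \<le> real (m + 1) ^ q" for n m
    using q[of n m] pochhammer_nonzero[OF add_of_nat_notin_nonpos_Ints[OF assms], of n m]
    by (simp add: norm_divide divide_le_eq)
  then show ?thesis by blast
qed

lemma norm_pochhammer_ratio_le_0:
  fixes \<alpha> \<beta> :: complex
  assumes "\<beta> \<notin> \<int>\<^sub>\<le>\<^sub>0"
  shows "\<exists>q. \<forall>m. norm (pochhammer \<alpha> m / pochhammer \<beta> m) \<le> real (m + 1) ^ q"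
proof -
  obtain q where "\<And>n m. norm (pochhammer (\<alpha> + of_nat n) m / pochhammer (\<beta> + of_nat n) m) \<le> real (m + 1) ^ q"
    using norm_pochhammer_ratio_le[OF assms] by blast
  from this[of 0] show ?thesis by auto
qed

lemma Re_pos_notin_nonpos_Ints: "Re z > 0 \<Longrightarrow> z \<notin> \<int>\<^sub>\<le>\<^sub>0"
  by (auto elim!: nonpos_Ints_cases)

lemma one_notin_nonpos_Ints: "(1::complex) \<notin> \<int>\<^sub>\<le>\<^sub>0"
  by (rule Re_pos_notin_nonpos_Ints) simp

lemma norm_pochhammer_over_fact_le:
  fixes \<alpha> :: complex
  shows "\<exists>q. \<forall>m. norm (pochhammer \<alpha> m / fact m) \<le> real (m + 1) ^ q"
  using norm_pochhammer_ratio_le_0[OF one_notin_nonpos_Ints, of \<alpha>] by (simp add: pochhammer_fact)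

text \<open>Each further power of m + 1 comes from termwise differentiation, at the price of a
  slightly larger radius; therefore r is generalised in the induction.\<close>

lemma summable_Suc_power_mult_power:
  fixes r :: real
  assumes "0 \<le> r" "r < 1"
  shows "summable (\<lambda>m. real (m + 1) ^ q * r ^ m)"
  using assms
proof (induction q arbitrary: r)
  case (Suc q)
  define K where "K = (1 + r) / 2"
  have K: "0 \<le> K" "r < K" "K < 1" using Suc.prems by (auto simp: K_def)
  have "summable (\<lambda>m. diffs (\<lambda>m. real (m + 1) ^ q) m * r ^ m)"
  proof (rule termdiff_converges[where K = K])
    fix x :: real assume x: "norm x < K"
    have "summable (\<lambda>m. norm (real (m + 1) ^ q * x ^ m))"
      using Suc.IH[of "\<bar>x\<bar>"] x K by (simp add: abs_mult power_abs)
    then show "summable (\<lambda>m. real (m + 1) ^ q * x ^ m)" by (rule summable_norm_cancel)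
  qed (use K Suc.prems in auto)
  then show ?case
  proof (rule summable_comparison_test'[where N = 0])
    fix m :: nat
    have "real (m + 1) ^ q \<le> real (Suc m + 1) ^ q" by (intro power_mono) auto
    then have "real (m + 1) ^ Suc q \<le> real (Suc m) * real (Suc m + 1) ^ q"
      by (simp add: mult_left_mono)
    then show "norm (real (m + 1) ^ Suc q * r ^ m) \<le> diffs (\<lambda>m. real (m + 1) ^ q) m * r ^ m"
      using Suc.prems by (simp add: diffs_def mult_right_mono abs_mult)
  qed
qed (auto intro: summable_geometric)

text \<open>Vandermonde's identity between two reflections (x)_n = (-1)^n (1 - x - n)_n. In this
  form it resums the diagonals in Pfaff's transformation and later introduces the parameter c + c' -
  a - 1 into the coefficients.\<close>

lemma pochhammer_diff_sum:
  fixes \<beta> s :: "'a::comm_ring_1"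
  shows "pochhammer (\<beta> - s) p = (\<Sum>i\<le>p. (- 1) ^ i * of_nat (p choose i) * pochhammer s i * pochhammer (\<beta> + of_nat i) (p - i))"
proof -
  have refl: "pochhammer x n = (- 1) ^ n * pochhammer (1 - x - of_nat n) n" for x :: 'a and n
    using pochhammer_minus[of "- x" n] by (simp add: algebra_simps)
  have "pochhammer (\<beta> - s) p = (- 1) ^ p * pochhammer (s + (1 - \<beta> - of_nat p)) p"
    by (subst refl) (simp add: algebra_simps)
  also have "\<dots> = (\<Sum>i\<le>p. (- 1) ^ p * (of_nat (p choose i) * pochhammer s i * pochhammer (1 - \<beta> - of_nat p) (p - i)))"
    by (simp add: pochhammer_binomial_sum sum_distrib_left)
  also have "\<dots> = (\<Sum>i\<le>p. (- 1) ^ i * of_nat (p choose i) * pochhammer s i * pochhammer (\<beta> + of_nat i) (p - i))"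
  proof (rule sum.cong)
    fix i assume "i \<in> {..p}"
    then have i: "i \<le> p" by simp
    have "pochhammer (\<beta> + of_nat i) (p - i) = (- 1) ^ (p - i) * pochhammer (1 - \<beta> - of_nat p) (p - i)"
      by (subst refl) (use i in \<open>simp add: of_nat_diff algebra_simps\<close>)
    moreover have "(- 1 :: 'a) ^ p = (- 1) ^ i * (- 1) ^ (p - i)" using i by (simp flip: power_add)
    ultimately show "(- 1) ^ p * (of_nat (p choose i) * pochhammer s i * pochhammer (1 - \<beta> - of_nat p) (p - i)) =
      (- 1) ^ i * of_nat (p choose i) * pochhammer s i * pochhammer (\<beta> + of_nat i) (p - i)"
      by (simp add: mult_ac)
  qed simp
  finally show ?thesis .
qed

section \<open>The Gauss hypergeometric series\<close>

definition hyp2F1_coeff :: "complex \<Rightarrow> complex \<Rightarrow> complex \<Rightarrow> nat \<Rightarrow> complex" where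
  "hyp2F1_coeff \<alpha> \<beta> \<gamma> n = pochhammer \<alpha> n * pochhammer \<beta> n / (pochhammer \<gamma> n * fact n)"

definition hyp2F1 :: "complex \<Rightarrow> complex \<Rightarrow> complex \<Rightarrow> complex \<Rightarrow> complex" where
  "hyp2F1 \<alpha> \<beta> \<gamma> z = (\<Sum>n. hyp2F1_coeff \<alpha> \<beta> \<gamma> n * z ^ n)"

lemma hyp2F1_coeff_0 [simp]: "hyp2F1_coeff \<alpha> \<beta> \<gamma> 0 = 1"
  by (simp add: hyp2F1_coeff_def)

lemma hyp2F1_commute: "hyp2F1 \<alpha> \<beta> \<gamma> z = hyp2F1 \<beta> \<alpha> \<gamma> z"
  by (simp add: hyp2F1_def hyp2F1_coeff_def mult_ac)

lemma hyp2F1_0 [simp]: "hyp2F1 \<alpha> \<beta> \<gamma> 0 = 1"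
  using powser_zero[of "hyp2F1_coeff \<alpha> \<beta> \<gamma>"] by (simp add: hyp2F1_def)

lemma hyp2F1_coeff_Suc:
  "hyp2F1_coeff \<alpha> \<beta> \<gamma> (Suc n) * of_nat (Suc n) =
     (\<alpha> + of_nat n) * (\<beta> + of_nat n) / (\<gamma> + of_nat n) * hyp2F1_coeff \<alpha> \<beta> \<gamma> n"
  by (simp add: hyp2F1_coeff_def pochhammer_Suc divide_simps del: of_nat_Suc)

lemma hyp2F1_coeff_plus1:
  assumes "\<gamma> \<notin> \<int>\<^sub>\<le>\<^sub>0"
  shows "(\<gamma> + of_nat n) * hyp2F1_coeff \<alpha> \<beta> (\<gamma> + 1) n = \<gamma> * hyp2F1_coeff \<alpha> \<beta> \<gamma> n"
proof -
  have "\<gamma> \<noteq> 0" using assms by auto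
  moreover have "\<gamma> * pochhammer (\<gamma> + 1) n = pochhammer \<gamma> n * (\<gamma> + of_nat n)"
    by (simp flip: pochhammer_Suc pochhammer_rec)
  moreover have "pochhammer \<gamma> n \<noteq> 0" "pochhammer \<gamma> (Suc n) \<noteq> 0"
    using assms pochhammer_nonzero by blast+
  ultimately show ?thesis
    unfolding hyp2F1_coeff_def
    by (smt (verit, ccfv_threshold) divide_divide_eq_left mult.assoc mult.commute mult_eq_0_iff
      nonzero_mult_divide_mult_cancel_left pochhammer_Suc times_divide_eq_right)
qed

text \<open>Coefficient form of (1 - z) F' = (\<alpha> + \<beta> - \<gamma>) F + (\<gamma> -
  \<alpha>) (\<gamma> - \<beta>) / \<gamma> * F(\<gamma> + 1). The left side is a difference of
  consecutive terms, so the same identity telescopes at z = 1 and leads to Gauss's theorem.\<close>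

lemma hyp2F1_coeff_ladder:
  assumes "\<gamma> \<notin> \<int>\<^sub>\<le>\<^sub>0"
  shows "of_nat (Suc n) * hyp2F1_coeff \<alpha> \<beta> \<gamma> (Suc n) - of_nat n * hyp2F1_coeff \<alpha> \<beta> \<gamma> n =
     (\<alpha> + \<beta> - \<gamma>) * hyp2F1_coeff \<alpha> \<beta> \<gamma> n + (\<gamma> - \<alpha>) * (\<gamma> - \<beta>) / \<gamma> * hyp2F1_coeff \<alpha> \<beta> (\<gamma> + 1) n"
proof -
  have nz: "\<gamma> \<noteq> 0" "\<gamma> + of_nat n \<noteq> 0"
    using assms add_of_nat_notin_nonpos_Ints[OF assms, of n] by auto
  have 1: "hyp2F1_coeff \<alpha> \<beta> (\<gamma> + 1) n = \<gamma> * hyp2F1_coeff \<alpha> \<beta> \<gamma> n / (\<gamma> + of_nat n)"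
    using hyp2F1_coeff_plus1[OF assms, of n \<alpha> \<beta>] nz by (simp add: field_simps)
  have 2: "of_nat (Suc n) * hyp2F1_coeff \<alpha> \<beta> \<gamma> (Suc n) =
     (\<alpha> + of_nat n) * (\<beta> + of_nat n) / (\<gamma> + of_nat n) * hyp2F1_coeff \<alpha> \<beta> \<gamma> n"
    using hyp2F1_coeff_Suc by (simp add: mult.commute)
  show ?thesis unfolding 1 2 using nz by (simp add: divide_simps) (simp add: algebra_simps)
qed

lemma norm_hyp2F1_coeff_le:
  assumes "\<gamma> \<notin> \<int>\<^sub>\<le>\<^sub>0"
  shows "\<exists>q. \<forall>n. norm (hyp2F1_coeff \<alpha> \<beta> \<gamma> n) \<le> real (n + 1) ^ q"
proof -
  obtain q1 where q1: "\<And>n. norm (pochhammer \<alpha> n / pochhammer \<gamma> n) \<le> real (n + 1) ^ q1"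
    using norm_pochhammer_ratio_le_0[OF assms] by blast
  obtain q2 where q2: "\<And>n. norm (pochhammer \<beta> n / fact n) \<le> real (n + 1) ^ q2"
    using norm_pochhammer_over_fact_le by blast
  have "norm (hyp2F1_coeff \<alpha> \<beta> \<gamma> n) = norm (pochhammer \<alpha> n / pochhammer \<gamma> n) * norm (pochhammer \<beta> n / fact n)" for n
    by (simp add: hyp2F1_coeff_def norm_mult norm_divide)
  also have "\<dots> n \<le> real (n + 1) ^ q1 * real (n + 1) ^ q2" for n
    by (intro mult_mono q1 q2) auto
  finally show ?thesis by (intro exI[of _ "q1 + q2"]) (simp add: power_add)
qed

lemma summable_poly_bounded_powser:
  fixes c :: "nat \<Rightarrow> complex"
  assumes "\<And>n. norm (c n) \<le> C * real (n + 1) ^ q" "norm z < 1"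
  shows "summable (\<lambda>n. norm (c n * z ^ n))"
proof (rule summable_comparison_test')
  show "summable (\<lambda>n. C * (real (n + 1) ^ q * norm z ^ n))"
    using assms by (intro summable_mult summable_Suc_power_mult_power) auto
  show "norm (norm (c n * z ^ n)) \<le> C * (real (n + 1) ^ q * norm z ^ n)" if "n \<ge> 0" for n
    using assms(1)[of n] by (simp add: norm_mult norm_power mult_right_mono flip: mult.assoc)
qed

lemma summable_norm_hyp2F1:
  assumes "\<gamma> \<notin> \<int>\<^sub>\<le>\<^sub>0" "norm z < 1"
  shows "summable (\<lambda>n. norm (hyp2F1_coeff \<alpha> \<beta> \<gamma> n * z ^ n))"
proof -
  obtain q where "\<And>n. norm (hyp2F1_coeff \<alpha> \<beta> \<gamma> n) \<le> real (n + 1) ^ q"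
    using norm_hyp2F1_coeff_le[OF assms(1)] by blast
  then have "norm (hyp2F1_coeff \<alpha> \<beta> \<gamma> n) \<le> 1 * real (n + 1) ^ q" for n by simp
  then show ?thesis by (rule summable_poly_bounded_powser[OF _ assms(2)])
qed

lemma hyp2F1_sums:
  assumes "\<gamma> \<notin> \<int>\<^sub>\<le>\<^sub>0" "norm z < 1"
  shows "(\<lambda>n. hyp2F1_coeff \<alpha> \<beta> \<gamma> n * z ^ n) sums hyp2F1 \<alpha> \<beta> \<gamma> z"
  unfolding hyp2F1_def by (rule summable_sums[OF summable_norm_cancel[OF summable_norm_hyp2F1[OF assms]]])

section \<open>Derivatives and contiguous relations inside the unit disc\<close>

lemma powser_has_derivative_sums:
  fixes c :: "nat \<Rightarrow> complex"
  assumes "\<And>z. norm z < 1 \<Longrightarrow> summable (\<lambda>n. c n * z ^ n)" "norm z < 1"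
  obtains D where "((\<lambda>z. \<Sum>n. c n * z ^ n) has_field_derivative D) (at z)"
    "(\<lambda>n. of_nat (Suc n) * c (Suc n) * z ^ n) sums D" "(\<lambda>n. of_nat n * c n * z ^ n) sums (z * D)"
proof -
  obtain K where K: "norm z < K" "K < 1" using assms(2) dense by blast
  define D where "D = (\<Sum>n. diffs c n * z ^ n)"
  have "K \<ge> 0" using K norm_ge_zero[of z] by linarith
  then have "summable (\<lambda>n. c n * of_real K ^ n)" using K by (intro assms(1)) simp
  then have "((\<lambda>z. \<Sum>n. c n * z ^ n) has_field_derivative D) (at z)"
    unfolding D_def by (rule termdiffs_strong) (use K in simp)
  moreover have "summable (\<lambda>n. diffs c n * z ^ n)"
    by (rule termdiff_converges[OF K(1)]) (use K in \<open>auto intro!: assms(1)\<close>)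
  then have D: "(\<lambda>n. of_nat (Suc n) * c (Suc n) * z ^ n) sums D"
    unfolding D_def diffs_def by (rule summable_sums)
  moreover have "(\<lambda>n. of_nat n * c n * z ^ n) sums (z * D)"
    using sums_mult[OF D, of z] sums_Suc_iff[of "\<lambda>n. of_nat n * c n * z ^ n" "z * D"]
    by (simp add: mult_ac)
  ultimately show ?thesis using that by blast
qed

lemma hyp2F1_derivative_sums:
  assumes "\<gamma> \<notin> \<int>\<^sub>\<le>\<^sub>0" "norm z < 1"
  obtains D where "(hyp2F1 \<alpha> \<beta> \<gamma> has_field_derivative D) (at z)"
    "(\<lambda>n. of_nat (Suc n) * hyp2F1_coeff \<alpha> \<beta> \<gamma> (Suc n) * z ^ n) sums D"
    "(\<lambda>n. of_nat n * hyp2F1_coeff \<alpha> \<beta> \<gamma> n * z ^ n) sums (z * D)"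
proof (rule powser_has_derivative_sums[OF _ assms(2)])
  show "summable (\<lambda>n. hyp2F1_coeff \<alpha> \<beta> \<gamma> n * w ^ n)" if "norm w < 1" for w
    using hyp2F1_sums[OF assms(1) that] by (rule sums_summable)
  fix D assume "((\<lambda>z. \<Sum>n. hyp2F1_coeff \<alpha> \<beta> \<gamma> n * z ^ n) has_field_derivative D) (at z)"
    "(\<lambda>n. of_nat (Suc n) * hyp2F1_coeff \<alpha> \<beta> \<gamma> (Suc n) * z ^ n) sums D"
    "(\<lambda>n. of_nat n * hyp2F1_coeff \<alpha> \<beta> \<gamma> n * z ^ n) sums (z * D)"
  then show thesis by (intro that) (simp_all add: hyp2F1_def[abs_def])
qed

lemma hyp2F1_derivative:
  assumes "\<gamma> \<notin> \<int>\<^sub>\<le>\<^sub>0" "norm z < 1"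
  shows "(hyp2F1 \<alpha> \<beta> \<gamma> has_field_derivative \<alpha> * \<beta> / \<gamma> * hyp2F1 (\<alpha> + 1) (\<beta> + 1) (\<gamma> + 1) z) (at z)"
proof -
  obtain D where D: "(hyp2F1 \<alpha> \<beta> \<gamma> has_field_derivative D) (at z)"
    "(\<lambda>n. of_nat (Suc n) * hyp2F1_coeff \<alpha> \<beta> \<gamma> (Suc n) * z ^ n) sums D"
    by (rule hyp2F1_derivative_sums[OF assms])
  have g: "\<gamma> + 1 \<notin> \<int>\<^sub>\<le>\<^sub>0" using add_of_nat_notin_nonpos_Ints[OF assms(1), of 1] by simp
  have "of_nat (Suc n) * hyp2F1_coeff \<alpha> \<beta> \<gamma> (Suc n) = \<alpha> * \<beta> / \<gamma> * hyp2F1_coeff (\<alpha> + 1) (\<beta> + 1) (\<gamma> + 1) n" for n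
    by (simp add: hyp2F1_coeff_def pochhammer_rec divide_simps del: of_nat_Suc)
  then have "(\<lambda>n. of_nat (Suc n) * hyp2F1_coeff \<alpha> \<beta> \<gamma> (Suc n) * z ^ n) sums
     (\<alpha> * \<beta> / \<gamma> * hyp2F1 (\<alpha> + 1) (\<beta> + 1) (\<gamma> + 1) z)"
    using sums_mult[OF hyp2F1_sums[OF g assms(2), of "\<alpha> + 1" "\<beta> + 1"], of "\<alpha> * \<beta> / \<gamma>"] by (simp add: mult_ac)
  then have "D = \<alpha> * \<beta> / \<gamma> * hyp2F1 (\<alpha> + 1) (\<beta> + 1) (\<gamma> + 1) z" using D(2) sums_unique2 by blast
  then show ?thesis using D(1) by simp
qed

lemma holomorphic_hyp2F1:
  assumes "\<gamma> \<notin> \<int>\<^sub>\<le>\<^sub>0"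
  shows "hyp2F1 \<alpha> \<beta> \<gamma> holomorphic_on ball 0 1"
proof -
  have "\<exists>D. (hyp2F1 \<alpha> \<beta> \<gamma> has_field_derivative D) (at z)" if "z \<in> ball 0 1" for z
    using hyp2F1_derivative[OF assms, of z] that by auto
  then show ?thesis by (subst holomorphic_on_open) auto
qed

text \<open>Comparison of coefficients by \<open>hyp2F1_coeff_plus1\<close> and
  \<open>hyp2F1_coeff_ladder\<close>. The two relations express both derivatives through the same
  two functions, so F(\<gamma>) and F(\<gamma> + 1) form a closed first-order linear system.\<close>

lemma hyp2F1_ladder:
  assumes "\<gamma> \<notin> \<int>\<^sub>\<le>\<^sub>0" "norm z < 1"
  obtains D1 D2 where
    "(hyp2F1 \<alpha> \<beta> (\<gamma> + 1) has_field_derivative D1) (at z)"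
    "z * D1 = \<gamma> * hyp2F1 \<alpha> \<beta> \<gamma> z - \<gamma> * hyp2F1 \<alpha> \<beta> (\<gamma> + 1) z"
    "(hyp2F1 \<alpha> \<beta> \<gamma> has_field_derivative D2) (at z)"
    "(1 - z) * D2 = (\<alpha> + \<beta> - \<gamma>) * hyp2F1 \<alpha> \<beta> \<gamma> z + (\<gamma> - \<alpha>) * (\<gamma> - \<beta>) / \<gamma> * hyp2F1 \<alpha> \<beta> (\<gamma> + 1) z"
proof -
  have g: "\<gamma> + 1 \<notin> \<int>\<^sub>\<le>\<^sub>0" using add_of_nat_notin_nonpos_Ints[OF assms(1), of 1] by simp
  note S0 = hyp2F1_sums[OF assms, of \<alpha> \<beta>] and S1 = hyp2F1_sums[OF g assms(2), of \<alpha> \<beta>]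
  obtain D1 where D1: "(hyp2F1 \<alpha> \<beta> (\<gamma> + 1) has_field_derivative D1) (at z)"
    "(\<lambda>n. of_nat n * hyp2F1_coeff \<alpha> \<beta> (\<gamma> + 1) n * z ^ n) sums (z * D1)"
    by (rule hyp2F1_derivative_sums[OF g assms(2)])
  obtain D2 where D2: "(hyp2F1 \<alpha> \<beta> \<gamma> has_field_derivative D2) (at z)"
    "(\<lambda>n. of_nat (Suc n) * hyp2F1_coeff \<alpha> \<beta> \<gamma> (Suc n) * z ^ n) sums D2"
    "(\<lambda>n. of_nat n * hyp2F1_coeff \<alpha> \<beta> \<gamma> n * z ^ n) sums (z * D2)"
    by (rule hyp2F1_derivative_sums[OF assms])
  have "(\<lambda>n. (of_nat n * hyp2F1_coeff \<alpha> \<beta> (\<gamma> + 1) n * z ^ n) + \<gamma> * (hyp2F1_coeff \<alpha> \<beta> (\<gamma> + 1) n * z ^ n)) sums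
     (z * D1 + \<gamma> * hyp2F1 \<alpha> \<beta> (\<gamma> + 1) z)"
    by (intro sums_add sums_mult S1 D1)
  moreover have "(of_nat n * hyp2F1_coeff \<alpha> \<beta> (\<gamma> + 1) n * z ^ n) + \<gamma> * (hyp2F1_coeff \<alpha> \<beta> (\<gamma> + 1) n * z ^ n)
      = \<gamma> * (hyp2F1_coeff \<alpha> \<beta> \<gamma> n * z ^ n)" for n
    using arg_cong[OF hyp2F1_coeff_plus1[OF assms(1), of n \<alpha> \<beta>], of "\<lambda>x. x * z ^ n"] by (simp add: algebra_simps)
  ultimately have "z * D1 + \<gamma> * hyp2F1 \<alpha> \<beta> (\<gamma> + 1) z = \<gamma> * hyp2F1 \<alpha> \<beta> \<gamma> z"
    using sums_unique2 sums_mult[OF S0, of \<gamma>] by auto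
  then have 1: "z * D1 = \<gamma> * hyp2F1 \<alpha> \<beta> \<gamma> z - \<gamma> * hyp2F1 \<alpha> \<beta> (\<gamma> + 1) z" by (simp add: algebra_simps)
  have "(\<lambda>n. (of_nat (Suc n) * hyp2F1_coeff \<alpha> \<beta> \<gamma> (Suc n) * z ^ n) - of_nat n * hyp2F1_coeff \<alpha> \<beta> \<gamma> n * z ^ n)
       sums (D2 - z * D2)"
    by (intro sums_diff D2)
  moreover have "(of_nat (Suc n) * hyp2F1_coeff \<alpha> \<beta> \<gamma> (Suc n) * z ^ n) - of_nat n * hyp2F1_coeff \<alpha> \<beta> \<gamma> n * z ^ n
     = (\<alpha> + \<beta> - \<gamma>) * (hyp2F1_coeff \<alpha> \<beta> \<gamma> n * z ^ n) + (\<gamma> - \<alpha>) * (\<gamma> - \<beta>) / \<gamma> * (hyp2F1_coeff \<alpha> \<beta> (\<gamma> + 1) n * z ^ n)" for n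
    using arg_cong[OF hyp2F1_coeff_ladder[OF assms(1), of n \<alpha> \<beta>], of "\<lambda>x. x * z ^ n"]
    by (simp only: ring_distribs mult.assoc)
  moreover have "(\<lambda>n. (\<alpha> + \<beta> - \<gamma>) * (hyp2F1_coeff \<alpha> \<beta> \<gamma> n * z ^ n) + (\<gamma> - \<alpha>) * (\<gamma> - \<beta>) / \<gamma> * (hyp2F1_coeff \<alpha> \<beta> (\<gamma> + 1) n * z ^ n))
    sums ((\<alpha> + \<beta> - \<gamma>) * hyp2F1 \<alpha> \<beta> \<gamma> z + (\<gamma> - \<alpha>) * (\<gamma> - \<beta>) / \<gamma> * hyp2F1 \<alpha> \<beta> (\<gamma> + 1) z)"
    by (intro sums_add sums_mult S0 S1)
  ultimately have "D2 - z * D2 = (\<alpha> + \<beta> - \<gamma>) * hyp2F1 \<alpha> \<beta> \<gamma> z + (\<gamma> - \<alpha>) * (\<gamma> - \<beta>) / \<gamma> * hyp2F1 \<alpha> \<beta> (\<gamma> + 1) z"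
    by (metis (no_types, lifting) sums_cong sums_unique2)
  then have 2: "(1 - z) * D2 = (\<alpha> + \<beta> - \<gamma>) * hyp2F1 \<alpha> \<beta> \<gamma> z + (\<gamma> - \<alpha>) * (\<gamma> - \<beta>) / \<gamma> * hyp2F1 \<alpha> \<beta> (\<gamma> + 1) z"
    by (simp add: left_diff_distrib)
  show ?thesis using that[OF D1(1) 1 D2(1) 2] .
qed

section \<open>Gauss's summation theorem\<close>

lemma pochhammer_Suc_rGamma_series:
  assumes "n > 0"
  shows "pochhammer z (Suc n) = rGamma_series z n * fact n * exp (z * of_real (ln (of_nat n)))"
  unfolding rGamma_series_def by simp

lemma rGamma_nonzero: "\<gamma> \<notin> \<int>\<^sub>\<le>\<^sub>0 \<Longrightarrow> rGamma (\<gamma>::complex) \<noteq> 0"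
  by (simp add: rGamma_eq_zero_iff)

text \<open>Expressing each Pochhammer symbol by \<open>rGamma_series\<close>, the factorial being
  the symbol of 1, leaves a convergent quotient \<open>r\<close> times n to the power \<alpha> +
  \<beta> - \<gamma> - 1. Inside the disc any polynomial bound would do; at z = 1 this order of
  decay decides convergence.\<close>

lemma norm_hyp2F1_coeff_le_powr:
  assumes "\<gamma> \<notin> \<int>\<^sub>\<le>\<^sub>0"
  shows "\<exists>C. \<forall>n>0. norm (hyp2F1_coeff \<alpha> \<beta> \<gamma> (Suc n)) \<le> C * real n powr (Re (\<alpha> + \<beta> - \<gamma>) - 1)"
proof -
  define r where "r = (\<lambda>n. rGamma_series \<alpha> n * rGamma_series \<beta> n / (rGamma_series \<gamma> n * rGamma_series 1 n))"
  have "r \<longlonglongrightarrow> rGamma \<alpha> * rGamma \<beta> / (rGamma \<gamma> * rGamma 1)"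
    unfolding r_def using assms rGamma_nonzero by (intro tendsto_intros) (auto simp: rGamma_eq_zero_iff)
  then have "Bseq r" by (rule convergent_imp_Bseq[OF convergentI])
  then obtain C where C: "\<And>n. norm (r n) \<le> C" by (metis BseqE)
  have "norm (hyp2F1_coeff \<alpha> \<beta> \<gamma> (Suc n)) \<le> C * real n powr (Re (\<alpha> + \<beta> - \<gamma>) - 1)" if n: "n > 0" for n
  proof -
    let ?e = "\<lambda>z::complex. exp (z * of_real (ln (of_nat n)))"
    have "hyp2F1_coeff \<alpha> \<beta> \<gamma> (Suc n) =
       pochhammer \<alpha> (Suc n) * pochhammer \<beta> (Suc n) / (pochhammer \<gamma> (Suc n) * pochhammer 1 (Suc n))"
      by (simp only: hyp2F1_coeff_def pochhammer_fact)
    also have "\<dots> = r n * (?e \<alpha> * ?e \<beta> / (?e \<gamma> * ?e 1))"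
      unfolding pochhammer_Suc_rGamma_series[OF n] r_def by (simp add: field_simps)
    also have "?e \<alpha> * ?e \<beta> / (?e \<gamma> * ?e 1) = ?e (\<alpha> + \<beta> - \<gamma> - 1)"
      by (simp add: algebra_simps exp_add exp_diff)
    also have "norm (r n * ?e (\<alpha> + \<beta> - \<gamma> - 1)) = norm (r n) * real n powr (Re (\<alpha> + \<beta> - \<gamma>) - 1)"
      using n by (simp add: norm_mult powr_def)
    finally show ?thesis using C[of n] by (simp add: mult_right_mono)
  qed
  then show ?thesis by blast
qed

lemma summable_norm_hyp2F1_coeff:
  assumes "\<gamma> \<notin> \<int>\<^sub>\<le>\<^sub>0" "Re (\<gamma> - \<alpha> - \<beta>) > 0"
  shows "summable (\<lambda>n. norm (hyp2F1_coeff \<alpha> \<beta> \<gamma> n))"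
proof -
  obtain C where C: "\<And>n. n > 0 \<Longrightarrow> norm (hyp2F1_coeff \<alpha> \<beta> \<gamma> (Suc n)) \<le> C * real n powr (Re (\<alpha> + \<beta> - \<gamma>) - 1)"
    using norm_hyp2F1_coeff_le_powr[OF assms(1)] by blast
  have "summable (\<lambda>n. norm (hyp2F1_coeff \<alpha> \<beta> \<gamma> (Suc n)))"
  proof (rule summable_comparison_test'[where N = 1])
    show "summable (\<lambda>n. C * real n powr (Re (\<alpha> + \<beta> - \<gamma>) - 1))"
      using assms(2) by (intro summable_mult) (simp add: summable_real_powr_iff)
  qed (use C in simp)
  then show ?thesis by (subst (asm) summable_Suc_iff)
qed

lemma hyp2F1_coeff_times_nat_tendsto_0:
  assumes "\<gamma> \<notin> \<int>\<^sub>\<le>\<^sub>0" "Re (\<gamma> - \<alpha> - \<beta>) > 0"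
  shows "(\<lambda>n. of_nat n * hyp2F1_coeff \<alpha> \<beta> \<gamma> n) \<longlonglongrightarrow> 0"
proof -
  obtain C where C: "\<And>n. n > 0 \<Longrightarrow> norm (hyp2F1_coeff \<alpha> \<beta> \<gamma> (Suc n)) \<le> C * real n powr (Re (\<alpha> + \<beta> - \<gamma>) - 1)"
    using norm_hyp2F1_coeff_le_powr[OF assms(1)] by blast
  define \<delta> where "\<delta> = Re (\<gamma> - \<alpha> - \<beta>)"
  have "(\<lambda>n. of_nat (Suc n) * hyp2F1_coeff \<alpha> \<beta> \<gamma> (Suc n)) \<longlonglongrightarrow> 0"
  proof (rule Lim_null_comparison)
    have "(\<lambda>n. real n powr (- \<delta>)) \<longlonglongrightarrow> 0"
      using assms(2) by (intro tendsto_neg_powr filterlim_real_sequentially) (simp add: \<delta>_def)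
    then show "(\<lambda>n. 2 * C * real n powr (- \<delta>)) \<longlonglongrightarrow> 0" by (rule tendsto_mult_right_zero)
    show "\<forall>\<^sub>F n in sequentially. norm (of_nat (Suc n) * hyp2F1_coeff \<alpha> \<beta> \<gamma> (Suc n)) \<le> 2 * C * real n powr (- \<delta>)"
      using eventually_gt_at_top[of 0]
    proof eventually_elim
      case (elim n)
      have C': "norm (hyp2F1_coeff \<alpha> \<beta> \<gamma> (Suc n)) \<le> C * real n powr (- \<delta> - 1)"
        using C[OF elim] by (simp add: \<delta>_def algebra_simps)
      have Cpos: "0 \<le> C * real n powr (- \<delta> - 1)"
        by (rule order_trans[OF norm_ge_zero C'])
      have "norm (of_nat (Suc n) * hyp2F1_coeff \<alpha> \<beta> \<gamma> (Suc n)) \<le> real (Suc n) * (C * real n powr (- \<delta> - 1))"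
        unfolding norm_mult norm_of_nat using C' by (intro mult_left_mono) auto
      also have "\<dots> \<le> (2 * real n) * (C * real n powr (- \<delta> - 1))"
        using elim Cpos by (intro mult_right_mono) auto
      also have "\<dots> = 2 * C * (real n powr 1 * real n powr (- \<delta> - 1))" using elim by simp
      also have "real n powr 1 * real n powr (- \<delta> - 1) = real n powr (- \<delta>)" by (subst powr_add[symmetric]) simp
      finally show ?case .
    qed
  qed
  then show ?thesis by (rule LIMSEQ_imp_Suc)
qed

text \<open>Summing \<open>hyp2F1_coeff_ladder\<close> over n telescopes its left side to zero,
  because n times the n-th coefficient tends to 0 when the real part of \<gamma> - \<alpha> -
  \<beta> is positive.\<close>

lemma hyp2F1_at_1_ladder:
  assumes "\<gamma> \<notin> \<int>\<^sub>\<le>\<^sub>0" "Re (\<gamma> - \<alpha> - \<beta>) > 0"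
  shows "\<gamma> * (\<gamma> - \<alpha> - \<beta>) * hyp2F1 \<alpha> \<beta> \<gamma> 1 = (\<gamma> - \<alpha>) * (\<gamma> - \<beta>) * hyp2F1 \<alpha> \<beta> (\<gamma> + 1) 1"
proof -
  have g: "\<gamma> + 1 \<notin> \<int>\<^sub>\<le>\<^sub>0" using add_of_nat_notin_nonpos_Ints[OF assms(1), of 1] by simp
  have S0: "hyp2F1_coeff \<alpha> \<beta> \<gamma> sums hyp2F1 \<alpha> \<beta> \<gamma> 1"
    using summable_sums[OF summable_norm_cancel[OF summable_norm_hyp2F1_coeff[OF assms]]] by (simp add: hyp2F1_def)
  have S1: "hyp2F1_coeff \<alpha> \<beta> (\<gamma> + 1) sums hyp2F1 \<alpha> \<beta> (\<gamma> + 1) 1"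
    using summable_sums[OF summable_norm_cancel[OF summable_norm_hyp2F1_coeff[OF g, of \<alpha> \<beta>]]] assms(2)
    by (simp add: hyp2F1_def)
  have "(\<lambda>n. of_nat (Suc n) * hyp2F1_coeff \<alpha> \<beta> \<gamma> (Suc n) - of_nat n * hyp2F1_coeff \<alpha> \<beta> \<gamma> n) sums (0 - of_nat 0 * hyp2F1_coeff \<alpha> \<beta> \<gamma> 0)"
    by (rule telescope_sums[OF hyp2F1_coeff_times_nat_tendsto_0[OF assms]])
  moreover have "(\<lambda>n. of_nat (Suc n) * hyp2F1_coeff \<alpha> \<beta> \<gamma> (Suc n) - of_nat n * hyp2F1_coeff \<alpha> \<beta> \<gamma> n) sums
    ((\<alpha> + \<beta> - \<gamma>) * hyp2F1 \<alpha> \<beta> \<gamma> 1 + (\<gamma> - \<alpha>) * (\<gamma> - \<beta>) / \<gamma> * hyp2F1 \<alpha> \<beta> (\<gamma> + 1) 1)"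
    unfolding hyp2F1_coeff_ladder[OF assms(1)] by (intro sums_add sums_mult S0 S1)
  ultimately have "(\<alpha> + \<beta> - \<gamma>) * hyp2F1 \<alpha> \<beta> \<gamma> 1 + (\<gamma> - \<alpha>) * (\<gamma> - \<beta>) / \<gamma> * hyp2F1 \<alpha> \<beta> (\<gamma> + 1) 1 = 0"
    using sums_unique2 by fastforce
  moreover have "\<gamma> \<noteq> 0" using assms(1) by auto
  ultimately show ?thesis by (simp add: field_simps)
qed

lemma norm_add_of_nat_mono:
  assumes "Re \<gamma> > 0" "m \<le> n"
  shows "norm (\<gamma> + of_nat m) \<le> norm (\<gamma> + of_nat n)"
  unfolding cmod_def using assms by (auto intro!: power_mono)

lemma norm_pochhammer_mono:
  assumes "Re \<gamma> > 0" "m \<le> n"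
  shows "norm (pochhammer (\<gamma> + of_nat m) k) \<le> norm (pochhammer (\<gamma> + of_nat n) k)"
  unfolding pochhammer_prod prod_norm[symmetric]
proof (rule prod_mono)
  fix i show "0 \<le> norm (\<gamma> + of_nat m + of_nat i) \<and> norm (\<gamma> + of_nat m + of_nat i) \<le> norm (\<gamma> + of_nat n + of_nat i)"
    using norm_add_of_nat_mono[of \<gamma> "m + i" "n + i"] assms by (simp add: add.assoc)
qed

text \<open>Tannery's theorem: all coefficients but the first tend to 0. Once the real part of the
  lower parameter is positive, raising it by n only enlarges the moduli of its Pochhammer symbols,
  so the series at \<open>g\<close> dominates all later ones.\<close>

lemma hyp2F1_at_1_tendsto:
  shows "(\<lambda>n. hyp2F1 \<alpha> \<beta> (\<gamma> + of_nat n) 1) \<longlonglongrightarrow> 1"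
proof -
  obtain N :: nat where N: "real N > max (- Re \<gamma>) (- Re (\<gamma> - \<alpha> - \<beta>))" using reals_Archimedean2 by blast
  define g where "g = \<gamma> + of_nat N"
  have g: "Re g > 0" "Re (g - \<alpha> - \<beta>) > 0" using N by (auto simp: g_def)
  have g': "g \<notin> \<int>\<^sub>\<le>\<^sub>0" using Re_pos_notin_nonpos_Ints[OF g(1)] .
  have "(\<lambda>n. \<Sum>k. hyp2F1_coeff \<alpha> \<beta> (g + of_nat n) k) \<longlonglongrightarrow> (\<Sum>k. if k = 0 then 1 else 0)"
  proof (rule tannerys_theorem[THEN conjunct2, THEN conjunct2])
    show "summable (\<lambda>k. norm (hyp2F1_coeff \<alpha> \<beta> g k))"
      by (rule summable_norm_hyp2F1_coeff[OF g' g(2)])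
    have "norm (hyp2F1_coeff \<alpha> \<beta> (g + of_nat n) k) \<le> norm (hyp2F1_coeff \<alpha> \<beta> g k)" for n k
      using norm_pochhammer_mono[OF g(1), of 0 n k] pochhammer_nonzero[OF g', of k] pochhammer_nonzero[OF add_of_nat_notin_nonpos_Ints[OF g'], of n k]
      unfolding hyp2F1_coeff_def norm_divide norm_mult
      by (intro divide_left_mono mult_right_mono mult_nonneg_nonneg mult_pos_pos) auto
    then show "\<forall>\<^sub>F (k, n) in sequentially \<times>\<^sub>F sequentially. norm (hyp2F1_coeff \<alpha> \<beta> (g + of_nat n) k) \<le> norm (hyp2F1_coeff \<alpha> \<beta> g k)"
      by (intro always_eventually) auto
    fix k
    show "(\<lambda>n. hyp2F1_coeff \<alpha> \<beta> (g + of_nat n) k) \<longlonglongrightarrow> (if k = 0 then 1 else 0)"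
    proof (cases k)
      case (Suc l)
      have "(\<lambda>n. pochhammer \<alpha> k * pochhammer \<beta> k / fact k * (inverse (g + of_nat n) * inverse (pochhammer (g + 1 + of_nat n) l))) \<longlonglongrightarrow> 0"
      proof (rule tendsto_mult_right_zero, rule Lim_null_comparison)
        show "\<forall>\<^sub>F n in sequentially. norm (inverse (g + of_nat n) * inverse (pochhammer (g + 1 + of_nat n) l)) \<le>
           inverse (norm (pochhammer (g + 1) l)) * norm (inverse (g + of_nat n))"
        proof (rule always_eventually, rule allI)
          fix n
          have "pochhammer (g + 1) l \<noteq> 0"
            using pochhammer_nonzero[OF Re_pos_notin_nonpos_Ints[of "g + 1"]] g by simp
          then have "norm (inverse (pochhammer (g + 1 + of_nat n) l)) \<le> inverse (norm (pochhammer (g + 1) l))"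
            using norm_pochhammer_mono[of "g + 1" 0 n l] g(1) by (simp add: norm_inverse le_imp_inverse_le)
          then show "norm (inverse (g + of_nat n) * inverse (pochhammer (g + 1 + of_nat n) l)) \<le>
             inverse (norm (pochhammer (g + 1) l)) * norm (inverse (g + of_nat n))"
            unfolding norm_mult by (subst mult.commute) (rule mult_right_mono, simp_all)
        qed
        have "filterlim (\<lambda>n. g + of_nat n) at_infinity sequentially"
          by (intro tendsto_add_filterlim_at_infinity[OF tendsto_const] tendsto_of_nat)
        then have "(\<lambda>n. inverse (g + of_nat n)) \<longlonglongrightarrow> 0"
          using filterlim_compose[OF tendsto_inverse_0] by blast
        then show "(\<lambda>n. inverse (norm (pochhammer (g + 1) l)) * norm (inverse (g + of_nat n))) \<longlonglongrightarrow> 0"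
          by (intro tendsto_mult_right_zero tendsto_norm_zero)
      qed
      moreover have "hyp2F1_coeff \<alpha> \<beta> (g + of_nat n) k = pochhammer \<alpha> k * pochhammer \<beta> k / fact k * (inverse (g + of_nat n) * inverse (pochhammer (g + 1 + of_nat n) l))" for n
        by (simp add: hyp2F1_coeff_def Suc pochhammer_rec[of "g + of_nat n"] divide_simps add_ac)
      ultimately show ?thesis using Suc by simp
    qed simp
  qed simp
  also have "(\<Sum>k. if k = 0 then 1 else 0 :: complex) = 1" using suminf_finite[of "{0}" "\<lambda>k. if k = 0 then 1 else 0 :: complex"] by simp
  finally have "(\<lambda>n. hyp2F1 \<alpha> \<beta> (\<gamma> + of_nat (n + N)) 1) \<longlonglongrightarrow> 1"
    by (simp add: hyp2F1_def g_def add_ac)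
  then show ?thesis by (rule LIMSEQ_offset)
qed

text \<open>Iterating the relation at z = 1 pushes \<gamma> to infinity, where the value tends to 1.
  The accumulated quotient of Pochhammer symbols converges to a quotient of reciprocal Gamma
  functions; the powers of n cancel because (\<gamma> - \<alpha>) + (\<gamma> - \<beta>) = \<gamma>
  + d.\<close>

theorem hyp2F1_Gauss:
  assumes "\<gamma> \<notin> \<int>\<^sub>\<le>\<^sub>0" "Re (\<gamma> - \<alpha> - \<beta>) > 0"
  shows "hyp2F1 \<alpha> \<beta> \<gamma> 1 = Gamma \<gamma> * Gamma (\<gamma> - \<alpha> - \<beta>) * rGamma (\<gamma> - \<alpha>) * rGamma (\<gamma> - \<beta>)"
proof -
  define d where "d = \<gamma> - \<alpha> - \<beta>"
  have d: "d \<notin> \<int>\<^sub>\<le>\<^sub>0" using assms(2) Re_pos_notin_nonpos_Ints by (simp add: d_def)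
  have iter: "hyp2F1 \<alpha> \<beta> \<gamma> 1 = pochhammer (\<gamma> - \<alpha>) n * pochhammer (\<gamma> - \<beta>) n / (pochhammer \<gamma> n * pochhammer d n) * hyp2F1 \<alpha> \<beta> (\<gamma> + of_nat n) 1" for n
  proof (induction n)
    case (Suc n)
    have "\<gamma> + of_nat n \<notin> \<int>\<^sub>\<le>\<^sub>0" "d + of_nat n \<notin> \<int>\<^sub>\<le>\<^sub>0" using assms(1) d add_of_nat_notin_nonpos_Ints by blast+
    moreover from this have "\<gamma> + of_nat n \<noteq> 0" "d + of_nat n \<noteq> 0" by auto
    moreover have "(\<gamma> + of_nat n) * (d + of_nat n) * hyp2F1 \<alpha> \<beta> (\<gamma> + of_nat n) 1 =
       (\<gamma> - \<alpha> + of_nat n) * (\<gamma> - \<beta> + of_nat n) * hyp2F1 \<alpha> \<beta> (\<gamma> + of_nat (Suc n)) 1"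
      using hyp2F1_at_1_ladder[of "\<gamma> + of_nat n" \<alpha> \<beta>] calculation(1) assms(2) by (simp add: d_def algebra_simps)
    ultimately have "hyp2F1 \<alpha> \<beta> (\<gamma> + of_nat n) 1 =
       (\<gamma> - \<alpha> + of_nat n) * (\<gamma> - \<beta> + of_nat n) / ((\<gamma> + of_nat n) * (d + of_nat n)) * hyp2F1 \<alpha> \<beta> (\<gamma> + of_nat (Suc n)) 1"
      by (simp add: divide_simps) (simp add: mult_ac)
    then have "pochhammer (\<gamma> - \<alpha>) n * pochhammer (\<gamma> - \<beta>) n / (pochhammer \<gamma> n * pochhammer d n) * hyp2F1 \<alpha> \<beta> (\<gamma> + of_nat n) 1 =
      pochhammer (\<gamma> - \<alpha>) (Suc n) * pochhammer (\<gamma> - \<beta>) (Suc n) / (pochhammer \<gamma> (Suc n) * pochhammer d (Suc n)) * hyp2F1 \<alpha> \<beta> (\<gamma> + of_nat (Suc n)) 1"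
      by (simp add: pochhammer_Suc mult_ac)
    with Suc.IH show ?case by (rule trans)
  qed simp
  define r where "r = (\<lambda>n. rGamma_series (\<gamma> - \<alpha>) n * rGamma_series (\<gamma> - \<beta>) n / (rGamma_series \<gamma> n * rGamma_series d n))"
  have r: "r \<longlonglongrightarrow> rGamma (\<gamma> - \<alpha>) * rGamma (\<gamma> - \<beta>) / (rGamma \<gamma> * rGamma d)"
    unfolding r_def using assms(1) d rGamma_nonzero by (intro tendsto_intros) auto
  have "hyp2F1 \<alpha> \<beta> \<gamma> 1 = r n * hyp2F1 \<alpha> \<beta> (\<gamma> + of_nat (Suc n)) 1" if n: "n > 0" for n
  proof -
    let ?e = "\<lambda>z::complex. exp (z * of_real (ln (of_nat n)))"
    have "?e (\<gamma> - \<alpha>) * ?e (\<gamma> - \<beta>) = ?e \<gamma> * ?e d"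
      by (simp add: d_def algebra_simps flip: exp_add)
    then have "pochhammer (\<gamma> - \<alpha>) (Suc n) * pochhammer (\<gamma> - \<beta>) (Suc n) / (pochhammer \<gamma> (Suc n) * pochhammer d (Suc n)) = r n"
      unfolding pochhammer_Suc_rGamma_series[OF n] r_def
      by (simp add: divide_simps) (simp add: mult_ac)?
    then show ?thesis using iter[of "Suc n"] by simp
  qed
  then have "\<forall>\<^sub>F n in sequentially. r n * hyp2F1 \<alpha> \<beta> (\<gamma> + of_nat (Suc n)) 1 = hyp2F1 \<alpha> \<beta> \<gamma> 1"
    by (intro eventually_mono[OF eventually_gt_at_top[of 0]]) metis
  moreover have "(\<lambda>n. r n * hyp2F1 \<alpha> \<beta> (\<gamma> + of_nat (Suc n)) 1) \<longlonglongrightarrow> rGamma (\<gamma> - \<alpha>) * rGamma (\<gamma> - \<beta>) / (rGamma \<gamma> * rGamma d) * 1"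
    by (intro tendsto_mult r LIMSEQ_Suc hyp2F1_at_1_tendsto)
  ultimately have "(\<lambda>n. hyp2F1 \<alpha> \<beta> \<gamma> 1) \<longlonglongrightarrow> rGamma (\<gamma> - \<alpha>) * rGamma (\<gamma> - \<beta>) / (rGamma \<gamma> * rGamma d) * 1"
    by (rule Lim_transform_eventually[rotated])
  then have "hyp2F1 \<alpha> \<beta> \<gamma> 1 = rGamma (\<gamma> - \<alpha>) * rGamma (\<gamma> - \<beta>) / (rGamma \<gamma> * rGamma d) * 1"
    by (simp add: LIMSEQ_const_iff)
  then show ?thesis unfolding d_def by (simp add: rGamma_inverse_Gamma field_simps)
qed

section \<open>Interchanging double series\<close>

text \<open>The two hypotheses are Tonelli's condition in iterated form. Passing to an unordered sum
  over pairs makes both rearrangements needed later, exchange of the two sums and summation along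
  diagonals, mere reindexings.\<close>

lemma double_series_has_sum:
  fixes t :: "nat \<Rightarrow> nat \<Rightarrow> complex"
  assumes "\<And>k. summable (\<lambda>j. norm (t k j))" "summable (\<lambda>k. \<Sum>j. norm (t k j))"
  shows "((\<lambda>(k, j). t k j) has_sum (\<Sum>k. \<Sum>j. t k j)) UNIV"
    and "(\<lambda>x. norm ((\<lambda>(k, j). t k j) x)) summable_on UNIV"
proof -
  have inner: "((\<lambda>j. norm (t k j)) has_sum (\<Sum>j. norm (t k j))) UNIV" for k
    using assms(1) by (intro norm_summable_imp_has_sum summable_sums) auto
  have nn: "0 \<le> (\<Sum>j. norm (t k j))" for k using assms(1) by (intro suminf_nonneg) auto
  have "(\<lambda>x. norm ((\<lambda>(k, j). t k j) x)) summable_on Sigma UNIV (\<lambda>_. UNIV)"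
    unfolding Infinite_Sum.abs_summable_on_Sigma_iff
  proof (intro conjI ballI)
    fix k show "(\<lambda>j. norm ((\<lambda>(k, j). t k j) (k, j))) summable_on UNIV"
      using inner by (auto simp: summable_on_def)
    have "infsum (\<lambda>j. norm (t k j)) UNIV = (\<Sum>j. norm (t k j))" for k
      using inner by (rule infsumI)
    then show "(\<lambda>k. norm (infsum (\<lambda>j. norm ((\<lambda>(k, j). t k j) (k, j))) UNIV)) summable_on UNIV"
      using assms(2) nn by (simp add: summable_on_UNIV_nonneg_real_iff)
  qed
  then show abs: "(\<lambda>x. norm ((\<lambda>(k, j). t k j) x)) summable_on UNIV" by simp
  then obtain S where S: "((\<lambda>(k, j). t k j) has_sum S) UNIV"
    using abs_summable_summable summable_on_def by blast
  have "((\<lambda>k. \<Sum>j. t k j) has_sum S) UNIV"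
  proof (rule has_sum_SigmaD)
    show "((\<lambda>(k, j). t k j) has_sum S) (Sigma UNIV (\<lambda>_. UNIV))" using S by simp
    show "((\<lambda>j. (\<lambda>(k, j). t k j) (k, j)) has_sum (\<Sum>j. t k j)) UNIV" for k
      using norm_summable_imp_has_sum[OF assms(1) summable_sums[OF summable_norm_cancel[OF assms(1)]]] by simp
  qed
  then have "(\<lambda>k. \<Sum>j. t k j) sums S" by (rule has_sum_imp_sums)
  then show "((\<lambda>(k, j). t k j) has_sum (\<Sum>k. \<Sum>j. t k j)) UNIV"
    using S by (simp add: sums_iff)
qed

lemma double_series_swap:
  fixes t :: "nat \<Rightarrow> nat \<Rightarrow> complex"
  assumes "\<And>k. summable (\<lambda>j. norm (t k j))" "summable (\<lambda>k. \<Sum>j. norm (t k j))"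
  shows "summable (\<lambda>k. t k j)" "(\<lambda>j. \<Sum>k. t k j) sums (\<Sum>k. \<Sum>j. t k j)"
proof -
  have S: "((\<lambda>(j, k). t k j) has_sum (\<Sum>k. \<Sum>j. t k j)) (UNIV \<times> UNIV)"
    using double_series_has_sum(1)[OF assms] by (subst has_sum_swap) simp
  have "(\<lambda>x. norm ((\<lambda>(j, k). t k j) x)) summable_on (UNIV \<times> UNIV)"
    using double_series_has_sum(2)[OF assms] by (subst summable_on_swap) (simp add: case_prod_unfold)
  then have abs: "(\<lambda>k. norm (t k j)) summable_on UNIV" for j
    unfolding Infinite_Sum.abs_summable_on_Sigma_iff by auto
  then have 1: "summable (\<lambda>k. norm (t k j))" for j
    by (simp add: summable_on_UNIV_nonneg_real_iff)
  then show "summable (\<lambda>k. t k j)" by (rule summable_norm_cancel)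
  have "((\<lambda>j. \<Sum>k. t k j) has_sum (\<Sum>k. \<Sum>j. t k j)) UNIV"
  proof (rule has_sum_SigmaD)
    show "((\<lambda>(j, k). t k j) has_sum (\<Sum>k. \<Sum>j. t k j)) (Sigma UNIV (\<lambda>_. UNIV))" using S by simp
    show "((\<lambda>k. (\<lambda>(j, k). t k j) (j, k)) has_sum (\<Sum>k. t k j)) UNIV" for j
      using norm_summable_imp_has_sum[OF 1 summable_sums[OF summable_norm_cancel[OF 1]]] by simp
  qed
  then show "(\<lambda>j. \<Sum>k. t k j) sums (\<Sum>k. \<Sum>j. t k j)" by (rule has_sum_imp_sums)
qed

lemma double_series_triangle:
  fixes t :: "nat \<Rightarrow> nat \<Rightarrow> complex"
  assumes "\<And>k. summable (\<lambda>j. norm (t k j))" "summable (\<lambda>k. \<Sum>j. norm (t k j))"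
  shows "(\<lambda>n. \<Sum>k\<le>n. t k (n - k)) sums (\<Sum>k. \<Sum>j. t k j)"
proof -
  have "((\<lambda>(n, k). t k (n - k)) has_sum (\<Sum>k. \<Sum>j. t k j)) (Sigma UNIV (\<lambda>n. {..n})) \<longleftrightarrow>
     ((\<lambda>(k, j). t k j) has_sum (\<Sum>k. \<Sum>j. t k j)) UNIV"
    by (rule has_sum_reindex_bij_witness[of _ "\<lambda>(k, j). (k + j, k)" "\<lambda>(n, k). (k, n - k)"]) auto
  then have "((\<lambda>(n, k). t k (n - k)) has_sum (\<Sum>k. \<Sum>j. t k j)) (Sigma UNIV (\<lambda>n. {..n}))"
    using double_series_has_sum(1)[OF assms] by simp
  then have "((\<lambda>n. \<Sum>k\<le>n. t k (n - k)) has_sum (\<Sum>k. \<Sum>j. t k j)) UNIV"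
    by (rule has_sum_SigmaD) (auto intro: has_sum_finiteI)
  then show ?thesis by (rule has_sum_imp_sums)
qed

section \<open>The transformations of Pfaff and Euler\<close>

lemma pochhammer_binomial_series:
  fixes s z :: complex
  assumes "norm z < 1"
  shows "(\<lambda>n. pochhammer s n / fact n * z ^ n) sums (1 - z) powr (- s)"
proof -
  have "(- s gchoose n) * (- z) ^ n = pochhammer s n / fact n * z ^ n" for n
    unfolding gbinomial_pochhammer power_minus[of z n] by simp
  then show ?thesis using gen_binomial_complex[of "- z" "- s"] assms by simp
qed

lemma pochhammer_binomial_series_real:
  fixes s r :: real
  assumes "\<bar>r\<bar> < 1"
  shows "(\<lambda>n. pochhammer s n / fact n * r ^ n) sums (1 - r) powr (- s)"
proof -
  have "(- s gchoose n) * (- r) ^ n = pochhammer s n / fact n * r ^ n" for n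
    unfolding gbinomial_pochhammer power_minus[of r n] by simp
  then show ?thesis using gen_binomial_real[of "- r" "- s"] assms by simp
qed

lemma norm_pochhammer_le:
  fixes a :: complex
  assumes "norm a \<le> r"
  shows "norm (pochhammer a n) \<le> pochhammer r n"
proof -
  have "norm (a + of_nat i) \<le> r + real i" for i
    using norm_triangle_ineq[of a "of_nat i"] assms by simp
  then show ?thesis
    unfolding pochhammer_prod prod_norm[symmetric] by (intro prod_mono) auto
qed

lemma norm_divide_diff_1_less_1:
  fixes x :: complex
  assumes "Re x < 1 / 2"
  shows "norm (x / (x - 1)) < 1"
proof -
  have "norm x ^ 2 < norm (x - 1) ^ 2"
    using assms unfolding cmod_power2 by (simp add: power2_eq_square algebra_simps)
  then have "norm x < norm (x - 1)" by (rule power_less_imp_less_base) simp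
  moreover from this have "norm (x - 1) > 0" by (meson norm_ge_zero order_le_less_trans)
  ultimately show ?thesis by (simp add: norm_divide)
qed

text \<open>On the right, the k-th term with its prefactor is (-x)^k (1 - x)^(-b-k) times a
  coefficient. Expanding this power binomially gives a double series whose n-th diagonal is summed
  by \<open>pochhammer_diff_sum\<close>, with s = c - a, to the n-th term on the left.\<close>

lemma hyp2F1_Pfaff_small:
  assumes c: "c \<notin> \<int>\<^sub>\<le>\<^sub>0" and x: "norm x < 1 / 3"
  shows "hyp2F1 a b c x = (1 - x) powr (- b) * hyp2F1 b (c - a) c (x / (x - 1))"
proof -
  define C where "C = hyp2F1_coeff b (c - a) c"
  define t where "t = (\<lambda>k j. C k * (- x) ^ k * (pochhammer (b + of_nat k) j / fact j * x ^ j))"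
  define r where "r = norm x"
  have r: "0 \<le> r" "r < 1 / 3" using x by (auto simp: r_def)
  have x1: "x \<noteq> 1" using x by auto
  have inner: "(\<lambda>j. t k j) sums ((1 - x) powr (- b) * (C k * (x / (x - 1)) ^ k))" for k
  proof -
    have "(\<lambda>j. t k j) sums (C k * (- x) ^ k * (1 - x) powr (- (b + of_nat k)))"
      unfolding t_def by (intro sums_mult pochhammer_binomial_series) (use x in auto)
    also have "(1 - x) powr (- (b + of_nat k)) = (1 - x) powr (- b) / (1 - x) ^ k"
      using x1 by (simp add: powr_diff powr_nat')
    also have "C k * (- x) ^ k * ((1 - x) powr (- b) / (1 - x) ^ k) = (1 - x) powr (- b) * (C k * (- x / (1 - x)) ^ k)"
      unfolding power_divide by simp
    also have "- x / (1 - x) = x / (x - 1)" using x1 by (simp add: field_simps)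
    finally show ?thesis .
  qed
  \<comment> \<open>Majorant obtained from \<open>t\<close> by replacing b and x with their moduli.
    Its rows sum to terms geometric in r / (1 - r), which is below 1 because r < 1 / 3.\<close>
  define u where "u = (\<lambda>k j. norm (C k) * r ^ k * (pochhammer (norm b + real k) j / fact j * r ^ j))"
  have u: "(\<lambda>j. u k j) sums ((1 - r) powr (- norm b) * (norm (C k) * (r / (1 - r)) ^ k))" for k
  proof -
    have "(\<lambda>j. u k j) sums (norm (C k) * r ^ k * (1 - r) powr (- (norm b + real k)))"
      unfolding u_def by (intro sums_mult pochhammer_binomial_series_real) (use r in auto)
    also have "(1 - r) powr (- (norm b + real k)) = (1 - r) powr (- norm b) / (1 - r) ^ k"
      using r by (simp add: powr_diff powr_realpow)
    finally show ?thesis by (simp add: power_divide mult_ac)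
  qed
  have pnn: "0 \<le> pochhammer (norm b + real k) j / fact j" for k j
    by (intro divide_nonneg_nonneg) (simp_all add: pochhammer_prod prod_nonneg)
  have le: "norm (t k j) \<le> u k j" for k j
  proof -
    have "norm (pochhammer (b + of_nat k) j) \<le> pochhammer (norm b + real k) j"
      using norm_triangle_ineq[of b "of_nat k"] by (intro norm_pochhammer_le) simp
    then show ?thesis unfolding t_def u_def r_def norm_mult norm_divide norm_power
      by (intro mult_mono divide_right_mono) (auto simp: pnn intro: divide_right_mono)
  qed
  have s1: "summable (\<lambda>j. norm (t k j))" for k
    by (rule summable_comparison_test'[OF sums_summable[OF u], where N = 0]) (use le in simp)
  have nr: "norm (complex_of_real (r / (1 - r))) = r / (1 - r)" using r by (simp only: norm_of_real) simp
  then have "norm (complex_of_real (r / (1 - r))) < 1" using r by simp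
  then have "summable (\<lambda>k. norm (C k * of_real (r / (1 - r)) ^ k))"
    unfolding C_def by (rule summable_norm_hyp2F1[OF c])
  then have "summable (\<lambda>k. (1 - r) powr (- norm b) * (norm (C k) * (r / (1 - r)) ^ k))"
    unfolding norm_mult norm_power nr by (intro summable_mult)
  then have s2: "summable (\<lambda>k. \<Sum>j. norm (t k j))"
  proof (rule summable_comparison_test'[where N = 0])
    fix k :: nat
    have "(\<Sum>j. norm (t k j)) \<le> (\<Sum>j. u k j)" by (intro suminf_le le s1 sums_summable[OF u])
    then show "norm (\<Sum>j. norm (t k j)) \<le> (1 - r) powr (- norm b) * (norm (C k) * (r / (1 - r)) ^ k)"
      using sums_unique[OF u] s1 by (simp add: suminf_nonneg)
  qed
  have "(\<Sum>k\<le>n. t k (n - k)) = hyp2F1_coeff a b c n * x ^ n" for n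
  proof -
    have "(\<Sum>k\<le>n. t k (n - k)) = (\<Sum>k\<le>n. pochhammer b n / (pochhammer c n * fact n) * x ^ n *
       ((- 1) ^ k * of_nat (n choose k) * pochhammer (c - a) k * pochhammer (c + of_nat k) (n - k)))"
    proof (rule sum.cong)
      fix k assume "k \<in> {..n}"
      then have k: "k \<le> n" by simp
      have alg: "A * B / (D * E) * (s * y) * (F / G * w) = (A * F) * (s * B / (D * (E * G))) * (y * w)"
        for A B D E F G s y w :: complex by (simp add: mult_ac)
      have nz: "pochhammer c k \<noteq> 0" "pochhammer (c + of_nat k) (n - k) \<noteq> 0"
        using c pochhammer_nonzero add_of_nat_notin_nonpos_Ints by blast+
      have "t k (n - k) = (pochhammer b k * pochhammer (b + of_nat k) (n - k)) * ((- 1) ^ k * pochhammer (c - a) k / (pochhammer c k * (fact k * fact (n - k)))) * (x ^ k * x ^ (n - k))"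
        unfolding t_def C_def hyp2F1_coeff_def power_minus[of x k] by (rule alg)
      also have "pochhammer b k * pochhammer (b + of_nat k) (n - k) = pochhammer b n"
        by (rule pochhammer_product[OF k, symmetric])
      also have "x ^ k * x ^ (n - k) = x ^ n" using k by (simp flip: power_add)
      also have "(- 1) ^ k * pochhammer (c - a) k / (pochhammer c k * (fact k * fact (n - k))) =
         (- 1) ^ k * of_nat (n choose k) * pochhammer (c - a) k * pochhammer (c + of_nat k) (n - k) / (pochhammer c n * fact n)"
        unfolding pochhammer_product[OF k, of c] binomial_fact[OF k, where 'a = complex] using nz by simp
      finally show "t k (n - k) = pochhammer b n / (pochhammer c n * fact n) * x ^ n *
       ((- 1) ^ k * of_nat (n choose k) * pochhammer (c - a) k * pochhammer (c + of_nat k) (n - k))"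
        by (simp add: mult_ac)
    qed simp
    also have "\<dots> = pochhammer b n / (pochhammer c n * fact n) * x ^ n * pochhammer a n"
      using pochhammer_diff_sum[of c "c - a" n] by (simp only: sum_distrib_left[symmetric]) simp
    finally show ?thesis by (simp add: hyp2F1_coeff_def)
  qed
  then have "hyp2F1 a b c x = (\<Sum>k. \<Sum>j. t k j)"
    using double_series_triangle[OF s1 s2] by (simp add: hyp2F1_def sums_iff)
  also have "\<dots> = (\<Sum>k. (1 - x) powr (- b) * (C k * (x / (x - 1)) ^ k))"
    using inner by (simp add: sums_iff)
  also have "\<dots> = (1 - x) powr (- b) * hyp2F1 b (c - a) c (x / (x - 1))"
  proof (rule sums_unique[symmetric], rule sums_mult)
    show "(\<lambda>k. C k * (x / (x - 1)) ^ k) sums hyp2F1 b (c - a) c (x / (x - 1))"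
      unfolding C_def by (intro hyp2F1_sums c norm_divide_diff_1_less_1) (use x complex_Re_le_cmod[of x] in linarith)
  qed
  finally show ?thesis .
qed

text \<open>The condition Re x < 1 / 2 says that x / (x - 1) lies in the unit disc. On the convex
  set where both series converge, the identity theorem extends the formula from the small
  disc.\<close>

theorem hyp2F1_Pfaff:
  assumes c: "c \<notin> \<int>\<^sub>\<le>\<^sub>0" and x: "norm x < 1" "Re x < 1 / 2"
  shows "hyp2F1 a b c x = (1 - x) powr (- b) * hyp2F1 b (c - a) c (x / (x - 1))"
proof -
  define S where "S = ball (0::complex) 1 \<inter> {x. Re x < 1 / 2}"
  define F where "F = (\<lambda>x. hyp2F1 a b c x - (1 - x) powr (- b) * hyp2F1 b (c - a) c (x / (x - 1)))"
  have "F x = 0"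
  proof (rule analytic_continuation[where f = F and S = S and U = "ball 0 (1 / 3)" and \<xi> = 0])
    have "hyp2F1 b (c - a) c \<circ> (\<lambda>x. x / (x - 1)) holomorphic_on S"
    proof (rule holomorphic_on_compose_gen[OF _ holomorphic_hyp2F1[OF c]])
      show "(\<lambda>x. x / (x - 1)) holomorphic_on S"
        by (intro holomorphic_intros) (auto simp: S_def)
      show "(\<lambda>x. x / (x - 1)) ` S \<subseteq> ball 0 1"
        using norm_divide_diff_1_less_1 by (auto simp: S_def)
    qed
    moreover have "hyp2F1 a b c holomorphic_on S"
      by (rule holomorphic_on_subset[OF holomorphic_hyp2F1[OF c]]) (auto simp: S_def)
    moreover have "(\<lambda>x. (1 - x) powr (- b)) holomorphic_on S"
      by (intro holomorphic_intros) (auto simp: S_def complex_nonpos_Reals_iff)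
    ultimately show "F holomorphic_on S"
      unfolding F_def by (intro holomorphic_on_diff holomorphic_on_mult) (simp_all add: o_def)
    show "open S" unfolding S_def by (intro open_Int open_ball open_halfspace_Re_lt)
    show "connected S" unfolding S_def
      by (intro convex_connected convex_Int convex_ball convex_halfspace_Re_lt)
    have "Re z < 1 / 2" if "norm z < 1 / 3" for z :: complex
      using complex_Re_le_cmod[of z] that by linarith
    then show "ball 0 (1 / 3) \<subseteq> S" by (auto simp: S_def)
    show "0 islimpt ball (0::complex) (1 / 3)" by (simp add: islimpt_ball)
    show "F z = 0" if "z \<in> ball 0 (1 / 3)" for z
      using hyp2F1_Pfaff_small[OF c, of z a b] that by (simp add: F_def)
  qed (use x in \<open>auto simp: S_def\<close>)
  then show ?thesis by (simp add: F_def)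
qed

text \<open>The map z / (z - 1) is an involution, so Pfaff's transformation applied twice returns to
  z. For norm z < 1 / 4 the intermediate point has modulus at most 1 / 3, which makes both
  applications legitimate; the identity theorem does the rest.\<close>

theorem hyp2F1_Euler:
  assumes c: "c \<notin> \<int>\<^sub>\<le>\<^sub>0" and z: "norm z < 1"
  shows "hyp2F1 a b c z = (1 - z) powr (c - a - b) * hyp2F1 (c - a) (c - b) c z"
proof -
  define F where "F = (\<lambda>z. hyp2F1 a b c z - (1 - z) powr (c - a - b) * hyp2F1 (c - a) (c - b) c z)"
  have small: "F z = 0" if z: "z \<in> ball 0 (1 / 4)" for z
  proof -
    define w where "w = z / (z - 1)"
    have z1: "z \<noteq> 1" "norm z < 1" "Re z < 1 / 2" "Re z < 1"
      using z complex_Re_le_cmod[of z] by auto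
    have "norm (1 - z) \<ge> 1 - norm z" by (metis norm_one norm_triangle_ineq2)
    then have "norm w \<le> (1 / 4) / (3 / 4)"
      unfolding w_def norm_divide using z by (intro frac_le) (auto simp: norm_minus_commute)
    then have w: "norm w < 1" "Re w < 1 / 2" using complex_Re_le_cmod[of w] by auto
    have w': "w / (w - 1) = z" "1 - w = inverse (1 - z)"
      using z1 by (auto simp: w_def field_simps)
    have "hyp2F1 a b c z = (1 - z) powr (- b) * hyp2F1 b (c - a) c w"
      unfolding w_def by (rule hyp2F1_Pfaff[OF c]) (use z1 in auto)
    also have "hyp2F1 b (c - a) c w = (1 - w) powr (- (c - a)) * hyp2F1 (c - a) (c - b) c z"
      using hyp2F1_Pfaff[OF c w, of b "c - a"] w'(1) by simp
    also have "(1 - w) powr (- (c - a)) = (1 - z) powr (c - a)"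
    proof -
      have "1 - z \<notin> \<real>\<^sub>\<le>\<^sub>0" using z1 by (auto simp: complex_nonpos_Reals_iff)
      then show ?thesis unfolding w'(2) using z1 by (simp add: powr_def Ln_inverse algebra_simps)
    qed
    also have "(1 - z) powr (- b) * ((1 - z) powr (c - a) * hyp2F1 (c - a) (c - b) c z) =
       (1 - z) powr (c - a - b) * hyp2F1 (c - a) (c - b) c z"
      by (simp add: powr_diff powr_minus divide_inverse mult_ac)
    finally show ?thesis by (simp add: F_def)
  qed
  have "F z = 0"
  proof (rule analytic_continuation[where f = F and S = "ball 0 1" and U = "ball 0 (1 / 4)" and \<xi> = 0])
    have "Re z < 1" if "norm z < 1" for z using complex_Re_le_cmod[of z] that by linarith
    then show "F holomorphic_on ball 0 1"
      unfolding F_def by (intro holomorphic_intros holomorphic_hyp2F1 c) (force simp: complex_nonpos_Reals_iff)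
    show "0 islimpt ball (0::complex) (1 / 4)" by (simp add: islimpt_ball)
  qed (use z small in auto)
  then show ?thesis by (simp add: F_def)
qed

section \<open>The connection formula\<close>

text \<open>A limit at the boundary point by dominated convergence, since the coefficients are
  absolutely summable. It supplies the limits of Wronskians at z = 1.\<close>

lemma hyp2F1_tendsto_1:
  assumes "\<gamma> \<notin> \<int>\<^sub>\<le>\<^sub>0" "Re (\<gamma> - \<alpha> - \<beta>) > 0" "\<And>n. norm (z n) \<le> 1" "z \<longlonglongrightarrow> 1"
  shows "(\<lambda>n. hyp2F1 \<alpha> \<beta> \<gamma> (z n)) \<longlonglongrightarrow> hyp2F1 \<alpha> \<beta> \<gamma> 1"
  unfolding hyp2F1_def
proof (rule tannerys_theorem[THEN conjunct2, THEN conjunct2])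
  show "summable (\<lambda>k. norm (hyp2F1_coeff \<alpha> \<beta> \<gamma> k))"
    by (rule summable_norm_hyp2F1_coeff[OF assms(1,2)])
  show "(\<lambda>n. hyp2F1_coeff \<alpha> \<beta> \<gamma> k * z n ^ k) \<longlonglongrightarrow> hyp2F1_coeff \<alpha> \<beta> \<gamma> k * 1 ^ k" for k
    by (intro tendsto_intros assms)
  have "norm (hyp2F1_coeff \<alpha> \<beta> \<gamma> k * z n ^ k) \<le> norm (hyp2F1_coeff \<alpha> \<beta> \<gamma> k)" for k n
    using power_le_one[OF norm_ge_zero assms(3)[of n], of k]
    by (simp add: norm_mult norm_power mult_left_le)
  then show "\<forall>\<^sub>F (k, n) in sequentially \<times>\<^sub>F sequentially.
      norm (hyp2F1_coeff \<alpha> \<beta> \<gamma> k * z n ^ k) \<le> norm (hyp2F1_coeff \<alpha> \<beta> \<gamma> k)"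
    by (intro always_eventually) auto
qed simp

lemma hyp2F1_tendsto_0:
  assumes "\<gamma> \<notin> \<int>\<^sub>\<le>\<^sub>0" "z \<longlonglongrightarrow> 0"
  shows "(\<lambda>n. hyp2F1 \<alpha> \<beta> \<gamma> (z n)) \<longlonglongrightarrow> 1"
proof -
  have "isCont (hyp2F1 \<alpha> \<beta> \<gamma>) 0"
    using hyp2F1_derivative[OF assms(1), of 0] DERIV_isCont by force
  from isCont_tendsto_compose[OF this assms(2)] show ?thesis by simp
qed

text \<open>Here the series in z and in 1 - z both converge. The set is convex and lies in the strip
  0 < Re z < 1, so the principal powers of z and 1 - z are holomorphic on it.\<close>

definition lens :: "complex set" where "lens = ball 0 1 \<inter> ball 1 1"

lemma lens_iff: "z \<in> lens \<longleftrightarrow> norm z < 1 \<and> norm (1 - z) < 1"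
  by (auto simp: lens_def dist_norm)

lemma lens_Re:
  assumes "z \<in> lens"
  shows "0 < Re z" "0 < Re (1 - z)"
  using assms complex_Re_le_cmod[of z] complex_Re_le_cmod[of "1 - z"] by (auto simp: lens_iff)

lemma lens_notin:
  assumes "z \<in> lens"
  shows "z \<notin> \<real>\<^sub>\<le>\<^sub>0" "1 - z \<notin> \<real>\<^sub>\<le>\<^sub>0" "z \<noteq> 0" "1 - z \<noteq> 0"
  using lens_Re[OF assms] by (auto simp: complex_nonpos_Reals_iff)

lemma convex_lens: "convex lens" and open_lens: "open lens"
  unfolding lens_def by (auto intro: convex_Int)

lemma lens_of_real: "0 < r \<Longrightarrow> r < 1 \<Longrightarrow> complex_of_real r \<in> lens"
  using norm_of_real[of "1 - r", where 'a = complex] by (simp add: lens_iff)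

text \<open>
  Both local solutions of the hypergeometric equation, paired with their contiguous
  companions, satisfy one first-order system. Working with this system instead of the
  second-order equation makes Wronskians and limits derivative-free.
\<close>

definition contig_system :: "complex \<Rightarrow> complex \<Rightarrow> complex \<Rightarrow> (complex \<Rightarrow> complex) \<Rightarrow> (complex \<Rightarrow> complex) \<Rightarrow> bool" where
  "contig_system \<alpha> \<beta> \<gamma> f F \<longleftrightarrow> (\<forall>z\<in>lens. \<exists>f' F'.
     (f has_field_derivative f') (at z) \<and> (F has_field_derivative F') (at z) \<and>
     (1 - z) * f' = (\<alpha> + \<beta> - \<gamma>) * f z + (\<gamma> - \<alpha>) * (\<gamma> - \<beta>) / \<gamma> * F z \<and>
     z * F' = \<gamma> * f z - \<gamma> * F z)"

text \<open>Liouville's formula: the system gives W' = - (\<gamma> / z + d / (1 - z)) * W, so W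
  divided by the displayed product of powers has derivative zero on a convex set.\<close>

lemma contig_system_Wronskian:
  assumes "contig_system \<alpha> \<beta> \<gamma> f F" "contig_system \<alpha> \<beta> \<gamma> g G"
  shows "\<exists>c. \<forall>z\<in>lens. f z * G z - F z * g z = c * (z powr (- \<gamma>) * (1 - z) powr (\<gamma> - \<alpha> - \<beta>))"
proof -
  define d where "d = \<gamma> - \<alpha> - \<beta>"
  define \<Theta> where "\<Theta> = (\<lambda>z. (f z * G z - F z * g z) * (z powr \<gamma> * (1 - z) powr (- d)))"
  have "(\<Theta> has_field_derivative 0) (at z)" if z: "z \<in> lens" for z
  proof -
    obtain f' F' where f: "(f has_field_derivative f') (at z)" "(F has_field_derivative F') (at z)"
      "(1 - z) * f' = (\<alpha> + \<beta> - \<gamma>) * f z + (\<gamma> - \<alpha>) * (\<gamma> - \<beta>) / \<gamma> * F z" "z * F' = \<gamma> * f z - \<gamma> * F z"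
      using assms(1) z unfolding contig_system_def by blast
    obtain g' G' where g: "(g has_field_derivative g') (at z)" "(G has_field_derivative G') (at z)"
      "(1 - z) * g' = (\<alpha> + \<beta> - \<gamma>) * g z + (\<gamma> - \<alpha>) * (\<gamma> - \<beta>) / \<gamma> * G z" "z * G' = \<gamma> * g z - \<gamma> * G z"
      using assms(2) z unfolding contig_system_def by blast
    note nz = lens_notin[OF z]
    define W where "W = f z * G z - F z * g z"
    define W' where "W' = f' * G z + f z * G' - (F' * g z + F z * g')"
    have P1: "((\<lambda>z. f z * G z - F z * g z) has_field_derivative W') (at z)"
      unfolding W'_def by (rule derivative_eq_intros f g refl | simp add: algebra_simps)+
    define p where "p = z powr \<gamma> * (1 - z) powr (- d)"
    have P2: "((\<lambda>z. z powr \<gamma> * (1 - z) powr (- d)) has_field_derivative (\<gamma> / z + d / (1 - z)) * p) (at z)"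
      unfolding p_def using nz
      by (auto intro!: derivative_eq_intros simp: powr_diff field_simps)
    have "(1 - z) * (f' * G z - F z * g') = - d * W"
    proof -
      have "(1 - z) * (f' * G z - F z * g') = ((1 - z) * f') * G z - F z * ((1 - z) * g')" by (simp add: algebra_simps)
      also have "\<dots> = - d * W" unfolding f(3) g(3) by (simp add: W_def d_def algebra_simps)
      finally show ?thesis .
    qed
    then have e1: "f' * G z - F z * g' = - d * W / (1 - z)" using nz by (simp add: field_simps)
    have "z * (f z * G' - F' * g z) = - \<gamma> * W"
    proof -
      have "z * (f z * G' - F' * g z) = f z * (z * G') - (z * F') * g z" by (simp add: algebra_simps)
      also have "\<dots> = - \<gamma> * W" unfolding f(4) g(4) by (simp add: W_def algebra_simps)
      finally show ?thesis .
    qed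
    then have e2: "f z * G' - F' * g z = - \<gamma> * W / z" using nz by (simp add: field_simps)
    have "W' = (f' * G z - F z * g') + (f z * G' - F' * g z)" by (simp add: W'_def)
    also have "\<dots> = - (\<gamma> / z + d / (1 - z)) * W" unfolding e1 e2 by (simp add: algebra_simps)
    finally have W': "W' = - (\<gamma> / z + d / (1 - z)) * W" .
    have "(\<Theta> has_field_derivative W * ((\<gamma> / z + d / (1 - z)) * p) + W' * p) (at z)"
      unfolding \<Theta>_def by (rule DERIV_cong[OF DERIV_mult[OF P1 P2]]) (simp add: W_def p_def)
    then show ?thesis unfolding W' by (simp add: algebra_simps)
  qed
  then obtain c where c: "\<And>z. z \<in> lens \<Longrightarrow> \<Theta> z = c"
    using has_field_derivative_zero_constant[OF convex_lens, of \<Theta>] has_field_derivative_at_within by metis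
  have "f z * G z - F z * g z = c * (z powr (- \<gamma>) * (1 - z) powr d)" if z: "z \<in> lens" for z
    using c[OF z] lens_notin[OF z] unfolding \<Theta>_def by (simp add: powr_minus field_simps)
  then show ?thesis unfolding d_def by blast
qed

lemma contig_system_hyp2F1:
  assumes "\<gamma> \<notin> \<int>\<^sub>\<le>\<^sub>0"
  shows "contig_system \<alpha> \<beta> \<gamma> (hyp2F1 \<alpha> \<beta> \<gamma>) (hyp2F1 \<alpha> \<beta> (\<gamma> + 1))"
  unfolding contig_system_def
proof
  fix z assume "z \<in> lens"
  then have "norm z < 1" by (simp add: lens_iff)
  from hyp2F1_ladder[OF assms this] show "\<exists>f' F'.
     (hyp2F1 \<alpha> \<beta> \<gamma> has_field_derivative f') (at z) \<and> (hyp2F1 \<alpha> \<beta> (\<gamma> + 1) has_field_derivative F') (at z) \<and>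
     (1 - z) * f' = (\<alpha> + \<beta> - \<gamma>) * hyp2F1 \<alpha> \<beta> \<gamma> z + (\<gamma> - \<alpha>) * (\<gamma> - \<beta>) / \<gamma> * hyp2F1 \<alpha> \<beta> (\<gamma> + 1) z \<and>
     z * F' = \<gamma> * hyp2F1 \<alpha> \<beta> \<gamma> z - \<gamma> * hyp2F1 \<alpha> \<beta> (\<gamma> + 1) z"
    by metis
qed

lemma DERIV_reflect:
  fixes f :: "complex \<Rightarrow> complex"
  assumes "(f has_field_derivative D) (at (1 - z))"
  shows "((\<lambda>z. f (1 - z)) has_field_derivative - D) (at z)"
proof -
  have "((\<lambda>z. 1 - z :: complex) has_field_derivative - 1) (at z)"
    by (auto intro!: derivative_eq_intros)
  from DERIV_chain'[OF this assms] show ?thesis by simp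
qed

lemma has_field_derivative_powr_div:
  fixes z a :: complex
  assumes "z \<notin> \<real>\<^sub>\<le>\<^sub>0"
  shows "((\<lambda>z. z powr a) has_field_derivative a / z * z powr a) (at z)"
  by (rule DERIV_cong[OF has_field_derivative_powr[OF assms]]) (use assms in \<open>auto simp: powr_diff\<close>)

lemma has_field_derivative_powr_reflect:
  fixes z a :: complex
  assumes "1 - z \<notin> \<real>\<^sub>\<le>\<^sub>0"
  shows "((\<lambda>z. (1 - z) powr a) has_field_derivative - (a / (1 - z) * (1 - z) powr a)) (at z)"
  by (rule DERIV_reflect[OF has_field_derivative_powr_div[OF assms]])

lemma notin_Ints_nonpos: "d \<notin> \<int> \<Longrightarrow> d + of_int n \<notin> \<int>\<^sub>\<le>\<^sub>0" "d \<notin> \<int> \<Longrightarrow> of_int n - d \<notin> \<int>\<^sub>\<le>\<^sub>0"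
  for d :: complex
proof -
  assume d: "d \<notin> \<int>"
  show "d + of_int n \<notin> \<int>\<^sub>\<le>\<^sub>0"
  proof
    assume "d + of_int n \<in> \<int>\<^sub>\<le>\<^sub>0"
    then have "d + of_int n - of_int n \<in> \<int>" by (intro Ints_diff Ints_of_int) (rule nonpos_Ints_Int)
    then show False using d by simp
  qed
  show "of_int n - d \<notin> \<int>\<^sub>\<le>\<^sub>0"
  proof
    assume "of_int n - d \<in> \<int>\<^sub>\<le>\<^sub>0"
    then have "of_int n - (of_int n - d) \<in> \<int>" by (rule Ints_diff[OF Ints_of_int nonpos_Ints_Int])
    then show False using d by simp
  qed
qed

text \<open>\<open>hyp2F1_ladder\<close> at the point 1 - z with lower parameter - \<delta>.
  Reflection exchanges the factors z and 1 - z, so the two relations exchange their roles.\<close>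

lemma reflected_ladder:
  assumes \<delta>: "\<gamma> - \<alpha> - \<beta> \<notin> \<int>" and z: "z \<in> lens"
  defines "\<delta> \<equiv> \<gamma> - \<alpha> - \<beta>"
  obtains D1 D2 where
    "((\<lambda>z. hyp2F1 \<alpha> \<beta> (1 - \<delta>) (1 - z)) has_field_derivative D1) (at z)"
    "(1 - z) * D1 = - \<delta> * hyp2F1 \<alpha> \<beta> (1 - \<delta>) (1 - z) + \<delta> * hyp2F1 \<alpha> \<beta> (- \<delta>) (1 - z)"
    "((\<lambda>z. hyp2F1 \<alpha> \<beta> (- \<delta>) (1 - z)) has_field_derivative D2) (at z)"
    "z * D2 = (\<gamma> - \<alpha>) * (\<gamma> - \<beta>) / \<delta> * hyp2F1 \<alpha> \<beta> (1 - \<delta>) (1 - z) - \<gamma> * hyp2F1 \<alpha> \<beta> (- \<delta>) (1 - z)"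
proof -
  have nz: "\<delta> \<noteq> 0" using \<delta> by (auto simp: \<delta>_def)
  have g: "- \<delta> \<notin> \<int>\<^sub>\<le>\<^sub>0" using notin_Ints_nonpos(2)[OF \<delta>, of 0] by (simp add: \<delta>_def)
  have "norm (1 - z) < 1" using z by (simp add: lens_iff)
  from hyp2F1_ladder[OF g this, of \<alpha> \<beta>] obtain D1 D2 where D:
    "(hyp2F1 \<alpha> \<beta> (1 - \<delta>) has_field_derivative D1) (at (1 - z))"
    "(1 - z) * D1 = - \<delta> * hyp2F1 \<alpha> \<beta> (- \<delta>) (1 - z) + \<delta> * hyp2F1 \<alpha> \<beta> (1 - \<delta>) (1 - z)"
    "(hyp2F1 \<alpha> \<beta> (- \<delta>) has_field_derivative D2) (at (1 - z))"
    "z * D2 = (\<alpha> + \<beta> + \<delta>) * hyp2F1 \<alpha> \<beta> (- \<delta>) (1 - z) + (- \<delta> - \<alpha>) * (- \<delta> - \<beta>) / (- \<delta>) * hyp2F1 \<alpha> \<beta> (1 - \<delta>) (1 - z)"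
    by (auto simp: algebra_simps)
  have "- \<delta> - \<alpha> = - (\<gamma> - \<beta>)" "- \<delta> - \<beta> = - (\<gamma> - \<alpha>)" by (simp_all add: \<delta>_def)
  then have 1: "(- \<delta> - \<alpha>) * (- \<delta> - \<beta>) / (- \<delta>) = - ((\<gamma> - \<alpha>) * (\<gamma> - \<beta>) / \<delta>)" "\<alpha> + \<beta> + \<delta> = \<gamma>"
    by (simp_all only: minus_mult_minus minus_divide_right mult.commute) (simp add: \<delta>_def)
  show ?thesis
  proof (rule that[OF DERIV_reflect[OF D(1)] _ DERIV_reflect[OF D(3)]])
    show "(1 - z) * - D1 = - \<delta> * hyp2F1 \<alpha> \<beta> (1 - \<delta>) (1 - z) + \<delta> * hyp2F1 \<alpha> \<beta> (- \<delta>) (1 - z)"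
      using D(2) by (simp add: algebra_simps)
    show "z * - D2 = (\<gamma> - \<alpha>) * (\<gamma> - \<beta>) / \<delta> * hyp2F1 \<alpha> \<beta> (1 - \<delta>) (1 - z) - \<gamma> * hyp2F1 \<alpha> \<beta> (- \<delta>) (1 - z)"
      using D(4) unfolding 1 by (simp add: algebra_simps)
  qed
qed

text \<open>The solution with exponent \<gamma> - \<alpha> - \<beta> at z = 1, written in its
  Euler-transformed form. The upper parameters 1 - \<alpha> and 1 - \<beta> do not involve \<gamma>,
  so raising \<gamma> by 1 shifts only the lower parameter, as \<open>hyp2F1_ladder\<close>
  requires.\<close>

definition second_sol :: "complex \<Rightarrow> complex \<Rightarrow> complex \<Rightarrow> complex \<Rightarrow> complex" where
  "second_sol \<alpha> \<beta> \<gamma> z = (1 - z) powr (\<gamma> - \<alpha> - \<beta>) * z powr (1 - \<gamma>) *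
     hyp2F1 (1 - \<alpha>) (1 - \<beta>) (1 + \<gamma> - \<alpha> - \<beta>) (1 - z)"

lemma second_sol_ladder:
  assumes \<delta>: "\<gamma> - \<alpha> - \<beta> \<notin> \<int>" and z: "z \<in> lens"
  defines "\<delta> \<equiv> \<gamma> - \<alpha> - \<beta>"
  obtains D1 D2 where
    "(second_sol \<alpha> \<beta> \<gamma> has_field_derivative D1) (at z)"
    "(1 - z) * D1 = - \<delta> * second_sol \<alpha> \<beta> \<gamma> z - (\<gamma> - \<alpha>) * (\<gamma> - \<beta>) / (\<delta> + 1) * second_sol \<alpha> \<beta> (\<gamma> + 1) z"
    "(second_sol \<alpha> \<beta> (\<gamma> + 1) has_field_derivative D2) (at z)"
    "z * D2 = - (\<delta> + 1) * second_sol \<alpha> \<beta> \<gamma> z - \<gamma> * second_sol \<alpha> \<beta> (\<gamma> + 1) z"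
proof -
  have nz: "\<delta> + 1 \<noteq> 0"
    using notin_Ints_nonpos(1)[OF \<delta>, of 1] by (auto simp: \<delta>_def)
  have g: "\<delta> + 1 \<notin> \<int>\<^sub>\<le>\<^sub>0" using notin_Ints_nonpos(1)[OF \<delta>, of 1] by (simp add: \<delta>_def)
  note zn = lens_notin[OF z]
  have v: "norm (1 - z) < 1" using z by (simp add: lens_iff)
  define h where "h = hyp2F1 (1 - \<alpha>) (1 - \<beta>) (\<delta> + 1)"
  define H where "H = hyp2F1 (1 - \<alpha>) (1 - \<beta>) (\<delta> + 2)"
  obtain d1 d2 where D:
    "(H has_field_derivative d1) (at (1 - z))"
    "(1 - z) * d1 = (\<delta> + 1) * h (1 - z) - (\<delta> + 1) * H (1 - z)"
    "(h has_field_derivative d2) (at (1 - z))"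
    "z * d2 = (1 - \<gamma>) * h (1 - z) + (\<gamma> - \<beta>) * (\<gamma> - \<alpha>) / (\<delta> + 1) * H (1 - z)"
  proof (rule hyp2F1_ladder[OF g v, of "1 - \<alpha>" "1 - \<beta>"])
    have eq: "\<delta> + 1 + 1 = \<delta> + 2" "1 - \<alpha> + (1 - \<beta>) - (\<delta> + 1) = 1 - \<gamma>" "\<delta> + 1 - (1 - \<alpha>) = \<gamma> - \<beta>" "\<delta> + 1 - (1 - \<beta>) = \<gamma> - \<alpha>" "1 - (1 - z) = z"
      by (simp_all add: \<delta>_def)
    fix d1 d2
    assume "(hyp2F1 (1 - \<alpha>) (1 - \<beta>) (\<delta> + 1 + 1) has_field_derivative d1) (at (1 - z))"
      "(1 - z) * d1 = (\<delta> + 1) * hyp2F1 (1 - \<alpha>) (1 - \<beta>) (\<delta> + 1) (1 - z) - (\<delta> + 1) * hyp2F1 (1 - \<alpha>) (1 - \<beta>) (\<delta> + 1 + 1) (1 - z)"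
      "(hyp2F1 (1 - \<alpha>) (1 - \<beta>) (\<delta> + 1) has_field_derivative d2) (at (1 - z))"
      "(1 - (1 - z)) * d2 = (1 - \<alpha> + (1 - \<beta>) - (\<delta> + 1)) * hyp2F1 (1 - \<alpha>) (1 - \<beta>) (\<delta> + 1) (1 - z) +
         (\<delta> + 1 - (1 - \<alpha>)) * (\<delta> + 1 - (1 - \<beta>)) / (\<delta> + 1) * hyp2F1 (1 - \<alpha>) (1 - \<beta>) (\<delta> + 1 + 1) (1 - z)"
    then show thesis unfolding eq by (intro that) (simp_all add: h_def H_def)
  qed
  have s0: "second_sol \<alpha> \<beta> \<gamma> = (\<lambda>z. (1 - z) powr \<delta> * z powr (1 - \<gamma>) * h (1 - z))"
    by (auto simp: second_sol_def h_def \<delta>_def algebra_simps)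
  have s1: "second_sol \<alpha> \<beta> (\<gamma> + 1) = (\<lambda>z. (1 - z) powr (\<delta> + 1) * z powr (- \<gamma>) * H (1 - z))"
    by (auto simp: second_sol_def H_def \<delta>_def algebra_simps)
  \<comment> \<open>With this common factor the prefactors of the two functions are z * p and (1 -
    z) * p, and the remaining verification is rational.\<close>
  define p where "p = (1 - z) powr \<delta> * z powr (- \<gamma>)"
  have pw: "(1 - z) powr \<delta> * z powr (1 - \<gamma>) = z * p" "(1 - z) powr (\<delta> + 1) * z powr (- \<gamma>) = (1 - z) * p"
    using zn by (simp_all add: p_def powr_diff powr_add powr_minus field_simps)
  have q1: "((\<lambda>z. (1 - z) powr \<delta> * z powr (1 - \<gamma>)) has_field_derivative ((1 - \<gamma>) / z - \<delta> / (1 - z)) * (z * p)) (at z)"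
    unfolding pw(1)[symmetric]
    by (rule DERIV_cong[OF DERIV_mult[OF has_field_derivative_powr_reflect has_field_derivative_powr_div]])
       (use zn in \<open>simp_all add: algebra_simps\<close>)
  have q2: "((\<lambda>z. (1 - z) powr (\<delta> + 1) * z powr (- \<gamma>)) has_field_derivative (- \<gamma> / z - (\<delta> + 1) / (1 - z)) * ((1 - z) * p)) (at z)"
    unfolding pw(2)[symmetric]
    by (rule DERIV_cong[OF DERIV_mult[OF has_field_derivative_powr_reflect has_field_derivative_powr_div]])
       (use zn in \<open>simp_all add: algebra_simps\<close>)
  show ?thesis
  proof (rule that)
    show "(second_sol \<alpha> \<beta> \<gamma> has_field_derivative
       ((1 - \<gamma>) / z - \<delta> / (1 - z)) * (z * p) * h (1 - z) + z * p * (- d2)) (at z)"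
      unfolding s0 by (rule DERIV_cong[OF DERIV_mult[OF q1 DERIV_reflect[OF D(3)]]]) (simp add: pw)
    show "(second_sol \<alpha> \<beta> (\<gamma> + 1) has_field_derivative
       (- \<gamma> / z - (\<delta> + 1) / (1 - z)) * ((1 - z) * p) * H (1 - z) + (1 - z) * p * (- d1)) (at z)"
      unfolding s1 by (rule DERIV_cong[OF DERIV_mult[OF q2 DERIV_reflect[OF D(1)]]]) (simp add: pw)
    have "(1 - z) * (((1 - \<gamma>) / z - \<delta> / (1 - z)) * (z * p) * h (1 - z) + z * p * (- d2)) =
      ((1 - \<gamma>) * (1 - z) - \<delta> * z) * p * h (1 - z) - (1 - z) * p * (z * d2)"
      using zn by (simp add: field_simps)
    also have "\<dots> = - \<delta> * (z * p * h (1 - z)) - (\<gamma> - \<alpha>) * (\<gamma> - \<beta>) / (\<delta> + 1) * ((1 - z) * p * H (1 - z))"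
      unfolding D(4) by (simp add: algebra_simps)
    finally show "(1 - z) * (((1 - \<gamma>) / z - \<delta> / (1 - z)) * (z * p) * h (1 - z) + z * p * (- d2)) =
       - \<delta> * second_sol \<alpha> \<beta> \<gamma> z - (\<gamma> - \<alpha>) * (\<gamma> - \<beta>) / (\<delta> + 1) * second_sol \<alpha> \<beta> (\<gamma> + 1) z"
      unfolding s0 s1 pw .
    have "z * ((- \<gamma> / z - (\<delta> + 1) / (1 - z)) * ((1 - z) * p) * H (1 - z) + (1 - z) * p * (- d1)) =
      (- \<gamma> * (1 - z) - (\<delta> + 1) * z) * p * H (1 - z) - z * p * ((1 - z) * d1)"
      using zn by (simp add: field_simps)
    also have "\<dots> = - (\<delta> + 1) * (z * p * h (1 - z)) - \<gamma> * ((1 - z) * p * H (1 - z))"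
      unfolding D(2) by (simp add: algebra_simps)
    finally show "z * ((- \<gamma> / z - (\<delta> + 1) / (1 - z)) * ((1 - z) * p) * H (1 - z) + (1 - z) * p * (- d1)) =
       - (\<delta> + 1) * second_sol \<alpha> \<beta> \<gamma> z - \<gamma> * second_sol \<alpha> \<beta> (\<gamma> + 1) z"
      unfolding s0 s1 pw .
  qed
qed

text \<open>The relation for z * F' in \<open>contig_system\<close> fixes the scale of the
  companion, whence the constant \<gamma> * \<delta> / ((\<gamma> - \<alpha>) * (\<gamma> -
  \<beta>)). The first relation of the system is then satisfied as well.\<close>

lemma contig_system_reflected:
  assumes \<gamma>: "\<gamma> \<notin> \<int>\<^sub>\<le>\<^sub>0" and \<delta>: "\<gamma> - \<alpha> - \<beta> \<notin> \<int>" and P: "\<gamma> - \<alpha> \<noteq> 0" "\<gamma> - \<beta> \<noteq> 0"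
  defines "\<delta> \<equiv> \<gamma> - \<alpha> - \<beta>"
  shows "contig_system \<alpha> \<beta> \<gamma> (\<lambda>z. hyp2F1 \<alpha> \<beta> (1 - \<delta>) (1 - z))
    (\<lambda>z. \<gamma> * \<delta> / ((\<gamma> - \<alpha>) * (\<gamma> - \<beta>)) * hyp2F1 \<alpha> \<beta> (- \<delta>) (1 - z))"
  unfolding contig_system_def
proof
  fix z assume z: "z \<in> lens"
  have nz: "\<delta> \<noteq> 0" "\<gamma> \<noteq> 0" using \<delta> \<gamma> by (auto simp: \<delta>_def)
  define \<kappa> where "\<kappa> = \<gamma> * \<delta> / ((\<gamma> - \<alpha>) * (\<gamma> - \<beta>))"
  obtain D1 D2 where D: 
    "((\<lambda>z. hyp2F1 \<alpha> \<beta> (1 - \<delta>) (1 - z)) has_field_derivative D1) (at z)"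
    "(1 - z) * D1 = - \<delta> * hyp2F1 \<alpha> \<beta> (1 - \<delta>) (1 - z) + \<delta> * hyp2F1 \<alpha> \<beta> (- \<delta>) (1 - z)"
    "((\<lambda>z. hyp2F1 \<alpha> \<beta> (- \<delta>) (1 - z)) has_field_derivative D2) (at z)"
    "z * D2 = (\<gamma> - \<alpha>) * (\<gamma> - \<beta>) / \<delta> * hyp2F1 \<alpha> \<beta> (1 - \<delta>) (1 - z) - \<gamma> * hyp2F1 \<alpha> \<beta> (- \<delta>) (1 - z)"
    unfolding \<delta>_def by (rule reflected_ladder[OF \<delta> z])
  define Q where "Q = (\<gamma> - \<alpha>) * (\<gamma> - \<beta>)"
  have Q: "Q \<noteq> 0" using P by (simp add: Q_def)
  have k: "Q / \<gamma> * (\<kappa> * w) = \<delta> * w" "\<kappa> * (Q / \<delta> * w - \<gamma> * v) = \<gamma> * w - \<gamma> * (\<kappa> * v)" for w v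
  proof -
    have "\<kappa> = \<gamma> * \<delta> / Q" by (simp add: \<kappa>_def Q_def)
    then show "Q / \<gamma> * (\<kappa> * w) = \<delta> * w" "\<kappa> * (Q / \<delta> * w - \<gamma> * v) = \<gamma> * w - \<gamma> * (\<kappa> * v)"
      using nz Q by (simp_all add: right_diff_distrib)
  qed
  note k = k[unfolded Q_def]
  have "z * (\<kappa> * D2) = \<kappa> * (z * D2)" by simp
  also have "\<dots> = \<gamma> * hyp2F1 \<alpha> \<beta> (1 - \<delta>) (1 - z) - \<gamma> * (\<kappa> * hyp2F1 \<alpha> \<beta> (- \<delta>) (1 - z))"
    unfolding D(4) k ..
  finally have e: "z * (\<kappa> * D2) = \<gamma> * hyp2F1 \<alpha> \<beta> (1 - \<delta>) (1 - z) - \<gamma> * (\<kappa> * hyp2F1 \<alpha> \<beta> (- \<delta>) (1 - z))" .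
  show "\<exists>f' F'. ((\<lambda>z. hyp2F1 \<alpha> \<beta> (1 - \<delta>) (1 - z)) has_field_derivative f') (at z) \<and>
      ((\<lambda>z. \<gamma> * \<delta> / ((\<gamma> - \<alpha>) * (\<gamma> - \<beta>)) * hyp2F1 \<alpha> \<beta> (- \<delta>) (1 - z)) has_field_derivative F') (at z) \<and>
      (1 - z) * f' = (\<alpha> + \<beta> - \<gamma>) * hyp2F1 \<alpha> \<beta> (1 - \<delta>) (1 - z) + (\<gamma> - \<alpha>) * (\<gamma> - \<beta>) / \<gamma> * (\<gamma> * \<delta> / ((\<gamma> - \<alpha>) * (\<gamma> - \<beta>)) * hyp2F1 \<alpha> \<beta> (- \<delta>) (1 - z)) \<and>
      z * F' = \<gamma> * hyp2F1 \<alpha> \<beta> (1 - \<delta>) (1 - z) - \<gamma> * (\<gamma> * \<delta> / ((\<gamma> - \<alpha>) * (\<gamma> - \<beta>)) * hyp2F1 \<alpha> \<beta> (- \<delta>) (1 - z))"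
    unfolding \<kappa>_def[symmetric]
  proof (intro exI conjI)
    show "((\<lambda>z. hyp2F1 \<alpha> \<beta> (1 - \<delta>) (1 - z)) has_field_derivative D1) (at z)" by (rule D)
    show "((\<lambda>z. \<kappa> * hyp2F1 \<alpha> \<beta> (- \<delta>) (1 - z)) has_field_derivative \<kappa> * D2) (at z)" by (rule DERIV_cmult[OF D(3)])
    show "(1 - z) * D1 = (\<alpha> + \<beta> - \<gamma>) * hyp2F1 \<alpha> \<beta> (1 - \<delta>) (1 - z) + (\<gamma> - \<alpha>) * (\<gamma> - \<beta>) / \<gamma> * (\<kappa> * hyp2F1 \<alpha> \<beta> (- \<delta>) (1 - z))"
      unfolding k(1) D(2) by (simp add: \<delta>_def)
  qed (rule e)
qed

text \<open>The factor - \<gamma> / (\<delta> + 1) is forced by the same normalisation of the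
  companion; \<delta> + 1 is nonzero because \<delta> is not an integer.\<close>

lemma contig_system_second_sol:
  assumes \<gamma>: "\<gamma> \<notin> \<int>\<^sub>\<le>\<^sub>0" and \<delta>: "\<gamma> - \<alpha> - \<beta> \<notin> \<int>"
  defines "\<delta> \<equiv> \<gamma> - \<alpha> - \<beta>"
  shows "contig_system \<alpha> \<beta> \<gamma> (second_sol \<alpha> \<beta> \<gamma>) (\<lambda>z. - \<gamma> / (\<delta> + 1) * second_sol \<alpha> \<beta> (\<gamma> + 1) z)"
  unfolding contig_system_def
proof
  fix z assume z: "z \<in> lens"
  have nz: "\<delta> + 1 \<noteq> 0" "\<gamma> \<noteq> 0" using notin_Ints_nonpos(1)[OF \<delta>, of 1] \<gamma> by (auto simp: \<delta>_def)
  define \<kappa> where "\<kappa> = - \<gamma> / (\<delta> + 1)"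
  obtain D1 D2 where D: 
    "(second_sol \<alpha> \<beta> \<gamma> has_field_derivative D1) (at z)"
    "(1 - z) * D1 = - \<delta> * second_sol \<alpha> \<beta> \<gamma> z - (\<gamma> - \<alpha>) * (\<gamma> - \<beta>) / (\<delta> + 1) * second_sol \<alpha> \<beta> (\<gamma> + 1) z"
    "(second_sol \<alpha> \<beta> (\<gamma> + 1) has_field_derivative D2) (at z)"
    "z * D2 = - (\<delta> + 1) * second_sol \<alpha> \<beta> \<gamma> z - \<gamma> * second_sol \<alpha> \<beta> (\<gamma> + 1) z"
    unfolding \<delta>_def by (rule second_sol_ladder[OF \<delta> z])
  have k: "(\<gamma> - \<alpha>) * (\<gamma> - \<beta>) / \<gamma> * (\<kappa> * w) = - ((\<gamma> - \<alpha>) * (\<gamma> - \<beta>) / (\<delta> + 1) * w)" "\<kappa> * (- (\<delta> + 1) * w - \<gamma> * v) = \<gamma> * w - \<gamma> * (\<kappa> * v)" for w v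
  proof -
    have "\<kappa> * (\<delta> + 1) = - \<gamma>" using nz by (simp add: \<kappa>_def)
    then have "\<kappa> * ((\<delta> + 1) * w) = - \<gamma> * w" by (metis mult.assoc)
    then show "\<kappa> * (- (\<delta> + 1) * w - \<gamma> * v) = \<gamma> * w - \<gamma> * (\<kappa> * v)"
      by (simp add: right_diff_distrib del: minus_add_distrib)
  qed (use nz in \<open>simp add: \<kappa>_def\<close>)
  have "z * (\<kappa> * D2) = \<kappa> * (z * D2)" by simp
  also have "\<dots> = \<gamma> * second_sol \<alpha> \<beta> \<gamma> z - \<gamma> * (\<kappa> * second_sol \<alpha> \<beta> (\<gamma> + 1) z)"
    unfolding D(4) k ..
  finally have e: "z * (\<kappa> * D2) = \<gamma> * second_sol \<alpha> \<beta> \<gamma> z - \<gamma> * (\<kappa> * second_sol \<alpha> \<beta> (\<gamma> + 1) z)" .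
  show "\<exists>f' F'. (second_sol \<alpha> \<beta> \<gamma> has_field_derivative f') (at z) \<and>
      ((\<lambda>z. - \<gamma> / (\<delta> + 1) * second_sol \<alpha> \<beta> (\<gamma> + 1) z) has_field_derivative F') (at z) \<and>
      (1 - z) * f' = (\<alpha> + \<beta> - \<gamma>) * second_sol \<alpha> \<beta> \<gamma> z + (\<gamma> - \<alpha>) * (\<gamma> - \<beta>) / \<gamma> * (- \<gamma> / (\<delta> + 1) * second_sol \<alpha> \<beta> (\<gamma> + 1) z) \<and>
      z * F' = \<gamma> * second_sol \<alpha> \<beta> \<gamma> z - \<gamma> * (- \<gamma> / (\<delta> + 1) * second_sol \<alpha> \<beta> (\<gamma> + 1) z)"
    unfolding \<kappa>_def[symmetric]
  proof (intro exI conjI)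
    show "(second_sol \<alpha> \<beta> \<gamma> has_field_derivative D1) (at z)" by (rule D)
    show "((\<lambda>z. \<kappa> * second_sol \<alpha> \<beta> (\<gamma> + 1) z) has_field_derivative \<kappa> * D2) (at z)" by (rule DERIV_cmult[OF D(3)])
    show "(1 - z) * D1 = (\<alpha> + \<beta> - \<gamma>) * second_sol \<alpha> \<beta> \<gamma> z + (\<gamma> - \<alpha>) * (\<gamma> - \<beta>) / \<gamma> * (\<kappa> * second_sol \<alpha> \<beta> (\<gamma> + 1) z)"
      unfolding k(1) D(2) by (simp add: \<delta>_def)
  qed (rule e)
qed

text \<open>Three solutions of a system of rank two are linearly dependent, and the coefficients are
  quotients of their Wronskian constants. Those multiplying f and g follow from the limit z -> 1;
  the third, \<open>c01\<close>, is left undetermined and becomes the unknown B.\<close>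

lemma hyp2F1_connection_base:
  assumes \<gamma>: "\<gamma> \<notin> \<int>\<^sub>\<le>\<^sub>0" and \<delta>: "\<gamma> - \<alpha> - \<beta> \<notin> \<int>" "Re (\<gamma> - \<alpha> - \<beta>) > 0"
    and P: "\<gamma> - \<alpha> \<noteq> 0" "\<gamma> - \<beta> \<noteq> 0"
  shows "\<exists>B. \<forall>z\<in>lens. hyp2F1 \<alpha> \<beta> \<gamma> z =
     hyp2F1 \<alpha> \<beta> \<gamma> 1 * hyp2F1 \<alpha> \<beta> (1 - (\<gamma> - \<alpha> - \<beta>)) (1 - z) + B * second_sol \<alpha> \<beta> \<gamma> z"
proof -
  define d where "d = \<gamma> - \<alpha> - \<beta>"
  define \<kappa> where "\<kappa> = \<gamma> * d / ((\<gamma> - \<alpha>) * (\<gamma> - \<beta>))"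
  define \<mu> where "\<mu> = - \<gamma> / (d + 1)"
  define f0 where "f0 = hyp2F1 \<alpha> \<beta> \<gamma>"
  define f1 where "f1 = hyp2F1 \<alpha> \<beta> (\<gamma> + 1)"
  define g0 where "g0 = (\<lambda>z. hyp2F1 \<alpha> \<beta> (1 - d) (1 - z))"
  define g1 where "g1 = (\<lambda>z. \<kappa> * hyp2F1 \<alpha> \<beta> (- d) (1 - z))"
  define k0 where "k0 = second_sol \<alpha> \<beta> \<gamma>"
  define k1 where "k1 = (\<lambda>z. \<mu> * second_sol \<alpha> \<beta> (\<gamma> + 1) z)"
  define h0 where "h0 = (\<lambda>z. hyp2F1 (1 - \<alpha>) (1 - \<beta>) (d + 1) (1 - z))"
  define h1 where "h1 = (\<lambda>z. hyp2F1 (1 - \<alpha>) (1 - \<beta>) (d + 2) (1 - z))"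
  have \<gamma>0: "\<gamma> \<noteq> 0" "d \<noteq> 0" using \<gamma> \<delta> by (auto simp: d_def)
  have \<gamma>1: "\<gamma> + 1 \<notin> \<int>\<^sub>\<le>\<^sub>0" using add_of_nat_notin_nonpos_Ints[OF \<gamma>, of 1] by simp
  have dn: "1 - d \<notin> \<int>\<^sub>\<le>\<^sub>0" "- d \<notin> \<int>\<^sub>\<le>\<^sub>0" "d + 1 \<notin> \<int>\<^sub>\<le>\<^sub>0" "d + 2 \<notin> \<int>\<^sub>\<le>\<^sub>0"
    using notin_Ints_nonpos(2)[OF \<delta>(1), of 1] notin_Ints_nonpos(2)[OF \<delta>(1), of 0]
      notin_Ints_nonpos(1)[OF \<delta>(1), of 1] notin_Ints_nonpos(1)[OF \<delta>(1), of 2] by (simp_all add: d_def)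
  \<comment> \<open>The common shape of all Wronskians. Both components of the second solution
    contain it as a factor, so it cancels before the limit and what remains converges at z =
    1.\<close>
  define E where "E = (\<lambda>z. z powr (- \<gamma>) * (1 - z) powr d)"
  have E: "E z \<noteq> 0" if "z \<in> lens" for z using lens_notin[OF that] by (simp add: E_def)
  have k0: "k0 z = E z * (z * h0 z)" and k1: "k1 z = E z * (\<mu> * ((1 - z) * h1 z))" if "z \<in> lens" for z
    using lens_notin[OF that]
    by (simp_all add: k0_def k1_def h0_def h1_def E_def second_sol_def d_def powr_add powr_diff powr_minus algebra_simps field_simps)
  have sf: "contig_system \<alpha> \<beta> \<gamma> f0 f1" unfolding f0_def f1_def by (rule contig_system_hyp2F1[OF \<gamma>])
  have sg: "contig_system \<alpha> \<beta> \<gamma> g0 g1" unfolding g0_def g1_def \<kappa>_def d_def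
    by (rule contig_system_reflected[OF \<gamma> \<delta>(1) P])
  have sk: "contig_system \<alpha> \<beta> \<gamma> k0 k1" unfolding k0_def k1_def \<mu>_def d_def
    by (rule contig_system_second_sol[OF \<gamma> \<delta>(1)])
  obtain c12 where c12: "\<And>z. z \<in> lens \<Longrightarrow> g0 z * k1 z - g1 z * k0 z = c12 * E z"
    using contig_system_Wronskian[OF sg sk] unfolding E_def d_def by blast
  obtain c02 where c02: "\<And>z. z \<in> lens \<Longrightarrow> f0 z * k1 z - f1 z * k0 z = c02 * E z"
    using contig_system_Wronskian[OF sf sk] unfolding E_def d_def by blast
  obtain c01 where c01: "\<And>z. z \<in> lens \<Longrightarrow> f0 z * g1 z - f1 z * g0 z = c01 * E z"
    using contig_system_Wronskian[OF sf sg] unfolding E_def d_def by blast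
  define z where "z = (\<lambda>n::nat. complex_of_real (1 - 1 / (real n + 2)))"
  have z: "z n \<in> lens" for n unfolding z_def by (rule lens_of_real) (auto simp: field_simps)
  have "(\<lambda>n. 1 / (real n + 2)) \<longlonglongrightarrow> 0" by real_asymp
  then have "(\<lambda>n. complex_of_real (1 - 1 / (real n + 2))) \<longlonglongrightarrow> complex_of_real (1 - 0)" by (intro tendsto_intros)
  then have z1: "z \<longlonglongrightarrow> 1" by (simp add: z_def)
  then have z0: "(\<lambda>n. 1 - z n) \<longlonglongrightarrow> 0" using tendsto_diff[OF tendsto_const[of 1] z1] by simp
  have lim_g0: "(\<lambda>n. g0 (z n)) \<longlonglongrightarrow> 1" unfolding g0_def by (rule hyp2F1_tendsto_0[OF dn(1) z0])
  have lim_g1: "(\<lambda>n. g1 (z n)) \<longlonglongrightarrow> \<kappa> * 1" unfolding g1_def by (intro tendsto_mult tendsto_const hyp2F1_tendsto_0[OF dn(2) z0])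
  have lim_h0: "(\<lambda>n. h0 (z n)) \<longlonglongrightarrow> 1" unfolding h0_def by (rule hyp2F1_tendsto_0[OF dn(3) z0])
  have lim_h1: "(\<lambda>n. h1 (z n)) \<longlonglongrightarrow> 1" unfolding h1_def by (rule hyp2F1_tendsto_0[OF dn(4) z0])
  have zn: "norm (z n) \<le> 1" for n using z[of n] by (simp add: lens_iff)
  have lim_f0: "(\<lambda>n. f0 (z n)) \<longlonglongrightarrow> f0 1" unfolding f0_def by (rule hyp2F1_tendsto_1[OF \<gamma> \<delta>(2) zn z1])
  have lim_f1: "(\<lambda>n. f1 (z n)) \<longlonglongrightarrow> f1 1" unfolding f1_def
    by (rule hyp2F1_tendsto_1[OF \<gamma>1 _ zn z1]) (use \<delta>(2) in simp)
  have "c12 = g0 (z n) * (\<mu> * ((1 - z n) * h1 (z n))) - g1 (z n) * (z n * h0 (z n))" for n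
  proof -
    have "E (z n) * c12 = E (z n) * (g0 (z n) * (\<mu> * ((1 - z n) * h1 (z n))) - g1 (z n) * (z n * h0 (z n)))"
      using c12[OF z, of n] unfolding k0[OF z] k1[OF z] by (simp add: algebra_simps)
    then show ?thesis using E[OF z, of n] by simp
  qed
  then have "(\<lambda>n. g0 (z n) * (\<mu> * ((1 - z n) * h1 (z n))) - g1 (z n) * (z n * h0 (z n))) \<longlonglongrightarrow> c12"
    by (intro tendsto_eventually always_eventually) metis
  moreover have "(\<lambda>n. g0 (z n) * (\<mu> * ((1 - z n) * h1 (z n))) - g1 (z n) * (z n * h0 (z n))) \<longlonglongrightarrow>
      1 * (\<mu> * (0 * 1)) - \<kappa> * 1 * (1 * 1)"
    by (intro tendsto_diff tendsto_mult tendsto_const lim_g0 lim_g1 lim_h0 lim_h1 z0 z1)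
  ultimately have c12': "c12 = - \<kappa>" using LIMSEQ_unique by fastforce
  have "c02 = f0 (z n) * (\<mu> * ((1 - z n) * h1 (z n))) - f1 (z n) * (z n * h0 (z n))" for n
  proof -
    have "E (z n) * c02 = E (z n) * (f0 (z n) * (\<mu> * ((1 - z n) * h1 (z n))) - f1 (z n) * (z n * h0 (z n)))"
      using c02[OF z, of n] unfolding k0[OF z] k1[OF z] by (simp add: algebra_simps)
    then show ?thesis using E[OF z, of n] by simp
  qed
  then have "(\<lambda>n. f0 (z n) * (\<mu> * ((1 - z n) * h1 (z n))) - f1 (z n) * (z n * h0 (z n))) \<longlonglongrightarrow> c02"
    by (intro tendsto_eventually always_eventually) metis
  moreover have "(\<lambda>n. f0 (z n) * (\<mu> * ((1 - z n) * h1 (z n))) - f1 (z n) * (z n * h0 (z n))) \<longlonglongrightarrow>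
      f0 1 * (\<mu> * (0 * 1)) - f1 1 * (1 * 1)"
    by (intro tendsto_diff tendsto_mult tendsto_const lim_f0 lim_f1 lim_h0 lim_h1 z0 z1)
  ultimately have c02': "c02 = - f1 1" using LIMSEQ_unique by fastforce
  \<comment> \<open>The relation at z = 1 makes \<open>c02\<close> the multiple \<open>f0 1\<close>
    of \<open>c12\<close>, so the coefficient of \<open>g0\<close> is exactly the value at
    1.\<close>
  have "\<gamma> * d * f0 1 = (\<gamma> - \<alpha>) * (\<gamma> - \<beta>) * f1 1"
    unfolding f0_def f1_def d_def by (rule hyp2F1_at_1_ladder[OF \<gamma> \<delta>(2)])
  moreover define Q where "Q = (\<gamma> - \<alpha>) * (\<gamma> - \<beta>)"
  moreover have "Q \<noteq> 0" using P by (simp add: Q_def)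
  ultimately have f1: "f1 1 = \<kappa> * f0 1" unfolding \<kappa>_def Q_def[symmetric] by (simp add: field_simps)
  have \<kappa>: "\<kappa> \<noteq> 0" using \<gamma>0 P by (simp add: \<kappa>_def)
  have "f0 w = f0 1 * g0 w + c01 / \<kappa> * k0 w" if w: "w \<in> lens" for w
  proof -
    \<comment> \<open>The Pluecker relation among the three 2-by-2 determinants of the solution
      pairs.\<close>
    have "f0 w * (g0 w * k1 w - g1 w * k0 w) = g0 w * (f0 w * k1 w - f1 w * k0 w) - k0 w * (f0 w * g1 w - f1 w * g0 w)"
      by (simp add: algebra_simps)
    then have "E w * (f0 w * c12) = E w * (g0 w * c02 - k0 w * c01)"
      unfolding c12[OF w] c02[OF w] c01[OF w] by (simp add: algebra_simps)
    then have "f0 w * c12 = g0 w * c02 - k0 w * c01" using E[OF w] by simp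
    then have "\<kappa> * f0 w = \<kappa> * (f0 1 * g0 w) + k0 w * c01" unfolding c12' c02' f1 by (simp add: algebra_simps)
    then show ?thesis using \<kappa> by (simp add: field_simps)
  qed
  then show ?thesis unfolding f0_def g0_def k0_def d_def by blast
qed

text \<open>The value at z = 1 according to Gauss, as a Gamma product that remains meaningful where
  the series at 1 diverges.\<close>

definition gauss_factor :: "complex \<Rightarrow> complex \<Rightarrow> complex \<Rightarrow> complex" where
  "gauss_factor \<alpha> \<beta> \<gamma> = Gamma \<gamma> * Gamma (\<gamma> - \<alpha> - \<beta>) * rGamma (\<gamma> - \<alpha>) * rGamma (\<gamma> - \<beta>)"

lemma gauss_factor_plus1:
  assumes "\<gamma> \<notin> \<int>\<^sub>\<le>\<^sub>0" "\<gamma> - \<alpha> - \<beta> \<notin> \<int>\<^sub>\<le>\<^sub>0"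
  shows "gauss_factor \<alpha> \<beta> (\<gamma> + 1) * ((\<gamma> - \<alpha>) * (\<gamma> - \<beta>)) = \<gamma> * (\<gamma> - \<alpha> - \<beta>) * gauss_factor \<alpha> \<beta> \<gamma>"
proof -
  have 1: "Gamma (\<gamma> + 1) = \<gamma> * Gamma \<gamma>" using assms by (intro Gamma_plus1)
  have 2: "Gamma (\<gamma> + 1 - \<alpha> - \<beta>) = (\<gamma> - \<alpha> - \<beta>) * Gamma (\<gamma> - \<alpha> - \<beta>)"
    using Gamma_plus1[OF assms(2)] by (simp add: algebra_simps)
  have 3: "rGamma (\<gamma> - x) = (\<gamma> - x) * rGamma (\<gamma> + 1 - x)" for x
    using rGamma_plus1[of "\<gamma> - x"] by (simp add: algebra_simps)
  show ?thesis unfolding gauss_factor_def 1 2 3[of \<alpha>] 3[of \<beta>] by (simp only: mult_ac)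
qed

text \<open>The operator z d/dz + \<gamma> takes each of the three functions with parameter \<gamma>
  + 1 to a multiple of the one with parameter \<gamma>. Applied to the formula at \<gamma> + 1 it
  yields the formula at \<gamma>, and \<open>gauss_factor\<close> obeys the matching
  recursion.\<close>

lemma hyp2F1_connection_exists:
  assumes \<gamma>: "\<gamma> \<notin> \<int>\<^sub>\<le>\<^sub>0" and \<delta>: "\<gamma> - \<alpha> - \<beta> \<notin> \<int>"
  shows "\<exists>B. \<forall>z\<in>lens. hyp2F1 \<alpha> \<beta> \<gamma> z =
     gauss_factor \<alpha> \<beta> \<gamma> * hyp2F1 \<alpha> \<beta> (1 - (\<gamma> - \<alpha> - \<beta>)) (1 - z) + B * second_sol \<alpha> \<beta> \<gamma> z"
proof -
  \<comment> \<open>A real part of \<gamma> above M gives all requirements of the base case: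
    convergence at 1, and \<gamma> different from \<alpha> and \<beta>.\<close>
  define M where "M = max (max (Re \<alpha>) (Re \<beta>)) (Re (\<alpha> + \<beta>))"
  obtain n :: nat where "M - Re \<gamma> < real n" using reals_Archimedean2 by blast
  then have "M < Re \<gamma> + real n" by simp
  then show ?thesis using \<gamma> \<delta>
  proof (induction n arbitrary: \<gamma>)
    case 0
    have r: "Re (\<gamma> - \<alpha> - \<beta>) > 0" "\<gamma> - \<alpha> \<noteq> 0" "\<gamma> - \<beta> \<noteq> 0" using 0 by (auto simp: M_def)
    have "hyp2F1 \<alpha> \<beta> \<gamma> 1 = gauss_factor \<alpha> \<beta> \<gamma>"
      unfolding gauss_factor_def by (rule hyp2F1_Gauss[OF 0(2) r(1)])
    then show ?case using hyp2F1_connection_base[OF 0(2,3) r] by simp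
  next
    case (Suc n)
    define d where "d = \<gamma> - \<alpha> - \<beta>"
    define Q where "Q = (\<gamma> - \<alpha>) * (\<gamma> - \<beta>)"
    have nz: "\<gamma> \<noteq> 0" "d \<noteq> 0" using Suc.prems by (auto simp: d_def)
    have \<gamma>1: "\<gamma> + 1 \<notin> \<int>\<^sub>\<le>\<^sub>0" using add_of_nat_notin_nonpos_Ints[OF Suc.prems(2), of 1] by simp
    have "\<gamma> + 1 - \<alpha> - \<beta> \<notin> \<int>"
    proof
      assume "\<gamma> + 1 - \<alpha> - \<beta> \<in> \<int>"
      then have "\<gamma> + 1 - \<alpha> - \<beta> - 1 \<in> \<int>" by (rule Ints_diff[OF _ Ints_1])
      then show False using Suc.prems(3) by (simp add: algebra_simps)
    qed
    moreover have "M < Re (\<gamma> + 1) + real n" using Suc.prems(1) by simp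
    ultimately obtain B where B: "\<And>z. z \<in> lens \<Longrightarrow> hyp2F1 \<alpha> \<beta> (\<gamma> + 1) z =
      gauss_factor \<alpha> \<beta> (\<gamma> + 1) * hyp2F1 \<alpha> \<beta> (- d) (1 - z) + B * second_sol \<alpha> \<beta> (\<gamma> + 1) z"
      using Suc.IH[of "\<gamma> + 1"] \<gamma>1 by (auto simp: d_def algebra_simps)
    define A where "A = gauss_factor \<alpha> \<beta> (\<gamma> + 1)"
    have AQ: "A * Q = \<gamma> * d * gauss_factor \<alpha> \<beta> \<gamma>"
      unfolding A_def Q_def d_def using Suc.prems nonpos_Ints_Int by (intro gauss_factor_plus1) auto
    have "hyp2F1 \<alpha> \<beta> \<gamma> z = gauss_factor \<alpha> \<beta> \<gamma> * hyp2F1 \<alpha> \<beta> (1 - d) (1 - z) + (- B * (d + 1) / \<gamma>) * second_sol \<alpha> \<beta> \<gamma> z"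
      if z: "z \<in> lens" for z
    proof -
      have zn: "norm z < 1" using z by (simp add: lens_iff)
      obtain D where D: "(hyp2F1 \<alpha> \<beta> (\<gamma> + 1) has_field_derivative D) (at z)"
        "z * D = \<gamma> * hyp2F1 \<alpha> \<beta> \<gamma> z - \<gamma> * hyp2F1 \<alpha> \<beta> (\<gamma> + 1) z"
        by (rule hyp2F1_ladder[OF Suc.prems(2) zn])
      obtain D1 where D1: "((\<lambda>z. hyp2F1 \<alpha> \<beta> (- d) (1 - z)) has_field_derivative D1) (at z)"
        "z * D1 = Q / d * hyp2F1 \<alpha> \<beta> (1 - d) (1 - z) - \<gamma> * hyp2F1 \<alpha> \<beta> (- d) (1 - z)"
        unfolding d_def Q_def by (rule reflected_ladder[OF Suc.prems(3) z])
      obtain D2 where D2: "(second_sol \<alpha> \<beta> (\<gamma> + 1) has_field_derivative D2) (at z)"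
        "z * D2 = - (d + 1) * second_sol \<alpha> \<beta> \<gamma> z - \<gamma> * second_sol \<alpha> \<beta> (\<gamma> + 1) z"
        unfolding d_def by (rule second_sol_ladder[OF Suc.prems(3) z])
      have "((\<lambda>z. A * hyp2F1 \<alpha> \<beta> (- d) (1 - z) + B * second_sol \<alpha> \<beta> (\<gamma> + 1) z) has_field_derivative A * D1 + B * D2) (at z)"
        by (intro DERIV_add DERIV_cmult D1 D2)
      then have "(hyp2F1 \<alpha> \<beta> (\<gamma> + 1) has_field_derivative A * D1 + B * D2) (at z)"
        by (rule has_field_derivative_transform_within_open[OF _ open_lens z]) (simp add: B A_def)
      then have "D = A * D1 + B * D2" using D(1) DERIV_unique by blast
      then have "z * D = A * (z * D1) + B * (z * D2)" by (simp add: algebra_simps)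
      then have "\<gamma> * hyp2F1 \<alpha> \<beta> \<gamma> z = A * (Q / d * hyp2F1 \<alpha> \<beta> (1 - d) (1 - z)) - B * (d + 1) * second_sol \<alpha> \<beta> \<gamma> z"
        unfolding D D1 D2 B[OF z] by (simp add: A_def algebra_simps)
      also have "A * (Q / d * hyp2F1 \<alpha> \<beta> (1 - d) (1 - z)) = (A * Q) / d * hyp2F1 \<alpha> \<beta> (1 - d) (1 - z)" by simp
      also have "\<dots> = \<gamma> * (gauss_factor \<alpha> \<beta> \<gamma> * hyp2F1 \<alpha> \<beta> (1 - d) (1 - z))" unfolding AQ using nz by simp
      finally show ?thesis using nz by (simp add: field_simps)
    qed
    then show ?case unfolding d_def by blast
  qed
qed

text \<open>As z -> 1 the left side tends to p, while the right side behaves like q * (1 - z) powr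
  d. Since d may be purely imaginary, sizes alone do not separate the two; the phase along a
  suitable sequence does.\<close>

lemma reflected_solutions_independent:
  assumes d: "d \<notin> \<int>" and eq: "\<And>z. z \<in> lens \<Longrightarrow>
     p * hyp2F1 \<alpha> \<beta> (1 - d) (1 - z) = q * ((1 - z) powr d * hyp2F1 \<alpha>' \<beta>' (1 + d) (1 - z))"
  shows "p = 0 \<and> q = 0"
proof -
  have d0: "d \<noteq> 0" using d by auto
  \<comment> \<open>Chosen so that (1 - z n) powr d is the power e ^ Suc n of one number e = exp (-
    d / norm d). Its exponent has modulus 1.\<close>
  define r where "r = (\<lambda>n::nat. exp (- (real n + 1) / norm d))"
  define z where "z = (\<lambda>n. 1 - complex_of_real (r n))"
  have r: "0 < r n" "r n < 1" for n using d0 by (auto simp: r_def divide_neg_pos)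
  have z: "z n \<in> lens" for n
    using lens_of_real[of "1 - r n"] r[of n] by (simp add: z_def)
  have dn: "1 - d \<notin> \<int>\<^sub>\<le>\<^sub>0" "1 + d \<notin> \<int>\<^sub>\<le>\<^sub>0"
    using notin_Ints_nonpos(2)[OF d, of 1] notin_Ints_nonpos(1)[OF d, of 1] by (simp_all add: add.commute)
  have "r \<longlonglongrightarrow> 0"
  proof -
    have "filterlim (\<lambda>n::nat. real n + 1) at_top sequentially" by real_asymp
    then have "filterlim (\<lambda>n::nat. (1 / norm d) * (real n + 1)) at_top sequentially"
      using d0 by (intro filterlim_tendsto_pos_mult_at_top[OF tendsto_const]) auto
    then have "filterlim (\<lambda>n::nat. - ((1 / norm d) * (real n + 1))) at_bot sequentially"
      by (simp add: filterlim_uminus_at_bot)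
    then have "(\<lambda>n::nat. exp (- ((1 / norm d) * (real n + 1)))) \<longlonglongrightarrow> 0"
      by (rule filterlim_compose[OF exp_at_bot])
    moreover have "- ((1 / norm d) * (real n + 1)) = - (real n + 1) / norm d" for n
      by (simp add: diff_divide_distrib add_divide_distrib)
    ultimately show ?thesis unfolding r_def by (simp only:)
  qed
  then have "(\<lambda>n. complex_of_real (r n)) \<longlonglongrightarrow> complex_of_real 0" by (intro tendsto_of_real)
  then have z0: "(\<lambda>n. 1 - z n) \<longlonglongrightarrow> 0" by (simp add: z_def)
  define X where "X = (\<lambda>n. hyp2F1 \<alpha>' \<beta>' (1 + d) (1 - z n))"
  define Y where "Y = (\<lambda>n. hyp2F1 \<alpha> \<beta> (1 - d) (1 - z n))"
  have X: "X \<longlonglongrightarrow> 1" and Y: "Y \<longlonglongrightarrow> 1"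
    unfolding X_def Y_def by (rule hyp2F1_tendsto_0[OF dn(2) z0], rule hyp2F1_tendsto_0[OF dn(1) z0])
  define e where "e = exp (- (d / of_real (norm d)))"
  have pw: "(1 - z n) powr d = e ^ Suc n" for n
  proof -
    have "(1 - z n) powr d = exp (d * of_real (- (real n + 1) / norm d))"
      using r[of n] by (simp add: z_def r_def powr_def exp_of_real[symmetric] Ln_of_real' flip: of_real_mult)
    also have "d * of_real (- (real n + 1) / norm d) = of_nat (Suc n) * (- (d / of_real (norm d)))"
      using d0 by (simp add: field_simps)
    finally show ?thesis unfolding e_def exp_of_nat_mult .
  qed
  \<comment> \<open>The zeros of exp w - 1 are the multiples of 2 * pi * i, and none of them has
    modulus 1. With e different from 1, the limit relation p = e * p forces p = 0.\<close>
  have e1: "e \<noteq> 1"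
  proof
    assume "e = 1"
    define w where "w = - (d / of_real (norm d))"
    have "exp w = 1" using \<open>e = 1\<close> by (simp add: e_def w_def)
    then obtain k :: int where "Re w = 0" "Im w = of_int (2 * k) * pi"
      unfolding exp_eq_1 by blast
    moreover have "norm w = 1" using d0 by (simp add: norm_divide w_def)
    ultimately have k: "2 * \<bar>real_of_int k\<bar> * pi = 1" by (simp add: cmod_def abs_mult)
    then have "k \<noteq> 0" by auto
    then have "\<bar>real_of_int k\<bar> \<ge> 1" by linarith
    then have "2 * \<bar>real_of_int k\<bar> * pi \<ge> 2 * 1 * pi" by (intro mult_right_mono) auto
    then show False using k pi_gt3 by linarith
  qed
  have E: "p * Y n = q * (e ^ Suc n * X n)" for n
    using eq[OF z[of n]] unfolding pw X_def Y_def .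
  have evX: "\<forall>\<^sub>F n in sequentially. X n \<noteq> 0" using X by (rule tendsto_imp_eventually_ne) simp
  have "(\<lambda>n. p * Y n / X n) \<longlonglongrightarrow> p * 1 / 1" by (intro tendsto_intros X Y) simp
  moreover have "\<forall>\<^sub>F n in sequentially. p * Y n / X n = q * e ^ Suc n"
    using evX by eventually_elim (simp add: E)
  ultimately have "(\<lambda>n. q * e ^ Suc n) \<longlonglongrightarrow> p * 1 / 1" by (rule Lim_transform_eventually)
  then have lim: "(\<lambda>n. q * e ^ Suc n) \<longlonglongrightarrow> p" by simp
  have "(\<lambda>n. q * e ^ Suc (Suc n)) \<longlonglongrightarrow> p" by (rule LIMSEQ_Suc[OF lim])
  then have "(\<lambda>n. e * (q * e ^ Suc n)) \<longlonglongrightarrow> p" by (simp add: mult_ac)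
  moreover have "(\<lambda>n. e * (q * e ^ Suc n)) \<longlonglongrightarrow> e * p" by (intro tendsto_mult tendsto_const lim)
  ultimately have "p = e * p" by (rule LIMSEQ_unique)
  then have p: "p = 0" using e1 by auto
  obtain n where "X n \<noteq> 0" using evX eventually_happens[OF evX] by auto
  then have "q = 0" using E[of n] p by (simp add: e_def)
  with p show ?thesis by simp
qed

text \<open>The second coefficient needs no further limit. Euler's transformation interchanges the
  two local solutions at 1, so the expansion for the parameters \<gamma> - \<alpha> and \<gamma> -
  \<beta>, whose leading coefficient is known, is a second expansion of the same function. By
  independence B equals \<open>A'\<close>.\<close>

theorem hyp2F1_connection:
  assumes \<gamma>: "\<gamma> \<notin> \<int>\<^sub>\<le>\<^sub>0" and \<delta>: "\<gamma> - \<alpha> - \<beta> \<notin> \<int>" and z: "z \<in> lens"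
  defines "\<delta> \<equiv> \<gamma> - \<alpha> - \<beta>"
  shows "hyp2F1 \<alpha> \<beta> \<gamma> z =
     Gamma \<gamma> * Gamma \<delta> * rGamma (\<gamma> - \<alpha>) * rGamma (\<gamma> - \<beta>) * hyp2F1 \<alpha> \<beta> (1 - \<delta>) (1 - z) +
     Gamma \<gamma> * Gamma (- \<delta>) * rGamma \<alpha> * rGamma \<beta> * ((1 - z) powr \<delta> * hyp2F1 (\<gamma> - \<alpha>) (\<gamma> - \<beta>) (1 + \<delta>) (1 - z))"
proof -
  have dn: "1 - \<delta> \<notin> \<int>\<^sub>\<le>\<^sub>0" "1 + \<delta> \<notin> \<int>\<^sub>\<le>\<^sub>0"
    using notin_Ints_nonpos(2)[OF \<delta>, of 1] notin_Ints_nonpos(1)[OF \<delta>, of 1] by (simp_all add: add.commute \<delta>_def)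
  define A where "A = gauss_factor \<alpha> \<beta> \<gamma>"
  define A' where "A' = gauss_factor (\<gamma> - \<alpha>) (\<gamma> - \<beta>) \<gamma>"
  define g where "g = (\<lambda>z. hyp2F1 \<alpha> \<beta> (1 - \<delta>) (1 - z))"
  define k where "k = (\<lambda>z. (1 - z) powr \<delta> * hyp2F1 (\<gamma> - \<alpha>) (\<gamma> - \<beta>) (1 + \<delta>) (1 - z))"
  have d': "\<gamma> - (\<gamma> - \<alpha>) - (\<gamma> - \<beta>) = - \<delta>" by (simp add: \<delta>_def)
  have sol: "second_sol \<alpha> \<beta> \<gamma> z = k z" if z: "z \<in> lens" for z
  proof -
    have "hyp2F1 (1 - \<alpha>) (1 - \<beta>) (1 + \<delta>) (1 - z) = z powr (\<gamma> - 1) * hyp2F1 (\<gamma> - \<beta>) (\<gamma> - \<alpha>) (1 + \<delta>) (1 - z)"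
      using hyp2F1_Euler[OF dn(2), of "1 - z" "1 - \<alpha>" "1 - \<beta>"] z by (simp add: lens_iff \<delta>_def algebra_simps)
    moreover have "z powr (1 - \<gamma>) * z powr (\<gamma> - 1) = 1" using lens_notin[OF z] by (simp flip: powr_add)
    moreover have "1 + \<gamma> - \<alpha> - \<beta> = 1 + \<delta>" by (simp add: \<delta>_def)
    then have "second_sol \<alpha> \<beta> \<gamma> z = (1 - z) powr \<delta> * (z powr (1 - \<gamma>) * hyp2F1 (1 - \<alpha>) (1 - \<beta>) (1 + \<delta>) (1 - z))"
      unfolding second_sol_def \<delta>_def[symmetric] by (simp only: mult.assoc)
    ultimately show ?thesis
      unfolding k_def hyp2F1_commute[of "\<gamma> - \<alpha>"] by (simp add: mult.assoc[symmetric])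
  qed
  have sol': "(1 - z) powr \<delta> * second_sol (\<gamma> - \<alpha>) (\<gamma> - \<beta>) \<gamma> z = g z" if z: "z \<in> lens" for z
  proof -
    have "hyp2F1 (1 - (\<gamma> - \<alpha>)) (1 - (\<gamma> - \<beta>)) (1 - \<delta>) (1 - z) = z powr (\<gamma> - 1) * hyp2F1 \<beta> \<alpha> (1 - \<delta>) (1 - z)"
      using hyp2F1_Euler[OF dn(1), of "1 - z" "1 - (\<gamma> - \<alpha>)" "1 - (\<gamma> - \<beta>)"] z by (simp add: lens_iff \<delta>_def algebra_simps)
    moreover have "z powr (1 - \<gamma>) * z powr (\<gamma> - 1) = 1" "(1 - z) powr \<delta> * (1 - z) powr (- \<delta>) = 1"
      using lens_notin[OF z] by (simp_all flip: powr_add)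
    moreover have "1 + \<gamma> - (\<gamma> - \<alpha>) - (\<gamma> - \<beta>) = 1 - \<delta>" by (simp add: \<delta>_def)
    then have "(1 - z) powr \<delta> * second_sol (\<gamma> - \<alpha>) (\<gamma> - \<beta>) \<gamma> z = ((1 - z) powr \<delta> * (1 - z) powr (- \<delta>)) *
        (z powr (1 - \<gamma>) * hyp2F1 (1 - (\<gamma> - \<alpha>)) (1 - (\<gamma> - \<beta>)) (1 - \<delta>) (1 - z))"
      unfolding second_sol_def d' by (simp only: mult.assoc)
    ultimately show ?thesis
      unfolding g_def hyp2F1_commute[of \<alpha>] by (simp add: mult.assoc[symmetric])
  qed
  obtain B where B: "\<And>z. z \<in> lens \<Longrightarrow> hyp2F1 \<alpha> \<beta> \<gamma> z = A * g z + B * k z"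
    using hyp2F1_connection_exists[OF \<gamma> \<delta>] sol unfolding A_def g_def \<delta>_def by metis
  have \<delta>': "\<gamma> - (\<gamma> - \<alpha>) - (\<gamma> - \<beta>) \<notin> \<int>" using \<delta> Ints_minus[of "- \<delta>"] unfolding d' by (auto simp: \<delta>_def)
  obtain B' where B': "\<And>z. z \<in> lens \<Longrightarrow> hyp2F1 (\<gamma> - \<alpha>) (\<gamma> - \<beta>) \<gamma> z =
      A' * hyp2F1 (\<gamma> - \<alpha>) (\<gamma> - \<beta>) (1 + \<delta>) (1 - z) + B' * second_sol (\<gamma> - \<alpha>) (\<gamma> - \<beta>) \<gamma> z"
    using hyp2F1_connection_exists[OF \<gamma> \<delta>'] unfolding A'_def d' by auto
  have eq: "(A - B') * g z = (A' - B) * k z" if z: "z \<in> lens" for z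
  proof -
    have "norm z < 1" using z by (simp add: lens_iff)
    from hyp2F1_Euler[OF \<gamma> this, of \<alpha> \<beta>]
    have "hyp2F1 \<alpha> \<beta> \<gamma> z = (1 - z) powr \<delta> * (A' * hyp2F1 (\<gamma> - \<alpha>) (\<gamma> - \<beta>) (1 + \<delta>) (1 - z) + B' * second_sol (\<gamma> - \<alpha>) (\<gamma> - \<beta>) \<gamma> z)"
      unfolding B'[OF z] by (simp add: \<delta>_def)
    also have "\<dots> = A' * k z + B' * g z" unfolding sol'[OF z, symmetric] k_def by (simp add: algebra_simps)
    finally show ?thesis unfolding B[OF z] by (simp add: algebra_simps)
  qed
  have "A - B' = 0 \<and> A' - B = 0"
    by (rule reflected_solutions_independent) (use \<delta> eq in \<open>auto simp: \<delta>_def g_def k_def\<close>)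
  then have "B = A'" by simp
  then show ?thesis using B[OF z]
    unfolding A_def A'_def gauss_factor_def g_def k_def d' by (simp add: \<delta>_def)
qed

section \<open>Asymptotics of Kummer-type series\<close>

lemma norm_rGamma_shift_le:
  assumes "Re w \<ge> 1"
  shows "norm (rGamma (w + of_nat k)) \<le> norm (rGamma w) / fact k"
proof -
  have "fact k = pochhammer (1::real) k" by (simp add: pochhammer_fact)
  also have "\<dots> \<le> norm (pochhammer w k)"
    unfolding pochhammer_prod prod_norm[symmetric]
  proof (rule prod_mono)
    fix i show "0 \<le> 1 + real i \<and> 1 + real i \<le> norm (w + of_nat i)"
      using complex_Re_le_cmod[of "w + of_nat i"] assms by simp
  qed
  finally have f: "fact k \<le> norm (pochhammer w k)" .
  have "norm (rGamma w) = norm (pochhammer w k) * norm (rGamma (w + of_nat k))"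
    by (metis norm_mult pochhammer_rGamma)
  also have "\<dots> \<ge> fact k * norm (rGamma (w + of_nat k))" using f by (intro mult_right_mono) auto
  finally show ?thesis by (simp add: field_simps)
qed

lemma summable_norm_rGamma_powser:
  fixes \<mu> z :: complex
  shows "summable (\<lambda>n. norm (rGamma (of_nat n + 1 + \<mu>) * z ^ n))"
proof -
  obtain N :: nat where N: "real N \<ge> - Re \<mu>" using real_arch_simple by blast
  define w where "w = of_nat N + 1 + \<mu>"
  have w: "Re w \<ge> 1" using N by (simp add: w_def)
  have "summable (\<lambda>k. norm (rGamma w) * norm z ^ N * (norm z ^ k / fact k))"
    using summable_exp[of "norm z"] by (intro summable_mult) (simp add: field_simps)
  then have "summable (\<lambda>k. norm (rGamma (of_nat (k + N) + 1 + \<mu>) * z ^ (k + N)))"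
  proof (rule summable_comparison_test'[where N = 0])
    fix k :: nat
    have "norm (rGamma (of_nat (k + N) + 1 + \<mu>)) \<le> norm (rGamma w) / fact k"
      using norm_rGamma_shift_le[OF w, of k] by (simp add: w_def add_ac)
    then have "norm (rGamma (of_nat (k + N) + 1 + \<mu>)) * norm z ^ (k + N) \<le> norm (rGamma w) / fact k * norm z ^ (k + N)"
      by (rule mult_right_mono) simp
    then show "norm (norm (rGamma (of_nat (k + N) + 1 + \<mu>) * z ^ (k + N))) \<le> norm (rGamma w) * norm z ^ N * (norm z ^ k / fact k)"
      by (simp add: norm_mult norm_power power_add mult_ac)
  qed
  then show ?thesis by (rule summable_iff_shift[THEN iffD1])
qed

text \<open>For positive z this is exp z * z powr (- \<mu>) times the regularised lower incomplete
  Gamma function of index \<mu>, but it is entire in z and defined for every \<mu>.\<close>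

definition rGamma_powser :: "complex \<Rightarrow> complex \<Rightarrow> complex" where
  "rGamma_powser \<mu> z = (\<Sum>n. rGamma (of_nat n + 1 + \<mu>) * z ^ n)"

lemma rGamma_powser_sums: "(\<lambda>n. rGamma (of_nat n + 1 + \<mu>) * z ^ n) sums rGamma_powser \<mu> z"
  unfolding rGamma_powser_def by (rule summable_sums[OF summable_norm_cancel[OF summable_norm_rGamma_powser]])

lemma rGamma_powser_rec: "rGamma_powser \<mu> z = rGamma (1 + \<mu>) + z * rGamma_powser (\<mu> + 1) z"
proof -
  have "(\<lambda>n. z * (rGamma (of_nat n + 1 + (\<mu> + 1)) * z ^ n)) sums (z * rGamma_powser (\<mu> + 1) z)"
    by (intro sums_mult rGamma_powser_sums)
  then have "(\<lambda>n. rGamma (of_nat (Suc n) + 1 + \<mu>) * z ^ Suc n) sums (z * rGamma_powser (\<mu> + 1) z)"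
    by (simp add: algebra_simps)
  then have "(\<lambda>n. rGamma (of_nat n + 1 + \<mu>) * z ^ n) sums (z * rGamma_powser (\<mu> + 1) z + rGamma (of_nat 0 + 1 + \<mu>) * z ^ 0)"
    by (subst (asm) sums_Suc_iff)
  then show ?thesis using rGamma_powser_sums sums_unique2 by fastforce
qed

text \<open>The functional equation turns (n + \<mu>) / Gamma (n + 1 + \<mu>) into 1 / Gamma (n +
  \<mu>). The resulting equation says that exp (- z) * z powr \<mu> *
  \<open>rGamma_powser \<mu> z\<close> is a primitive of rGamma \<mu> * z powr (\<mu> - 1) * exp (-
  z).\<close>

lemma rGamma_powser_derivative:
  obtains D where "(rGamma_powser \<mu> has_field_derivative D) (at z)"
    "z * D + \<mu> * rGamma_powser \<mu> z = rGamma \<mu> + z * rGamma_powser \<mu> z"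
proof -
  define c where "c = (\<lambda>n. rGamma (of_nat n + 1 + \<mu>))"
  have c: "summable (\<lambda>n. c n * y ^ n)" for y
    unfolding c_def by (rule sums_summable[OF rGamma_powser_sums])
  define D where "D = (\<Sum>n. diffs c n * z ^ n)"
  have D: "(rGamma_powser \<mu> has_field_derivative D) (at z)"
  proof -
    have "rGamma_powser \<mu> = (\<lambda>z. \<Sum>n. c n * z ^ n)" by (simp add: fun_eq_iff rGamma_powser_def c_def)
    then show ?thesis unfolding D_def using termdiffs_strong_converges_everywhere[OF c] by simp
  qed
  have "summable (\<lambda>n. diffs c n * z ^ n)" by (rule termdiff_converges_all[OF c])
  then have "(\<lambda>n. diffs c n * z ^ n) sums D" unfolding D_def by (rule summable_sums)
  then have "(\<lambda>n. z * (diffs c n * z ^ n)) sums (z * D)" by (rule sums_mult)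
  then have "(\<lambda>n. of_nat (Suc n) * c (Suc n) * z ^ Suc n) sums (z * D)" by (simp add: diffs_def mult_ac)
  then have "(\<lambda>n. of_nat n * c n * z ^ n) sums (z * D)"
    using sums_Suc_iff[of "\<lambda>n. of_nat n * c n * z ^ n" "z * D"] by simp
  then have "(\<lambda>n. of_nat n * c n * z ^ n + \<mu> * (c n * z ^ n)) sums (z * D + \<mu> * rGamma_powser \<mu> z)"
    unfolding c_def by (intro sums_add sums_mult rGamma_powser_sums)
  moreover have "of_nat n * c n * z ^ n + \<mu> * (c n * z ^ n) = rGamma (of_nat n + \<mu>) * z ^ n" for n
  proof -
    have "of_nat n * c n * z ^ n + \<mu> * (c n * z ^ n) = ((of_nat n + \<mu>) * c n) * z ^ n" by (simp add: algebra_simps)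
    also have "(of_nat n + \<mu>) * c n = rGamma (of_nat n + \<mu>)"
      using rGamma_plus1[of "of_nat n + \<mu>"] by (simp add: c_def add_ac)
    finally show ?thesis .
  qed
  ultimately have "(\<lambda>n. rGamma (of_nat n + 1 + (\<mu> - 1)) * z ^ n) sums (z * D + \<mu> * rGamma_powser \<mu> z)" by (simp add: algebra_simps)
  then have "z * D + \<mu> * rGamma_powser \<mu> z = rGamma_powser (\<mu> - 1) z" using rGamma_powser_sums sums_unique2 by blast
  also have "\<dots> = rGamma \<mu> + z * rGamma_powser \<mu> z" using rGamma_powser_rec[of "\<mu> - 1" z] by simp
  finally show ?thesis using D that by blast
qed

lemma rGamma_powser_integral:
  assumes \<mu>: "Re \<mu> > 0" and y: "y > 0"
  shows "((\<lambda>t. of_real t powr (\<mu> - 1) / of_real (exp t)) has_integral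
     Gamma \<mu> * (exp (- of_real y) * of_real y powr \<mu> * rGamma_powser \<mu> (of_real y))) {0..y}"
proof -
  define F where "F = (\<lambda>t::real. Gamma \<mu> * (exp (- of_real t) * of_real t powr \<mu> * rGamma_powser \<mu> (of_real t)))"
  have G: "Gamma \<mu> * rGamma \<mu> = 1" using Re_pos_notin_nonpos_Ints[OF \<mu>] by (simp add: rGamma_inverse_Gamma Gamma_eq_zero_iff)
  have "((\<lambda>t. of_real t powr (\<mu> - 1) / of_real (exp t)) has_integral (F y - F 0)) {0..y}"
  proof (rule fundamental_theorem_of_calculus_interior)
    have "continuous_on UNIV (rGamma_powser \<mu>)"
      by (metis rGamma_powser_derivative DERIV_isCont continuous_at_imp_continuous_on)
    then have "continuous_on {0..y} (\<lambda>t. rGamma_powser \<mu> (of_real t))"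
      by (rule continuous_on_compose2) (auto intro: continuous_intros)
    moreover have "continuous_on {0..y} (\<lambda>t. complex_of_real t powr \<mu>)"
      by (intro continuous_intros) (use \<mu> in auto)
    ultimately show "continuous_on {0..y} F" unfolding F_def
      by (intro continuous_on_mult continuous_on_const continuous_on_exp continuous_on_minus continuous_on_of_real continuous_on_id)
    fix t assume t: "t \<in> {0<..<y}"
    define z where "z = complex_of_real t"
    have z: "z \<notin> \<real>\<^sub>\<le>\<^sub>0" "z \<noteq> 0" using t by (auto simp: z_def)
    obtain D where D: "(rGamma_powser \<mu> has_field_derivative D) (at z)"
      "z * D + \<mu> * rGamma_powser \<mu> z = rGamma \<mu> + z * rGamma_powser \<mu> z"
      by (rule rGamma_powser_derivative)
    define p where "p = exp (- z) * z powr \<mu>"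
    have 1: "((\<lambda>z. exp (- z) * z powr \<mu>) has_field_derivative (\<mu> / z - 1) * p) (at z)"
    proof -
      have "((\<lambda>z::complex. exp (- z)) has_field_derivative - exp (- z)) (at z)"
        by (auto intro!: derivative_eq_intros)
      from DERIV_mult[OF this has_field_derivative_powr_div[OF z(1), of \<mu>]]
      show ?thesis by (rule DERIV_cong) (simp add: p_def algebra_simps)
    qed
    have "((\<lambda>z. Gamma \<mu> * (exp (- z) * z powr \<mu> * rGamma_powser \<mu> z)) has_field_derivative
       Gamma \<mu> * ((\<mu> / z - 1) * p * rGamma_powser \<mu> z + D * p)) (at z)"
      unfolding p_def by (rule DERIV_cmult[OF DERIV_mult[OF 1[unfolded p_def] D(1)]])
    moreover have "(\<mu> / z - 1) * p * rGamma_powser \<mu> z + D * p = p / z * (z * D + \<mu> * rGamma_powser \<mu> z - z * rGamma_powser \<mu> z)"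
      using z by (simp add: field_simps)
    moreover have "z * D + \<mu> * rGamma_powser \<mu> z - z * rGamma_powser \<mu> z = rGamma \<mu>" unfolding D(2) by simp
    ultimately have "((\<lambda>z. Gamma \<mu> * (exp (- z) * z powr \<mu> * rGamma_powser \<mu> z)) has_field_derivative
       Gamma \<mu> * (p / z * rGamma \<mu>)) (at z)" by simp
    also have "Gamma \<mu> * (p / z * rGamma \<mu>) = Gamma \<mu> * rGamma \<mu> * (p / z)" by simp
    also have "\<dots> = of_real t powr (\<mu> - 1) / of_real (exp t)"
      unfolding G p_def using z by (simp add: z_def powr_diff exp_minus exp_of_real field_simps)
    finally show "(F has_vector_derivative of_real t powr (\<mu> - 1) / of_real (exp t)) (at t)"
      unfolding F_def z_def by (rule has_vector_derivative_real_field)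
  qed (use y in auto)
  moreover have "F 0 = 0" by (simp add: F_def)
  ultimately show ?thesis by (simp add: F_def)
qed

text \<open>By the integral representation the deviation from 1 is, up to the factor 1 / Gamma \<mu>
  and a sign, the Gamma integral over t > y. There exp (- t) is at most exp (- y / 2) * exp (- t /
  2), and the last factor keeps the integral finite.\<close>

lemma rGamma_powser_bound:
  assumes \<mu>: "Re \<mu> > 0"
  shows "\<exists>C. \<forall>y>0. norm (exp (- of_real y) * of_real y powr \<mu> * rGamma_powser \<mu> (of_real y) - 1) \<le> C * exp (- y / 2)"
proof -
  define f where "f = (\<lambda>t::real. of_real t powr (\<mu> - 1) / of_real (exp t) :: complex)"
  define g where "g = (\<lambda>t::real. norm (of_real t powr (\<mu> - 1) / of_real (exp (1 / 2 * t)) :: complex))"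
  have f: "(f has_integral Gamma \<mu>) {0<..}" unfolding f_def by (rule Gamma_integral_complex'[OF \<mu>])
  have g: "g integrable_on {0<..}"
    using absolutely_integrable_Gamma_integral[OF \<mu>, of "1 / 2"] unfolding g_def absolutely_integrable_on_def by simp
  define J where "J = integral {0<..} g"
  have G: "Gamma \<mu> \<noteq> 0" using Re_pos_notin_nonpos_Ints[OF \<mu>] by (simp add: Gamma_eq_zero_iff)
  have "norm (exp (- of_real y) * of_real y powr \<mu> * rGamma_powser \<mu> (of_real y) - 1) \<le> J / norm (Gamma \<mu>) * exp (- y / 2)"
    if y: "y > 0" for y
  proof -
    define W where "W = exp (- of_real y) * of_real y powr \<mu> * rGamma_powser \<mu> (of_real y)"
    have "(f has_integral Gamma \<mu> * W) {0..y}" unfolding f_def W_def by (rule rGamma_powser_integral[OF \<mu> y])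
    then have I: "(f has_integral Gamma \<mu> * W) {0<..y}"
      by (rule has_integral_spike_set_eq[THEN iffD1, rotated 2]) (auto intro: negligible_subset[of "{0}"])
    have "{0<..y} \<subseteq> {0<..}" by auto
    then have "((\<lambda>t. if t \<in> {0<..y} then f t else 0) has_integral Gamma \<mu> * W) {0<..}"
      using has_integral_restrict[of "{0<..y}" "{0<..}" f] I by blast
    from has_integral_diff[OF f this]
    have h: "((\<lambda>t. f t - (if t \<in> {0<..y} then f t else 0)) has_integral (Gamma \<mu> - Gamma \<mu> * W)) {0<..}" .
    have "norm (integral {0<..} (\<lambda>t. f t - (if t \<in> {0<..y} then f t else 0))) \<le> integral {0<..} (\<lambda>t. exp (- y / 2) * g t)"
    proof (rule integral_norm_bound_integral)
      show "(\<lambda>t. f t - (if t \<in> {0<..y} then f t else 0)) integrable_on {0<..}" using h by blast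
      show "(\<lambda>t. exp (- y / 2) * g t) integrable_on {0<..}" using g by (rule integrable_on_mult_right)
      fix t :: real assume t: "t \<in> {0<..}"
      show "norm (f t - (if t \<in> {0<..y} then f t else 0)) \<le> exp (- y / 2) * g t"
      proof (cases "t \<le> y")
        case False
        have nrm: "norm (w / of_real (exp x)) = norm w * exp (- x)" for w :: complex and x :: real
          by (subst norm_divide) (simp add: exp_minus divide_inverse)
        have "exp (- t) \<le> exp (- y / 2) * exp (- (1 / 2 * t))" unfolding exp_add[symmetric] using False by simp
        then have "norm (of_real t powr (\<mu> - 1) :: complex) * exp (- t) \<le> norm (of_real t powr (\<mu> - 1) :: complex) * (exp (- y / 2) * exp (- (1 / 2 * t)))"
          by (rule mult_left_mono) simp
        moreover have "norm (f t) = norm (of_real t powr (\<mu> - 1) :: complex) * exp (- t)"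
          unfolding f_def by (rule nrm)
        moreover have "g t = norm (of_real t powr (\<mu> - 1) :: complex) * exp (- (1 / 2 * t))"
          unfolding g_def by (rule nrm)
        moreover have "exp (- y / 2) * (norm (of_real t powr (\<mu> - 1) :: complex) * exp (- (1 / 2 * t))) =
            norm (of_real t powr (\<mu> - 1) :: complex) * (exp (- y / 2) * exp (- (1 / 2 * t)))"
          by (rule mult.left_commute)
        moreover have "f t - (if t \<in> {0<..y} then f t else 0) = f t" using False by simp
        ultimately show ?thesis by (simp only:)
      qed (use t in \<open>simp add: g_def\<close>)
    qed
    then have "norm (Gamma \<mu> - Gamma \<mu> * W) \<le> exp (- y / 2) * J"
      using integral_unique[OF h] by (simp add: J_def)
    also have "Gamma \<mu> - Gamma \<mu> * W = - (Gamma \<mu> * (W - 1))" by (simp add: algebra_simps)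
    finally have "norm (Gamma \<mu>) * norm (W - 1) \<le> exp (- y / 2) * J" by (simp only: norm_minus_cancel norm_mult)
    then have "norm (W - 1) \<le> J / norm (Gamma \<mu>) * exp (- y / 2)" using G by (simp add: field_simps)
    then show ?thesis unfolding W_def .
  qed
  then show ?thesis by blast
qed

lemma bigo_exp_half_powr: "(\<lambda>y::real. exp (- y) * y powr r) \<in> O(\<lambda>y. exp (- y / 2))"
  by real_asymp

lemma bigo_cmult_left: "f \<in> O[F](g) \<Longrightarrow> (\<lambda>x. c * f x) \<in> O[F](g)"
  for f g :: "'a \<Rightarrow> complex"
  by (cases "c = 0") simp_all

lemma bigo_cmult_right: "f \<in> O[F](g) \<Longrightarrow> (\<lambda>x. f x * c) \<in> O[F](g)"
  for f g :: "'a \<Rightarrow> complex"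
  by (cases "c = 0") simp_all

lemma norm_of_real_powr: "y > 0 \<Longrightarrow> norm (complex_of_real y powr s) = y powr Re s"
  by (simp add: norm_powr_real_powr)

text \<open>The integral needs a positive real part of \<mu>. The recursion from \<mu> + 1 to \<mu>
  adds only a multiple of exp (- y) * y powr \<mu>, which exp (- y / 2) absorbs whatever \<mu>
  is.\<close>

lemma rGamma_powser_asymp:
  "(\<lambda>y::real. exp (- of_real y) * of_real y powr \<mu> * rGamma_powser \<mu> (of_real y) - 1) \<in> O(\<lambda>y. of_real (exp (- y / 2)))"
proof -
  obtain n :: nat where "- Re \<mu> < real n" using reals_Archimedean2 by blast
  then have "Re \<mu> + real n > 0" by simp
  then show ?thesis
  proof (induction n arbitrary: \<mu>)
    case 0
    then obtain C where C: "\<And>y. y > 0 \<Longrightarrow> norm (exp (- of_real y) * of_real y powr \<mu> * rGamma_powser \<mu> (of_real y) - 1) \<le> C * exp (- y / 2)"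
      using rGamma_powser_bound[of \<mu>] by auto
    show ?case
      by (rule bigoI[of _ C], rule eventually_mono[OF eventually_gt_at_top[of 0]]) (use C in \<open>simp del: of_real_exp\<close>)
  next
    case (Suc n)
    have IH: "(\<lambda>y::real. exp (- of_real y) * of_real y powr (\<mu> + 1) * rGamma_powser (\<mu> + 1) (of_real y) - 1) \<in> O(\<lambda>y. of_real (exp (- y / 2)))"
      by (rule Suc.IH) (use Suc.prems in simp)
    have "(\<lambda>y::real. exp (- of_real y) * of_real y powr \<mu> * rGamma (1 + \<mu>)) \<in> O(\<lambda>y. complex_of_real (exp (- y / 2)))"
    proof (rule bigo_cmult_right)
      have "(\<lambda>y::real. exp (- of_real y) * of_real y powr \<mu>) \<in> O(\<lambda>y. complex_of_real (exp (- y) * y powr Re \<mu>))"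
      proof (rule bigoI[of _ 1], rule eventually_mono[OF eventually_gt_at_top[of 0]])
        fix y :: real assume "y > 0"
        then show "norm (exp (- of_real y) * complex_of_real y powr \<mu>) \<le> 1 * norm (complex_of_real (exp (- y) * y powr Re \<mu>))"
          by (simp add: norm_mult norm_of_real_powr abs_mult del: of_real_mult of_real_exp)
      qed
      also have "(\<lambda>y. complex_of_real (exp (- y) * y powr Re \<mu>)) \<in> O(\<lambda>y. complex_of_real (exp (- y / 2)))"
        using bigo_exp_half_powr by (subst landau_o.big.of_real_iff)
      finally show "(\<lambda>y::real. exp (- of_real y) * of_real y powr \<mu>) \<in> O(\<lambda>y. complex_of_real (exp (- y / 2)))" .
    qed
    from sum_in_bigo(1)[OF this IH]
    have "(\<lambda>y::real. exp (- of_real y) * of_real y powr \<mu> * rGamma (1 + \<mu>) +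
       (exp (- of_real y) * of_real y powr (\<mu> + 1) * rGamma_powser (\<mu> + 1) (of_real y) - 1)) \<in> O(\<lambda>y. complex_of_real (exp (- y / 2)))" .
    also have "?this \<longleftrightarrow> ?case"
    proof (rule landau_o.big.in_cong, rule eventually_mono[OF eventually_gt_at_top[of 0]])
      fix y :: real assume "y > 0"
      then show "exp (- of_real y) * of_real y powr \<mu> * rGamma (1 + \<mu>) +
       (exp (- of_real y) * of_real y powr (\<mu> + 1) * rGamma_powser (\<mu> + 1) (of_real y) - 1) =
        exp (- complex_of_real y) * of_real y powr \<mu> * rGamma_powser \<mu> (of_real y) - 1"
        by (simp add: rGamma_powser_rec[of \<mu>] powr_add algebra_simps)
    qed
    finally show ?case .
  qed
qed

section \<open>Expansions on the scale exp y * y powr r\<close>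

abbreviation exp_powr :: "real \<Rightarrow> real \<Rightarrow> complex" where
  "exp_powr r \<equiv> (\<lambda>y. of_real (exp y * y powr r))"

lemma exp_powr_mono: "r \<le> s \<Longrightarrow> exp_powr r \<in> O(exp_powr s)"
proof (rule bigoI[of _ 1], rule eventually_mono[OF eventually_ge_at_top[of 1]])
  fix y :: real assume "r \<le> s" "1 \<le> y"
  then have "y powr r \<le> y powr s" by (intro powr_mono)
  then show "norm (exp_powr r y) \<le> 1 * norm (exp_powr s y)" by (simp add: abs_mult del: of_real_mult of_real_exp)
qed

lemma power_bigo_exp_powr: "(\<lambda>y::real. complex_of_real y ^ n) \<in> O(exp_powr r)"
proof -
  have "(\<lambda>y::real. y ^ n) \<in> O(\<lambda>y. exp y * y powr r)" by real_asymp
  then have "(\<lambda>y::real. complex_of_real (y ^ n)) \<in> O(exp_powr r)" by (subst landau_o.big.of_real_iff)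
  then show ?thesis by simp
qed

text \<open>The exponent r is arbitrary: the error is of order exp (y / 2) times a power of y, hence
  below every member of the scale.\<close>

lemma rGamma_powser_expansion:
  "(\<lambda>y::real. rGamma_powser \<mu> (of_real y) - exp (of_real y) * of_real y powr (- \<mu>)) \<in> O(exp_powr r)"
proof -
  have "(\<lambda>y::real. exp (of_real y) * of_real y powr (- \<mu>) * (exp (- of_real y) * of_real y powr \<mu> * rGamma_powser \<mu> (of_real y) - 1))
     \<in> O(\<lambda>y. of_real (exp y * y powr (- Re \<mu>)) * of_real (exp (- y / 2)))"
  proof (rule landau_o.big.mult[OF _ rGamma_powser_asymp])
    show "(\<lambda>y::real. exp (of_real y) * of_real y powr (- \<mu>)) \<in> O(exp_powr (- Re \<mu>))"
    proof (rule bigoI[of _ 1], rule eventually_mono[OF eventually_gt_at_top[of 0]])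
      fix y :: real assume "y > 0"
      then show "norm (exp (of_real y) * complex_of_real y powr (- \<mu>)) \<le> 1 * norm (exp_powr (- Re \<mu>) y)"
        by (simp add: norm_mult norm_of_real_powr abs_mult del: of_real_mult of_real_exp)
    qed
  qed
  also have "(\<lambda>y. of_real (exp y * y powr (- Re \<mu>)) * of_real (exp (- y / 2))) \<in> O(exp_powr r)"
    unfolding of_real_mult[symmetric]
  proof (subst landau_o.big.of_real_iff)
    show "(\<lambda>y::real. exp y * y powr (- Re \<mu>) * exp (- y / 2)) \<in> O(\<lambda>y. exp y * y powr r)" by real_asymp
  qed
  also have "(\<lambda>y::real. exp (of_real y) * of_real y powr (- \<mu>) * (exp (- of_real y) * of_real y powr \<mu> * rGamma_powser \<mu> (of_real y) - 1)) \<in> O(exp_powr r) \<longleftrightarrow> ?thesis"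
  proof (rule landau_o.big.in_cong, rule eventually_mono[OF eventually_gt_at_top[of 0]])
    fix y :: real assume y: "y > 0"
    have "exp (of_real y) * exp (- of_real y) = (1::complex)" "of_real y powr (- \<mu>) * of_real y powr \<mu> = (1::complex)"
      using y by (simp_all add: powr_minus flip: exp_add)
    moreover have "exp (of_real y) * of_real y powr (- \<mu>) * (exp (- of_real y) * of_real y powr \<mu> * rGamma_powser \<mu> (of_real y) - 1) =
       (exp (of_real y) * exp (- of_real y)) * (of_real y powr (- \<mu>) * of_real y powr \<mu>) * rGamma_powser \<mu> (of_real y) - exp (of_real y) * of_real y powr (- \<mu>)"
      by (simp add: algebra_simps)
    ultimately show "exp (of_real y) * of_real y powr (- \<mu>) * (exp (- of_real y) * of_real y powr \<mu> * rGamma_powser \<mu> (of_real y) - 1) =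
       rGamma_powser \<mu> (of_real y) - exp (of_real y) * of_real y powr (- \<mu>)"
      by simp
  qed
  finally show ?thesis .
qed

lemma rGamma_powser_bigo: "(\<lambda>y::real. rGamma_powser \<mu> (of_real y)) \<in> O(exp_powr (- Re \<mu>))"
proof -
  have "(\<lambda>y::real. exp (of_real y) * of_real y powr (- \<mu>)) \<in> O(exp_powr (- Re \<mu>))"
  proof (rule bigoI[of _ 1], rule eventually_mono[OF eventually_gt_at_top[of 0]])
    fix y :: real assume "y > 0"
    then show "norm (exp (of_real y) * complex_of_real y powr (- \<mu>)) \<le> 1 * norm (exp_powr (- Re \<mu>) y)"
      by (simp add: norm_mult norm_of_real_powr abs_mult del: of_real_mult of_real_exp)
  qed
  from sum_in_bigo(1)[OF rGamma_powser_expansion[of \<mu> "- Re \<mu>"] this] show ?thesis by simp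
qed

text \<open>The comparison series is \<open>rGamma_powser\<close> with the real index Re \<mu>,
  whose coefficients are eventually positive, so that absolute values can be summed without losing
  the order. The finitely many initial terms form a polynomial in y, negligible on this
  scale.\<close>

lemma rGamma_dominated_series:
  fixes d :: "nat \<Rightarrow> complex"
  assumes d: "\<And>n. n \<ge> N \<Longrightarrow> norm (d n) \<le> K * norm (rGamma (of_nat n + 1 + \<mu>))"
  shows "summable (\<lambda>n. norm (d n) * \<bar>y\<bar> ^ n)"
    and "(\<lambda>y::real. complex_of_real (\<Sum>n. norm (d n) * \<bar>y\<bar> ^ n)) \<in> O(exp_powr (- Re \<mu>))"
proof -
  obtain N' :: nat where N': "real N' \<ge> - Re \<mu>" using real_arch_simple by blast
  define M where "M = max N N'"
  define w where "w = of_nat M + 1 + \<mu>"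
  define \<nu> where "\<nu> = complex_of_real (Re \<mu>)"
  have w: "Re w \<ge> 1" using N' by (simp add: w_def M_def)
  have rw: "rGamma (Re w) > 0" using w by (simp add: rGamma_inverse_Gamma)
  \<comment> \<open>Since |w + i| is at least Re w + i, the quotient of the modulus of rGamma (w +
    k) by rGamma (Re w + k) is largest at k = 0. This constant therefore serves for all n \<ge>
    M.\<close>
  define L where "L = \<bar>K\<bar> * (norm (rGamma w) / rGamma (Re w))"
  have L: "L \<ge> 0" using rw by (simp add: L_def)
  have e: "rGamma (of_nat n + 1 + \<nu>) = of_real (rGamma (real n + 1 + Re \<mu>))" for n
    by (simp add: \<nu>_def rGamma_complex_of_real[symmetric])
  have pos: "rGamma (real n + 1 + Re \<mu>) \<ge> 0" if "n \<ge> M" for n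
    using that N' by (simp add: rGamma_inverse_Gamma M_def less_imp_le)
  have dl: "norm (d n) \<le> L * rGamma (real n + 1 + Re \<mu>)" if n: "n \<ge> M" for n
  proof -
    define k where "k = n - M"
    have nk: "of_nat n + 1 + \<mu> = w + of_nat k" "real n + 1 + Re \<mu> = Re w + real k" using n by (auto simp: w_def k_def of_nat_diff)
    have "norm (rGamma w) = norm (pochhammer w k) * norm (rGamma (w + of_nat k))"
      by (metis norm_mult pochhammer_rGamma)
    moreover have "pochhammer (Re w) k \<le> norm (pochhammer w k)"
      unfolding pochhammer_prod prod_norm[symmetric]
    proof (rule prod_mono)
      fix i show "0 \<le> Re w + real i \<and> Re w + real i \<le> norm (w + of_nat i)"
        using complex_Re_le_cmod[of "w + of_nat i"] w by simp
    qed
    moreover have "pochhammer (Re w) k > 0" using w by (intro pochhammer_pos) simp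
    moreover have "rGamma (Re w) = pochhammer (Re w) k * rGamma (Re w + real k)" by (rule pochhammer_rGamma)
    ultimately have "norm (rGamma (w + of_nat k)) * rGamma (Re w) \<le> norm (rGamma w) * rGamma (Re w + real k)"
    proof -
      assume a: "norm (rGamma w) = norm (pochhammer w k) * norm (rGamma (w + of_nat k))"
        "pochhammer (Re w) k \<le> norm (pochhammer w k)" "pochhammer (Re w) k > 0"
        "rGamma (Re w) = pochhammer (Re w) k * rGamma (Re w + real k)"
      have r: "rGamma (Re w + real k) > 0" using w by (simp add: rGamma_inverse_Gamma)
      have "norm (rGamma (w + of_nat k)) * rGamma (Re w) = pochhammer (Re w) k * (norm (rGamma (w + of_nat k)) * rGamma (Re w + real k))"
        unfolding a(4) by simp
      also have "\<dots> \<le> norm (pochhammer w k) * (norm (rGamma (w + of_nat k)) * rGamma (Re w + real k))"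
        using a(2) r by (intro mult_right_mono) auto
      finally show ?thesis unfolding a(1) by simp
    qed
    then have "norm (rGamma (of_nat n + 1 + \<mu>)) \<le> norm (rGamma w) / rGamma (Re w) * rGamma (real n + 1 + Re \<mu>)"
      unfolding nk using rw by (simp add: field_simps)
    then have "\<bar>K\<bar> * norm (rGamma (of_nat n + 1 + \<mu>)) \<le> L * rGamma (real n + 1 + Re \<mu>)"
      unfolding L_def mult.assoc by (rule mult_left_mono) simp
    moreover have "norm (d n) \<le> \<bar>K\<bar> * norm (rGamma (of_nat n + 1 + \<mu>))"
      using d[of n] n by (intro order_trans[OF d] mult_right_mono) (auto simp: M_def)
    ultimately show ?thesis by linarith
  qed
  have sE: "(\<lambda>n. rGamma (real n + 1 + Re \<mu>) * y ^ n) sums Re (rGamma_powser \<nu> (of_real y))" for y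
    using sums_Re[OF rGamma_powser_sums[of \<nu> "of_real y"]] unfolding e by (simp flip: of_real_power of_real_mult)
  have sum: "summable (\<lambda>n. norm (d n) * \<bar>y\<bar> ^ n)" for y :: real
  proof (rule summable_comparison_test')
    show "summable (\<lambda>n. L * (rGamma (real n + 1 + Re \<mu>) * \<bar>y\<bar> ^ n))"
      using sE by (intro summable_mult) (rule sums_summable)
    show "norm (norm (d n) * \<bar>y\<bar> ^ n) \<le> L * (rGamma (real n + 1 + Re \<mu>) * \<bar>y\<bar> ^ n)" if "n \<ge> M" for n
      using mult_right_mono[OF dl[OF that], of "\<bar>y\<bar> ^ n"] by (simp add: mult.assoc)
  qed
  then show "summable (\<lambda>n. norm (d n) * \<bar>y\<bar> ^ n)" .
  define g where "g = (\<lambda>y::real. (\<Sum>n<M. (norm (d n) + L * \<bar>rGamma (real n + 1 + Re \<mu>)\<bar>) * y ^ n) + L * norm (rGamma_powser \<nu> (of_real y)))"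
  have "(\<lambda>y::real. complex_of_real (\<Sum>n. norm (d n) * \<bar>y\<bar> ^ n)) \<in> O(\<lambda>y. complex_of_real (g y))"
  proof (rule bigoI[of _ 1], rule eventually_mono[OF eventually_ge_at_top[of 0]])
    fix y :: real assume y: "y \<ge> 0"
    have "norm (d n) * \<bar>y\<bar> ^ n \<le> (if n < M then (norm (d n) + L * \<bar>rGamma (real n + 1 + Re \<mu>)\<bar>) * y ^ n else 0) + L * (rGamma (real n + 1 + Re \<mu>) * y ^ n)" for n
    proof (cases "n < M")
      case True
      have "0 \<le> (L * \<bar>rGamma (real n + 1 + Re \<mu>)\<bar> + L * rGamma (real n + 1 + Re \<mu>)) * y ^ n"
        unfolding distrib_left[symmetric] using L y by (intro mult_nonneg_nonneg) auto
      then show ?thesis using True y by (simp add: algebra_simps)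
    next
      case False
      then show ?thesis using mult_right_mono[OF dl[of n], of "y ^ n"] y by (simp add: mult.assoc)
    qed
    moreover have "(\<lambda>n. (if n < M then (norm (d n) + L * \<bar>rGamma (real n + 1 + Re \<mu>)\<bar>) * y ^ n else 0) + L * (rGamma (real n + 1 + Re \<mu>) * y ^ n)) sums
      ((\<Sum>n<M. (norm (d n) + L * \<bar>rGamma (real n + 1 + Re \<mu>)\<bar>) * y ^ n) + L * Re (rGamma_powser \<nu> (of_real y)))"
      by (intro sums_add sums_mult sE) (use sums_If_finite_set[of "{..<M}" "\<lambda>n. (norm (d n) + L * \<bar>rGamma (real n + 1 + Re \<mu>)\<bar>) * y ^ n"] in simp)
    ultimately have "(\<Sum>n. norm (d n) * \<bar>y\<bar> ^ n) \<le> (\<Sum>n<M. (norm (d n) + L * \<bar>rGamma (real n + 1 + Re \<mu>)\<bar>) * y ^ n) + L * Re (rGamma_powser \<nu> (of_real y))"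
      by (rule sums_le[OF _ summable_sums[OF sum]])
    also have "\<dots> \<le> g y" unfolding g_def using L by (intro add_left_mono mult_left_mono complex_Re_le_cmod)
    finally have "(\<Sum>n. norm (d n) * \<bar>y\<bar> ^ n) \<le> g y" .
    moreover have "0 \<le> (\<Sum>n. norm (d n) * \<bar>y\<bar> ^ n)" by (intro suminf_nonneg sum) simp
    ultimately show "norm (complex_of_real (\<Sum>n. norm (d n) * \<bar>y\<bar> ^ n)) \<le> 1 * norm (complex_of_real (g y))"
      unfolding norm_of_real by simp
  qed
  also have "(\<lambda>y. complex_of_real (g y)) \<in> O(exp_powr (- Re \<mu>))"
  proof -
    have "(\<lambda>y. complex_of_real (g y)) = (\<lambda>y. (\<Sum>n<M. of_real (norm (d n) + L * \<bar>rGamma (real n + 1 + Re \<mu>)\<bar>) * of_real y ^ n)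
        + of_real L * of_real (norm (rGamma_powser \<nu> (of_real y))))"
      by (simp add: g_def fun_eq_iff)
    also have "\<dots> \<in> O(exp_powr (- Re \<mu>))"
    proof (intro sum_in_bigo(1) big_sum_in_bigo bigo_cmult_left power_bigo_exp_powr)
      have "(\<lambda>y. norm (rGamma_powser \<nu> (of_real y))) \<in> O(\<lambda>y. norm (exp_powr (- Re \<mu>) y))"
        using rGamma_powser_bigo[of \<nu>] by (subst landau_o.big.norm_iff) (simp add: \<nu>_def)
      then show "(\<lambda>y. complex_of_real (norm (rGamma_powser \<nu> (of_real y)))) \<in> O(exp_powr (- Re \<mu>))"
        by (simp add: bigo_def)
    qed
    finally show ?thesis .
  qed
  finally show "(\<lambda>y::real. complex_of_real (\<Sum>n. norm (d n) * \<bar>y\<bar> ^ n)) \<in> O(exp_powr (- Re \<mu>))" .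
qed

text \<open>
  Gauss's theorem turns the ratio of Gamma functions into an inverse factorial series;
  the generating function of each of its terms is elementary up to exponentially small errors.
\<close>

lemma Gamma_ratio_expansion:
  fixes A c :: complex
  assumes A: "A \<notin> \<int>\<^sub>\<le>\<^sub>0"
  defines "e \<equiv> (\<lambda>s. pochhammer (c - A) s * pochhammer (1 - A) s / fact s)"
  shows "\<exists>K N. \<forall>n\<ge>N. norm (Gamma (A + of_nat n) * rGamma (c + of_nat n) / fact n -
     (\<Sum>s<S. e s * rGamma (of_nat n + 1 + (c - A + of_nat s)))) \<le> K * norm (rGamma (of_nat n + 1 + (c - A + of_nat S)))"
proof -
  \<comment> \<open>The lower parameter for which Gauss's theorem with upper parameters c - A and 1
    - A produces Gamma (A + n) / (Gamma (n + 1) * Gamma (c + n)), up to the factor Gamma (C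
    n).\<close>
  define C where "C = (\<lambda>n::nat. of_nat n + 1 + c - A)"
  obtain N :: nat where N: "real N > max (- Re A) (- Re (c - A))" using reals_Archimedean2 by blast
  have ReC: "Re (C N) > 0" using N by (simp add: C_def)
  have Cn: "C n = C N + of_nat (n - N)" if "n \<ge> N" for n using that by (simp add: C_def of_nat_diff)
  have ReCn: "Re (C n) > 0" if "n \<ge> N" for n using ReC Cn[OF that] by simp
  define h where "h = (\<lambda>n k. e k * rGamma (C n + of_nat k))"
  have h: "h n k = rGamma (C n) * hyp2F1_coeff (c - A) (1 - A) (C n) k" if n: "n \<ge> N" for n k
  proof -
    have "pochhammer (C n) k \<noteq> 0" using pochhammer_nonzero[OF Re_pos_notin_nonpos_Ints[OF ReCn[OF n]]] .
    then show ?thesis using pochhammer_rGamma[of "C n" k] by (simp add: h_def e_def hyp2F1_coeff_def field_simps)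
  qed
  have d: "C n - (c - A) - (1 - A) = A + of_nat n" "C n - (c - A) = of_nat n + 1" "C n - (1 - A) = c + of_nat n" for n
    by (simp_all add: C_def)
  have d': "of_nat n + 1 - (1 - A) = A + of_nat n" for n by simp
  have Repos: "Re (C n - (c - A) - (1 - A)) > 0" if "n \<ge> N" for n
    unfolding d(1) using N that by simp
  have hs: "summable (\<lambda>k. norm (h n k))" if n: "n \<ge> N" for n
    unfolding h[OF n] norm_mult
    by (intro summable_mult summable_norm_hyp2F1_coeff Re_pos_notin_nonpos_Ints ReCn Repos n)
  have hsum: "h n sums (Gamma (A + of_nat n) * rGamma (c + of_nat n) / fact n)" if n: "n \<ge> N" for n
  proof -
    note nC = Re_pos_notin_nonpos_Ints[OF ReCn[OF n]]
    have "(\<lambda>k. rGamma (C n) * hyp2F1_coeff (c - A) (1 - A) (C n) k) sums (rGamma (C n) * hyp2F1 (c - A) (1 - A) (C n) 1)"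
      using summable_sums[OF summable_norm_cancel[OF summable_norm_hyp2F1_coeff[OF nC Repos[OF n]]]]
      by (intro sums_mult) (simp add: hyp2F1_def)
    also have "hyp2F1 (c - A) (1 - A) (C n) 1 = Gamma (C n) * Gamma (A + of_nat n) * rGamma (of_nat n + 1) * rGamma (c + of_nat n)"
      using hyp2F1_Gauss[OF nC Repos[OF n]] by (simp only: d d')
    also have "rGamma (C n) * (Gamma (C n) * Gamma (A + of_nat n) * rGamma (of_nat n + 1) * rGamma (c + of_nat n)) =
       (rGamma (C n) * Gamma (C n)) * (Gamma (A + of_nat n) * rGamma (c + of_nat n) * rGamma (of_nat n + 1))"
      by simp
    also have "rGamma (C n) * Gamma (C n) = 1" using nC by (simp add: rGamma_inverse_Gamma Gamma_eq_zero_iff)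
    also have "rGamma (of_nat n + 1 :: complex) = 1 / fact n"
      using Gamma_fact[of n, where 'a = complex] by (simp add: rGamma_inverse_Gamma add.commute divide_inverse)
    finally have "(\<lambda>k. rGamma (C n) * hyp2F1_coeff (c - A) (1 - A) (C n) k) sums (1 * (Gamma (A + of_nat n) * rGamma (c + of_nat n) * (1 / fact n)))" .
    moreover have "h n = (\<lambda>k. rGamma (C n) * hyp2F1_coeff (c - A) (1 - A) (C n) k)" using h[OF n] by (simp add: fun_eq_iff)
    ultimately show ?thesis by simp
  qed
  \<comment> \<open>Divided by rGamma (C n + S), the k-th tail term is e (k + S) over a Pochhammer
    symbol at C n + S, whose modulus increases with n. So n = N is the worst case, and its tail
    bounds all others.\<close>
  define K where "K = (\<Sum>k. norm (h N (k + S))) / norm (rGamma (C N + of_nat S))"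
  have rS: "rGamma (C N + of_nat S) \<noteq> 0"
    using ReC by (intro rGamma_nonzero Re_pos_notin_nonpos_Ints) simp
  have "norm (Gamma (A + of_nat n) * rGamma (c + of_nat n) / fact n - (\<Sum>s<S. h n s)) \<le> K * norm (rGamma (C n + of_nat S))"
    if n: "n \<ge> N" for n
  proof -
    have le: "norm (h n (k + S)) * norm (rGamma (C N + of_nat S)) \<le> norm (rGamma (C n + of_nat S)) * norm (h N (k + S))" for k
    proof -
      define P where "P = (\<lambda>m. pochhammer (C m + of_nat S) k)"
      have ReS: "Re (C N + of_nat S) > 0" using ReC by simp
      have 1: "norm (P N) \<le> norm (P n)"
        unfolding P_def Cn[OF n] using norm_pochhammer_mono[OF ReS, of 0 "n - N" k] by (simp add: add_ac)
      have P: "rGamma (C m + of_nat S) = P m * rGamma (C m + of_nat (k + S))" for m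
        unfolding P_def using pochhammer_rGamma[of "C m + of_nat S" k] by (simp add: add_ac)
      have "norm (h n (k + S)) * norm (rGamma (C N + of_nat S)) =
        norm (P N) * (norm (e (k + S)) * norm (rGamma (C n + of_nat (k + S))) * norm (rGamma (C N + of_nat (k + S))))"
        unfolding h_def P norm_mult by simp
      also have "\<dots> \<le> norm (P n) * (norm (e (k + S)) * norm (rGamma (C n + of_nat (k + S))) * norm (rGamma (C N + of_nat (k + S))))"
        using 1 by (intro mult_right_mono mult_nonneg_nonneg) auto
      also have "\<dots> = norm (rGamma (C n + of_nat S)) * norm (h N (k + S))" unfolding h_def P norm_mult by simp
      finally show ?thesis .
    qed
    have sn: "summable (\<lambda>k. norm (h n (k + S)))" "summable (\<lambda>k. norm (h N (k + S)))"
      using hs[OF n] hs[of N] by (auto intro: summable_ignore_initial_segment)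
    have "(\<Sum>k. h n (k + S)) = Gamma (A + of_nat n) * rGamma (c + of_nat n) / fact n - (\<Sum>s<S. h n s)"
      using suminf_minus_initial_segment[OF sums_summable[OF hsum[OF n]], of S] sums_unique[OF hsum[OF n]] by simp
    then have "norm (Gamma (A + of_nat n) * rGamma (c + of_nat n) / fact n - (\<Sum>s<S. h n s)) * norm (rGamma (C N + of_nat S))
       \<le> (\<Sum>k. norm (h n (k + S))) * norm (rGamma (C N + of_nat S))"
      using summable_norm[OF sn(1)] by (intro mult_right_mono) auto
    also have "\<dots> = (\<Sum>k. norm (h n (k + S)) * norm (rGamma (C N + of_nat S)))"
      by (rule suminf_mult2[OF sn(1)])
    also have "\<dots> \<le> (\<Sum>k. norm (rGamma (C n + of_nat S)) * norm (h N (k + S)))"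
      by (intro suminf_le le summable_mult summable_mult2 sn)
    also have "\<dots> = norm (rGamma (C n + of_nat S)) * (\<Sum>k. norm (h N (k + S)))"
      by (rule suminf_mult[OF sn(2)])
    finally show ?thesis using rS by (simp add: K_def field_simps)
  qed
  moreover have "C n + of_nat s = of_nat n + 1 + (c - A + of_nat s)" for n s by (simp add: C_def)
  ultimately show ?thesis unfolding h_def by auto
qed

text \<open>Gamma A / Gamma c times Kummer's function 1F1(A; c; z), with the quotient kept inside
  the series so that c is unrestricted.\<close>

definition kummer_series :: "complex \<Rightarrow> complex \<Rightarrow> complex \<Rightarrow> complex" where
  "kummer_series A c z = (\<Sum>n. Gamma (A + of_nat n) * rGamma (c + of_nat n) / fact n * z ^ n)"

text \<open>The case S = 0 of \<open>Gamma_ratio_expansion\<close>. Control of the sum of absolute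
  values, rather than of the function, is what later allows estimates uniform in m.\<close>

lemma kummer_series_majorant:
  fixes A c :: complex
  assumes A: "A \<notin> \<int>\<^sub>\<le>\<^sub>0"
  shows "summable (\<lambda>n. norm (Gamma (A + of_nat n) * rGamma (c + of_nat n) / fact n) * \<bar>y\<bar> ^ n)"
    and "(\<lambda>y::real. complex_of_real (\<Sum>n. norm (Gamma (A + of_nat n) * rGamma (c + of_nat n) / fact n) * \<bar>y\<bar> ^ n)) \<in> O(exp_powr (Re (A - c)))"
proof -
  obtain K N where "\<And>n. n \<ge> N \<Longrightarrow> norm (Gamma (A + of_nat n) * rGamma (c + of_nat n) / fact n) \<le> K * norm (rGamma (of_nat n + 1 + (c - A)))"
    using Gamma_ratio_expansion[OF A, of c 0] by auto
  note * = rGamma_dominated_series[OF this]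
  show "summable (\<lambda>n. norm (Gamma (A + of_nat n) * rGamma (c + of_nat n) / fact n) * \<bar>y\<bar> ^ n)" by (rule *(1))
  show "(\<lambda>y::real. complex_of_real (\<Sum>n. norm (Gamma (A + of_nat n) * rGamma (c + of_nat n) / fact n) * \<bar>y\<bar> ^ n)) \<in> O(exp_powr (Re (A - c)))"
    using *(2) by simp
qed

lemma kummer_series_sums:
  assumes A: "A \<notin> \<int>\<^sub>\<le>\<^sub>0"
  shows "(\<lambda>n. Gamma (A + of_nat n) * rGamma (c + of_nat n) / fact n * of_real y ^ n) sums kummer_series A c (of_real y)"
proof -
  have "summable (\<lambda>n. norm (Gamma (A + of_nat n) * rGamma (c + of_nat n) / fact n * of_real y ^ n))"
    using kummer_series_majorant(1)[OF A, of c y] by (simp add: norm_mult norm_divide norm_power)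
  then show ?thesis unfolding kummer_series_def by (intro summable_sums) (rule summable_norm_cancel)
qed

text \<open>The first S terms of the inverse factorial series are summed against y ^ n to functions
  \<open>rGamma_powser\<close>, each equal to exp y times a power of y up to negligible errors. The
  remaining coefficients are dominated by those of index c - A + S, which gives the stated
  order.\<close>

theorem kummer_series_asymp:
  fixes A c :: complex
  assumes A: "A \<notin> \<int>\<^sub>\<le>\<^sub>0"
  shows "(\<lambda>y::real. kummer_series A c (of_real y) - exp (of_real y) * of_real y powr (A - c) *
     (\<Sum>s<S. pochhammer (c - A) s * pochhammer (1 - A) s / fact s / of_real y ^ s)) \<in> O(exp_powr (Re (A - c) - real S))"
proof -
  define e where "e = (\<lambda>s. pochhammer (c - A) s * pochhammer (1 - A) s / fact s)"
  define \<rho> where "\<rho> = Re (A - c) - real S"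
  define d where "d = (\<lambda>n. Gamma (A + of_nat n) * rGamma (c + of_nat n) / fact n - (\<Sum>s<S. e s * rGamma (of_nat n + 1 + (c - A + of_nat s))))"
  obtain K N where "\<And>n. n \<ge> N \<Longrightarrow> norm (d n) \<le> K * norm (rGamma (of_nat n + 1 + (c - A + of_nat S)))"
    using Gamma_ratio_expansion[OF A, of c S] unfolding d_def e_def by auto
  note dom = rGamma_dominated_series[OF this]
  have \<rho>: "- Re (c - A + of_nat S) = \<rho>" by (simp add: \<rho>_def)
  have "(\<lambda>y::real. \<Sum>n. d n * of_real y ^ n) \<in> O(exp_powr \<rho>)"
  proof -
    have "(\<lambda>y::real. \<Sum>n. d n * of_real y ^ n) \<in> O(\<lambda>y. complex_of_real (\<Sum>n. norm (d n) * \<bar>y\<bar> ^ n))"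
    proof (rule bigoI[of _ 1], rule always_eventually, rule allI)
      fix y :: real
      have "norm (\<Sum>n. d n * of_real y ^ n) \<le> (\<Sum>n. norm (d n * of_real y ^ n))"
        using dom(1)[where y = y] by (intro summable_norm) (simp add: norm_mult norm_power)
      also have "\<dots> = (\<Sum>n. norm (d n) * \<bar>y\<bar> ^ n)" by (simp add: norm_mult norm_power)
      finally show "norm (\<Sum>n. d n * of_real y ^ n) \<le> 1 * norm (complex_of_real (\<Sum>n. norm (d n) * \<bar>y\<bar> ^ n))"
        unfolding norm_of_real by linarith
    qed
    also have "(\<lambda>y. complex_of_real (\<Sum>n. norm (d n) * \<bar>y\<bar> ^ n)) \<in> O(exp_powr \<rho>)" using dom(2) unfolding \<rho> .
    finally show ?thesis .
  qed
  moreover have "(\<lambda>y::real. \<Sum>s<S. e s * (rGamma_powser (c - A + of_nat s) (of_real y) - exp (of_real y) * of_real y powr (- (c - A + of_nat s)))) \<in> O(exp_powr \<rho>)"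
    by (intro big_sum_in_bigo bigo_cmult_left rGamma_powser_expansion)
  ultimately have "(\<lambda>y::real. (\<Sum>n. d n * of_real y ^ n) + (\<Sum>s<S. e s * (rGamma_powser (c - A + of_nat s) (of_real y) - exp (of_real y) * of_real y powr (- (c - A + of_nat s))))) \<in> O(exp_powr \<rho>)"
    by (rule sum_in_bigo(1))
  also have "?this \<longleftrightarrow> ?thesis" unfolding \<rho>_def[symmetric]
  proof (rule landau_o.big.in_cong, rule eventually_mono[OF eventually_gt_at_top[of 0]])
    fix y :: real assume y: "y > 0"
    have "(\<lambda>n. Gamma (A + of_nat n) * rGamma (c + of_nat n) / fact n * of_real y ^ n -
        (\<Sum>s<S. e s * (rGamma (of_nat n + 1 + (c - A + of_nat s)) * of_real y ^ n))) sums
        (kummer_series A c (of_real y) - (\<Sum>s<S. e s * rGamma_powser (c - A + of_nat s) (of_real y)))"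
      by (intro sums_diff sums_sum sums_mult rGamma_powser_sums kummer_series_sums A)
    then have "(\<lambda>n. d n * of_real y ^ n) sums
        (kummer_series A c (of_real y) - (\<Sum>s<S. e s * rGamma_powser (c - A + of_nat s) (of_real y)))"
      by (simp add: d_def left_diff_distrib sum_distrib_right mult.assoc)
    then have 1: "(\<Sum>n. d n * of_real y ^ n) = kummer_series A c (of_real y) - (\<Sum>s<S. e s * rGamma_powser (c - A + of_nat s) (of_real y))"
      by (simp add: sums_iff)
    have e': "pochhammer (c - A) s * pochhammer (1 - A) s / fact s = e s" for s by (simp add: e_def)
    have 2: "of_real y powr (- (c - A + of_nat s)) = of_real y powr (A - c) / of_real y ^ s" for s
    proof -
      have "- (c - A + of_nat s) = A - c - of_nat s" by simp
      then show ?thesis using y by (simp only: powr_diff) (simp add: powr_nat')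
    qed
    show "(\<Sum>n. d n * of_real y ^ n) + (\<Sum>s<S. e s * (rGamma_powser (c - A + of_nat s) (of_real y) - exp (of_real y) * of_real y powr (- (c - A + of_nat s)))) =
      kummer_series A c (of_real y) - exp (of_real y) * of_real y powr (A - c) * (\<Sum>s<S. pochhammer (c - A) s * pochhammer (1 - A) s / fact s / of_real y ^ s)"
      unfolding 1 2 e' by (simp add: right_diff_distrib sum_subtractf sum_distrib_left mult_ac)
  qed
  finally show ?thesis .
qed

section \<open>Continuation to the slit plane\<close>

lemma slit_plane_iff: "x \<in> slit_plane \<longleftrightarrow> 1 - x \<notin> \<real>\<^sub>\<le>\<^sub>0"
  unfolding slit_plane_eq by (auto intro!: image_eqI[where x = "1 - x"])

text \<open>If t * x lies on the cut [1, \<infinity>) with 0 < t \<le> 1, then so does x.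
  Starlikeness about 0 provides primitives and keeps 1 - t * x off the negative axis in Euler's
  integral.\<close>

lemma slit_plane_scale:
  assumes "x \<in> slit_plane" "0 \<le> t" "t \<le> 1"
  shows "of_real t * x \<in> slit_plane"
proof (rule ccontr)
  assume "of_real t * x \<notin> slit_plane"
  then have 1: "t * Re x \<ge> 1" "t * Im x = 0"
    by (auto simp: slit_plane_iff complex_nonpos_Reals_iff)
  then have "t \<noteq> 0" by auto
  then have t: "t > 0" using assms by simp
  then have "Im x = 0" using 1(2) by simp
  moreover have "Re x \<ge> 1"
  proof -
    have "0 < Re x" using zero_less_mult_pos[of t "Re x"] 1(1) t by simp
    have "1 \<le> t * Re x" by (rule 1)
    also have "\<dots> \<le> 1 * Re x" using \<open>0 < Re x\<close> assms(3)
      by (intro mult_right_mono) auto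
    finally show ?thesis by simp
  qed
  ultimately show False using assms(1) by (auto simp: slit_plane_iff complex_nonpos_Reals_iff)
qed

lemma zero_in_slit_plane: "0 \<in> slit_plane"
  using ball_subset_slit_plane by auto

lemma starlike_slit_plane: "starlike slit_plane"
  unfolding starlike_def
proof (intro bexI[of _ 0] ballI subsetI)
  fix x z :: complex assume x: "x \<in> slit_plane" "z \<in> closed_segment 0 x"
  then obtain t where "0 \<le> t" "t \<le> 1" "z = of_real t * x"
    by (auto simp: closed_segment_def scaleR_conv_of_real)
  then show "z \<in> slit_plane" using slit_plane_scale[OF x(1)] by simp
qed (rule zero_in_slit_plane)

text \<open>Room for Cauchy's inequality: a radius common to all points of K, with all the discs
  inside one compact set on which bounds are already available.\<close>

lemma compact_slit_plane_collar:
  assumes "compact K" "K \<subseteq> slit_plane"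
  obtains r K' where "r > 0" "compact K'" "K' \<subseteq> slit_plane" "\<And>x. x \<in> K \<Longrightarrow> cball x r \<subseteq> K'"
proof -
  obtain r where r: "r > 0" "(\<Union>x\<in>K. cball x r) \<subseteq> slit_plane"
    using compact_subset_open_imp_cball_epsilon_subset[OF assms(1) open_slit_plane assms(2)] .
  define K' where "K' = (\<lambda>p. fst p + snd p) ` (K \<times> cball 0 r)"
  have "compact K'" unfolding K'_def
    using assms(1) by (intro compact_continuous_image compact_Times continuous_intros) auto
  moreover have "K' \<subseteq> slit_plane"
  proof
    fix z assume "z \<in> K'"
    then obtain x y where "x \<in> K" "norm y \<le> r" "z = x + y" by (auto simp: K'_def)
    then have "z \<in> cball x r" by (simp add: dist_norm)
    then show "z \<in> slit_plane" using r(2) \<open>x \<in> K\<close> by blast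
  qed
  moreover have "cball x r \<subseteq> K'" if "x \<in> K" for x
  proof
    fix z assume "z \<in> cball x r"
    then have "(x, z - x) \<in> K \<times> cball 0 r" using that by (simp add: dist_norm norm_minus_commute)
    then have "fst (x, z - x) + snd (x, z - x) \<in> K'" unfolding K'_def by (rule imageI)
    then show "z \<in> K'" by simp
  qed
  ultimately show ?thesis using that[OF r(1)] by blast
qed

text \<open>The functions with first parameter a + n are treated together because the constants C
  and R must be common to all n. Both may depend on K; geometric growth is stable under the
  parameter shifts below and harmless against the factorial in \<open>psi1_coeff\<close>.\<close>

definition hyp2F1_family :: "complex \<Rightarrow> complex \<Rightarrow> complex \<Rightarrow> (nat \<Rightarrow> complex \<Rightarrow> complex) \<Rightarrow> bool" where
  "hyp2F1_family a b c h \<longleftrightarrow>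
     (\<forall>n. h n holomorphic_on slit_plane) \<and>
     (\<forall>n x. norm x < 1 \<longrightarrow> h n x = hyp2F1 (a + of_nat n) b c x) \<and>
     (\<forall>K. compact K \<and> K \<subseteq> slit_plane \<longrightarrow> (\<exists>C R. C \<ge> 0 \<and> R \<ge> 0 \<and> (\<forall>n. \<forall>x\<in>K. norm (h n x) \<le> C * R ^ n)))"

lemma hyp2F1_family_bound:
  assumes "hyp2F1_family a b c h" "compact K" "K \<subseteq> slit_plane"
  obtains C R where "C \<ge> 0" "R \<ge> 0" "\<And>n x. x \<in> K \<Longrightarrow> norm (h n x) \<le> C * R ^ n"
proof -
  have "\<exists>C R. C \<ge> 0 \<and> R \<ge> 0 \<and> (\<forall>n. \<forall>x\<in>K. norm (h n x) \<le> C * R ^ n)"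
    using assms by (simp add: hyp2F1_family_def)
  then show ?thesis using that by blast
qed

lemma compact_norm_bound:
  fixes K :: "complex set"
  assumes "compact K"
  obtains B where "B > 0" "\<And>x. x \<in> K \<Longrightarrow> norm x \<le> B"
  using compact_imp_bounded[OF assms] by (auto simp: bounded_pos)

text \<open>The operator 1 + (x / c) d/dx lowers the third parameter from c + 1 to c, by
  \<open>hyp2F1_ladder\<close>. Cauchy's inequality on a collar bounds the derivative with the same
  ratio R.\<close>

lemma hyp2F1_family_lower_c:
  assumes h: "hyp2F1_family a b (c + 1) h" and c: "c \<notin> \<int>\<^sub>\<le>\<^sub>0"
  shows "hyp2F1_family a b c (\<lambda>n x. h n x + x / c * deriv (h n) x)"
  unfolding hyp2F1_family_def
proof (intro conjI allI impI)
  have hol: "h n holomorphic_on slit_plane" for n using h by (simp add: hyp2F1_family_def)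
  have c0: "c \<noteq> 0" using c by auto
  show "(\<lambda>x. h n x + x / c * deriv (h n) x) holomorphic_on slit_plane" for n
    using c0 by (intro holomorphic_intros hol open_slit_plane)
  show "h n x + x / c * deriv (h n) x = hyp2F1 (a + of_nat n) b c x" if x: "norm x < 1" for n x
  proof -
    obtain D where D: "(hyp2F1 (a + of_nat n) b (c + 1) has_field_derivative D) (at x)"
      "x * D = c * hyp2F1 (a + of_nat n) b c x - c * hyp2F1 (a + of_nat n) b (c + 1) x"
      by (rule hyp2F1_ladder[OF c x])
    have eq: "hyp2F1 (a + of_nat n) b (c + 1) z = h n z" if "norm z < 1" for z
      using h that by (simp add: hyp2F1_family_def)
    have "(h n has_field_derivative D) (at x)"
      by (rule has_field_derivative_transform_within_open[OF D(1), of "ball 0 1"]) (use x eq in auto)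
    then have "deriv (h n) x = D" by (rule DERIV_imp_deriv)
    then have "c * (h n x + x / c * deriv (h n) x) = c * hyp2F1 (a + of_nat n) b c x"
      using D(2) c0 eq[OF x] by (simp add: distrib_left)
    then show ?thesis using c0 by simp
  qed
  fix K assume K: "compact K \<and> K \<subseteq> slit_plane"
  then have K': "compact K" "K \<subseteq> slit_plane" by auto
  obtain r K' where r: "r > 0" "compact K'" "K' \<subseteq> slit_plane" "\<And>x. x \<in> K \<Longrightarrow> cball x r \<subseteq> K'"
    using compact_slit_plane_collar[OF K'] by blast
  obtain C R where C: "C \<ge> 0" "R \<ge> 0" "\<And>n x. x \<in> K' \<Longrightarrow> norm (h n x) \<le> C * R ^ n"
    using hyp2F1_family_bound[OF h r(2,3)] by blast
  obtain B where B: "B > 0" "\<And>x. x \<in> K \<Longrightarrow> norm x \<le> B"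
    using compact_norm_bound[OF K'(1)] by blast
  have nn: "0 \<le> C + B / norm c * (C / r)" using C B r by (intro add_nonneg_nonneg mult_nonneg_nonneg divide_nonneg_nonneg) auto
  have bd: "norm (h n x + x / c * deriv (h n) x) \<le> (C + B / norm c * (C / r)) * R ^ n" if x: "x \<in> K" for n x
  proof -
    have sub: "cball x r \<subseteq> slit_plane" using r(3) r(4)[OF x] by blast
    have "norm ((deriv ^^ 1) (h n) x) \<le> fact 1 * (C * R ^ n) / r ^ 1"
    proof (rule Cauchy_inequality[OF _ _ r(1)])
      show "h n holomorphic_on ball x r" using sub ball_subset_cball by (intro holomorphic_on_subset[OF hol]) blast
      show "continuous_on (cball x r) (h n)"
        using sub by (intro holomorphic_on_imp_continuous_on holomorphic_on_subset[OF hol])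
      show "norm (h n y) \<le> C * R ^ n" if "norm (x - y) = r" for y
        using that r(4)[OF x] by (intro C) (auto simp: dist_norm)
    qed
    then have d: "norm (deriv (h n) x) \<le> C * R ^ n / r" by simp
    have "norm (h n x + x / c * deriv (h n) x) \<le> norm (h n x) + norm x / norm c * norm (deriv (h n) x)"
      using norm_triangle_ineq[of "h n x" "x / c * deriv (h n) x"] by (simp add: norm_mult norm_divide)
    also have "\<dots> \<le> C * R ^ n + B / norm c * (C * R ^ n / r)"
    proof (intro add_mono mult_mono divide_right_mono d B x C)
      show "x \<in> K'" using r(1) r(4)[OF x] by auto
    qed (use B in auto)
    also have "\<dots> = (C + B / norm c * (C / r)) * R ^ n" by (simp add: algebra_simps)
    finally show ?thesis .
  qed
  show "\<exists>C R. C \<ge> 0 \<and> R \<ge> 0 \<and> (\<forall>n. \<forall>x\<in>K. norm (h n x + x / c * deriv (h n) x) \<le> C * R ^ n)"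
    using nn C(2) bd by blast
qed

text \<open>The derivative of F(a + n, b; c) is a multiple of F(a + n + 1, b + 1; c + 1), so the
  continuation is obtained by integrating from 0, with value 1 there.\<close>

lemma hyp2F1_family_lower_bc:
  assumes h: "hyp2F1_family (a + 1) (b + 1) (c + 1) h" and c: "c \<notin> \<int>\<^sub>\<le>\<^sub>0"
  shows "\<exists>g. hyp2F1_family a b c g"
proof -
  have hol: "h n holomorphic_on slit_plane" for n using h by (simp add: hyp2F1_family_def)
  define k where "k = (\<lambda>n x. (a + of_nat n) * b / c * h n x)"
  have khol: "k n holomorphic_on slit_plane" for n unfolding k_def by (intro holomorphic_intros hol)
  have "\<exists>G. \<forall>x\<in>slit_plane. (G has_field_derivative k n x) (at x)" for n
    by (rule holomorphic_starlike_primitive[OF _ starlike_slit_plane open_slit_plane finite.emptyI])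
       (use khol open_slit_plane in \<open>auto intro: holomorphic_on_imp_continuous_on holomorphic_on_imp_differentiable_at\<close>)
  then obtain G where G: "\<And>n x. x \<in> slit_plane \<Longrightarrow> (G n has_field_derivative k n x) (at x)" by metis
  define g where "g = (\<lambda>n x. G n x - G n 0 + 1)"
  have g: "(g n has_field_derivative k n x) (at x)" if "x \<in> slit_plane" for n x
    unfolding g_def using G[OF that, of n] by (auto intro!: derivative_eq_intros)
  have "hyp2F1_family a b c g"
    unfolding hyp2F1_family_def
  proof (intro conjI allI impI)
    show "g n holomorphic_on slit_plane" for n
      using g by (subst holomorphic_on_open[OF open_slit_plane]) blast
    show "g n x = hyp2F1 (a + of_nat n) b c x" if x: "norm x < 1" for n x
    proof -
      have "((\<lambda>z. g n z - hyp2F1 (a + of_nat n) b c z) has_field_derivative 0) (at z)" if z: "z \<in> ball 0 1" for z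
      proof -
        have z': "norm z < 1" "z \<in> slit_plane" using z ball_subset_slit_plane by auto
        have "k n z = (a + of_nat n) * b / c * hyp2F1 (a + of_nat n + 1) (b + 1) (c + 1) z"
          using h z' by (simp add: hyp2F1_family_def k_def add_ac)
        then show ?thesis using DERIV_diff[OF g[OF z'(2), of n] hyp2F1_derivative[OF c z'(1), of "a + of_nat n" b]] by simp
      qed
      then have "((\<lambda>z. g n z - hyp2F1 (a + of_nat n) b c z) has_field_derivative 0) (at z within ball 0 1)" if "z \<in> ball 0 1" for z
        using that has_field_derivative_at_within by blast
      from has_field_derivative_zero_constant[OF convex_ball this]
      obtain C where C: "\<And>z. z \<in> ball 0 1 \<Longrightarrow> g n z - hyp2F1 (a + of_nat n) b c z = C" by blast
      have "C = 0" using C[of 0] by (simp add: g_def)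
      then show ?thesis using C[of x] x by simp
    qed
    fix K assume K: "compact K \<and> K \<subseteq> slit_plane"
    define K' where "K' = (\<lambda>(t, x). complex_of_real t * x) ` ({0..1} \<times> K)"
    have K': "compact K'" "K' \<subseteq> slit_plane"
      using K slit_plane_scale unfolding K'_def
      by (auto intro!: compact_continuous_image compact_Times continuous_intros simp: case_prod_unfold)
    obtain C R where C: "C \<ge> 0" "R \<ge> 0" "\<And>n x. x \<in> K' \<Longrightarrow> norm (h n x) \<le> C * R ^ n"
      using hyp2F1_family_bound[OF h K'] by blast
    obtain B where B: "B > 0" "\<And>x. x \<in> K \<Longrightarrow> norm x \<le> B"
      using compact_norm_bound K by blast
    define D where "D = (norm a + 1) * norm b / norm c * C * B + 1"
    \<comment> \<open>The factor 2 pays for the linear growth of a + n in the derivative; the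
      maximum with 1 makes the powers of S absorb the value 1 at the origin.\<close>
    define S where "S = 2 * max R 1"
    have D: "0 \<le> D" unfolding D_def using C B by (intro add_nonneg_nonneg mult_nonneg_nonneg divide_nonneg_nonneg) auto
    have S: "0 \<le> S" by (simp add: S_def)
    have bd: "norm (g n x) \<le> D * S ^ n" if x: "x \<in> K" for n x
    proof -
      have na: "norm (a + of_nat n) \<le> (norm a + 1) * 2 ^ n"
      proof -
        have "real n < 2 ^ n" by (rule of_nat_less_two_power)
        moreover have "norm a * 1 \<le> norm a * 2 ^ n" by (intro mult_left_mono) auto
        moreover have "norm (a + of_nat n) \<le> norm a + real n" using norm_triangle_ineq[of a "of_nat n"] by simp
        moreover have "(norm a + 1) * 2 ^ n = norm a * 2 ^ n + 2 ^ n" by (simp add: distrib_right)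
        ultimately show ?thesis by linarith
      qed
      have seg: "z \<in> K'" if z: "z \<in> closed_segment 0 x" for z
      proof -
        obtain t where t: "0 \<le> t" "t \<le> 1" "z = of_real t * x"
          using z by (auto simp: closed_segment_def scaleR_conv_of_real)
        then have "(t, x) \<in> {0..1} \<times> K" using x by simp
        then have "(\<lambda>(t, x). complex_of_real t * x) (t, x) \<in> K'" unfolding K'_def by (rule imageI)
        then show ?thesis by (simp add: t)
      qed
      have "norm (g n x - g n 0) \<le> ((norm a + 1) * 2 ^ n * norm b / norm c * (C * R ^ n)) * norm (x - 0)"
      proof (rule field_differentiable_bound[of "closed_segment 0 x"])
        show "(g n has_field_derivative k n z) (at z within closed_segment 0 x)" if "z \<in> closed_segment 0 x" for z
          using seg[OF that] K'(2) by (intro has_field_derivative_at_within[OF g]) blast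
        show "norm (k n z) \<le> (norm a + 1) * 2 ^ n * norm b / norm c * (C * R ^ n)" if "z \<in> closed_segment 0 x" for z
          unfolding k_def norm_mult norm_divide
          using C by (intro mult_mono divide_right_mono na C seg that) auto
      qed auto
      also have "\<dots> \<le> ((norm a + 1) * 2 ^ n * norm b / norm c * (C * (max R 1) ^ n)) * B"
        using C B x by (intro mult_mono power_mono mult_left_mono) auto
      also have "\<dots> = (norm a + 1) * norm b / norm c * C * B * S ^ n" by (simp add: S_def power_mult_distrib)
      finally have 1: "norm (g n x - g n 0) \<le> (norm a + 1) * norm b / norm c * C * B * S ^ n" .
      have "1 \<le> S ^ n" by (rule one_le_power) (simp add: S_def)
      moreover have "norm (g n x) \<le> norm (g n x - g n 0) + 1"
        using norm_triangle_ineq[of "g n x - g n 0" "g n 0"] by (simp add: g_def)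
      ultimately show ?thesis using 1 unfolding D_def distrib_right by linarith
    qed
    show "\<exists>C R. C \<ge> 0 \<and> R \<ge> 0 \<and> (\<forall>n. \<forall>x\<in>K. norm (g n x) \<le> C * R ^ n)"
      using D S bd by blast
  qed
  then show ?thesis by blast
qed

section \<open>Moments of the beta weight and Euler's integral\<close>

lemma moments_zero_imp_zero:
  fixes r :: "real \<Rightarrow> real"
  assumes r: "continuous_on {0..1} r" and m: "\<And>m. integral {0..1} (\<lambda>t. r t * t ^ m) = 0" and t: "t \<in> {0..1}"
  shows "r t = 0"
proof -
  have zero: "integral {0..1} (\<lambda>t. r t * g t) = 0" if g: "real_polynomial_function g" for g
  proof -
    obtain \<alpha> n where g: "g = (\<lambda>x. \<Sum>i\<le>n. \<alpha> i * x ^ i)" using g real_polynomial_function_iff_sum by auto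
    have "integral {0..1} (\<lambda>t. \<Sum>i\<le>n. \<alpha> i * (r t * t ^ i)) = (\<Sum>i\<le>n. integral {0..1} (\<lambda>t. \<alpha> i * (r t * t ^ i)))"
      using r by (intro integral_sum integrable_continuous_real continuous_intros) auto
    also have "\<dots> = 0" by (simp add: m)
    finally show ?thesis unfolding g by (simp add: sum_distrib_left mult_ac)
  qed
  define I where "I = integral {0..1} (\<lambda>t. r t * r t)"
  obtain B where B: "B > 0" "\<And>t. t \<in> {0..1} \<Longrightarrow> norm (r t) \<le> B"
    using compact_imp_bounded[OF compact_continuous_image[OF r compact_Icc]] by (auto simp: bounded_pos)
  have "\<bar>I\<bar> \<le> 0 + e" if e: "e > 0" for e
  proof -
    obtain g where g: "real_polynomial_function g" "\<And>t. t \<in> {0..1} \<Longrightarrow> \<bar>r t - g t\<bar> < e / B"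
      using Stone_Weierstrass_real_polynomial_function[OF compact_Icc r, of "e / B"] B e by auto
    have cg: "continuous_on {0..1} g" using g(1) continuous_on_polymonial_function real_polynomial_function_eq by blast
    have "I = integral {0..1} (\<lambda>t. r t * r t) - integral {0..1} (\<lambda>t. r t * g t)"
      by (simp add: I_def zero[OF g(1)])
    also have "\<dots> = integral {0..1} (\<lambda>t. r t * r t - r t * g t)"
      using r cg by (intro integral_diff[symmetric] integrable_continuous_real continuous_intros)
    finally have I: "I = integral {0..1} (\<lambda>t. r t * r t - r t * g t)" .
    have "norm I \<le> e * (1 - 0)" unfolding I
    proof (rule integral_bound)
      show "continuous_on {0..1} (\<lambda>t. r t * r t - r t * g t)" using r cg by (intro continuous_intros)
      show "norm (r t * r t - r t * g t) \<le> e" if t: "t \<in> {0..1}" for t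
      proof -
        have "norm (r t * r t - r t * g t) = norm (r t) * \<bar>r t - g t\<bar>" by (simp add: abs_mult flip: right_diff_distrib)
        also have "\<dots> \<le> B * (e / B)" using B g(2)[OF t] t by (intro mult_mono) auto
        finally show ?thesis using B by simp
      qed
    qed simp
    then show ?thesis by simp
  qed
  then have "I = 0" using field_le_epsilon[of "\<bar>I\<bar>" 0] by auto
  moreover have "integral {0..1} (\<lambda>t. r t * r t) = 0 \<longleftrightarrow> (\<forall>t\<in>{0..1}. r t * r t = 0)"
    using r by (intro integral_eq_0_iff continuous_on_mult) auto
  ultimately have "r t * r t = 0" using t unfolding I_def by blast
  then show ?thesis by simp
qed

definition beta_weight :: "complex \<Rightarrow> complex \<Rightarrow> real \<Rightarrow> complex" where
  "beta_weight b c t = of_real t powr (b - 1) * of_real (1 - t) powr (c - b - 1)"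

lemma continuous_on_beta_weight:
  assumes "Re b > 1" "Re (c - b) > 1"
  shows "continuous_on {0..1} (beta_weight b c)"
  unfolding beta_weight_def by (intro continuous_intros) (use assms in auto)

text \<open>Integrate the derivative of t powr (b + m) * (1 - t) powr (c - b) over [0, 1]; the
  boundary values vanish.\<close>

lemma beta_moment_rec:
  assumes b: "Re b > 1" "Re (c - b) > 1"
  shows "(c + of_nat m) * integral {0..1} (\<lambda>t. beta_weight b c t * of_real t ^ Suc m) =
     (b + of_nat m) * integral {0..1} (\<lambda>t. beta_weight b c t * of_real t ^ m)"
proof -
  define w where "w = beta_weight b c"
  have w: "continuous_on {0..1} w" unfolding w_def by (rule continuous_on_beta_weight[OF b])
  define W where "W = (\<lambda>t::real. of_real t ^ m * (of_real t powr b * of_real (1 - t) powr (c - b)))"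
  have "((\<lambda>t. (b + of_nat m) * (w t * of_real t ^ m) - (c + of_nat m) * (w t * of_real t ^ Suc m)) has_integral (W 1 - W 0)) {0..1}"
  proof (rule fundamental_theorem_of_calculus_interior)
    show "continuous_on {0..1} W" unfolding W_def by (intro continuous_intros) (use b in auto)
    fix t :: real assume t: "t \<in> {0<..<1}"
    define z where "z = complex_of_real t"
    have "complex_of_real t \<notin> \<real>\<^sub>\<le>\<^sub>0" "complex_of_real (1 - t) \<notin> \<real>\<^sub>\<le>\<^sub>0" using t by (simp_all only: nonpos_Reals_of_real_iff) auto
    then have z: "z \<notin> \<real>\<^sub>\<le>\<^sub>0" "1 - z \<notin> \<real>\<^sub>\<le>\<^sub>0" by (simp_all add: z_def)
    then have z0: "z \<noteq> 0" "1 - z \<noteq> 0" by auto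
    have "((\<lambda>z. z powr b * (1 - z) powr (c - b)) has_field_derivative
       (b / z - (c - b) / (1 - z)) * (z powr b * (1 - z) powr (c - b))) (at z)"
      by (rule DERIV_cong[OF DERIV_mult[OF has_field_derivative_powr_div[OF z(1)] has_field_derivative_powr_reflect[OF z(2)]]])
         (simp add: algebra_simps)
    moreover have "((\<lambda>z. z ^ m) has_field_derivative of_nat m / z * z ^ m) (at z)"
    proof (cases m)
      case (Suc k)
      have "((\<lambda>z. z ^ m) has_field_derivative of_nat m * (1 * z ^ (m - Suc 0))) (at z)"
        by (rule DERIV_power[OF DERIV_ident])
      then show ?thesis using z0 by (simp add: Suc)
    qed simp
    ultimately have "((\<lambda>z. z ^ m * (z powr b * (1 - z) powr (c - b))) has_field_derivative
       (of_nat m / z * z ^ m) * (z powr b * (1 - z) powr (c - b)) +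
       (b / z - (c - b) / (1 - z)) * (z powr b * (1 - z) powr (c - b)) * z ^ m) (at z)"
      by (rule DERIV_mult[rotated])
    moreover have "z powr b = z powr (b - 1) * z" "(1 - z) powr (c - b) = (1 - z) powr (c - b - 1) * (1 - z)"
      using z0 by (simp_all add: powr_diff)
    moreover have "w t = z powr (b - 1) * (1 - z) powr (c - b - 1)" by (simp add: w_def beta_weight_def z_def)
    ultimately have "((\<lambda>z. z ^ m * (z powr b * (1 - z) powr (c - b))) has_field_derivative
       (of_nat m / z * z ^ m) * (w t * (z * (1 - z))) + (b / z - (c - b) / (1 - z)) * (w t * (z * (1 - z))) * z ^ m) (at z)"
      by (simp add: mult_ac)
    also have "(of_nat m / z * z ^ m) * (w t * (z * (1 - z))) + (b / z - (c - b) / (1 - z)) * (w t * (z * (1 - z))) * z ^ m =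
       (b + of_nat m) * (w t * of_real t ^ m) - (c + of_nat m) * (w t * of_real t ^ Suc m)"
      unfolding z_def[symmetric] using z0 by (simp add: field_simps)
    finally have "((\<lambda>t. of_real t ^ m * (of_real t powr b * (1 - of_real t) powr (c - b))) has_vector_derivative
       (b + of_nat m) * (w t * of_real t ^ m) - (c + of_nat m) * (w t * of_real t ^ Suc m)) (at t)"
      unfolding z_def by (rule has_vector_derivative_real_field)
    then show "(W has_vector_derivative (b + of_nat m) * (w t * of_real t ^ m) - (c + of_nat m) * (w t * of_real t ^ Suc m)) (at t)"
      unfolding W_def by simp
  qed simp
  moreover have "W 1 = 0" "W 0 = 0" by (simp_all add: W_def)
  ultimately have "integral {0..1} (\<lambda>t. (b + of_nat m) * (w t * of_real t ^ m) - (c + of_nat m) * (w t * of_real t ^ Suc m)) = 0"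
    by (auto dest: integral_unique)
  moreover have int: "(\<lambda>t. w t * of_real t ^ k) integrable_on {0..1}" for k
    using w by (intro integrable_continuous_real continuous_intros)
  have "integral {0..1} (\<lambda>t. (b + of_nat m) * (w t * of_real t ^ m) - (c + of_nat m) * (w t * of_real t ^ Suc m)) =
     (b + of_nat m) * integral {0..1} (\<lambda>t. w t * of_real t ^ m) - (c + of_nat m) * integral {0..1} (\<lambda>t. w t * of_real t ^ Suc m)"
    unfolding integral_mult_right[symmetric] by (intro integral_diff integrable_on_mult_right int)
  ultimately show ?thesis unfolding w_def[symmetric] by simp
qed

lemma beta_moment:
  assumes b: "Re b > 1" "Re (c - b) > 1"
  shows "integral {0..1} (\<lambda>t. beta_weight b c t * of_real t ^ m) =
     pochhammer b m / pochhammer c m * integral {0..1} (beta_weight b c)"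
proof (induction m)
  case (Suc m)
  have "Re c > 0" using b by simp
  then have "Re (c + of_nat m) > 0" by simp
  then have "c + of_nat m \<noteq> 0" by (metis less_irrefl zero_complex.simps(1))
  then have "integral {0..1} (\<lambda>t. beta_weight b c t * of_real t ^ Suc m) =
     (b + of_nat m) / (c + of_nat m) * integral {0..1} (\<lambda>t. beta_weight b c t * of_real t ^ m)"
    using beta_moment_rec[OF b, of m] by (simp add: nonzero_eq_divide_eq mult.commute)
  then show ?case unfolding Suc.IH by (simp only: pochhammer_Suc times_divide_times_eq mult.assoc[symmetric]) (simp add: mult.commute)
qed simp

text \<open>All moments are multiples of this integral. Were it zero, the real and imaginary parts
  of the weight would have vanishing moments and hence vanish, although the weight is nonzero at 1 /
  2. The integral itself is never evaluated.\<close>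

lemma beta_integral_nonzero:
  assumes b: "Re b > 1" "Re (c - b) > 1"
  shows "integral {0..1} (beta_weight b c) \<noteq> 0"
proof
  assume 0: "integral {0..1} (beta_weight b c) = 0"
  define w where "w = beta_weight b c"
  have w: "continuous_on {0..1} w" unfolding w_def by (rule continuous_on_beta_weight[OF b])
  have int: "(\<lambda>t. w t * of_real t ^ m) integrable_on {0..1}" for m
    using w by (intro integrable_continuous_real continuous_intros)
  have m: "integral {0..1} (\<lambda>t. w t * of_real t ^ m) = 0" for m
    unfolding w_def beta_moment[OF b] 0 by simp
  have "Re (w (1 / 2)) = 0"
  proof (rule moments_zero_imp_zero[where r = "\<lambda>t. Re (w t)"])
    show "continuous_on {0..1} (\<lambda>t. Re (w t))" using w by (intro continuous_intros)
    show "integral {0..1} (\<lambda>t. Re (w t) * t ^ m) = 0" for m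
      using arg_cong[OF m[of m], of Re] integral_linear[OF int[of m] bounded_linear_Re]
      by (simp add: o_def flip: of_real_power)
  qed auto
  moreover have "Im (w (1 / 2)) = 0"
  proof (rule moments_zero_imp_zero[where r = "\<lambda>t. Im (w t)"])
    show "continuous_on {0..1} (\<lambda>t. Im (w t))" using w by (intro continuous_intros)
    show "integral {0..1} (\<lambda>t. Im (w t) * t ^ m) = 0" for m
      using arg_cong[OF m[of m], of Im] integral_linear[OF int[of m] bounded_linear_Im]
      by (simp add: o_def flip: of_real_power)
  qed auto
  ultimately have "w (1 / 2) = 0" by (simp add: complex_eq_iff)
  then show False by (simp add: w_def beta_weight_def)
qed

text \<open>Euler's integral, normalised by the total mass of the weight. Real parts above 1, rather
  than 0, make the weight continuous on the closed interval, so that all integrals are of continuous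
  functions and uniform limits pass through them.\<close>

lemma hyp2F1_family_base:
  assumes b: "Re b > 1" "Re (c - b) > 1"
  shows "\<exists>h. hyp2F1_family a b c h"
proof -
  define w where "w = beta_weight b c"
  have w: "continuous_on {0..1} w" unfolding w_def by (rule continuous_on_beta_weight[OF b])
  define M where "M = integral {0..1} w"
  have M: "M \<noteq> 0" unfolding M_def w_def by (rule beta_integral_nonzero[OF b])
  define f where "f = (\<lambda>n x t. w t * (1 - of_real t * x) powr (- (a + of_nat n)))"
  define h where "h = (\<lambda>n x. integral {0..1} (f n x) / M)"
  have slit: "1 - of_real t * x \<notin> \<real>\<^sub>\<le>\<^sub>0" if "x \<in> slit_plane" "t \<in> {0..1}" for x t
    using slit_plane_scale[OF that(1), of t] that(2) by (simp add: slit_plane_iff)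
  have slit': "Re (1 - of_real t * x) \<ge> 0 \<or> Im (1 - of_real t * x) \<noteq> 0" "1 - of_real t * x \<noteq> 0"
    if "x \<in> slit_plane" "t \<in> {0..1}" for x t
  proof -
    have "Re u \<ge> 0 \<or> Im u \<noteq> 0" "u \<noteq> 0" if "u \<notin> \<real>\<^sub>\<le>\<^sub>0" for u :: complex
      using that by (auto simp: complex_nonpos_Reals_iff)
    from this[OF slit[OF that]] show "Re (1 - of_real t * x) \<ge> 0 \<or> Im (1 - of_real t * x) \<noteq> 0" "1 - of_real t * x \<noteq> 0"
      by blast+
  qed
  have cont: "continuous_on (S \<times> {0..1}) (\<lambda>(x, t). w t * (1 - of_real t * x) powr s)" if S: "S \<subseteq> slit_plane" for s S
  proof -
    have "continuous_on (S \<times> {0..1}) (\<lambda>p. w (snd p))"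
      by (rule continuous_on_compose2[OF w]) (auto intro: continuous_intros)
    moreover have "continuous_on (S \<times> {0..1}) (\<lambda>p. (1 - of_real (snd p) * fst p) powr s)"
      by (intro continuous_intros) (use slit' S in \<open>force\<close>)+
    ultimately show ?thesis unfolding case_prod_unfold by (rule continuous_on_mult)
  qed
  have cont1: "continuous_on {0..1} (f n x)" if "x \<in> slit_plane" for n x
    unfolding f_def by (intro continuous_intros w) (use slit'[OF that] in force)+
  have hol: "h n holomorphic_on slit_plane" for n
  proof -
    have "h n holomorphic_on ball x r" if r: "ball x r \<subseteq> slit_plane" for x r
    proof -
      have "(\<lambda>x. integral (cbox 0 1) (f n x)) holomorphic_on ball x r"
      proof (rule leibniz_rule_holomorphic)
        fix z and t :: real assume z: "z \<in> ball x r" "t \<in> cbox 0 1"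
        then have n: "1 - of_real t * z \<notin> \<real>\<^sub>\<le>\<^sub>0" using r slit by auto
        have "((\<lambda>z. 1 - of_real t * z) has_field_derivative - of_real t) (at z)" by (auto intro!: derivative_eq_intros)
        from DERIV_chain2[OF has_field_derivative_powr[OF n] this]
        have "((\<lambda>z. (1 - of_real t * z) powr (- (a + of_nat n))) has_field_derivative
           - (a + of_nat n) * (1 - of_real t * z) powr (- (a + of_nat n) - 1) * - of_real t) (at z)" .
        from DERIV_cmult[OF this, of "w t"]
        have "((\<lambda>z. f n z t) has_field_derivative (a + of_nat n) * of_real t * (w t * (1 - of_real t * z) powr (- (a + of_nat n) - 1))) (at z)"
          unfolding f_def by (rule DERIV_cong) (simp add: algebra_simps)
        then show "((\<lambda>z. f n z t) has_field_derivative (a + of_nat n) * of_real t * (w t * (1 - of_real t * z) powr (- (a + of_nat n) - 1))) (at z within ball x r)"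
          by (rule has_field_derivative_at_within)
      next
        fix z assume "z \<in> ball x r"
        then have "continuous_on {0..1} (f n z)" using r by (intro cont1) auto
        then show "f n z integrable_on cbox 0 1" using integrable_continuous_real by simp
      next
        have "continuous_on (ball x r \<times> {0..1}) (\<lambda>p. (a + of_nat n) * of_real (snd p) *
          (case p of (z, t) \<Rightarrow> w t * (1 - of_real t * z) powr (- (a + of_nat n) - 1)))"
          using cont[OF r] by (intro continuous_intros)
        then show "continuous_on (ball x r \<times> cbox 0 1) (\<lambda>(z, t). (a + of_nat n) * of_real t * (w t * (1 - of_real t * z) powr (- (a + of_nat n) - 1)))"
          by (simp add: case_prod_unfold)
      qed simp
      then show ?thesis unfolding h_def using M by (intro holomorphic_intros) simp
    qed
    moreover have "\<exists>r>0. ball x r \<subseteq> slit_plane" if "x \<in> slit_plane" for x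
      using open_slit_plane that by (meson openE)
    ultimately show ?thesis
      by (metis holomorphic_on_open open_ball open_slit_plane centre_in_ball)
  qed
  have ser: "h n x = hyp2F1 (a + of_nat n) b c x" if x: "norm x < 1" for n x
  proof -
    define A where "A = a + of_nat n"
    have xs: "x \<in> slit_plane" using x ball_subset_slit_plane by auto
    obtain W where W: "W > 0" "\<And>t. t \<in> {0..1} \<Longrightarrow> norm (w t) \<le> W"
      using compact_imp_bounded[OF compact_continuous_image[OF w compact_Icc]] by (auto simp: bounded_pos)
    define s where "s = (\<lambda>m t. pochhammer A m / fact m * x ^ m * (w t * of_real t ^ m))"
    have ul: "uniform_limit {0..1} (\<lambda>k t. \<Sum>m<k. s m t) (\<lambda>t. \<Sum>m. s m t) sequentially"
    proof (rule Weierstrass_m_test)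
      have "summable (\<lambda>m. W * (pochhammer (norm A) m / fact m * norm x ^ m))"
        using pochhammer_binomial_series_real[of "norm x" "norm A"] x by (intro summable_mult) (auto intro: sums_summable)
      then show "summable (\<lambda>m. W * (pochhammer (norm A) m / fact m * norm x ^ m))" .
      fix m t assume t: "t \<in> {0..1::real}"
      have "norm (s m t) = norm (pochhammer A m) / fact m * norm x ^ m * (norm (w t) * t ^ m)"
        using t by (simp add: s_def norm_mult norm_divide norm_power)
      also have "\<dots> \<le> pochhammer (norm A) m / fact m * norm x ^ m * (W * 1)"
      proof -
        have p: "0 \<le> pochhammer (norm A) m" by (simp add: pochhammer_prod prod_nonneg)
        show ?thesis
          using t W p by (intro mult_mono divide_right_mono norm_pochhammer_le power_le_one mult_nonneg_nonneg divide_nonneg_nonneg) auto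
      qed
      finally show "norm (s m t) \<le> W * (pochhammer (norm A) m / fact m * norm x ^ m)" by (simp add: mult_ac)
    qed
    have sc: "continuous_on {0..1} (s m)" for m unfolding s_def using w by (intro continuous_intros)
    have sf: "(\<Sum>m. s m t) = f n x t" if t: "t \<in> {0..1}" for t
    proof -
      have "norm (of_real t * x) < 1" using t x by (simp add: norm_mult) (meson le_less_trans mult_left_le_one_le norm_ge_zero)
      from sums_mult[OF pochhammer_binomial_series[OF this, of A], of "w t"] show ?thesis
        by (simp add: s_def f_def A_def sums_iff power_mult_distrib mult_ac)
    qed
    obtain I J where IJ: "\<And>k. ((\<lambda>t. \<Sum>m<k. s m t) has_integral I k) {0..1}"
      "((\<lambda>t. \<Sum>m. s m t) has_integral J) {0..1}" "I \<longlonglongrightarrow> J"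
      by (rule uniform_limit_integral[OF ul]) (auto intro: continuous_on_sum sc)
    have "I k = (\<Sum>m<k. hyp2F1_coeff A b c m * x ^ m * M)" for k
    proof -
      have sm: "integral {0..1} (s m) = hyp2F1_coeff A b c m * x ^ m * M" for m
        unfolding s_def using beta_moment[OF b, of m] by (simp add: w_def[symmetric] M_def[symmetric] hyp2F1_coeff_def)
      have "((\<lambda>t. \<Sum>m<k. s m t) has_integral (\<Sum>m<k. integral {0..1} (s m))) {0..1}"
        by (intro has_integral_sum integrable_integral integrable_continuous_real sc) auto
      then show ?thesis using has_integral_unique[OF IJ(1)[of k]] by (simp add: sm)
    qed
    then have "I = (\<lambda>k. \<Sum>m<k. hyp2F1_coeff A b c m * x ^ m * M)" by (rule ext)
    then have "(\<lambda>m. hyp2F1_coeff A b c m * x ^ m * M) sums J" using IJ(3) by (simp add: sums_def)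
    moreover have "J = integral {0..1} (f n x)"
      using integral_unique[OF IJ(2)] sf by (metis (mono_tags, lifting) integral_cong)
    moreover have "c \<notin> \<int>\<^sub>\<le>\<^sub>0" by (rule Re_pos_notin_nonpos_Ints) (use b in simp)
    then have "(\<lambda>m. hyp2F1_coeff A b c m * x ^ m * M) sums (hyp2F1 A b c x * M)"
      by (intro sums_mult2 hyp2F1_sums x)
    ultimately show ?thesis using M sums_unique2 by (fastforce simp: h_def A_def)
  qed
  have bd: "\<exists>C R. C \<ge> 0 \<and> R \<ge> 0 \<and> (\<forall>n. \<forall>x\<in>K. norm (h n x) \<le> C * R ^ n)" if K: "compact K" "K \<subseteq> slit_plane" for K
  proof -
    have cK: "compact (K \<times> {0..1::real})" using K by (intro compact_Times) auto
    obtain C where C: "C > 0" "\<And>x t. x \<in> K \<Longrightarrow> t \<in> {0..1} \<Longrightarrow> norm (w t * (1 - of_real t * x) powr (- a)) \<le> C"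
      using compact_imp_bounded[OF compact_continuous_image[OF cont[OF K(2), of "- a"] cK]] by (force simp: bounded_pos)
    have "continuous_on (K \<times> {0..1}) (\<lambda>p. inverse (1 - of_real (snd p) * fst p))"
      by (intro continuous_intros) (use slit' K in force)+
    from compact_imp_bounded[OF compact_continuous_image[OF this cK]]
    obtain R where R: "R > 0" "\<And>x t. x \<in> K \<Longrightarrow> t \<in> {0..1} \<Longrightarrow> norm (inverse (1 - of_real t * x)) \<le> R"
      by (force simp: bounded_pos)
    have "norm (h n x) \<le> C / norm M * R ^ n" if x: "x \<in> K" for n x
    proof -
      have xs: "x \<in> slit_plane" using x K by auto
      have "norm (integral {0..1} (f n x)) \<le> (C * R ^ n) * (1 - 0)"
      proof (rule integral_bound)
        fix t :: real assume t: "t \<in> {0..1}"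
        \<comment> \<open>Splitting off the n-th power isolates the dependence on n: R bounds 1 / (1
          - t * x) on the compact product of K and [0, 1], and the bound is geometric.\<close>
        have "f n x t = (w t * (1 - of_real t * x) powr (- a)) * inverse (1 - of_real t * x) ^ n"
          unfolding f_def using slit'(2)[OF xs t] by (simp add: powr_diff powr_nat' divide_inverse power_inverse)
        then have "norm (f n x t) = norm (w t * (1 - of_real t * x) powr (- a)) * norm (inverse (1 - of_real t * x)) ^ n"
          by (simp only: norm_mult norm_power)
        also have "\<dots> \<le> C * R ^ n" using C R x t by (intro mult_mono power_mono) auto
        finally show "norm (f n x t) \<le> C * R ^ n" .
      qed (use cont1[OF xs] in auto)
      then show ?thesis using M by (simp add: h_def norm_divide divide_right_mono)
    qed
    moreover have "0 \<le> C / norm M" "0 \<le> R" using C R by auto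
    ultimately show ?thesis by blast
  qed
  have "hyp2F1_family a b c h" unfolding hyp2F1_family_def using hol ser bd by blast
  then show ?thesis by blast
qed

text \<open>Raising a, b, c together enlarges Re b and leaves c - b unchanged; raising c alone then
  enlarges Re (c - b). The two descents undo these shifts separately.\<close>

theorem hyp2F1_family_exists:
  assumes c: "c \<notin> \<int>\<^sub>\<le>\<^sub>0"
  shows "\<exists>h. hyp2F1_family a b c h"
proof -
  have 1: "\<exists>h. hyp2F1_family a b c h" if b: "Re b > 1" and c: "c \<notin> \<int>\<^sub>\<le>\<^sub>0" for a b c
  proof -
    obtain n :: nat where "1 - Re (c - b) < real n" using reals_Archimedean2 by blast
    then have "Re (c - b) + real n > 1" by simp
    then show ?thesis using c
    proof (induction n arbitrary: c)
      case 0
      then show ?case using hyp2F1_family_base[OF b] by simp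
    next
      case (Suc n)
      have "c + 1 \<notin> \<int>\<^sub>\<le>\<^sub>0" using add_of_nat_notin_nonpos_Ints[OF Suc.prems(2), of 1] by simp
      moreover have "Re (c + 1 - b) + real n > 1" using Suc.prems(1) by simp
      ultimately obtain h where "hyp2F1_family a b (c + 1) h" using Suc.IH by blast
      then show ?case using hyp2F1_family_lower_c[OF _ Suc.prems(2)] by blast
    qed
  qed
  obtain n :: nat where "1 - Re b < real n" using reals_Archimedean2 by blast
  then have "Re b + real n > 1" by simp
  then show ?thesis using c
  proof (induction n arbitrary: a b c)
    case 0
    then show ?case using 1 by simp
  next
    case (Suc n)
    have "c + 1 \<notin> \<int>\<^sub>\<le>\<^sub>0" using add_of_nat_notin_nonpos_Ints[OF Suc.prems(2), of 1] by simp
    moreover have "Re (b + 1) + real n > 1" using Suc.prems(1) by simp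
    ultimately obtain h where "hyp2F1_family (a + 1) (b + 1) (c + 1) h" using Suc.IH by blast
    then show ?case using hyp2F1_family_lower_bc[OF _ Suc.prems(2)] by blast
  qed
qed

section \<open>Continuation of the double series\<close>

lemma Suc_power_le_exp2: "\<exists>C\<ge>0. \<forall>n. real (n + 1) ^ q \<le> C * 2 ^ n"
proof -
  have "summable (\<lambda>m. real (m + 1) ^ q * (1 / 2) ^ m)" by (rule summable_Suc_power_mult_power) auto
  then have "Bseq (\<lambda>m. real (m + 1) ^ q * (1 / 2) ^ m)"
    by (rule convergent_imp_Bseq[OF convergentI[OF summable_LIMSEQ_zero]])
  then obtain C where C: "\<And>m. norm (real (m + 1) ^ q * (1 / 2) ^ m) \<le> C" unfolding Bseq_def by blast
  have "real (n + 1) ^ q \<le> C * 2 ^ n" for n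
  proof -
    have "real (n + 1) ^ q = real (n + 1) ^ q * (1 / 2) ^ n * 2 ^ n" by (simp add: power_one_over)
    also have "\<dots> \<le> C * 2 ^ n" using C[of n] by (intro mult_right_mono) auto
    finally show ?thesis .
  qed
  moreover have "0 \<le> C" using C[of 0] by simp
  ultimately show ?thesis by blast
qed

definition psi1_coeff :: "complex \<Rightarrow> complex \<Rightarrow> nat \<Rightarrow> complex" where
  "psi1_coeff a c' n = pochhammer a n / (pochhammer c' n * fact n)"

lemma norm_psi1_coeff_le:
  assumes "c' \<notin> \<int>\<^sub>\<le>\<^sub>0"
  shows "\<exists>C\<ge>0. \<forall>n. norm (psi1_coeff a c' n) \<le> C * 2 ^ n / fact n"
proof -
  obtain q where q: "\<And>n. norm (pochhammer a n / pochhammer c' n) \<le> real (n + 1) ^ q"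
    using norm_pochhammer_ratio_le_0[OF assms] by blast
  obtain C where C: "C \<ge> 0" "\<And>n. real (n + 1) ^ q \<le> C * 2 ^ n" using Suc_power_le_exp2 by blast
  have "norm (psi1_coeff a c' n) \<le> C * 2 ^ n / fact n" for n
  proof -
    have "norm (psi1_coeff a c' n) = norm (pochhammer a n / pochhammer c' n) / fact n"
      by (simp add: psi1_coeff_def norm_divide norm_mult)
    also have "\<dots> \<le> C * 2 ^ n / fact n" by (rule divide_right_mono[OF order_trans[OF q C(2)]]) simp
    finally show ?thesis .
  qed
  then show ?thesis using C(1) by blast
qed

lemma summable_geometric_over_fact: "summable (\<lambda>n. C * r ^ n / fact n :: real)"
  using summable_mult[OF summable_exp[of r], of C] by (simp add: field_simps)

text \<open>One Weierstrass test on a product of compact sets, from which joint continuity and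
  holomorphy in each variable all follow. The terms are bounded by those of an exponential series in
  2 * Y * R.\<close>

lemma psi1_uniform_limit:
  assumes h: "hyp2F1_family a b c h" and c': "c' \<notin> \<int>\<^sub>\<le>\<^sub>0" and K: "compact K" "K \<subseteq> slit_plane" and Y: "Y \<ge> 0"
  shows "uniform_limit (K \<times> cball 0 Y) (\<lambda>N p. \<Sum>n<N. psi1_coeff a c' n * snd p ^ n * h n (fst p))
     (\<lambda>p. \<Sum>n. psi1_coeff a c' n * snd p ^ n * h n (fst p)) sequentially"
proof -
  obtain C R where C: "C \<ge> 0" "R \<ge> 0" "\<And>n x. x \<in> K \<Longrightarrow> norm (h n x) \<le> C * R ^ n"
    using hyp2F1_family_bound[OF h K] by blast
  obtain D where D: "D \<ge> 0" "\<And>n. norm (psi1_coeff a c' n) \<le> D * 2 ^ n / fact n"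
    using norm_psi1_coeff_le[OF c'] by blast
  show ?thesis
  proof (rule Weierstrass_m_test)
    show "summable (\<lambda>n. (D * C) * (2 * Y * R) ^ n / fact n)" by (rule summable_geometric_over_fact)
    fix n p assume p: "p \<in> K \<times> cball (0::complex) Y"
    have "norm (psi1_coeff a c' n * snd p ^ n * h n (fst p)) \<le> (D * 2 ^ n / fact n) * Y ^ n * (C * R ^ n)"
      unfolding norm_mult norm_power using p Y C D
      by (intro mult_mono power_mono mult_nonneg_nonneg divide_nonneg_nonneg) auto
    then show "norm (psi1_coeff a c' n * snd p ^ n * h n (fst p)) \<le> (D * C) * (2 * Y * R) ^ n / fact n"
      by (simp add: power_mult_distrib mult_ac)
  qed
qed

text \<open>Write norm x = \<theta> * \<rho> with both factors below 1. The powers of \<theta>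
  absorb the polynomially growing quotient (b)_m / (c)_m, and those of \<rho> leave a binomial
  series with sum (1 - \<rho>) powr (- (norm a + n)), geometric in n.\<close>

lemma hyp2F1_row_majorant:
  assumes c: "c \<notin> \<int>\<^sub>\<le>\<^sub>0" and x: "norm x < 1"
  shows "\<exists>C\<ge>0. \<exists>R\<ge>0. \<forall>n. (\<Sum>m. norm (hyp2F1_coeff (a + of_nat n) b c m * x ^ m)) \<le> C * R ^ n"
proof -
  define \<rho> where "\<rho> = (1 + norm x) / 2"
  have \<rho>: "norm x < \<rho>" "\<rho> < 1" "0 < \<rho>" using x by (auto simp: \<rho>_def add_pos_nonneg)
  define \<theta> where "\<theta> = norm x / \<rho>"
  have \<theta>: "0 \<le> \<theta>" "\<theta> < 1" "norm x = \<theta> * \<rho>" using \<rho> by (auto simp: \<theta>_def)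
  obtain q where q: "\<And>m. norm (pochhammer b m / pochhammer c m) \<le> real (m + 1) ^ q"
    using norm_pochhammer_ratio_le_0[OF c] by blast
  have "Bseq (\<lambda>m. real (m + 1) ^ q * \<theta> ^ m)"
    by (rule convergent_imp_Bseq[OF convergentI[OF summable_LIMSEQ_zero[OF summable_Suc_power_mult_power[OF \<theta>(1,2)]]]])
  then obtain C where C: "\<And>m. norm (real (m + 1) ^ q * \<theta> ^ m) \<le> C" unfolding Bseq_def by blast
  have C0: "C \<ge> 0" using order_trans[OF norm_ge_zero C[of 0]] .
  have "(\<Sum>m. norm (hyp2F1_coeff (a + of_nat n) b c m * x ^ m)) \<le> C * (1 - \<rho>) powr (- norm a) * (1 / (1 - \<rho>)) ^ n" for n
  proof -
    have le: "norm (hyp2F1_coeff (a + of_nat n) b c m * x ^ m) \<le> C * (pochhammer (norm a + real n) m / fact m * \<rho> ^ m)" for m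
    proof -
      have "norm (hyp2F1_coeff (a + of_nat n) b c m * x ^ m) =
         (norm (pochhammer b m / pochhammer c m) * \<theta> ^ m) * (norm (pochhammer (a + of_nat n) m) / fact m * \<rho> ^ m)"
        by (simp add: hyp2F1_coeff_def norm_mult norm_divide norm_power \<theta>(3) power_mult_distrib)
      also have "\<dots> \<le> C * (pochhammer (norm a + real n) m / fact m * \<rho> ^ m)"
      proof (rule mult_mono)
        have "norm (pochhammer b m / pochhammer c m) * \<theta> ^ m \<le> real (m + 1) ^ q * \<theta> ^ m"
          using q \<theta> by (intro mult_right_mono) auto
        also have "\<dots> \<le> C" using C[of m] by simp
        finally show "norm (pochhammer b m / pochhammer c m) * \<theta> ^ m \<le> C" .
        have "norm (a + of_nat n) \<le> norm a + real n" using norm_triangle_ineq[of a "of_nat n"] by simp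
        then show "norm (pochhammer (a + of_nat n) m) / fact m * \<rho> ^ m \<le> pochhammer (norm a + real n) m / fact m * \<rho> ^ m"
          using \<rho> by (intro mult_right_mono divide_right_mono norm_pochhammer_le) auto
      qed (use C0 \<rho> in auto)
      finally show ?thesis .
    qed
    have s: "(\<lambda>m. C * (pochhammer (norm a + real n) m / fact m * \<rho> ^ m)) sums (C * (1 - \<rho>) powr (- (norm a + real n)))"
      by (intro sums_mult pochhammer_binomial_series_real) (use \<rho> in auto)
    have "(\<Sum>m. norm (hyp2F1_coeff (a + of_nat n) b c m * x ^ m)) \<le> (\<Sum>m. C * (pochhammer (norm a + real n) m / fact m * \<rho> ^ m))"
      by (intro suminf_le le summable_norm_hyp2F1 c x sums_summable[OF s])
    also have "\<dots> = C * (1 - \<rho>) powr (- (norm a + real n))" using s by (simp add: sums_iff)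
    also have "(1 - \<rho>) powr (- (norm a + real n)) = (1 - \<rho>) powr (- norm a) * (1 / (1 - \<rho>)) ^ n"
      using \<rho> by (simp add: powr_diff powr_realpow power_one_over divide_inverse power_inverse)
    finally show ?thesis by (simp add: mult.assoc)
  qed
  moreover have "C * (1 - \<rho>) powr (- norm a) \<ge> 0" "1 / (1 - \<rho>) \<ge> 0" using C0 \<rho> by auto
  ultimately show ?thesis by blast
qed

text \<open>The splitting (a)_(m+n) = (a)_n (a + n)_m makes the sum over m a Gauss series. The row
  bound, geometric in n, justifies turning the unordered double sum into an iterated one.\<close>

lemma Psi1_series_iterated:
  assumes c: "c \<notin> \<int>\<^sub>\<le>\<^sub>0" and c': "c' \<notin> \<int>\<^sub>\<le>\<^sub>0" and x: "norm x < 1"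
  shows "Psi1_series a b c c' x y = (\<Sum>n. psi1_coeff a c' n * y ^ n * hyp2F1 (a + of_nat n) b c x)"
proof -
  define t where "t = (\<lambda>n m. psi1_coeff a c' n * y ^ n * (hyp2F1_coeff (a + of_nat n) b c m * x ^ m))"
  obtain C R where C: "C \<ge> 0" "R \<ge> 0" "\<And>n. (\<Sum>m. norm (hyp2F1_coeff (a + of_nat n) b c m * x ^ m)) \<le> C * R ^ n"
    using hyp2F1_row_majorant[OF c x] by blast
  obtain D where D: "D \<ge> 0" "\<And>n. norm (psi1_coeff a c' n) \<le> D * 2 ^ n / fact n"
    using norm_psi1_coeff_le[OF c'] by blast
  have s1: "summable (\<lambda>m. norm (t n m))" for n
    unfolding t_def norm_mult[of "psi1_coeff a c' n * y ^ n"] by (intro summable_mult summable_norm_hyp2F1 c x)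
  have s2: "summable (\<lambda>n. \<Sum>m. norm (t n m))"
  proof (rule summable_comparison_test'[where N = 0])
    show "summable (\<lambda>n. (D * C) * (2 * norm y * R) ^ n / fact n)" by (rule summable_geometric_over_fact)
    fix n :: nat
    have "(\<Sum>m. norm (t n m)) = norm (psi1_coeff a c' n * y ^ n) * (\<Sum>m. norm (hyp2F1_coeff (a + of_nat n) b c m * x ^ m))"
      unfolding t_def norm_mult[of "psi1_coeff a c' n * y ^ n"] by (rule suminf_mult[OF summable_norm_hyp2F1[OF c x]])
    also have "\<dots> \<le> (D * 2 ^ n / fact n * norm y ^ n) * (C * R ^ n)"
      unfolding norm_mult norm_power using C D
      by (intro mult_mono mult_right_mono mult_nonneg_nonneg divide_nonneg_nonneg suminf_nonneg summable_norm_hyp2F1[OF c x, unfolded norm_mult norm_power]) (auto simp: norm_mult norm_power)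
    finally show "norm (\<Sum>m. norm (t n m)) \<le> (D * C) * (2 * norm y * R) ^ n / fact n"
      using suminf_nonneg[OF s1[of n]] by (simp add: power_mult_distrib mult_ac)
  qed
  have "((\<lambda>(n, m). t n m) has_sum (\<Sum>n. \<Sum>m. t n m)) (UNIV \<times> UNIV)"
    using double_series_has_sum(1)[OF s1 s2] by simp
  then have "((\<lambda>(m, n). t n m) has_sum (\<Sum>n. \<Sum>m. t n m)) (UNIV \<times> UNIV)"
    by (subst has_sum_swap) simp
  moreover have "t n m = pochhammer a (m + n) * pochhammer b m / (pochhammer c m * pochhammer c' n) * (x ^ m / fact m) * (y ^ n / fact n)" for n m
  proof -
    have "pochhammer a (m + n) = pochhammer a n * pochhammer (a + of_nat n) m"
      by (metis add.commute pochhammer_product')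
    then show ?thesis by (simp add: t_def psi1_coeff_def hyp2F1_coeff_def mult_ac)
  qed
  ultimately have "Psi1_series a b c c' x y = (\<Sum>n. \<Sum>m. t n m)"
    unfolding Psi1_series_def by (simp add: infsumI)
  moreover have "(\<Sum>m. t n m) = psi1_coeff a c' n * y ^ n * hyp2F1 (a + of_nat n) b c x" for n
    using sums_unique[OF sums_mult[OF hyp2F1_sums[OF c x, of "a + of_nat n" b], of "psi1_coeff a c' n * y ^ n"]] unfolding t_def by simp
  ultimately show ?thesis by simp
qed

theorem Psi1_continuation_exists:
  assumes c: "c \<notin> \<int>\<^sub>\<le>\<^sub>0" and c': "c' \<notin> \<int>\<^sub>\<le>\<^sub>0"
  shows "\<exists>F. is_Psi1_continuation a b c c' F"
proof -
  obtain h where h: "hyp2F1_family a b c h" using hyp2F1_family_exists[OF c] by blast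
  have hol: "h n holomorphic_on slit_plane" for n using h by (simp add: hyp2F1_family_def)
  have hc: "continuous_on slit_plane (h n)" for n using hol by (rule holomorphic_on_imp_continuous_on)
  define F where "F = (\<lambda>x y. \<Sum>n. psi1_coeff a c' n * y ^ n * h n x)"
  have cont: "continuous_on (slit_plane \<times> UNIV) (\<lambda>(x, y). F x y)"
  proof (rule continuous_at_imp_continuous_on, rule ballI)
    fix p assume "p \<in> slit_plane \<times> (UNIV :: complex set)"
    then obtain x y where p: "p = (x, y)" "x \<in> slit_plane" by auto
    obtain r where r: "r > 0" "cball x r \<subseteq> slit_plane" using open_slit_plane p(2) open_contains_cball by blast
    have "uniform_limit (cball x r \<times> cball 0 (norm y + 1)) (\<lambda>N p. \<Sum>n<N. psi1_coeff a c' n * snd p ^ n * h n (fst p))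
      (\<lambda>p. \<Sum>n. psi1_coeff a c' n * snd p ^ n * h n (fst p)) sequentially"
      by (rule psi1_uniform_limit[OF h c' compact_cball r(2)]) simp
    then have "continuous_on (cball x r \<times> cball 0 (norm y + 1)) (\<lambda>p. \<Sum>n. psi1_coeff a c' n * snd p ^ n * h n (fst p))"
    proof (rule uniform_limit_theorem[rotated])
      show "\<forall>\<^sub>F N in sequentially. continuous_on (cball x r \<times> cball 0 (norm y + 1)) (\<lambda>p. \<Sum>n<N. psi1_coeff a c' n * snd p ^ n * h n (fst p))"
      proof (rule always_eventually, rule allI)
        fix N
        have "continuous_on (cball x r \<times> cball 0 (norm y + 1)) (\<lambda>p. h n (fst p))" for n
          by (rule continuous_on_compose2[OF hc]) (use r in \<open>auto intro: continuous_intros\<close>)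
        then show "continuous_on (cball x r \<times> cball 0 (norm y + 1)) (\<lambda>p. \<Sum>n<N. psi1_coeff a c' n * snd p ^ n * h n (fst p))"
          by (intro continuous_intros)
      qed
    qed simp
    then have "continuous_on (ball x r \<times> ball 0 (norm y + 1)) (\<lambda>(x, y). F x y)"
      by (rule continuous_on_subset[THEN continuous_on_cong[THEN iffD1, OF refl, rotated]]) (auto simp: F_def)
    moreover have "open (ball x r \<times> ball (0::complex) (norm y + 1))" by (intro open_Times open_ball)
    moreover have "p \<in> ball x r \<times> ball 0 (norm y + 1)" using p r by simp
    ultimately show "isCont (\<lambda>(x, y). F x y) p" using continuous_on_eq_continuous_at by blast
  qed
  have holx: "(\<lambda>x. F x y) holomorphic_on slit_plane" for y
  proof (rule holomorphic_uniform_sequence[OF open_slit_plane])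
    show "(\<lambda>x. \<Sum>n<N. psi1_coeff a c' n * y ^ n * h n x) holomorphic_on slit_plane" for N
      by (intro holomorphic_intros hol)
    fix x assume "x \<in> slit_plane"
    then obtain r where r: "r > 0" "cball x r \<subseteq> slit_plane" using open_slit_plane open_contains_cball by blast
    have "uniform_limit ((\<lambda>x. (x, y)) ` cball x r) (\<lambda>N p. \<Sum>n<N. psi1_coeff a c' n * snd p ^ n * h n (fst p))
      (\<lambda>p. \<Sum>n. psi1_coeff a c' n * snd p ^ n * h n (fst p)) sequentially"
      by (rule uniform_limit_on_subset[OF psi1_uniform_limit[OF h c' compact_cball r(2), of "norm y"]]) auto
    then have "uniform_limit (cball x r) (\<lambda>N x. \<Sum>n<N. psi1_coeff a c' n * y ^ n * h n x) (\<lambda>x. F x y) sequentially"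
      unfolding uniform_limit_iff F_def by simp
    then show "\<exists>d. 0 < d \<and> cball x d \<subseteq> slit_plane \<and> uniform_limit (cball x d) (\<lambda>N x. \<Sum>n<N. psi1_coeff a c' n * y ^ n * h n x) (\<lambda>x. F x y) sequentially"
      using r by blast
  qed
  have holy: "(\<lambda>y. F x y) holomorphic_on UNIV" if x: "x \<in> slit_plane" for x
  proof (rule holomorphic_uniform_sequence[OF open_UNIV])
    show "(\<lambda>y. \<Sum>n<N. psi1_coeff a c' n * y ^ n * h n x) holomorphic_on UNIV" for N
      by (intro holomorphic_intros)
    fix y :: complex
    have "uniform_limit (Pair x ` cball y 1) (\<lambda>N p. \<Sum>n<N. psi1_coeff a c' n * snd p ^ n * h n (fst p))
      (\<lambda>p. \<Sum>n. psi1_coeff a c' n * snd p ^ n * h n (fst p)) sequentially"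
    proof (rule uniform_limit_on_subset[OF psi1_uniform_limit[OF h c', of "{x}" "norm y + 1"]])
      show "Pair x ` cball y 1 \<subseteq> {x} \<times> cball 0 (norm y + 1)"
      proof
        fix p assume "p \<in> Pair x ` cball y 1"
        then obtain z where z: "p = (x, z)" "dist y z \<le> 1" by auto
        have "norm z \<le> norm y + norm (z - y)" by (metis add.commute diff_add_cancel norm_triangle_ineq)
        then show "p \<in> {x} \<times> cball 0 (norm y + 1)" using z by (simp add: dist_norm norm_minus_commute)
      qed
    qed (use x in auto)
    then have "uniform_limit (cball y 1) (\<lambda>N y. \<Sum>n<N. psi1_coeff a c' n * y ^ n * h n x) (\<lambda>y. F x y) sequentially"
      unfolding uniform_limit_iff F_def by simp
    then show "\<exists>d. 0 < d \<and> cball y d \<subseteq> UNIV \<and> uniform_limit (cball y d) (\<lambda>N y. \<Sum>n<N. psi1_coeff a c' n * y ^ n * h n x) (\<lambda>y. F x y) sequentially"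
      by (intro exI[of _ 1]) simp
  qed
  have ser: "F x y = Psi1_series a b c c' x y" if "norm x < 1" for x y
    unfolding Psi1_series_iterated[OF c c' that] F_def using h that by (simp add: hyp2F1_family_def)
  show ?thesis
    using cont holx holy ser unfolding is_Psi1_continuation_def holomorphic2_on_def by blast
qed

lemma Psi1_is_continuation:
  assumes "c \<notin> \<int>\<^sub>\<le>\<^sub>0" "c' \<notin> \<int>\<^sub>\<le>\<^sub>0"
  shows "is_Psi1_continuation a b c c' (Psi1 a b c c')"
  unfolding Psi1_def using Psi1_continuation_exists[OF assms] by (rule someI_ex)

section \<open>Expansion at infinity\<close>

text \<open>Arises from Gamma (a + n - b) * (c - a - n)_m / (1 - a - n + b)_m when both Pochhammer
  symbols are reflected: the signs cancel, and the denominator merges into the Gamma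
  function.\<close>

definition gamma_ratio :: "complex \<Rightarrow> complex \<Rightarrow> complex \<Rightarrow> nat \<Rightarrow> nat \<Rightarrow> complex" where
  "gamma_ratio a b c n m =
     Gamma (a - b + (of_nat n - of_nat m)) * pochhammer (a - c + 1 + (of_nat n - of_nat m)) m"

lemma pochhammer_reflect: "pochhammer x n = (- 1) ^ n * pochhammer (1 - x - of_nat n) n"
  for x :: "'a::comm_ring_1"
  using pochhammer_minus[of "- x" n] by (simp add: algebra_simps)

lemma Gamma_shift_back:
  fixes s :: complex
  assumes "s \<notin> \<int>"
  shows "Gamma (s + of_nat n) = pochhammer (s + (of_nat n - of_nat m)) m * Gamma (s + (of_nat n - of_nat m))"
proof -
  define z where "z = s + (of_nat n - of_nat m)"
  have "z \<notin> \<int>\<^sub>\<le>\<^sub>0" using notin_Ints_nonpos(1)[OF assms, of "int n - int m"] by (simp add: z_def)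
  then have "pochhammer z m = Gamma (z + of_nat m) / Gamma z" "Gamma z \<noteq> 0"
    by (simp_all add: pochhammer_Gamma Gamma_eq_zero_iff)
  moreover have "z + of_nat m = s + of_nat n" by (simp add: z_def)
  ultimately show ?thesis by (simp add: z_def)
qed

lemma hyp2F1_coeff_gamma_ratio:
  assumes ab: "a - b \<notin> \<int>"
  shows "Gamma (a + of_nat n - b) * hyp2F1_coeff b (c - (a + of_nat n)) (1 - (a + of_nat n - b)) m =
     pochhammer b m / fact m * gamma_ratio a b c n m"
proof -
  have 0: "Gamma (a + of_nat n - b) = Gamma (a - b + of_nat n)" by (simp add: algebra_simps)
  have 1: "pochhammer (c - (a + of_nat n)) m = (- 1) ^ m * pochhammer (a - c + 1 + (of_nat n - of_nat m)) m"
    by (subst pochhammer_reflect) (simp add: algebra_simps)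
  have 2: "pochhammer (1 - (a + of_nat n - b)) m = (- 1) ^ m * pochhammer (a - b + (of_nat n - of_nat m)) m"
    by (subst pochhammer_reflect) (simp add: algebra_simps)
  have "a - b + (of_nat n - of_nat m) \<notin> \<int>\<^sub>\<le>\<^sub>0"
    using notin_Ints_nonpos(1)[OF ab, of "int n - int m"] by simp
  then have 3: "pochhammer (a - b + (of_nat n - of_nat m)) m \<noteq> 0" by (rule pochhammer_nonzero)
  show ?thesis
    unfolding hyp2F1_coeff_def 0 1 2 Gamma_shift_back[OF ab, of n m] gamma_ratio_def using 3 by simp
qed

text \<open>The shift n - m takes every integer value, so the comparison of Pochhammer symbols is
  used over all integers, with a - b as the non-integer. The bound costs a polynomial in m and
  leaves a function of n alone.\<close>

lemma norm_gamma_ratio_le: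
  assumes ab: "a - b \<notin> \<int>"
  shows "\<exists>q. \<forall>n m. norm (gamma_ratio a b c n m) \<le> real (m + 1) ^ q * norm (Gamma (a - b + of_nat n))"
proof -
  have "a - b + of_int j \<noteq> 0" if "j \<in> UNIV" for j
    using notin_Ints_nonpos(1)[OF ab, of j] by auto
  then obtain q where q: "\<And>k m. norm (pochhammer (a - c + 1 + of_int k) m) \<le> real (m + 1) ^ q * norm (pochhammer (a - b + of_int k) m)"
    using norm_pochhammer_le_shift[of UNIV "a - b" "a - c + 1"] by auto
  have "norm (gamma_ratio a b c n m) \<le> real (m + 1) ^ q * norm (Gamma (a - b + of_nat n))" for n m
  proof -
    have "norm (pochhammer (a - c + 1 + (of_nat n - of_nat m)) m) \<le> real (m + 1) ^ q * norm (pochhammer (a - b + (of_nat n - of_nat m)) m)"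
      using q[of "int n - int m" m] by simp
    then have "norm (gamma_ratio a b c n m) \<le> norm (Gamma (a - b + (of_nat n - of_nat m))) * (real (m + 1) ^ q * norm (pochhammer (a - b + (of_nat n - of_nat m)) m))"
      unfolding gamma_ratio_def norm_mult by (rule mult_left_mono) simp
    also have "\<dots> = real (m + 1) ^ q * norm (Gamma (a - b + of_nat n))"
      unfolding Gamma_shift_back[OF ab, of n m] norm_mult by simp
    finally show ?thesis .
  qed
  then show ?thesis by blast
qed

section \<open>The two power series in u = inverse (1 - x)\<close>

definition psi1_T :: "complex \<Rightarrow> complex \<Rightarrow> complex \<Rightarrow> complex \<Rightarrow> nat \<Rightarrow> real \<Rightarrow> complex" where
  "psi1_T a b c c' m y = (\<Sum>n. gamma_ratio a b c n m * rGamma (c' + of_nat n) / fact n * of_real y ^ n)"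

definition psi1_S1 :: "complex \<Rightarrow> complex \<Rightarrow> complex \<Rightarrow> complex \<Rightarrow> real \<Rightarrow> complex \<Rightarrow> complex" where
  "psi1_S1 a b c c' y u = (\<Sum>m. pochhammer b m / fact m * psi1_T a b c c' m y * u ^ m)"

text \<open>The quotient (a - c + 1)_n / (a - b + 1)_n is Gamma (b - a - n) * rGamma (c - a - n)
  relative to Gamma (b - a) * rGamma (c - a), which stands in front of the second solution as a
  constant.\<close>

definition psi1_p :: "complex \<Rightarrow> complex \<Rightarrow> complex \<Rightarrow> complex \<Rightarrow> nat \<Rightarrow> complex" where
  "psi1_p a b c c' n = pochhammer a n * pochhammer (a - c + 1) n / (pochhammer c' n * pochhammer (a - b + 1) n * fact n)"

definition psi1_S2 :: "complex \<Rightarrow> complex \<Rightarrow> complex \<Rightarrow> complex \<Rightarrow> real \<Rightarrow> complex \<Rightarrow> complex" where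
  "psi1_S2 a b c c' y u = (\<Sum>n. psi1_p a b c c' n * of_real y ^ n * u ^ n * hyp2F1 (a + of_nat n) (c - b) (a - b + 1 + of_nat n) u)"

definition kummer_majorant :: "complex \<Rightarrow> complex \<Rightarrow> real \<Rightarrow> real" where
  "kummer_majorant A c y = (\<Sum>n. norm (Gamma (A + of_nat n) * rGamma (c + of_nat n) / fact n) * \<bar>y\<bar> ^ n)"

text \<open>The estimates separate the variables: a power of m + 1 times a majorant depending on y
  only. Thus the power series in u has radius at least 1, with one rate in y for all
  coefficients.\<close>

lemma psi1_T_bound:
  assumes ab: "a - b \<notin> \<int>"
  obtains q where "\<And>m y. summable (\<lambda>n. norm (gamma_ratio a b c n m * rGamma (c' + of_nat n) / fact n * of_real y ^ n))"
    "\<And>m y. norm (psi1_T a b c c' m y) \<le> real (m + 1) ^ q * kummer_majorant (a - b) c' y"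
    "\<And>n m. norm (gamma_ratio a b c n m) \<le> real (m + 1) ^ q * norm (Gamma (a - b + of_nat n))"
proof -
  obtain q where q: "\<And>n m. norm (gamma_ratio a b c n m) \<le> real (m + 1) ^ q * norm (Gamma (a - b + of_nat n))"
    using norm_gamma_ratio_le[OF ab] by blast
  have A: "a - b \<notin> \<int>\<^sub>\<le>\<^sub>0" using ab nonpos_Ints_Int by blast
  have le: "norm (gamma_ratio a b c n m * rGamma (c' + of_nat n) / fact n * of_real y ^ n) \<le>
      real (m + 1) ^ q * (norm (Gamma (a - b + of_nat n) * rGamma (c' + of_nat n) / fact n) * \<bar>y\<bar> ^ n)" for n m y
  proof -
    have "norm (gamma_ratio a b c n m) * (norm (rGamma (c' + of_nat n)) / fact n * \<bar>y\<bar> ^ n) \<le>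
       (real (m + 1) ^ q * norm (Gamma (a - b + of_nat n))) * (norm (rGamma (c' + of_nat n)) / fact n * \<bar>y\<bar> ^ n)"
      by (rule mult_right_mono[OF q]) simp
    then show ?thesis by (simp add: norm_mult norm_divide norm_power)
  qed
  have s: "summable (\<lambda>n. real (m + 1) ^ q * (norm (Gamma (a - b + of_nat n) * rGamma (c' + of_nat n) / fact n) * \<bar>y\<bar> ^ n))" for m y
    by (rule summable_mult[OF kummer_series_majorant(1)[OF A]])
  have s': "summable (\<lambda>n. norm (gamma_ratio a b c n m * rGamma (c' + of_nat n) / fact n * of_real y ^ n))" for m y
    by (rule summable_comparison_test'[OF s, where N = 0]) (use le in simp)
  have "norm (psi1_T a b c c' m y) \<le> real (m + 1) ^ q * kummer_majorant (a - b) c' y" for m y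
  proof -
    have "norm (psi1_T a b c c' m y) \<le> (\<Sum>n. norm (gamma_ratio a b c n m * rGamma (c' + of_nat n) / fact n * of_real y ^ n))"
      unfolding psi1_T_def by (rule summable_norm[OF s'])
    also have "\<dots> \<le> (\<Sum>n. real (m + 1) ^ q * (norm (Gamma (a - b + of_nat n) * rGamma (c' + of_nat n) / fact n) * \<bar>y\<bar> ^ n))"
      by (rule suminf_le[OF le s' s])
    also have "\<dots> = real (m + 1) ^ q * kummer_majorant (a - b) c' y"
      unfolding kummer_majorant_def by (rule suminf_mult[OF kummer_series_majorant(1)[OF A]])
    finally show ?thesis .
  qed
  with s' q that show ?thesis by blast
qed

lemma kummer_majorant_nonneg: "a - b \<notin> \<int> \<Longrightarrow> 0 \<le> kummer_majorant (a - b) c' y"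
  unfolding kummer_majorant_def using nonpos_Ints_Int
  by (intro suminf_nonneg kummer_series_majorant(1)) auto

lemma psi1_S1_coeff_bound:
  assumes ab: "a - b \<notin> \<int>"
  obtains q where "\<And>m y. norm (pochhammer b m / fact m * psi1_T a b c c' m y) \<le> kummer_majorant (a - b) c' y * real (m + 1) ^ q"
proof -
  obtain q1 where q1: "\<And>m y. norm (psi1_T a b c c' m y) \<le> real (m + 1) ^ q1 * kummer_majorant (a - b) c' y"
    using psi1_T_bound[OF ab] by metis
  obtain q2 where q2: "\<And>m. norm (pochhammer b m / fact m) \<le> real (m + 1) ^ q2"
    using norm_pochhammer_over_fact_le by blast
  have "norm (pochhammer b m / fact m * psi1_T a b c c' m y) \<le> kummer_majorant (a - b) c' y * real (m + 1) ^ (q2 + q1)" for m y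
  proof -
    have "norm (pochhammer b m / fact m * psi1_T a b c c' m y) \<le> real (m + 1) ^ q2 * (real (m + 1) ^ q1 * kummer_majorant (a - b) c' y)"
      unfolding norm_mult[of "pochhammer b m / fact m"] by (intro mult_mono q1 q2) auto
    then show ?thesis by (simp add: power_add mult_ac)
  qed
  then show ?thesis by (rule that)
qed

lemma holomorphic_psi1_S1:
  assumes ab: "a - b \<notin> \<int>"
  shows "psi1_S1 a b c c' y holomorphic_on ball 0 1"
proof -
  obtain q where q: "\<And>m y. norm (pochhammer b m / fact m * psi1_T a b c c' m y) \<le> kummer_majorant (a - b) c' y * real (m + 1) ^ q"
    using psi1_S1_coeff_bound[OF ab] by blast
  have s: "summable (\<lambda>m. pochhammer b m / fact m * psi1_T a b c c' m y * z ^ m)" if "norm z < 1" for z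
    by (rule summable_norm_cancel[OF summable_poly_bounded_powser[OF q that]])
  have "\<exists>D. (psi1_S1 a b c c' y has_field_derivative D) (at z)" if "z \<in> ball 0 1" for z
  proof -
    have "norm z < 1" using that by simp
    then obtain D where "((\<lambda>z. \<Sum>m. pochhammer b m / fact m * psi1_T a b c c' m y * z ^ m) has_field_derivative D) (at z)"
      using powser_has_derivative_sums[OF s] by blast
    then show ?thesis unfolding psi1_S1_def[abs_def] by blast
  qed
  then show ?thesis by (subst holomorphic_on_open) auto
qed

lemma norm_psi1_p_le:
  assumes c': "c' \<notin> \<int>\<^sub>\<le>\<^sub>0" and ab: "a - b \<notin> \<int>"
  shows "\<exists>C\<ge>0. \<forall>n. norm (psi1_p a b c c' n) \<le> C * 4 ^ n / fact n"
proof -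
  obtain D where D: "D \<ge> 0" "\<And>n. norm (psi1_coeff a c' n) \<le> D * 2 ^ n / fact n"
    using norm_psi1_coeff_le[OF c'] by blast
  have "a - b + 1 \<notin> \<int>\<^sub>\<le>\<^sub>0" using notin_Ints_nonpos(1)[OF ab, of 1] by simp
  then obtain q where q: "\<And>n. norm (pochhammer (a - c + 1) n / pochhammer (a - b + 1) n) \<le> real (n + 1) ^ q"
    using norm_pochhammer_ratio_le_0 by blast
  obtain C where C: "C \<ge> 0" "\<And>n. real (n + 1) ^ q \<le> C * 2 ^ n" using Suc_power_le_exp2 by blast
  have "norm (psi1_p a b c c' n) \<le> D * C * 4 ^ n / fact n" for n
  proof -
    have "psi1_p a b c c' n = psi1_coeff a c' n * (pochhammer (a - c + 1) n / pochhammer (a - b + 1) n)"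
      by (simp add: psi1_p_def psi1_coeff_def mult_ac)
    then have "norm (psi1_p a b c c' n) = norm (psi1_coeff a c' n) * norm (pochhammer (a - c + 1) n / pochhammer (a - b + 1) n)"
      by (simp only: norm_mult)
    also have "\<dots> \<le> (D * 2 ^ n / fact n) * (C * 2 ^ n)"
      using D by (intro mult_mono D order_trans[OF q C(2)]) auto
    also have "\<dots> = D * C * 4 ^ n / fact n" by (simp flip: power_mult_distrib)
    finally show ?thesis .
  qed
  moreover have "D * C \<ge> 0" using D C by simp
  ultimately show ?thesis by blast
qed

text \<open>One upper and the lower parameter move together with n, so the quotient of their
  Pochhammer symbols stays below a power of m + 1 that does not depend on n.\<close>

lemma norm_hyp2F1_shift_le:
  assumes ab: "a - b \<notin> \<int>" and r: "0 \<le> r" "r < 1"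
  shows "\<exists>M\<ge>0. \<forall>n u. norm u \<le> r \<longrightarrow> norm (hyp2F1 (a + of_nat n) d (a - b + 1 + of_nat n) u) \<le> M"
proof -
  have nz: "a - b + 1 \<notin> \<int>\<^sub>\<le>\<^sub>0" using notin_Ints_nonpos(1)[OF ab, of 1] by simp
  obtain q1 where q1: "\<And>n m. norm (pochhammer (a + of_nat n) m / pochhammer (a - b + 1 + of_nat n) m) \<le> real (m + 1) ^ q1"
    using norm_pochhammer_ratio_le[OF nz] by blast
  obtain q2 where q2: "\<And>m. norm (pochhammer d m / fact m) \<le> real (m + 1) ^ q2"
    using norm_pochhammer_over_fact_le by blast
  define M where "M = (\<Sum>m. real (m + 1) ^ (q1 + q2) * r ^ m)"
  have sM: "summable (\<lambda>m. real (m + 1) ^ (q1 + q2) * r ^ m)" by (rule summable_Suc_power_mult_power[OF r])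
  have "norm (hyp2F1 (a + of_nat n) d (a - b + 1 + of_nat n) u) \<le> M" if u: "norm u \<le> r" for n u
  proof -
    have nz': "a - b + 1 + of_nat n \<notin> \<int>\<^sub>\<le>\<^sub>0" by (rule add_of_nat_notin_nonpos_Ints[OF nz])
    have u1: "norm u < 1" using u r by linarith
    have le: "norm (hyp2F1_coeff (a + of_nat n) d (a - b + 1 + of_nat n) m * u ^ m) \<le> real (m + 1) ^ (q1 + q2) * r ^ m" for m
    proof -
      have "norm (hyp2F1_coeff (a + of_nat n) d (a - b + 1 + of_nat n) m * u ^ m) =
        norm (pochhammer (a + of_nat n) m / pochhammer (a - b + 1 + of_nat n) m) * norm (pochhammer d m / fact m) * norm u ^ m"
        by (simp add: hyp2F1_coeff_def norm_mult norm_divide norm_power)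
      also have "\<dots> \<le> real (m + 1) ^ q1 * real (m + 1) ^ q2 * r ^ m"
        using u r by (intro mult_mono power_mono q1 q2) auto
      finally show ?thesis by (simp add: power_add)
    qed
    have "norm (hyp2F1 (a + of_nat n) d (a - b + 1 + of_nat n) u) \<le> (\<Sum>m. norm (hyp2F1_coeff (a + of_nat n) d (a - b + 1 + of_nat n) m * u ^ m))"
      unfolding hyp2F1_def by (rule summable_norm[OF summable_norm_hyp2F1[OF nz' u1]])
    also have "\<dots> \<le> M" unfolding M_def by (rule suminf_le[OF le summable_norm_hyp2F1[OF nz' u1] sM])
    finally show ?thesis .
  qed
  moreover have "M \<ge> 0" unfolding M_def using r by (intro suminf_nonneg sM) auto
  ultimately show ?thesis by blast
qed

text \<open>The two constraints on u express the limit regime: u is small while y * u stays bounded.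
  The n-th term contains y * u only to the power n, and the factorial in \<open>psi1_p\<close> makes
  the bounds summable.\<close>

lemma psi1_S2_bound:
  assumes c': "c' \<notin> \<int>\<^sub>\<le>\<^sub>0" and ab: "a - b \<notin> \<int>" and r: "0 \<le> r" "r < 1" and Y: "Y \<ge> 0"
  shows "\<exists>M. summable M \<and> (\<forall>n y u. norm u \<le> r \<longrightarrow> \<bar>y\<bar> * norm u \<le> Y \<longrightarrow>
     norm (psi1_p a b c c' n * of_real y ^ n * u ^ n * hyp2F1 (a + of_nat n) (c - b) (a - b + 1 + of_nat n) u) \<le> M n)"
proof -
  obtain C where C: "C \<ge> 0" "\<And>n. norm (psi1_p a b c c' n) \<le> C * 4 ^ n / fact n"
    using norm_psi1_p_le[OF c' ab] by blast
  obtain D where D: "D \<ge> 0" "\<And>n u. norm u \<le> r \<Longrightarrow> norm (hyp2F1 (a + of_nat n) (c - b) (a - b + 1 + of_nat n) u) \<le> D"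
    using norm_hyp2F1_shift_le[OF ab r] by blast
  show ?thesis
  proof (intro exI[of _ "\<lambda>n. (C * D) * (4 * Y) ^ n / fact n"] conjI allI impI)
    show "summable (\<lambda>n. (C * D) * (4 * Y) ^ n / fact n)" by (rule summable_geometric_over_fact)
    fix n and y :: real and u :: complex assume u: "norm u \<le> r" "\<bar>y\<bar> * norm u \<le> Y"
    have "norm (psi1_p a b c c' n * of_real y ^ n * u ^ n * hyp2F1 (a + of_nat n) (c - b) (a - b + 1 + of_nat n) u) =
      norm (psi1_p a b c c' n) * (\<bar>y\<bar> * norm u) ^ n * norm (hyp2F1 (a + of_nat n) (c - b) (a - b + 1 + of_nat n) u)"
      by (simp add: norm_mult norm_power power_mult_distrib)
    also have "\<dots> \<le> (C * 4 ^ n / fact n) * Y ^ n * D"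
      using C D u Y by (intro mult_mono power_mono mult_nonneg_nonneg divide_nonneg_nonneg) auto
    finally show "norm (psi1_p a b c c' n * of_real y ^ n * u ^ n * hyp2F1 (a + of_nat n) (c - b) (a - b + 1 + of_nat n) u) \<le> (C * D) * (4 * Y) ^ n / fact n"
      by (simp add: power_mult_distrib mult_ac)
  qed
qed

lemma holomorphic_psi1_S2:
  assumes c': "c' \<notin> \<int>\<^sub>\<le>\<^sub>0" and ab: "a - b \<notin> \<int>"
  shows "psi1_S2 a b c c' y holomorphic_on ball 0 1"
proof (rule holomorphic_uniform_sequence[OF open_ball])
  have nz: "a - b + 1 + of_nat n \<notin> \<int>\<^sub>\<le>\<^sub>0" for n
    using add_of_nat_notin_nonpos_Ints[of "a - b + 1" n] notin_Ints_nonpos(1)[OF ab, of 1] by simp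
  define f where "f = (\<lambda>n u. psi1_p a b c c' n * of_real y ^ n * u ^ n * hyp2F1 (a + of_nat n) (c - b) (a - b + 1 + of_nat n) u)"
  show "(\<lambda>u. \<Sum>n<N. f n u) holomorphic_on ball 0 1" for N
    unfolding f_def by (intro holomorphic_intros holomorphic_hyp2F1 nz)
  fix u :: complex assume u: "u \<in> ball 0 1"
  define d where "d = (1 - norm u) / 2"
  define r where "r = norm u + d"
  have d: "d > 0" "0 \<le> r" "r < 1" using u by (auto simp: d_def r_def field_simps add_nonneg_nonneg)
  have in_r: "norm z \<le> r" if "z \<in> cball u d" for z
  proof -
    have "norm z \<le> norm u + norm (z - u)" by (metis add.commute diff_add_cancel norm_triangle_ineq)
    then show ?thesis using that by (simp add: r_def dist_norm norm_minus_commute)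
  qed
  obtain M where M: "summable M" "\<And>n z. norm z \<le> r \<Longrightarrow> \<bar>y\<bar> * norm z \<le> \<bar>y\<bar> \<Longrightarrow> norm (f n z) \<le> M n"
    using psi1_S2_bound[OF c' ab d(2,3), of "\<bar>y\<bar>" c] unfolding f_def by auto
  have "uniform_limit (cball u d) (\<lambda>N z. \<Sum>n<N. f n z) (\<lambda>z. \<Sum>n. f n z) sequentially"
  proof (rule Weierstrass_m_test[OF _ M(1)])
    fix n z assume "z \<in> cball u d"
    then have z: "norm z \<le> r" by (rule in_r)
    then have "\<bar>y\<bar> * norm z \<le> \<bar>y\<bar> * 1" using d by (intro mult_left_mono) auto
    then show "norm (f n z) \<le> M n" using M(2)[OF z] by simp
  qed
  moreover have "cball u d \<subseteq> ball 0 1" using in_r d by force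
  ultimately show "\<exists>d. 0 < d \<and> cball u d \<subseteq> ball 0 1 \<and> uniform_limit (cball u d) (\<lambda>N u. \<Sum>n<N. f n u) (psi1_S2 a b c c' y) sequentially"
    using d unfolding psi1_S2_def[abs_def] f_def by blast
qed

text \<open>For x in (-1, 0) the defining series converges and z = x / (x - 1) lies in (0, 1 / 2),
  inside the lens. Pfaff's transformation followed by the connection formula at z then gives
  functions of 1 - z = u.\<close>

lemma Psi1_on_negative_reals:
  assumes c: "c \<notin> \<int>\<^sub>\<le>\<^sub>0" and c': "c' \<notin> \<int>\<^sub>\<le>\<^sub>0" and ab: "a - b \<notin> \<int>" and r: "- 1 < r" "r < 0"
  defines "x \<equiv> complex_of_real r"
  shows "Psi1_series a b c c' x (of_real y) =
     Gamma c * Gamma c' * rGamma a * rGamma (c - b) * ((1 - x) powr (- b) * psi1_S1 a b c c' y (inverse (1 - x))) +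
     Gamma c * Gamma (b - a) * rGamma b * rGamma (c - a) * ((1 - x) powr (- a) * psi1_S2 a b c c' y (inverse (1 - x)))"
proof -
  define u where "u = inverse (1 - x)"
  define z where "z = x / (x - 1)"
  have x: "norm x < 1" "Re x < 1 / 2" "1 - x \<noteq> 0" "x - 1 \<noteq> 0" "1 - x \<notin> \<real>\<^sub>\<le>\<^sub>0"
    using r by (auto simp: x_def complex_nonpos_Reals_iff complex_eq_iff)
  have u: "u = of_real (1 / (1 - r))" by (simp add: u_def x_def inverse_eq_divide)
  have z: "z = of_real (- r / (1 - r))" "1 - z = u"
    using r x by (simp_all add: z_def u_def x_def field_simps)
  have ur: "0 < 1 / (1 - r)" "1 / (1 - r) < 1" using r by (auto simp: field_simps)
  have zl: "z \<in> lens" unfolding z(1) by (rule lens_of_real) (use r in \<open>auto simp: field_simps\<close>)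
  have nu: "norm u < 1" using ur unfolding u norm_of_real by simp
  have u0: "u \<noteq> 0" using x by (simp add: u_def)
  have upw: "(1 - x) powr (- s) = u powr s" for s
    unfolding u_def using x by (simp add: powr_def Ln_inverse)
  define K1 where "K1 = Gamma c * Gamma c' * rGamma a * rGamma (c - b)"
  define K2 where "K2 = Gamma c * Gamma (b - a) * rGamma b * rGamma (c - a)"
  define t where "t = (\<lambda>n m. gamma_ratio a b c n m * rGamma (c' + of_nat n) / fact n * of_real y ^ n * (pochhammer b m / fact m * u ^ m))"
  define s where "s = (\<lambda>n. psi1_p a b c c' n * of_real y ^ n * u ^ n * hyp2F1 (a + of_nat n) (c - b) (a - b + 1 + of_nat n) u)"
  have Gc': "Gamma c' \<noteq> 0" using c' by (simp add: Gamma_eq_zero_iff)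
  \<comment> \<open>Term by term in n, the constants in front are the same because (a)_n * rGamma (a
    + n) = rGamma a, and the factor 1 / (c')_n becomes Gamma c' * rGamma (c' + n).\<close>
  have trm: "psi1_coeff a c' n * of_real y ^ n * hyp2F1 (a + of_nat n) b c x =
      K1 * u powr b * (\<Sum>m. t n m) + K2 * u powr a * s n" for n
  proof -
    define A where "A = a + of_nat n"
    have dn: "c - b - (c - A) = A - b" by simp
    have di: "A - b \<notin> \<int>"
    proof
      assume "A - b \<in> \<int>"
      then have "A - b - of_nat n \<in> \<int>" by (rule Ints_diff) auto
      then show False using ab by (simp add: A_def algebra_simps)
    qed
    have "hyp2F1 A b c x = u powr b * hyp2F1 b (c - A) c z"
      using hyp2F1_Pfaff[OF c x(1,2), of A b] unfolding upw z_def .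
    also have "hyp2F1 b (c - A) c z =
       Gamma c * Gamma (A - b) * rGamma (c - b) * rGamma A * hyp2F1 b (c - A) (1 - (A - b)) u +
       Gamma c * Gamma (b - A) * rGamma b * rGamma (c - A) * (u powr (A - b) * hyp2F1 (c - b) A (1 + (A - b)) u)"
      using hyp2F1_connection[OF c, of b "c - A" z] di zl unfolding dn z(2) by simp
    finally have H: "hyp2F1 A b c x = u powr b * (Gamma c * Gamma (A - b) * rGamma (c - b) * rGamma A * hyp2F1 b (c - A) (1 - (A - b)) u) +
       u powr b * (Gamma c * Gamma (b - A) * rGamma b * rGamma (c - A) * (u powr (A - b) * hyp2F1 (c - b) A (1 + (A - b)) u))"
      by (simp add: distrib_left)
    have pc': "1 / pochhammer c' n = Gamma c' * rGamma (c' + of_nat n)"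
      using pochhammer_rGamma[of c' n] Gc' pochhammer_nonzero[OF c', of n]
      by (simp add: rGamma_inverse_Gamma[of c'] field_simps)
    have pa: "pochhammer a n * rGamma A = rGamma a" unfolding A_def by (rule pochhammer_rGamma[symmetric])
    have nz: "1 - (A - b) \<notin> \<int>\<^sub>\<le>\<^sub>0" using notin_Ints_nonpos(2)[OF di, of 1] by simp
    have "(\<lambda>m. (Gamma c' * rGamma (c' + of_nat n) / fact n * of_real y ^ n) * (Gamma (A - b) * (hyp2F1_coeff b (c - A) (1 - (A - b)) m * u ^ m)))
       sums ((Gamma c' * rGamma (c' + of_nat n) / fact n * of_real y ^ n) * (Gamma (A - b) * hyp2F1 b (c - A) (1 - (A - b)) u))"
      by (intro sums_mult hyp2F1_sums nz nu)
    moreover have "(Gamma c' * rGamma (c' + of_nat n) / fact n * of_real y ^ n) * (Gamma (A - b) * (hyp2F1_coeff b (c - A) (1 - (A - b)) m * u ^ m)) = Gamma c' * t n m" for m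
    proof -
      have "Gamma (A - b) * hyp2F1_coeff b (c - A) (1 - (A - b)) m = pochhammer b m / fact m * gamma_ratio a b c n m"
        unfolding A_def by (rule hyp2F1_coeff_gamma_ratio[OF ab])
      then have "Gamma (A - b) * (hyp2F1_coeff b (c - A) (1 - (A - b)) m * u ^ m) = pochhammer b m / fact m * gamma_ratio a b c n m * u ^ m"
        by (simp only: mult.assoc[symmetric])
      then show ?thesis by (simp add: t_def mult_ac)
    qed
    ultimately have tsum: "(\<lambda>m. Gamma c' * t n m) sums ((Gamma c' * rGamma (c' + of_nat n) / fact n * of_real y ^ n) * (Gamma (A - b) * hyp2F1 b (c - A) (1 - (A - b)) u))"
      by simp
    then have "(\<Sum>m. t n m) * Gamma c' = (Gamma c' * rGamma (c' + of_nat n) / fact n * of_real y ^ n) * (Gamma (A - b) * hyp2F1 b (c - A) (1 - (A - b)) u)"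
      using sums_mult_iff[OF Gc'] by (metis mult.commute sums_unique suminf_mult summable_cmult_iff Gc' sums_summable)
    then have E1: "psi1_coeff a c' n * of_real y ^ n * (u powr b * (Gamma c * Gamma (A - b) * rGamma (c - b) * rGamma A * hyp2F1 b (c - A) (1 - (A - b)) u)) =
       K1 * u powr b * (\<Sum>m. t n m)"
    proof -
      assume S: "(\<Sum>m. t n m) * Gamma c' = (Gamma c' * rGamma (c' + of_nat n) / fact n * of_real y ^ n) * (Gamma (A - b) * hyp2F1 b (c - A) (1 - (A - b)) u)"
      have "psi1_coeff a c' n * of_real y ^ n * (u powr b * (Gamma c * Gamma (A - b) * rGamma (c - b) * rGamma A * hyp2F1 b (c - A) (1 - (A - b)) u)) =
         u powr b * Gamma c * rGamma (c - b) * (pochhammer a n * rGamma A) * ((1 / pochhammer c' n / fact n * of_real y ^ n) * (Gamma (A - b) * hyp2F1 b (c - A) (1 - (A - b)) u))"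
        by (simp add: psi1_coeff_def)
      also have "\<dots> = u powr b * Gamma c * rGamma (c - b) * rGamma a * ((\<Sum>m. t n m) * Gamma c')"
        unfolding pa pc' S ..
      finally show ?thesis by (simp add: K1_def mult_ac)
    qed
    have GbA: "Gamma (b - A) * pochhammer (b - A) n = Gamma (b - a)"
    proof -
      have "b - A \<notin> \<int>\<^sub>\<le>\<^sub>0" using notin_Ints_nonpos(2)[OF di, of 0] by simp
      then have "Gamma (b - A + of_nat n) = pochhammer (b - A) n * Gamma (b - A)"
        by (simp add: pochhammer_Gamma Gamma_eq_zero_iff)
      then show ?thesis by (simp add: A_def mult.commute)
    qed
    have rG: "rGamma (c - A) = pochhammer (c - A) n * rGamma (c - a)"
      using pochhammer_rGamma[of "c - A" n] by (simp add: A_def)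
    have p1: "pochhammer (b - A) n = (- 1) ^ n * pochhammer (a - b + 1) n" "pochhammer (c - A) n = (- 1) ^ n * pochhammer (a - c + 1) n"
      by (subst pochhammer_reflect, simp add: A_def algebra_simps)+
    have pn: "pochhammer (a - b + 1) n \<noteq> 0"
      using pochhammer_nonzero notin_Ints_nonpos(1)[OF ab, of 1] by simp
    \<comment> \<open>Reflection introduces the sign (-1)^n in both factors, and the signs cancel.
      What remains is the quotient built into \<open>psi1_p\<close>.\<close>
    have GG: "Gamma (b - A) * rGamma (c - A) = Gamma (b - a) * rGamma (c - a) * (pochhammer (a - c + 1) n / pochhammer (a - b + 1) n)"
    proof -
      have "Gamma (b - A) * ((- 1) ^ n * pochhammer (a - b + 1) n) = Gamma (b - a)" using GbA unfolding p1 .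
      then have "(- 1) ^ n * (Gamma (b - A) * ((- 1) ^ n * pochhammer (a - b + 1) n)) = (- 1) ^ n * Gamma (b - a)" by simp
      moreover have "(- 1) ^ n * (Gamma (b - A) * ((- 1) ^ n * pochhammer (a - b + 1) n)) = Gamma (b - A) * pochhammer (a - b + 1) n"
        by (simp add: mult.left_commute)
      ultimately have "Gamma (b - A) = (- 1) ^ n * Gamma (b - a) / pochhammer (a - b + 1) n"
        using pn by (simp add: nonzero_eq_divide_eq)
      then show ?thesis unfolding rG p1 by simp
    qed
    have pw: "u powr b * u powr (A - b) = u powr a * u ^ n"
    proof -
      have "u powr b * u powr (A - b) = u powr (b + (A - b))" by (rule powr_add[symmetric])
      also have "b + (A - b) = a + of_nat n" by (simp add: A_def)
      also have "u powr (a + of_nat n) = u powr a * u ^ n" using u0 by (simp add: powr_add powr_nat')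
      finally show ?thesis .
    qed
    have E2: "psi1_coeff a c' n * of_real y ^ n * (u powr b * (Gamma c * Gamma (b - A) * rGamma b * rGamma (c - A) * (u powr (A - b) * hyp2F1 (c - b) A (1 + (A - b)) u))) =
       K2 * u powr a * s n"
    proof -
      have "hyp2F1 (c - b) A (1 + (A - b)) u = hyp2F1 (a + of_nat n) (c - b) (a - b + 1 + of_nat n) u"
        unfolding hyp2F1_commute[of "c - b"] by (simp add: A_def algebra_simps)
      then have "psi1_coeff a c' n * of_real y ^ n * (u powr b * (Gamma c * Gamma (b - A) * rGamma b * rGamma (c - A) * (u powr (A - b) * hyp2F1 (c - b) A (1 + (A - b)) u))) =
        psi1_coeff a c' n * of_real y ^ n * Gamma c * rGamma b * (Gamma (b - A) * rGamma (c - A)) * (u powr b * u powr (A - b)) * hyp2F1 (a + of_nat n) (c - b) (a - b + 1 + of_nat n) u"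
        by (simp add: mult_ac)
      also have "\<dots> = K2 * u powr a * s n"
        unfolding GG pw by (simp add: K2_def s_def psi1_coeff_def psi1_p_def mult_ac)
      finally show ?thesis .
    qed
    show ?thesis
      unfolding A_def[symmetric] H distrib_left E1 E2 ..
  qed
  obtain q where q: "\<And>n m. norm (gamma_ratio a b c n m) \<le> real (m + 1) ^ q * norm (Gamma (a - b + of_nat n))"
    using norm_gamma_ratio_le[OF ab] by blast
  obtain q2 where q2: "\<And>m. norm (pochhammer b m / fact m) \<le> real (m + 1) ^ q2"
    using norm_pochhammer_over_fact_le by blast
  have sM: "summable (\<lambda>m. real (m + 1) ^ (q + q2) * norm u ^ m)" using nu by (intro summable_Suc_power_mult_power) auto
  define w where "w = (\<lambda>n. norm (Gamma (a - b + of_nat n) * rGamma (c' + of_nat n) / fact n) * \<bar>y\<bar> ^ n)"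
  have A: "a - b \<notin> \<int>\<^sub>\<le>\<^sub>0" using ab nonpos_Ints_Int by blast
  have sw: "summable w" unfolding w_def by (rule kummer_series_majorant(1)[OF A])
  \<comment> \<open>The majorant is a product of a function of n and a function of m, so the
    conditions for exchanging the sums reduce to the convergence of two single series.\<close>
  have le: "norm (t n m) \<le> w n * (real (m + 1) ^ (q + q2) * norm u ^ m)" for n m
  proof -
    have "norm (t n m) = norm (gamma_ratio a b c n m) * (norm (rGamma (c' + of_nat n)) / fact n * \<bar>y\<bar> ^ n) * (norm (pochhammer b m / fact m) * norm u ^ m)"
      by (simp add: t_def norm_mult norm_divide norm_power)
    also have "\<dots> \<le> (real (m + 1) ^ q * norm (Gamma (a - b + of_nat n))) * (norm (rGamma (c' + of_nat n)) / fact n * \<bar>y\<bar> ^ n) * (real (m + 1) ^ q2 * norm u ^ m)"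
      by (intro mult_mono mult_right_mono q q2 mult_nonneg_nonneg) auto
    also have "\<dots> = w n * (real (m + 1) ^ (q + q2) * norm u ^ m)" by (simp add: w_def norm_mult norm_divide power_add mult_ac)
    finally show ?thesis .
  qed
  have s1: "summable (\<lambda>m. norm (t n m))" for n
    by (rule summable_comparison_test'[OF summable_mult[OF sM], where N = 0]) (use le in simp)
  have s2: "summable (\<lambda>n. \<Sum>m. norm (t n m))"
  proof (rule summable_comparison_test'[where N = 0])
    show "summable (\<lambda>n. w n * (\<Sum>m. real (m + 1) ^ (q + q2) * norm u ^ m))" by (rule summable_mult2[OF sw])
    fix n :: nat
    have "(\<Sum>m. norm (t n m)) \<le> (\<Sum>m. w n * (real (m + 1) ^ (q + q2) * norm u ^ m))"
      by (rule suminf_le[OF le s1 summable_mult[OF sM]])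
    also have "\<dots> = w n * (\<Sum>m. real (m + 1) ^ (q + q2) * norm u ^ m)" by (rule suminf_mult[OF sM])
    finally show "norm (\<Sum>m. norm (t n m)) \<le> w n * (\<Sum>m. real (m + 1) ^ (q + q2) * norm u ^ m)"
      using suminf_nonneg[OF s1[of n]] by simp
  qed
  have "(\<lambda>m. \<Sum>n. t n m) sums (\<Sum>n. \<Sum>m. t n m)" by (rule double_series_swap(2)[OF s1 s2])
  moreover have "(\<Sum>n. t n m) = pochhammer b m / fact m * psi1_T a b c c' m y * u ^ m" for m
  proof -
    have "summable (\<lambda>n. gamma_ratio a b c n m * rGamma (c' + of_nat n) / fact n * of_real y ^ n)"
      using psi1_T_bound[OF ab] summable_norm_cancel by metis
    from suminf_mult2[OF this, of "pochhammer b m / fact m * u ^ m"] show ?thesis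
      unfolding t_def psi1_T_def by (simp add: mult_ac)
  qed
  ultimately have S1: "(\<Sum>n. \<Sum>m. t n m) = psi1_S1 a b c c' y u" by (simp add: psi1_S1_def sums_iff)
  have st: "summable (\<lambda>n. \<Sum>m. t n m)"
  proof (rule summable_norm_cancel, rule summable_comparison_test'[OF s2, where N = 0])
    show "norm (norm (\<Sum>m. t n m)) \<le> (\<Sum>m. norm (t n m))" for n
      using summable_norm[OF s1[of n]] by simp
  qed
  obtain M where M: "summable M" "\<And>n. norm (s n) \<le> M n"
    using psi1_S2_bound[OF c' ab norm_ge_zero[of u] nu, of "\<bar>y\<bar> * norm u" c] unfolding s_def by auto
  have ss: "summable s" by (rule summable_comparison_test'[OF M(1), where N = 0]) (rule M(2))
  have "(\<lambda>n. K1 * u powr b * (\<Sum>m. t n m) + K2 * u powr a * s n) sums (K1 * u powr b * (\<Sum>n. \<Sum>m. t n m) + K2 * u powr a * (\<Sum>n. s n))"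
    by (intro sums_add sums_mult summable_sums st ss)
  from sums_unique[OF this]
  have "Psi1_series a b c c' x (of_real y) = K1 * u powr b * (\<Sum>n. \<Sum>m. t n m) + K2 * u powr a * (\<Sum>n. s n)"
    unfolding Psi1_series_iterated[OF c c' x(1)] trm by (rule sym)
  moreover have "(\<Sum>n. s n) = psi1_S2 a b c c' y u" unfolding psi1_S2_def s_def ..
  ultimately have "Psi1_series a b c c' x (of_real y) = K1 * u powr b * psi1_S1 a b c c' y u + K2 * u powr a * psi1_S2 a b c c' y u"
    unfolding S1 by simp
  then show ?thesis unfolding K1_def K2_def upw u_def[symmetric] by (simp only: mult.assoc)
qed

section \<open>The coefficients of the expansion\<close>

lemma sum_triangle_atMost: "(\<Sum>k\<le>n. \<Sum>i\<le>k. g i (k - i)) = (\<Sum>i\<le>n. \<Sum>r\<le>n - i. g i r)"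
  for g :: "nat \<Rightarrow> nat \<Rightarrow> 'a::comm_monoid_add"
proof -
  have "{(i, j). i + j \<le> n} = Sigma {..n} (\<lambda>i. {..n - i})" by auto
  then show ?thesis
    using sum.triangle_reindex_eq[of g n] by (simp add: sum.Sigma)
qed

lemma sum_triangle_lessThan: "(\<Sum>k<n. \<Sum>i\<le>k. g i (k - i)) = (\<Sum>i<n. \<Sum>r<n - i. g i r)"
  for g :: "nat \<Rightarrow> nat \<Rightarrow> 'a::comm_monoid_add"
proof -
  have "{(i, j). i + j < n} = Sigma {..<n} (\<lambda>i. {..<n - i})" by auto
  then show ?thesis
    using sum.triangle_reindex[of g n] by (simp add: sum.Sigma)
qed

lemma pochhammer_neg_of_nat: "pochhammer (- of_nat m :: complex) r = (- 1) ^ r * of_nat (m choose r) * fact r"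
proof -
  have "of_nat (m choose r) = (- 1) ^ r * pochhammer (- of_nat m :: complex) r / fact r"
    by (simp add: binomial_gbinomial gbinomial_pochhammer)
  then show ?thesis by (simp add: power_mult_distrib[symmetric] flip: mult.assoc)
qed

lemma choose_mult_shift: "((j choose p) * (p choose i) :: nat) = (j choose i) * ((j - i) choose (p - i))" if "i \<le> p"
proof (cases "p \<le> j")
  case True
  then show ?thesis using choose_mult[OF that True] by simp
next
  case False
  then have "(j choose p) = 0" "(j choose i) * ((j - i) choose (p - i)) = 0"
    using that by (auto simp: binomial_eq_0_iff)
  then show ?thesis by (simp only: mult_zero_left)
qed

text \<open>Vandermonde's identity for - M and 1 - e - L, after reflecting the symbols on both
  sides.\<close>

lemma sum_binomial_pochhammer_shift:
  fixes e :: complex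
  shows "(\<Sum>r\<le>L. of_nat (M choose r) * pochhammer (e + of_nat r) (L - r) / fact (L - r)) =
    pochhammer (e + of_nat M) L / fact L"
proof -
  have 1: "pochhammer (e + of_nat r) (L - r) = (- 1) ^ (L - r) * pochhammer (1 - e - of_nat L) (L - r)" if "r \<le> L" for r
    using that by (subst pochhammer_reflect) (simp add: of_nat_diff algebra_simps)
  have "pochhammer (e + of_nat M) L = (- 1) ^ L * pochhammer (- of_nat M + (1 - e - of_nat L)) L"
    by (subst pochhammer_reflect) (simp add: algebra_simps)
  also have "\<dots> = (\<Sum>r\<le>L. (- 1) ^ L * (of_nat (L choose r) * pochhammer (- of_nat M) r * pochhammer (1 - e - of_nat L) (L - r)))"
    unfolding pochhammer_binomial_sum sum_distrib_left ..
  finally have 2: "pochhammer (e + of_nat M) L / fact L =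
      (\<Sum>r\<le>L. (- 1) ^ L * (of_nat (L choose r) * pochhammer (- of_nat M) r * pochhammer (1 - e - of_nat L) (L - r)) / fact L)"
    by (simp add: sum_divide_distrib)
  show ?thesis
    unfolding 2
  proof (rule sum.cong)
    fix r assume "r \<in> {..L}"
    then have r: "r \<le> L" by simp
    have 3: "of_nat (L choose r) = (fact L / (fact r * fact (L - r)) :: complex)"
      using r by (rule binomial_fact)
    have 4: "(- 1 :: complex) ^ L * (- 1) ^ r = (- 1) ^ (L - r)"
    proof -
      have "(- 1 :: complex) ^ L = (- 1) ^ (L - r) * (- 1) ^ r" using r by (simp flip: power_add)
      then show ?thesis by (simp flip: power_mult_distrib add: mult.assoc)
    qed
    have "(- 1) ^ L * (fact L / (fact r * fact (L - r)) * ((- 1) ^ r * of_nat (M choose r) * fact r) * pochhammer (1 - e - of_nat L) (L - r)) / fact L =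
      ((- 1) ^ L * (- 1) ^ r) * (of_nat (M choose r) * pochhammer (1 - e - of_nat L) (L - r) / fact (L - r))"
      by (simp add: field_simps)
    then show "of_nat (M choose r) * pochhammer (e + of_nat r) (L - r) / fact (L - r) =
       (- 1) ^ L * (of_nat (L choose r) * pochhammer (- of_nat M) r * pochhammer (1 - e - of_nat L) (L - r)) / fact L"
      unfolding 1[OF r] pochhammer_neg_of_nat 3 by (simp add: mult_ac 4)
  qed simp
qed

text \<open>The coefficient of y ^ (- l) in \<open>psi1_T\<close> at index j, relative to exp y * y
  powr (a - b - c'). The index p counts the Kummer series into which \<open>psi1_T\<close> splits; l
  - p is the order within the p-th of them.\<close>

definition psi1_tau :: "complex \<Rightarrow> complex \<Rightarrow> complex \<Rightarrow> complex \<Rightarrow> nat \<Rightarrow> nat \<Rightarrow> complex" where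
  "psi1_tau a b c c' j l = (\<Sum>p\<le>l. of_nat (j choose p) * pochhammer (b - c + 1) p *
     (pochhammer (b - a + c' + of_nat p) (l - p) * pochhammer (b - a + 1 + of_nat p) (l - p) / fact (l - p)))"

text \<open>Expand (b - c + 1)_p by Vandermonde, exchange the summations, and sum over p again by a
  second Vandermonde. The product of the two binomial coefficients is rewritten so that the inner
  sum has upper index j - i.\<close>

lemma psi1_tau_eq:
  "psi1_tau a b c c' j l = (\<Sum>i\<le>l. (- 1) ^ i * of_nat (j choose i) * pochhammer (c + c' - a - 1) i *
     pochhammer (b - a + c' + of_nat i) (l - i) * (pochhammer (of_nat j + b - a + 1) (l - i) / fact (l - i)))"
proof -
  define \<beta> where "\<beta> = b - a + c'"
  define s where "s = c + c' - a - 1"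
  define e where "e = b - a + 1"
  \<comment> \<open>Here s is the upper parameter c + c' - a - 1 of the terminating series in
    \<open>acoeff\<close>. This splitting is how it enters.\<close>
  have q: "b - c + 1 = \<beta> - s" by (simp add: \<beta>_def s_def)
  define g where "g = (\<lambda>i r. (- 1) ^ i * of_nat (j choose i) * pochhammer s i * pochhammer (\<beta> + of_nat i) (l - i) *
     (of_nat ((j - i) choose r) * pochhammer (e + of_nat i + of_nat r) (l - i - r) / fact (l - i - r)))"
  have "psi1_tau a b c c' j l = (\<Sum>p\<le>l. \<Sum>i\<le>p. of_nat (j choose p) * ((- 1) ^ i * of_nat (p choose i) * pochhammer s i *
      pochhammer (\<beta> + of_nat i) (p - i)) * (pochhammer (\<beta> + of_nat p) (l - p) * pochhammer (e + of_nat p) (l - p) / fact (l - p)))"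
    unfolding psi1_tau_def q pochhammer_diff_sum sum_distrib_left sum_distrib_right \<beta>_def e_def ..
  also have "\<dots> = (\<Sum>p\<le>l. \<Sum>i\<le>p. g i (p - i))"
  proof (intro sum.cong refl)
    fix p i assume "p \<in> {..l}" "i \<in> {..p}"
    then have i: "i \<le> p" "p \<le> l" by auto
    have 1: "pochhammer (\<beta> + of_nat i) (l - i) = pochhammer (\<beta> + of_nat i) (p - i) * pochhammer (\<beta> + of_nat p) (l - p)"
      using pochhammer_product[of "p - i" "l - i" "\<beta> + of_nat i"] i by (simp add: of_nat_diff)
    have 2: "of_nat (j choose p) * of_nat (p choose i) = (of_nat (j choose i) * of_nat ((j - i) choose (p - i)) :: complex)"
      using choose_mult_shift[OF i(1), of j] by (metis of_nat_mult)
    have 3: "l - i - (p - i) = l - p" "e + of_nat i + of_nat (p - i) = e + of_nat p" using i by (simp_all add: of_nat_diff)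
    have "of_nat (j choose p) * ((- 1) ^ i * of_nat (p choose i) * pochhammer s i *
      pochhammer (\<beta> + of_nat i) (p - i)) * (pochhammer (\<beta> + of_nat p) (l - p) * pochhammer (e + of_nat p) (l - p) / fact (l - p)) =
      (of_nat (j choose p) * of_nat (p choose i)) * ((- 1) ^ i * pochhammer s i *
      pochhammer (\<beta> + of_nat i) (p - i) * (pochhammer (\<beta> + of_nat p) (l - p) * pochhammer (e + of_nat p) (l - p) / fact (l - p)))"
      by simp
    also have "\<dots> = g i (p - i)"
      unfolding g_def 2 3 1 by simp
    finally show "of_nat (j choose p) * ((- 1) ^ i * of_nat (p choose i) * pochhammer s i *
      pochhammer (\<beta> + of_nat i) (p - i)) * (pochhammer (\<beta> + of_nat p) (l - p) * pochhammer (e + of_nat p) (l - p) / fact (l - p)) = g i (p - i)" .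
  qed
  also have "\<dots> = (\<Sum>i\<le>l. \<Sum>r\<le>l - i. g i r)" by (rule sum_triangle_atMost)
  also have "\<dots> = (\<Sum>i\<le>l. (- 1) ^ i * of_nat (j choose i) * pochhammer s i *
     pochhammer (\<beta> + of_nat i) (l - i) * (pochhammer (of_nat j + b - a + 1) (l - i) / fact (l - i)))"
  proof (intro sum.cong refl)
    fix i assume "i \<in> {..l}"
    have 1: "(\<Sum>r\<le>l - i. of_nat ((j - i) choose r) * pochhammer (e + of_nat i + of_nat r) (l - i - r) / fact (l - i - r)) =
       pochhammer (e + of_nat i + of_nat (j - i)) (l - i) / fact (l - i)"
      by (rule sum_binomial_pochhammer_shift)
    have 2: "(\<Sum>r\<le>l - i. g i r) = (- 1) ^ i * of_nat (j choose i) * pochhammer s i * pochhammer (\<beta> + of_nat i) (l - i) *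
       (pochhammer (e + of_nat i + of_nat (j - i)) (l - i) / fact (l - i))"
      unfolding g_def 1[symmetric] sum_distrib_left ..
    show "(\<Sum>r\<le>l - i. g i r) = (- 1) ^ i * of_nat (j choose i) * pochhammer s i *
     pochhammer (\<beta> + of_nat i) (l - i) * (pochhammer (of_nat j + b - a + 1) (l - i) / fact (l - i))"
    \<comment> \<open>For i > j the truncated difference j - i differs from the true one, but the
      binomial coefficient of j over i is then zero.\<close>
    proof (cases "i \<le> j")
      case True
      then have "e + of_nat i + of_nat (j - i) = of_nat j + b - a + 1" by (simp add: e_def of_nat_diff)
      then show ?thesis unfolding 2 by simp
    qed (simp add: 2)
  qed
  finally show ?thesis unfolding \<beta>_def s_def .
qed

text \<open>Up to sign, the symbol of a - b - k in the denominator consists of the last i factors of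
  (j + b - a + 1)_(k-j). Cancelling them leaves (j + b - a + 1)_(k-j-i); they are nonzero because a
  - b is not an integer.\<close>

lemma acoeff_eq_psi1_tau:
  assumes ab: "a - b \<notin> \<int>"
  shows "acoeff a b c c' k x y = (\<Sum>j\<le>k. pochhammer b j / fact j * psi1_tau a b c c' j (k - j) *
     (of_real y / (1 - x)) powr (b + of_nat j))"
  unfolding acoeff_def
proof (intro sum.cong refl)
  fix j assume "j \<in> {..k}"
  then have j: "j \<le> k" by simp
  define l where "l = k - j"
  have k: "of_nat j - of_nat k = (- of_nat l :: complex)" using j by (simp add: l_def of_nat_diff)
  define \<delta> where "\<delta> = a - b - of_nat k"
  have "pochhammer (of_nat j + b - a + 1) l / fact l *
      (pochhammer (b - a + c' + of_nat i) (l - i) * (pochhammer (- of_nat j) i * pochhammer (- of_nat l) i * pochhammer s i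
        / (pochhammer \<delta> i * fact i))) =
      (- 1) ^ i * of_nat (j choose i) * pochhammer s i *
     pochhammer (b - a + c' + of_nat i) (l - i) * (pochhammer (of_nat j + b - a + 1) (l - i) / fact (l - i))"
    if i: "i \<le> l" for i s
  proof -
    define z where "z = of_nat j + b - a + 1 + of_nat (l - i)"
    have "z \<notin> \<int>\<^sub>\<le>\<^sub>0"
      using notin_Ints_nonpos(2)[OF ab, of "int j + 1 + int (l - i)"] by (simp add: z_def algebra_simps)
    then have nz: "pochhammer z i \<noteq> 0" by (rule pochhammer_nonzero)
    have 1: "pochhammer \<delta> i = (- 1) ^ i * pochhammer z i"
      using i j by (subst pochhammer_reflect) (simp add: z_def \<delta>_def l_def of_nat_diff algebra_simps)
    have 2: "pochhammer (of_nat j + b - a + 1) l = pochhammer (of_nat j + b - a + 1) (l - i) * pochhammer z i"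
      using pochhammer_product[of "l - i" l "of_nat j + b - a + 1"] i by (simp add: z_def)
    have 3: "of_nat (l choose i) = (fact l / (fact i * fact (l - i)) :: complex)"
      using i by (rule binomial_fact)
    show ?thesis
      unfolding pochhammer_neg_of_nat 1 2 3 using nz
      by (simp add: field_simps)
  qed
  then have "pochhammer (of_nat j + b - a + 1) l / fact l * poch_hyp k j (b - a + c') (c + c' - a - 1) \<delta> = psi1_tau a b c c' j l"
    unfolding poch_hyp_altdef[OF j] psi1_tau_eq sum_distrib_left k l_def[symmetric] by simp
  then show "pochhammer b j * pochhammer (of_nat j + b - a + 1) (k - j) / (fact j * fact (k - j)) *
         poch_hyp k j (b - a + c') (c + c' - a - 1) (a - b - of_nat k) * (of_real y / (1 - x)) powr (b + of_nat j) =
         pochhammer b j / fact j * psi1_tau a b c c' j (k - j) * (of_real y / (1 - x)) powr (b + of_nat j)"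
    by (simp add: l_def \<delta>_def field_simps)
qed

section \<open>Asymptotics of the coefficient functions\<close>

text \<open>Split a - c + 1 + n - j as (b - c + 1) + (a - b + n - j) in Vandermonde's identity. The
  symbol of the second summand merges with the Gamma function into Gamma (a - b - p + n), so each
  term is the coefficient of a Kummer series.\<close>

lemma psi1_T_eq_kummer_series:
  assumes ab: "a - b \<notin> \<int>"
  shows "psi1_T a b c c' j y = (\<Sum>p\<le>j. of_nat (j choose p) * pochhammer (b - c + 1) p * kummer_series (a - b - of_nat p) c' (of_real y))"
proof -
  have A: "a - b - of_nat p \<notin> \<int>\<^sub>\<le>\<^sub>0" for p
    using notin_Ints_nonpos(1)[OF ab, of "- int p"] by simp
  have I: "a - b - of_nat p \<notin> \<int>" for p
  proof
    assume "a - b - of_nat p \<in> \<int>"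
    then have "a - b - of_nat p + of_nat p \<in> \<int>" by (rule Ints_add) simp
    then show False using ab by simp
  qed
  have g: "gamma_ratio a b c n j = (\<Sum>p\<le>j. of_nat (j choose p) * pochhammer (b - c + 1) p * Gamma (a - b - of_nat p + of_nat n))" for n
  proof -
    have "a - c + 1 + (of_nat n - of_nat j) = (b - c + 1) + (a - b + (of_nat n - of_nat j))" by simp
    then have "pochhammer (a - c + 1 + (of_nat n - of_nat j)) j = (\<Sum>p\<le>j. of_nat (j choose p) * pochhammer (b - c + 1) p *
        pochhammer (a - b + (of_nat n - of_nat j)) (j - p))"
      by (simp only: pochhammer_binomial_sum)
    moreover have "Gamma (a - b - of_nat p + of_nat n) = pochhammer (a - b + (of_nat n - of_nat j)) (j - p) * Gamma (a - b + (of_nat n - of_nat j))"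
      if "p \<le> j" for p
    proof -
      have "a - b - of_nat p + (of_nat n - of_nat (j - p)) = a - b + (of_nat n - of_nat j)" using that by (simp add: of_nat_diff)
      from Gamma_shift_back[OF I[of p], of n "j - p", unfolded this] show ?thesis .
    qed
    ultimately show ?thesis
      unfolding gamma_ratio_def by (simp add: sum_distrib_left mult_ac)
  qed
  have "(\<lambda>n. \<Sum>p\<le>j. of_nat (j choose p) * pochhammer (b - c + 1) p *
      (Gamma (a - b - of_nat p + of_nat n) * rGamma (c' + of_nat n) / fact n * of_real y ^ n)) sums
      (\<Sum>p\<le>j. of_nat (j choose p) * pochhammer (b - c + 1) p * kummer_series (a - b - of_nat p) c' (of_real y))"
    by (intro sums_sum sums_mult kummer_series_sums A)
  moreover have "(\<Sum>p\<le>j. of_nat (j choose p) * pochhammer (b - c + 1) p *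
      (Gamma (a - b - of_nat p + of_nat n) * rGamma (c' + of_nat n) / fact n * of_real y ^ n)) =
      gamma_ratio a b c n j * rGamma (c' + of_nat n) / fact n * of_real y ^ n" for n
    unfolding g sum_distrib_right sum_divide_distrib by (intro sum.cong refl) simp
  ultimately show ?thesis unfolding psi1_T_def by (simp add: sums_iff)
qed

text \<open>The p-th Kummer series is smaller by the factor y ^ (- p), so L - p of its terms
  suffice. When p exceeds L this truncated difference is 0, and the plain growth bound is already
  good enough.\<close>

lemma psi1_T_asymp:
  assumes ab: "a - b \<notin> \<int>"
  shows "(\<lambda>y. psi1_T a b c c' j y - exp (of_real y) * of_real y powr (a - b - c') *
     (\<Sum>l<L. psi1_tau a b c c' j l / of_real y ^ l)) \<in> O(exp_powr (Re (a - b - c') - real L))"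
proof -
  have A: "a - b - of_nat p \<notin> \<int>\<^sub>\<le>\<^sub>0" for p
    using notin_Ints_nonpos(1)[OF ab, of "- int p"] by simp
  define h where "h = (\<lambda>p s. pochhammer (b - a + c' + of_nat p) s * pochhammer (b - a + 1 + of_nat p) s / fact s :: complex)"
  define w where "w = (\<lambda>p. of_nat (j choose p) * pochhammer (b - c + 1) p :: complex)"
  have 1: "(\<lambda>y. kummer_series (a - b - of_nat p) c' (of_real y) - exp (of_real y) * of_real y powr (a - b - of_nat p - c') *
      (\<Sum>s<L - p. h p s / of_real y ^ s)) \<in> O(exp_powr (Re (a - b - c') - real L))" for p
  proof (rule landau_o.big_trans)
    show "exp_powr (Re (a - b - of_nat p - c') - real (L - p)) \<in> O(exp_powr (Re (a - b - c') - real L))"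
      by (rule exp_powr_mono) auto
    show "(\<lambda>y. kummer_series (a - b - of_nat p) c' (of_real y) - exp (of_real y) * of_real y powr (a - b - of_nat p - c') *
      (\<Sum>s<L - p. h p s / of_real y ^ s)) \<in> O(exp_powr (Re (a - b - of_nat p - c') - real (L - p)))"
      using kummer_series_asymp[OF A[of p], of c' "L - p"] by (simp add: h_def algebra_simps)
  qed
  have "(\<lambda>y. \<Sum>p\<le>j. w p * (kummer_series (a - b - of_nat p) c' (of_real y) - exp (of_real y) * of_real y powr (a - b - of_nat p - c') *
      (\<Sum>s<L - p. h p s / of_real y ^ s))) \<in> O(exp_powr (Re (a - b - c') - real L))"
    by (intro big_sum_in_bigo bigo_cmult_left 1)
  moreover have "\<forall>\<^sub>F y in at_top. (\<Sum>p\<le>j. w p * (kummer_series (a - b - of_nat p) c' (of_real y) - exp (of_real y) * of_real y powr (a - b - of_nat p - c') *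
      (\<Sum>s<L - p. h p s / of_real y ^ s))) = psi1_T a b c c' j y - exp (of_real y) * of_real y powr (a - b - c') *
     (\<Sum>l<L. psi1_tau a b c c' j l / of_real y ^ l)"
    using eventually_gt_at_top[of 0]
  proof eventually_elim
    case (elim y)
    then have y: "complex_of_real y \<noteq> 0" by simp
    define E where "E = exp (of_real y) * complex_of_real y powr (a - b - c')"
    have pw: "complex_of_real y powr (a - b - of_nat p - c') = of_real y powr (a - b - c') / of_real y ^ p" for p
    proof -
      have "complex_of_real y powr (a - b - of_nat p - c') = of_real y powr (a - b - c' - of_nat p)" by (simp add: algebra_simps)
      also have "\<dots> = of_real y powr (a - b - c') / of_real y ^ p" using y by (simp add: powr_diff powr_nat')
      finally show ?thesis .
    qed
    define g where "g = (\<lambda>p s. w p * h p s / of_real y ^ (p + s))"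
    have "(\<Sum>l<L. psi1_tau a b c c' j l / of_real y ^ l) = (\<Sum>l<L. \<Sum>p\<le>l. g p (l - p))"
      unfolding psi1_tau_def sum_divide_distrib g_def w_def h_def by (intro sum.cong refl) simp
    also have "\<dots> = (\<Sum>p<L. \<Sum>s<L - p. g p s)" by (rule sum_triangle_lessThan)
    \<comment> \<open>An intermediate range containing both p < L and p \<le> j. Beyond L the inner
      sums are empty, and beyond j the binomial weight vanishes.\<close>
    also have "\<dots> = (\<Sum>p\<le>j + L. \<Sum>s<L - p. g p s)"
      by (rule sum.mono_neutral_left) auto
    also have "\<dots> = (\<Sum>p\<le>j. \<Sum>s<L - p. g p s)"
      by (rule sum.mono_neutral_right) (auto simp: g_def w_def intro!: sum.neutral)
    finally have 2: "E * (\<Sum>l<L. psi1_tau a b c c' j l / of_real y ^ l) = (\<Sum>p\<le>j. E * (\<Sum>s<L - p. g p s))"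
      by (simp add: sum_distrib_left)
    have 3: "w p * (exp (of_real y) * of_real y powr (a - b - of_nat p - c') * (\<Sum>s<L - p. h p s / of_real y ^ s)) = E * (\<Sum>s<L - p. g p s)" for p
      unfolding pw E_def g_def sum_distrib_left by (intro sum.cong refl) (simp add: power_add)
    show ?case
      unfolding psi1_T_eq_kummer_series[OF ab] E_def[symmetric] 2 right_diff_distrib sum_subtractf 3
      by (simp add: w_def)
  qed
  ultimately show ?thesis by (rule landau_o.big.in_cong[THEN iffD1, rotated])
qed

section \<open>The exterior of the unit disc about 1\<close>

text \<open>The logarithm of 1 - x straightens this set to the convex half-strip Re w > 0, |Im w| <
  pi.\<close>

lemma connected_slit_exterior: "connected {x \<in> slit_plane. norm (1 - x) > 1}"
proof -
  define H where "H = {w. Re w > 0} \<inter> ({w. Im w > - pi} \<inter> {w. Im w < pi})"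
  have "{x \<in> slit_plane. norm (1 - x) > 1} = (\<lambda>w. 1 - exp w) ` H"
  proof (intro equalityI subsetI)
    fix x assume "x \<in> {x \<in> slit_plane. norm (1 - x) > 1}"
    then have x: "1 - x \<notin> \<real>\<^sub>\<le>\<^sub>0" "norm (1 - x) > 1" by (auto simp: slit_plane_iff)
    then have nz: "1 - x \<noteq> 0" by auto
    have "Im (Ln (1 - x)) \<noteq> pi" using x(1) Im_Ln_eq_pi[OF nz] by (auto simp: complex_nonpos_Reals_iff)
    then have "Im (Ln (1 - x)) < pi" using Im_Ln_le_pi[OF nz] by simp
    then have "Ln (1 - x) \<in> H" using mpi_less_Im_Ln[OF nz] x(2) nz by (simp add: H_def)
    moreover have "x = 1 - exp (Ln (1 - x))" using nz by simp
    ultimately show "x \<in> (\<lambda>w. 1 - exp w) ` H" by blast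
  next
    fix x assume "x \<in> (\<lambda>w. 1 - exp w) ` H"
    then obtain w where w: "w \<in> H" "x = 1 - exp w" by blast
    then have "Ln (exp w) = w" by (intro Ln_exp) (auto simp: H_def)
    then have "Im (Ln (exp w)) \<noteq> pi" using w by (auto simp: H_def)
    moreover have "\<not> (Re (exp w) = 0 \<and> Im (exp w) = 0)"
    proof
      assume "Re (exp w) = 0 \<and> Im (exp w) = 0"
      then have "exp w = 0" by (intro complex_eqI) auto
      then show False by simp
    qed
    ultimately have "exp w \<notin> \<real>\<^sub>\<le>\<^sub>0" using Im_Ln_eq_pi[of "exp w"] by (auto simp: complex_nonpos_Reals_iff)
    then show "x \<in> {x \<in> slit_plane. norm (1 - x) > 1}"
      using w by (auto simp: slit_plane_iff H_def)
  qed
  moreover have "convex H"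
    unfolding H_def by (intro convex_Int convex_halfspace_Re_gt convex_halfspace_Im_gt convex_halfspace_Im_lt)
  then have "connected ((\<lambda>w. 1 - exp w) ` H)"
    by (intro connected_continuous_image continuous_intros convex_connected)
  ultimately show ?thesis by simp
qed

text \<open>For norm (1 - x) > 1 the variable u stays in the unit disc, so the right side is
  holomorphic there. The identity theorem extends the equality from (-1, 0), with - 1 / 2 as the
  accumulation point.\<close>

lemma Psi1_outside_disc:
  assumes c: "c \<notin> \<int>\<^sub>\<le>\<^sub>0" and c': "c' \<notin> \<int>\<^sub>\<le>\<^sub>0" and ab: "a - b \<notin> \<int>"
    and x: "x \<in> slit_plane" "norm (1 - x) > 1"
  shows "Psi1 a b c c' x (of_real y) =
     Gamma c * Gamma c' * rGamma a * rGamma (c - b) * ((1 - x) powr (- b) * psi1_S1 a b c c' y (inverse (1 - x))) +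
     Gamma c * Gamma (b - a) * rGamma b * rGamma (c - a) * ((1 - x) powr (- a) * psi1_S2 a b c c' y (inverse (1 - x)))"
proof -
  define \<Omega> where "\<Omega> = {x \<in> slit_plane. norm (1 - x) > 1}"
  define R where "R = (\<lambda>x. Gamma c * Gamma c' * rGamma a * rGamma (c - b) * ((1 - x) powr (- b) * psi1_S1 a b c c' y (inverse (1 - x))) +
     Gamma c * Gamma (b - a) * rGamma b * rGamma (c - a) * ((1 - x) powr (- a) * psi1_S2 a b c c' y (inverse (1 - x))))"
  have cont: "is_Psi1_continuation a b c c' (Psi1 a b c c')" by (rule Psi1_is_continuation[OF c c'])
  have "Psi1 a b c c' x (of_real y) - R x = 0"
  proof (rule analytic_continuation[where f = "\<lambda>x. Psi1 a b c c' x (of_real y) - R x" and S = \<Omega>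
        and U = "complex_of_real ` {- 1<..<0}" and \<xi> = "- 1 / 2"])
    have hol: "(\<lambda>x. Psi1 a b c c' x (of_real y)) holomorphic_on \<Omega>"
      using cont by (auto simp: is_Psi1_continuation_def holomorphic2_on_def \<Omega>_def intro: holomorphic_on_subset)
    have nz: "1 - z \<noteq> 0" "1 - z \<notin> \<real>\<^sub>\<le>\<^sub>0" "inverse (1 - z) \<in> ball 0 1" if "z \<in> \<Omega>" for z
    proof -
      have z: "1 < norm (1 - z)" using that by (simp add: \<Omega>_def)
      then show "1 - z \<noteq> 0" by auto
      show "1 - z \<notin> \<real>\<^sub>\<le>\<^sub>0" using that by (simp add: \<Omega>_def slit_plane_iff)
      have "inverse (norm (1 - z)) < inverse 1" using z by (intro less_imp_inverse_less) auto
      then show "inverse (1 - z) \<in> ball 0 1" by (simp add: norm_inverse)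
    qed
    have u: "(\<lambda>x. inverse (1 - x)) holomorphic_on \<Omega>"
      using nz(1) by (intro holomorphic_intros) auto
    have im: "(\<lambda>x. inverse (1 - x)) ` \<Omega> \<subseteq> ball 0 1" using nz(3) by blast
    have S1: "(\<lambda>x. psi1_S1 a b c c' y (inverse (1 - x))) holomorphic_on \<Omega>"
      using holomorphic_on_compose_gen[OF u holomorphic_psi1_S1[OF ab] im] by (simp add: o_def)
    have S2: "(\<lambda>x. psi1_S2 a b c c' y (inverse (1 - x))) holomorphic_on \<Omega>"
      using holomorphic_on_compose_gen[OF u holomorphic_psi1_S2[OF c' ab] im] by (simp add: o_def)
    have "R holomorphic_on \<Omega>"
      unfolding R_def using nz(2) by (intro holomorphic_intros S1 S2) auto
    with hol show "(\<lambda>x. Psi1 a b c c' x (of_real y) - R x) holomorphic_on \<Omega>"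
      by (intro holomorphic_intros)
    have eq: "\<Omega> = slit_plane \<inter> {x. norm (1 - x) > 1}" by (auto simp: \<Omega>_def)
    show "open \<Omega>"
      unfolding eq by (intro open_Int open_slit_plane open_Collect_less continuous_intros)
    show "connected \<Omega>" unfolding \<Omega>_def by (rule connected_slit_exterior)
    have neg: "complex_of_real r \<in> \<Omega>" if "- 1 < r" "r < 0" for r
    proof -
      have 1: "1 - complex_of_real r = of_real (1 - r)" by simp
      have "norm (1 - complex_of_real r) = 1 - r" unfolding 1 norm_of_real using that by simp
      then show ?thesis using that by (auto simp: \<Omega>_def slit_plane_iff complex_nonpos_Reals_iff)
    qed
    then show "complex_of_real ` {- 1<..<0} \<subseteq> \<Omega>" by auto
    show "- 1 / 2 \<in> \<Omega>" using neg[of "- 1 / 2"] by simp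
    show "- 1 / 2 islimpt complex_of_real ` {- 1<..<0}"
      unfolding islimpt_approachable
    proof (intro allI impI)
      fix e :: real assume e: "e > 0"
      define d where "d = min (e / 2) (1 / 4)"
      have d: "0 < d" "d < e" "d < 1 / 2" using e by (auto simp: d_def)
      have "dist (complex_of_real (- 1 / 2 + d)) (- 1 / 2) = d"
        using d by (simp add: dist_norm)
      moreover have "complex_of_real (- 1 / 2 + d) \<noteq> - 1 / 2"
        using d by (simp add: complex_eq_iff)
      moreover have "complex_of_real (- 1 / 2 + d) \<in> complex_of_real ` {- 1<..<0}"
        using d by (intro imageI) simp
      ultimately show "\<exists>x'\<in>complex_of_real ` {- 1<..<0}. x' \<noteq> - 1 / 2 \<and> dist x' (- 1 / 2) < e"
        using d by (intro bexI[of _ "complex_of_real (- 1 / 2 + d)"]) auto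
    qed
    show "Psi1 a b c c' z (of_real y) - R z = 0" if "z \<in> complex_of_real ` {- 1<..<0}" for z
    proof -
      obtain r where r: "z = of_real r" "- 1 < r" "r < 0" using \<open>z \<in> _\<close> by auto
      then have "norm z < 1" by simp
      then have "Psi1 a b c c' z (of_real y) = Psi1_series a b c c' z (of_real y)"
        using cont by (simp add: is_Psi1_continuation_def)
      also have "\<dots> = R z"
        unfolding R_def r(1) by (rule Psi1_on_negative_reals[OF c c' ab r(2,3)])
      finally show ?thesis by simp
    qed
    show "x \<in> \<Omega>" using x by (simp add: \<Omega>_def)
  qed
  then show ?thesis by (simp add: R_def)
qed

section \<open>The limit regime\<close>

text \<open>The modulus is norm z to the power Re s, times exp (- Im s * Im (Ln z)). The argument is
  bounded by pi, and ln (norm z) differs from ln y by at most |ln \<gamma>1| + |ln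
  \<gamma>2|.\<close>

lemma norm_powr_comparable_le:
  fixes z s :: complex
  assumes "y > 0" "z \<noteq> 0" "\<gamma>1 > 0" "\<gamma>1 \<le> y / norm z" "y / norm z \<le> \<gamma>2"
  shows "norm (z powr s) \<le> exp (\<bar>Re s\<bar> * (\<bar>ln \<gamma>1\<bar> + \<bar>ln \<gamma>2\<bar>) + \<bar>Im s\<bar> * pi) * y powr Re s"
proof -
  have q: "y / norm z > 0" using assms by simp
  have "ln \<gamma>1 \<le> ln (y / norm z)" "ln (y / norm z) \<le> ln \<gamma>2"
    using assms q by (intro ln_mono; simp)+
  moreover have "ln (y / norm z) = ln y - ln (norm z)" using assms by (simp add: ln_div)
  ultimately have "\<bar>ln (norm z) - ln y\<bar> \<le> \<bar>ln \<gamma>1\<bar> + \<bar>ln \<gamma>2\<bar>" by linarith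
  then have 1: "\<bar>Re s * (ln (norm z) - ln y)\<bar> \<le> \<bar>Re s\<bar> * (\<bar>ln \<gamma>1\<bar> + \<bar>ln \<gamma>2\<bar>)"
    unfolding abs_mult by (rule mult_left_mono) simp
  have "\<bar>Im (Ln z)\<bar> \<le> pi" using mpi_less_Im_Ln[of z] Im_Ln_le_pi[of z] assms by simp
  then have 2: "\<bar>Im s * Im (Ln z)\<bar> \<le> \<bar>Im s\<bar> * pi"
    unfolding abs_mult by (rule mult_left_mono) simp
  have "norm (z powr s) = exp (Re s * ln (norm z) - Im s * Im (Ln z))"
    using assms by (simp add: powr_def norm_exp_eq_Re)
  also have "Re s * ln (norm z) - Im s * Im (Ln z) \<le> (\<bar>Re s\<bar> * (\<bar>ln \<gamma>1\<bar> + \<bar>ln \<gamma>2\<bar>) + \<bar>Im s\<bar> * pi) + Re s * ln y"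
    using 1 2 unfolding right_diff_distrib by linarith
  also have "exp \<dots> = exp (\<bar>Re s\<bar> * (\<bar>ln \<gamma>1\<bar> + \<bar>ln \<gamma>2\<bar>) + \<bar>Im s\<bar> * pi) * y powr Re s"
    using assms by (simp add: powr_def exp_add mult_ac)
  finally show ?thesis by simp
qed

lemma filterlim_snd_humbert: "filterlim snd at_top (humbert_filter \<gamma>1 \<gamma>2)"
proof -
  have "filterlim snd at_top (at_infinity \<times>\<^sub>F at_top :: (complex \<times> real) filter)" by (rule filterlim_snd)
  then show ?thesis
    unfolding humbert_filter_def by (rule filterlim_mono) auto
qed

lemma eventually_humbert_filter:
  assumes "\<forall>\<^sub>F y in at_top. P y"
    and "\<And>x y. P y \<Longrightarrow> x \<in> slit_plane \<Longrightarrow> \<gamma>1 \<le> y / norm (1 - x) \<Longrightarrow> y / norm (1 - x) \<le> \<gamma>2 \<Longrightarrow> Q (x, y)"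
  shows "\<forall>\<^sub>F z in humbert_filter \<gamma>1 \<gamma>2. Q z"
proof -
  have "\<forall>\<^sub>F z in humbert_filter \<gamma>1 \<gamma>2. P (snd z)"
    using filterlim_snd_humbert assms(1) by (rule filterlim_iff[THEN iffD1, rule_format])
  moreover have "\<forall>\<^sub>F z in humbert_filter \<gamma>1 \<gamma>2. z \<in> {(x, y). x \<in> slit_plane \<and> \<gamma>1 \<le> y / norm (1 - x) \<and> y / norm (1 - x) \<le> \<gamma>2}"
    unfolding humbert_filter_def eventually_inf_principal by simp
  ultimately show ?thesis
    by eventually_elim (use assms(2) in auto)
qed

lemma bigo_humbert_filter:
  "f \<in> O(g) \<Longrightarrow> (\<lambda>z. f (snd z)) \<in> O[humbert_filter \<gamma>1 \<gamma>2](\<lambda>z. g (snd z))"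
  using landau_o.big.compose[OF _ filterlim_snd_humbert] by blast

lemma powr_bigo_humbert_filter:
  assumes "\<gamma>1 > 0"
  shows "(\<lambda>z. (1 - fst z) powr s) \<in> O[humbert_filter \<gamma>1 \<gamma>2](\<lambda>z. complex_of_real (snd z powr Re s))"
proof (rule landau_o.bigI)
  show "exp (\<bar>Re s\<bar> * (\<bar>ln \<gamma>1\<bar> + \<bar>ln \<gamma>2\<bar>) + \<bar>Im s\<bar> * pi) > 0" by simp
  show "\<forall>\<^sub>F z in humbert_filter \<gamma>1 \<gamma>2. norm ((1 - fst z) powr s) \<le>
     exp (\<bar>Re s\<bar> * (\<bar>ln \<gamma>1\<bar> + \<bar>ln \<gamma>2\<bar>) + \<bar>Im s\<bar> * pi) * norm (complex_of_real (snd z powr Re s))"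
  proof (rule eventually_humbert_filter[OF eventually_gt_at_top[of 0]])
    fix x y assume y: "(y::real) > 0" "x \<in> slit_plane" "\<gamma>1 \<le> y / norm (1 - x)" "y / norm (1 - x) \<le> \<gamma>2"
    have "1 - x \<noteq> 0" using y(2) by (auto simp: slit_plane_def)
    then show "norm ((1 - fst (x, y)) powr s) \<le>
     exp (\<bar>Re s\<bar> * (\<bar>ln \<gamma>1\<bar> + \<bar>ln \<gamma>2\<bar>) + \<bar>Im s\<bar> * pi) * norm (complex_of_real (snd (x, y) powr Re s))"
      using norm_powr_comparable_le[OF y(1) _ assms y(3,4), of s] by simp
  qed
qed

text \<open>Bookkeeping of orders: in the limit regime a power of 1 - x counts as the same power of
  y, uniformly in the argument.\<close>

lemma powr_mult_bigo_humbert_filter: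
  assumes "\<gamma>1 > 0" "g \<in> O[humbert_filter \<gamma>1 \<gamma>2](\<lambda>z. exp_powr r (snd z))" "Re s + r = t"
  shows "(\<lambda>z. (1 - fst z) powr s * g z) \<in> O[humbert_filter \<gamma>1 \<gamma>2](\<lambda>z. exp_powr t (snd z))"
proof -
  have "(\<lambda>z. (1 - fst z) powr s * g z) \<in> O[humbert_filter \<gamma>1 \<gamma>2](\<lambda>z. complex_of_real (snd z powr Re s) * exp_powr r (snd z))"
    by (rule landau_o.big_mult[OF powr_bigo_humbert_filter[OF assms(1)] assms(2)])
  moreover have "(\<lambda>z. complex_of_real (snd z powr Re s) * exp_powr r (snd z)) = (\<lambda>z :: complex \<times> real. exp_powr t (snd z))"
    unfolding assms(3)[symmetric] by (simp add: powr_add mult_ac)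
  ultimately show ?thesis by simp
qed

section \<open>The tail of the first series and the recessive second series\<close>

definition psi1_R :: "complex \<Rightarrow> complex \<Rightarrow> complex \<Rightarrow> complex \<Rightarrow> nat \<Rightarrow> real \<Rightarrow> complex \<Rightarrow> complex" where
  "psi1_R a b c c' N y u = (\<Sum>m. pochhammer b (m + N) / fact (m + N) * psi1_T a b c c' (m + N) y * u ^ m)"

lemma psi1_S1_split:
  assumes ab: "a - b \<notin> \<int>" and u: "norm u < 1"
  shows "psi1_S1 a b c c' y u =
    (\<Sum>j<N. pochhammer b j / fact j * psi1_T a b c c' j y * u ^ j) + u ^ N * psi1_R a b c c' N y u"
proof -
  obtain q where q: "\<And>m y. norm (pochhammer b m / fact m * psi1_T a b c c' m y) \<le> kummer_majorant (a - b) c' y * real (m + 1) ^ q"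
    using psi1_S1_coeff_bound[OF ab] by blast
  define f where "f = (\<lambda>m. pochhammer b m / fact m * psi1_T a b c c' m y)"
  have s: "summable (\<lambda>m. f m * u ^ m)"
    unfolding f_def by (rule summable_norm_cancel[OF summable_poly_bounded_powser[OF q u]])
  have "(\<Sum>m. f m * u ^ m) = (\<Sum>m. f (m + N) * u ^ (m + N)) + (\<Sum>j<N. f j * u ^ j)"
    by (rule suminf_split_initial_segment[OF s])
  moreover have "(\<Sum>m. f (m + N) * u ^ (m + N)) = u ^ N * (\<Sum>m. f (m + N) * u ^ m)"
  proof (cases "u = 0")
    case True
    then show ?thesis by (cases N) (simp_all add: power_0_left)
  next
    case False
    have "summable (\<lambda>m. f (m + N) * u ^ (m + N))" using s by (subst summable_iff_shift)
    then have "summable (\<lambda>m. inverse (u ^ N) * (f (m + N) * u ^ (m + N)))" by (rule summable_mult)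
    then have "summable (\<lambda>m. f (m + N) * u ^ m)" using False by (simp add: power_add field_simps)
    then have "u ^ N * (\<Sum>m. f (m + N) * u ^ m) = (\<Sum>m. u ^ N * (f (m + N) * u ^ m))" by (rule suminf_mult[symmetric])
    then show ?thesis by (simp add: power_add mult_ac)
  qed
  ultimately show ?thesis by (simp add: psi1_S1_def psi1_R_def f_def)
qed

lemma eventually_humbert_filter_small:
  assumes "\<gamma>1 > 0" "\<gamma>1 \<le> \<gamma>2"
    and "\<And>x y. y > 0 \<Longrightarrow> 1 - x \<notin> \<real>\<^sub>\<le>\<^sub>0 \<Longrightarrow> norm (1 - x) > 1 \<Longrightarrow> norm (inverse (1 - x)) \<le> 1 / 2 \<Longrightarrow>
       \<bar>y\<bar> * norm (inverse (1 - x)) \<le> \<gamma>2 \<Longrightarrow> Q (x, y)"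
  shows "\<forall>\<^sub>F z in humbert_filter \<gamma>1 \<gamma>2. Q z"
\<comment> \<open>Together with y / norm (1 - x) \<le> \<gamma>2, the threshold 2 * \<gamma>2 for y
  forces norm (1 - x) > 2 and hence norm u \<le> 1 / 2.\<close>
proof (rule eventually_humbert_filter[OF eventually_gt_at_top[of "2 * \<gamma>2"]])
  fix x y assume y: "2 * \<gamma>2 < y" "x \<in> slit_plane" "\<gamma>1 \<le> y / norm (1 - x)" "y / norm (1 - x) \<le> \<gamma>2"
  have x: "1 - x \<notin> \<real>\<^sub>\<le>\<^sub>0" using y(2) by (simp add: slit_plane_iff)
  then have "1 - x \<noteq> 0" by auto
  then have n: "norm (1 - x) > 0" by simp
  have "y \<le> \<gamma>2 * norm (1 - x)" using y(4) n by (simp add: field_simps)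
  then have "\<gamma>2 * 2 < \<gamma>2 * norm (1 - x)" using y(1) by linarith
  then have 2: "norm (1 - x) > 2" using assms by simp
  show "Q (x, y)"
  proof (rule assms(3)[OF _ x])
    show "y > 0" "norm (1 - x) > 1" using 2 y(1) assms by auto
    show "norm (inverse (1 - x)) \<le> 1 / 2" using le_imp_inverse_le[of 2 "norm (1 - x)"] 2 by (simp add: norm_inverse)
    have "\<bar>y\<bar> * norm (inverse (1 - x)) = y / norm (1 - x)"
      unfolding norm_inverse divide_inverse using y(1) assms(1,2) by simp
    then show "\<bar>y\<bar> * norm (inverse (1 - x)) \<le> \<gamma>2" using y(4) by simp
  qed
qed

text \<open>All coefficients of the tail share the majorant in y and differ by powers of m + 1,
  which the geometric factor (1 / 2) ^ m makes summable. The order is thus that of a single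
  coefficient, and the gain lies in the factor u ^ N split off before.\<close>

lemma psi1_R_bigo:
  assumes ab: "a - b \<notin> \<int>" and g: "\<gamma>1 > 0" "\<gamma>1 \<le> \<gamma>2"
  shows "(\<lambda>z. psi1_R a b c c' N (snd z) (inverse (1 - fst z))) \<in> O[humbert_filter \<gamma>1 \<gamma>2](\<lambda>z. exp_powr (Re (a - b - c')) (snd z))"
proof (rule landau_o.big_trans)
  have A: "a - b \<notin> \<int>\<^sub>\<le>\<^sub>0" using ab nonpos_Ints_Int by blast
  show "(\<lambda>z. complex_of_real (kummer_majorant (a - b) c' (snd z))) \<in> O[humbert_filter \<gamma>1 \<gamma>2](\<lambda>z. exp_powr (Re (a - b - c')) (snd z))"
    unfolding kummer_majorant_def by (rule bigo_humbert_filter[OF kummer_series_majorant(2)[OF A]])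
  obtain q where q: "\<And>m y. norm (pochhammer b m / fact m * psi1_T a b c c' m y) \<le> kummer_majorant (a - b) c' y * real (m + 1) ^ q"
    using psi1_S1_coeff_bound[OF ab] by blast
  define C where "C = real (N + 1) ^ q * (\<Sum>m. real (m + 1) ^ q * (1 / 2) ^ m)"
  show "(\<lambda>z. psi1_R a b c c' N (snd z) (inverse (1 - fst z))) \<in> O[humbert_filter \<gamma>1 \<gamma>2](\<lambda>z. complex_of_real (kummer_majorant (a - b) c' (snd z)))"
  proof (rule bigoI[of _ C], rule eventually_humbert_filter_small[OF g])
    fix x :: complex and y :: real assume u: "norm (inverse (1 - x)) \<le> 1 / 2"
    define u where "u = inverse (1 - x)"
    define K where "K = kummer_majorant (a - b) c' y"
    have K: "K \<ge> 0" unfolding K_def by (rule kummer_majorant_nonneg[OF ab])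
    have s: "summable (\<lambda>m. real (m + 1) ^ q * (1 / 2) ^ m)" by (rule summable_Suc_power_mult_power) auto
    have le: "norm (pochhammer b (m + N) / fact (m + N) * psi1_T a b c c' (m + N) y * u ^ m) \<le>
       (K * real (N + 1) ^ q) * (real (m + 1) ^ q * (1 / 2) ^ m)" for m
    proof -
      have "real (m + N + 1) \<le> real (N + 1) * real (m + 1)" by (simp add: algebra_simps)
      then have "real (m + N + 1) ^ q \<le> real (N + 1) ^ q * real (m + 1) ^ q"
        unfolding power_mult_distrib[symmetric] by (rule power_mono) simp
      then have "K * real (m + N + 1) ^ q \<le> K * (real (N + 1) ^ q * real (m + 1) ^ q)"
        by (rule mult_left_mono[OF _ K])
      then have "norm (pochhammer b (m + N) / fact (m + N) * psi1_T a b c c' (m + N) y) \<le> K * (real (N + 1) ^ q * real (m + 1) ^ q)"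
        using q[of "m + N" y] unfolding K_def[symmetric] by linarith
      moreover have "norm (u ^ m) \<le> (1 / 2) ^ m" unfolding norm_power u_def by (rule power_mono[OF u]) simp
      ultimately have "norm (pochhammer b (m + N) / fact (m + N) * psi1_T a b c c' (m + N) y) * norm (u ^ m) \<le>
         (K * (real (N + 1) ^ q * real (m + 1) ^ q)) * (1 / 2) ^ m"
        using K by (intro mult_mono) auto
      then show ?thesis
        unfolding norm_mult[of "pochhammer b (m + N) / fact (m + N) * psi1_T a b c c' (m + N) y" "u ^ m"] by (simp only: mult.assoc)
    qed
    have "norm (psi1_R a b c c' N y u) \<le> (\<Sum>m. (K * real (N + 1) ^ q) * (real (m + 1) ^ q * (1 / 2) ^ m))"
      unfolding psi1_R_def by (rule norm_suminf_le[OF le summable_mult[OF s]])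
    also have "\<dots> = C * K" unfolding C_def suminf_mult[OF s] by (simp only: mult_ac)
    finally show "norm (psi1_R a b c c' N (snd (x, y)) (inverse (1 - fst (x, y)))) \<le> C * norm (complex_of_real (kummer_majorant (a - b) c' (snd (x, y))))"
      using K by (simp add: u_def K_def)
  qed
qed

text \<open>The second series is bounded in the limit regime, hence negligible against exp y * y
  powr r for every r.\<close>

lemma psi1_S2_bigo:
  assumes c': "c' \<notin> \<int>\<^sub>\<le>\<^sub>0" and ab: "a - b \<notin> \<int>" and g: "\<gamma>1 > 0" "\<gamma>1 \<le> \<gamma>2"
  shows "(\<lambda>z. psi1_S2 a b c c' (snd z) (inverse (1 - fst z))) \<in> O[humbert_filter \<gamma>1 \<gamma>2](\<lambda>z. exp_powr r (snd z))"
proof (rule landau_o.big_trans)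
  show "(\<lambda>z. complex_of_real (snd z) ^ 0) \<in> O[humbert_filter \<gamma>1 \<gamma>2](\<lambda>z. exp_powr r (snd z))"
    by (rule bigo_humbert_filter[OF power_bigo_exp_powr])
  obtain M where M: "summable M" "\<And>n y u. norm u \<le> 1 / 2 \<Longrightarrow> \<bar>y\<bar> * norm u \<le> \<gamma>2 \<Longrightarrow>
     norm (psi1_p a b c c' n * of_real y ^ n * u ^ n * hyp2F1 (a + of_nat n) (c - b) (a - b + 1 + of_nat n) u) \<le> M n"
    using psi1_S2_bound[OF c' ab, of "1 / 2" \<gamma>2 c] g by auto
  show "(\<lambda>z. psi1_S2 a b c c' (snd z) (inverse (1 - fst z))) \<in> O[humbert_filter \<gamma>1 \<gamma>2](\<lambda>z. complex_of_real (snd z) ^ 0)"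
  proof (rule bigoI[of _ "suminf M"], rule eventually_humbert_filter_small[OF g])
    fix x :: complex and y :: real assume u: "norm (inverse (1 - x)) \<le> 1 / 2" "\<bar>y\<bar> * norm (inverse (1 - x)) \<le> \<gamma>2"
    have "norm (psi1_S2 a b c c' y (inverse (1 - x))) \<le> suminf M"
      unfolding psi1_S2_def by (rule norm_suminf_le[OF M(2)[OF u] M(1)])
    then show "norm (psi1_S2 a b c c' (snd (x, y)) (inverse (1 - fst (x, y)))) \<le> suminf M * norm (complex_of_real (snd (x, y)) ^ 0)"
      by simp
  qed
qed

text \<open>Substituting j + l = k turns the sum over k into one over powers of u and of 1 / y: (y /
  (1 - x)) powr (b + j) * y ^ (- k) equals y powr b * (1 - x) powr (- b) * u ^ j * y ^ (-
  l).\<close>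

lemma sum_acoeff_eq:
  assumes ab: "a - b \<notin> \<int>" and y: "y > 0" and x: "1 - x \<notin> \<real>\<^sub>\<le>\<^sub>0"
  shows "of_real y powr (a - 2 * b - c') * exp (of_real y) * (\<Sum>k<N. acoeff a b c c' k x y / of_real y ^ k) =
    (1 - x) powr (- b) * (\<Sum>j<N. pochhammer b j / fact j * inverse (1 - x) ^ j *
      (exp (of_real y) * of_real y powr (a - b - c') * (\<Sum>l<N - j. psi1_tau a b c c' j l / of_real y ^ l)))"
proof -
  have x0: "1 - x \<noteq> 0" using x by auto
  have y0: "complex_of_real y \<noteq> 0" using y by simp
  \<comment> \<open>The principal power of the quotient factorises because y is positive and 1 - x
    is off the cut, so the logarithms add without a multiple of 2 * pi * i.\<close>
  have pw: "(of_real y / (1 - x)) powr (b + of_nat j) = of_real y powr b * (1 - x) powr (- b) * of_real y ^ j * inverse (1 - x) ^ j" for j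
  proof -
    have "Ln (inverse (1 - x)) = - Ln (1 - x)" by (rule Ln_inverse[OF x])
    moreover have "Ln (of_real y * inverse (1 - x)) = of_real (ln y) + Ln (inverse (1 - x))"
      using Ln_times_of_real[OF y, of "inverse (1 - x)"] x0 y by (simp add: Ln_of_real)
    ultimately have "Ln (of_real y / (1 - x)) = Ln (of_real y) - Ln (1 - x)"
      using y by (simp add: divide_inverse Ln_of_real)
    then have "(of_real y / (1 - x)) powr b = exp (b * (Ln (of_real y) - Ln (1 - x)))"
      using x0 y0 by (simp add: powr_def)
    also have "\<dots> = of_real y powr b * (1 - x) powr (- b)"
      using x0 y0 by (simp add: powr_def right_diff_distrib exp_diff exp_minus divide_inverse)
    finally have "(of_real y / (1 - x)) powr b = of_real y powr b * (1 - x) powr (- b)" .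
    moreover have "(of_real y / (1 - x)) powr (b + of_nat j) = (of_real y / (1 - x)) powr b * (of_real y / (1 - x)) ^ j"
      using x0 y0 by (simp add: powr_add powr_nat')
    ultimately show ?thesis by (simp add: power_divide power_inverse field_simps)
  qed
  have py: "of_real y powr (a - 2 * b - c') * of_real y powr b = complex_of_real y powr (a - b - c')"
    by (simp add: powr_add[symmetric] algebra_simps)
  define E where "E = exp (of_real y) * complex_of_real y powr (a - b - c')"
  define g where "g = (\<lambda>j l. (1 - x) powr (- b) * (pochhammer b j / fact j * inverse (1 - x) ^ j *
      (E * (psi1_tau a b c c' j l / of_real y ^ l))))"
  have "of_real y powr (a - 2 * b - c') * exp (of_real y) * (\<Sum>k<N. acoeff a b c c' k x y / of_real y ^ k) =
     (\<Sum>k<N. \<Sum>j\<le>k. g j (k - j))"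
    unfolding acoeff_eq_psi1_tau[OF ab] sum_distrib_left sum_divide_distrib
  proof (intro sum.cong refl)
    fix k j assume "k \<in> {..<N}" "j \<in> {..k}"
    then have k: "(of_real y :: complex) ^ k = of_real y ^ j * of_real y ^ (k - j)" by (simp flip: power_add)
    show "of_real y powr (a - 2 * b - c') * exp (of_real y) *
      (pochhammer b j / fact j * psi1_tau a b c c' j (k - j) * (of_real y / (1 - x)) powr (b + of_nat j) / of_real y ^ k) = g j (k - j)"
      unfolding g_def pw k E_def py[symmetric] using y0 by simp
  qed
  also have "\<dots> = (\<Sum>j<N. \<Sum>l<N - j. g j l)" by (rule sum_triangle_lessThan)
  finally show ?thesis
    unfolding g_def by (simp only: sum_distrib_left E_def)
qed

text \<open>Three errors add up: from truncating the expansions of the first N coefficient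
  functions, from the tail of the series in u, and from the second solution. The main terms they
  leave are regrouped by \<open>sum_acoeff_eq\<close>.\<close>

theorem theorem1p2:
  fixes a b c c' :: complex and \<gamma>1 \<gamma>2 :: real
  assumes "c \<notin> \<int>\<^sub>\<le>\<^sub>0" and "c' \<notin> \<int>\<^sub>\<le>\<^sub>0"
    and "a - b \<notin> \<int>" and "a - c \<notin> \<int>"
    and "0 < \<gamma>1" and "\<gamma>1 \<le> \<gamma>2"
  shows "\<forall>N::nat. N \<ge> 1 \<longrightarrow>
    (\<lambda>(x, y). Psi1 a b c c' x (of_real y) -
        Gamma c * Gamma c' * rGamma a * rGamma (c - b)
          * of_real y powr (a - 2 * b - c') * exp (of_real y)
          * (\<Sum>k<N. acoeff a b c c' k x y / of_real y ^ k))
    \<in> O[humbert_filter \<gamma>1 \<gamma>2](\<lambda>(x, y). of_real (y powr (Re (a - 2 * b - c') - real N) * exp y))"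
proof (intro allI impI)
  fix N :: nat
  note ab = assms(3)
  define t where "t = Re (a - 2 * b - c') - real N"
  define K1 where "K1 = Gamma c * Gamma c' * rGamma a * rGamma (c - b)"
  define K2 where "K2 = Gamma c * Gamma (b - a) * rGamma b * rGamma (c - a)"
  \<comment> \<open>Since u ^ j already contributes the order y ^ (- j), the j-th coefficient
    function is expanded to N - j terms only; every error then has the common order
    \<open>t\<close>.\<close>
  define d where "d = (\<lambda>j y. psi1_T a b c c' j y - exp (of_real y) * of_real y powr (a - b - c') *
     (\<Sum>l<N - j. psi1_tau a b c c' j l / of_real y ^ l))"
  define B where "B = (\<lambda>z. K1 * ((\<Sum>j<N. pochhammer b j / fact j * ((1 - fst z) powr (- b - of_nat j) * d j (snd z))) +
       (1 - fst z) powr (- b - of_nat N) * psi1_R a b c c' N (snd z) (inverse (1 - fst z))) +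
     K2 * ((1 - fst z) powr (- a) * psi1_S2 a b c c' (snd z) (inverse (1 - fst z))))"
  have "B \<in> O[humbert_filter \<gamma>1 \<gamma>2](\<lambda>z. exp_powr t (snd z))"
    unfolding B_def
  proof (intro sum_in_bigo bigo_cmult_left big_sum_in_bigo)
    show "(\<lambda>z. (1 - fst z) powr (- b - of_nat j) * d j (snd z)) \<in> O[humbert_filter \<gamma>1 \<gamma>2](\<lambda>z. exp_powr t (snd z))"
      if "j \<in> {..<N}" for j
      unfolding d_def by (rule powr_mult_bigo_humbert_filter[OF assms(5) bigo_humbert_filter[OF psi1_T_asymp[OF ab]]])
        (use \<open>j \<in> {..<N}\<close> in \<open>simp add: t_def of_nat_diff\<close>)
    show "(\<lambda>z. (1 - fst z) powr (- b - of_nat N) * psi1_R a b c c' N (snd z) (inverse (1 - fst z))) \<in> O[humbert_filter \<gamma>1 \<gamma>2](\<lambda>z. exp_powr t (snd z))"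
      by (rule powr_mult_bigo_humbert_filter[OF assms(5) psi1_R_bigo[OF ab assms(5,6)]]) (simp add: t_def)
    \<comment> \<open>The exponent for the second series is free, and t + Re a compensates the order
      of (1 - x) powr (- a).\<close>
    show "(\<lambda>z. (1 - fst z) powr (- a) * psi1_S2 a b c c' (snd z) (inverse (1 - fst z))) \<in> O[humbert_filter \<gamma>1 \<gamma>2](\<lambda>z. exp_powr t (snd z))"
      by (rule powr_mult_bigo_humbert_filter[OF assms(5) psi1_S2_bigo[OF assms(2) ab assms(5,6), where r = "t + Re a"]]) simp
  qed
  also have "(\<lambda>z. exp_powr t (snd z)) = (\<lambda>(x :: complex, y). complex_of_real (y powr (Re (a - 2 * b - c') - real N) * exp y))"
    by (auto simp: t_def mult.commute)
  finally have "B \<in> O[humbert_filter \<gamma>1 \<gamma>2](\<lambda>(x, y). complex_of_real (y powr (Re (a - 2 * b - c') - real N) * exp y))" .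
  moreover have "\<forall>\<^sub>F z in humbert_filter \<gamma>1 \<gamma>2. B z = (\<lambda>(x, y). Psi1 a b c c' x (of_real y) -
        Gamma c * Gamma c' * rGamma a * rGamma (c - b)
          * of_real y powr (a - 2 * b - c') * exp (of_real y)
          * (\<Sum>k<N. acoeff a b c c' k x y / of_real y ^ k)) z"
  proof (rule eventually_humbert_filter_small[OF assms(5,6)])
    fix x :: complex and y :: real assume y: "y > 0" and x: "1 - x \<notin> \<real>\<^sub>\<le>\<^sub>0" "norm (1 - x) > 1" and u: "norm (inverse (1 - x)) \<le> 1 / 2"
    define u where "u = inverse (1 - x)"
    define P where "P = (1 - x) powr (- b)"
    define E where "E = (\<lambda>j. exp (of_real y) * of_real y powr (a - b - c') * (\<Sum>l<N - j. psi1_tau a b c c' j l / of_real y ^ l))"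
    define r where "r = (\<lambda>j. pochhammer b j / fact j :: complex)"
    have r: "pochhammer b j / fact j = r j" for j by (simp add: r_def)
    have x0: "1 - x \<noteq> 0" using x by auto
    have pw: "(1 - x) powr (- b - of_nat j) = P * u ^ j" for j
      using x0 by (simp add: powr_diff powr_nat' P_def u_def power_inverse divide_inverse)
    have Psi: "Psi1 a b c c' x (of_real y) = K1 * (P * psi1_S1 a b c c' y u) + K2 * ((1 - x) powr (- a) * psi1_S2 a b c c' y u)"
      unfolding K1_def K2_def u_def P_def using x by (intro Psi1_outside_disc assms) (simp_all add: slit_plane_iff)
    have main: "K1 * of_real y powr (a - 2 * b - c') * exp (of_real y) * (\<Sum>k<N. acoeff a b c c' k x y / of_real y ^ k) =
        K1 * (P * (\<Sum>j<N. r j * u ^ j * E j))"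
      unfolding P_def u_def E_def r_def sum_acoeff_eq[OF ab y x(1), symmetric] by (simp only: mult.assoc)
    have S1: "psi1_S1 a b c c' y u = (\<Sum>j<N. r j * psi1_T a b c c' j y * u ^ j) + u ^ N * psi1_R a b c c' N y u"
      unfolding r_def by (rule psi1_S1_split[OF ab]) (use u in \<open>simp add: u_def\<close>)
    have "(\<Sum>j<N. r j * (P * u ^ j * d j y)) = (\<Sum>j<N. P * (r j * psi1_T a b c c' j y * u ^ j) - P * (r j * u ^ j * E j))"
      by (intro sum.cong refl) (simp add: d_def E_def algebra_simps)
    also have "\<dots> = P * (\<Sum>j<N. r j * psi1_T a b c c' j y * u ^ j) - P * (\<Sum>j<N. r j * u ^ j * E j)"
      by (simp only: sum_subtractf sum_distrib_left)
    finally have D: "(\<Sum>j<N. r j * (P * u ^ j * d j y)) = P * (\<Sum>j<N. r j * psi1_T a b c c' j y * u ^ j) - P * (\<Sum>j<N. r j * u ^ j * E j)" .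
    have "B (x, y) = Psi1 a b c c' x (of_real y) - K1 * (P * (\<Sum>j<N. r j * u ^ j * E j))"
      unfolding B_def Psi S1 fst_conv snd_conv pw u_def[symmetric] r D by (simp add: algebra_simps)
    then show "B (x, y) = (case (x, y) of (x, y) \<Rightarrow> Psi1 a b c c' x (of_real y) -
        Gamma c * Gamma c' * rGamma a * rGamma (c - b)
          * of_real y powr (a - 2 * b - c') * exp (of_real y)
          * (\<Sum>k<N. acoeff a b c c' k x y / of_real y ^ k))"
      unfolding main[symmetric] unfolding K1_def by simp
  qed
  ultimately show "(\<lambda>(x, y). Psi1 a b c c' x (of_real y) -
        Gamma c * Gamma c' * rGamma a * rGamma (c - b)
          * of_real y powr (a - 2 * b - c') * exp (of_real y)
          * (\<Sum>k<N. acoeff a b c c' k x y / of_real y ^ k))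
    \<in> O[humbert_filter \<gamma>1 \<gamma>2](\<lambda>(x, y). of_real (y powr (Re (a - 2 * b - c') - real N) * exp y))"
    by (rule landau_o.big.in_cong[THEN iffD1, rotated])
qed

end
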